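(* Let $r\ge 2$, $G=SL_r$ over $\mathbb{Q}$, and let $\mathbb{A}$ be the adeles of $\mathbb{Q}$. For a normalized convex polygon $p:[0,r]\to\mathbb{R}$ let $$T(p):=\big(p(1),\,p(2)-p(1),\,\dots,\,p(i)-p(i-1),\,\dots,\,p(r-1)-p(r-2),\,-p(r-1)\big)\in\mathfrak{a}_0 .$$ If $T(p)$ is sufficiently positive (that is, there is a constant $c$ such that the following holds whenever $\alpha(T(p))>c$ for all simple roots $\alpha$), then for all $g\in G(\mathbb{A})$ $$\mathbf{1}(\overline{p}^{\,g}\le p)=\big(\Lambda^{T(p)}\mathbf{1}\big)(g).$$ Here $\mathbf{1}(\overline{p}^{\,g}\le p)$ is $1$ if the canonical polygon $\overline p^{\,g}$ of the lattice attached to $g$ satisfies $\overline p^{\,g}\le p$ and $0$ otherwise, and $\Lambda^{T}\mathbf{1}$ is Arthur's analytic truncation of the constant function $\mathbf{1}$.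
   Context: Polygons: a polygon $p:[0,r]\to\mathbb{R}$ is a continuous function, affine on each $[i-1,i]$; it is normalized if $p(0)=p(r)=0$, and convex (in the sense of Harder–Narasimhan polygons) if its slopes are non-increasing. Lattices: to $g=(g_v)\in G(\mathbb{A})$ attach the $\mathbb{Z}$-lattice of volume one $\Lambda^g:=\{x\in\mathbb{Q}^r: g_\ell^{-1}x\in\mathbb{Z}_\ell^r\text{ for all primes }\ell\}$ (column vectors) with norm $x\mapsto|g_\infty^{-1}x|$. For a sublattice $M$, with the induced norm, $\deg M:=-\log\mathrm{Vol}(M)$. The canonical polygon $\overline p^{\,g}$ is the polygon of the Harder–Narasimhan (canonical) filtration $0=\Lambda_0\subset\Lambda_1\subset\dots\subset\Lambda_l=\Lambda^g$ (the unique filtration by saturated sublattices with semi-stable quotients $\Lambda_i/\Lambda_{i-1}$ of strictly decreasing slopes $\deg/\mathrm{rank}$): it has value $\deg\Lambda_i$ at $\mathrm{rank}\,\Lambda_i$ and is affine in between. (A lattice $M$ is semi-stable if $\deg M_1/\mathrm{rank}\,M_1\le\deg M/\mathrm{rank}\,M$ for all non-zero sublattices $M_1$.) Truncation: $P_0$ is the upper triangular Borel subgroup, $K=\prod_\ell SL_r(\mathbb{Z}_\ell)\times SO(r)$, $\mathfrak{a}_0=\{H\in\mathbb{R}^r:\sum H_i=0\}$, with simple roots $\alpha_i(H)=H_i-H_{i+1}$ and simple weights $\varpi_i(H)=H_1+\dots+H_i$, $1\le i\le r-1$. For $g=nak$ with $n$ upper triangular unipotent, $a=\mathrm{diag}(a_1,\dots,a_r)$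 diagonal (adelic entries) and $k\in K$, put $H(g)=H_0(g):=(\log|a_1|_{\mathbb{A}},\dots,\log|a_r|_{\mathbb{A}})$. Standard parabolic subgroups $P\supset P_0$ correspond to ordered partitions $(d_1,\dots,d_{|P|})$ of $r$; put $r_i=d_1+\dots+d_i$. Let $\hat\tau_P$ be the characteristic function of $\{H\in\mathfrak{a}_0:\varpi_{r_i}(H)>0\text{ for }1\le i\le|P|-1\}$ (so $\hat\tau_G=1$). For the constant function $\mathbf{1}$ and $T\in\mathfrak{a}_0$, Arthur's analytic truncation is $$(\Lambda^T\mathbf{1})(g)=\sum_{P\supset P_0}(-1)^{|P|-1}\sum_{\delta\in P(\mathbb{Q})\backslash G(\mathbb{Q})}\hat\tau_P\big(H(\delta g)-T\big).$$ *)

theory Defs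
  imports
    "HOL-Analysis.Infinite_Sum"
    "HOL-Algebra.QuotRing"
    "Jordan_Normal_Form.Determinant"
begin

section \<open>The fields of p-adic numbers\<close>

definition padic_abs :: "nat \<Rightarrow> rat \<Rightarrow> real" where
  "padic_abs p x = (if x = 0 then 0 else
     real p powi (int (multiplicity (int p) (snd (quotient_of x)))
                - int (multiplicity (int p) (fst (quotient_of x)))))"

lemma padic_abs_fract:
  assumes p: "prime p" and a: "a \<noteq> 0" and b: "b \<noteq> 0"
  shows "padic_abs p (of_int a / of_int b) =
    real p powi (int (multiplicity (int p) b) - int (multiplicity (int p) a))"
proof -
  obtain c d where cd: "quotient_of (of_int a / of_int b) = (c, d)"
    by (cases "quotient_of (of_int a / of_int b)") auto
  have d: "d > 0" using cd by (rule quotient_of_denom_pos)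
  have eq: "(of_int a / of_int b :: rat) = of_int c / of_int d"
    using cd by (rule quotient_of_div)
  have c: "c \<noteq> 0" using eq a b d by auto
  have "(of_int (a * d) :: rat) = of_int (c * b)"
    using eq b d by (simp add: field_simps)
  then have "a * d = c * b" using of_int_eq_iff by blast
  moreover have "prime_elem (int p)" using p by simp
  ultimately have "multiplicity (int p) a + multiplicity (int p) d
      = multiplicity (int p) c + multiplicity (int p) b"
    using prime_elem_multiplicity_mult_distrib[of "int p"] a b c d
    by (metis less_irrefl)
  then have "int (multiplicity (int p) d) - int (multiplicity (int p) c)
      = int (multiplicity (int p) b) - int (multiplicity (int p) a)" by linarith
  then show ?thesis using a b cd by (simp add: padic_abs_def)
qed

lemma padic_abs_0 [simp]: "padic_abs p 0 = 0"
  by (simp add: padic_abs_def)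

lemma padic_abs_nonneg [simp]: "padic_abs p x \<ge> 0"
  by (simp add: padic_abs_def)

lemma rat_fractE:
  fixes x :: rat
  assumes "x \<noteq> 0"
  obtains a b where "a \<noteq> 0" "b \<noteq> 0" "x = of_int a / of_int b"
proof -
  obtain c d where cd: "quotient_of x = (c, d)" by (cases "quotient_of x") auto
  have "d > 0" using cd by (rule quotient_of_denom_pos)
  moreover have "x = of_int c / of_int d" using cd by (rule quotient_of_div)
  ultimately show thesis using that[of c d] assms by auto
qed

lemma padic_abs_mult:
  assumes p: "prime p"
  shows "padic_abs p (x * y) = padic_abs p x * padic_abs p y"
proof (cases "x = 0 \<or> y = 0")
  case False
  then obtain a b c d where h: "a \<noteq> 0" "b \<noteq> 0" "x = of_int a / of_int b"
    "c \<noteq> 0" "d \<noteq> 0" "y = of_int c / of_int d"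
    by (metis rat_fractE)
  have xy: "x * y = of_int (a * c) / of_int (b * d)" using h by simp
  have pe: "prime_elem (int p)" using p by simp
  have p0: "real p \<noteq> 0" using p by (auto dest: prime_gt_0_nat)
  have "padic_abs p (x * y) = real p powi (int (multiplicity (int p) (b * d)) - int (multiplicity (int p) (a * c)))"
    unfolding xy using h by (intro padic_abs_fract p) auto
  also have "\<dots> = real p powi ((int (multiplicity (int p) b) - int (multiplicity (int p) a))
      + (int (multiplicity (int p) d) - int (multiplicity (int p) c)))"
    using h pe by (simp add: prime_elem_multiplicity_mult_distrib algebra_simps)
  also have "\<dots> = padic_abs p x * padic_abs p y"
    unfolding h(3,6) using h p0 by (simp add: padic_abs_fract p power_int_add)
  finally show ?thesis .
qed auto

lemma padic_abs_of_int_le: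
  assumes p: "prime p" shows "padic_abs p (of_int a) \<le> 1"
proof (cases "a = 0")
  case False
  have "real p \<ge> 1" using p by (metis of_nat_1 of_nat_le_iff prime_ge_1_nat)
  then have "real p powi (- int (multiplicity (int p) a)) \<le> 1"
    by (simp add: power_int_minus field_simps)
  with padic_abs_fract[OF p False, of 1] show ?thesis by simp
qed auto

lemma padic_abs_minus [simp]: "padic_abs p (- x) = padic_abs p x"
proof (cases "x = 0")
  case False
  have "multiplicity (int p) (- a) = multiplicity (int p) a" for a
    by (simp add: multiplicity_def)
  then show ?thesis
    by (auto simp: padic_abs_def rat_uminus_code Let_def split: prod.splits)
qed auto

lemma padic_abs_1 [simp]: "padic_abs p 1 = 1"
  by (simp add: padic_abs_def)

lemma padic_abs_add:
  assumes p: "prime p"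
  shows "padic_abs p (x + y) \<le> max (padic_abs p x) (padic_abs p y)"
proof (cases "x = 0 \<or> y = 0 \<or> x + y = 0")
  case False
  then obtain a b c d where h: "a \<noteq> 0" "b \<noteq> 0" "x = of_int a / of_int b"
    "c \<noteq> 0" "d \<noteq> 0" "y = of_int c / of_int d"
    by (metis rat_fractE)
  define m where "m = min (multiplicity (int p) (a * d)) (multiplicity (int p) (c * b))"
  have x: "x = of_int (a * d) / of_int (b * d)" and y: "y = of_int (c * b) / of_int (b * d)"
    using h by auto
  then have xy: "x + y = of_int (a * d + c * b) / of_int (b * d)"
    by (simp add: add_divide_distrib)
  have nz: "a * d + c * b \<noteq> 0" using False xy by (metis div_0 of_int_0)
  have "int p ^ m dvd a * d" "int p ^ m dvd c * b"
    unfolding m_def by (auto intro: multiplicity_dvd' simp: min_def)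
  then have "int p ^ m dvd a * d + c * b" by (rule dvd_add)
  moreover have "\<not> is_unit (int p)" using p by auto
  ultimately have m: "m \<le> multiplicity (int p) (a * d + c * b)"
    using nz by (intro multiplicity_geI) auto
  have p1: "real p \<ge> 1" using p by (metis of_nat_1 of_nat_le_iff prime_ge_1_nat)
  have "padic_abs p (x + y) \<le> real p powi (int (multiplicity (int p) (b * d)) - int m)"
    unfolding xy using h nz m p1
    by (subst padic_abs_fract[OF p]) (auto intro!: power_int_increasing)
  also have "\<dots> \<le> max (padic_abs p x) (padic_abs p y)"
    unfolding x y using h p
    by (simp only: padic_abs_fract no_zero_divisors simp_thms) (auto simp: m_def min_def)
  finally show ?thesis .
qed (auto simp: add_eq_0_iff)

lemma padic_abs_add_le:
  assumes p: "prime p"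
  shows "padic_abs p (x + y) \<le> padic_abs p x + padic_abs p y"
  using padic_abs_add[OF p, of x y] padic_abs_nonneg[of p x] padic_abs_nonneg[of p y] by linarith

lemma padic_abs_diff_abs:
  assumes p: "prime p"
  shows "\<bar>padic_abs p x - padic_abs p y\<bar> \<le> padic_abs p (x - y)"
  using padic_abs_add_le[OF p, of "x - y" y] padic_abs_add_le[OF p, of "y - x" x]
    padic_abs_minus[of p "x - y"] by simp

definition padic_Cauchy :: "nat \<Rightarrow> (nat \<Rightarrow> rat) \<Rightarrow> bool" where
  "padic_Cauchy p f \<longleftrightarrow> (\<forall>e>0. \<exists>N. \<forall>m\<ge>N. \<forall>n\<ge>N. padic_abs p (f m - f n) < e)"

definition padic_null :: "nat \<Rightarrow> (nat \<Rightarrow> rat) \<Rightarrow> bool" where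
  "padic_null p f \<longleftrightarrow> (\<lambda>n. padic_abs p (f n)) \<longlonglongrightarrow> 0"

text \<open>The completion of the rationals: Cauchy sequences modulo null sequences.\<close>

definition padic_Cauchy_ring :: "nat \<Rightarrow> (nat \<Rightarrow> rat) ring" where
  "padic_Cauchy_ring p = \<lparr>carrier = {f. padic_Cauchy p f},
     monoid.mult = (\<lambda>f g n. f n * g n), one = (\<lambda>n. 1), zero = (\<lambda>n. 0), add = (\<lambda>f g n. f n + g n)\<rparr>"

definition padic_null_ideal :: "nat \<Rightarrow> (nat \<Rightarrow> rat) set" where
  "padic_null_ideal p = {f. padic_null p f}"

definition Q_p :: "nat \<Rightarrow> (nat \<Rightarrow> rat) set ring" where
  "Q_p p = padic_Cauchy_ring p Quot padic_null_ideal p"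

definition Q_p_abs :: "nat \<Rightarrow> (nat \<Rightarrow> rat) set \<Rightarrow> real" where
  "Q_p_abs p X = (THE v. \<exists>f\<in>X. (\<lambda>n. padic_abs p (f n)) \<longlonglongrightarrow> v)"

definition Z_p :: "nat \<Rightarrow> (nat \<Rightarrow> rat) set set" where
  "Z_p p = {X \<in> carrier (Q_p p). Q_p_abs p X \<le> 1}"

definition Q_p_of_rat :: "nat \<Rightarrow> rat \<Rightarrow> (nat \<Rightarrow> rat) set" where
  "Q_p_of_rat p x = padic_null_ideal p +>\<^bsub>padic_Cauchy_ring p\<^esub> (\<lambda>n. x)"

lemma padic_Cauchy_convergent:
  assumes p: "prime p" and f: "padic_Cauchy p f"
  shows "convergent (\<lambda>n. padic_abs p (f n))"
proof (rule Cauchy_convergent, rule metric_CauchyI)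
  fix e :: real assume "0 < e"
  then obtain N where N: "\<forall>m\<ge>N. \<forall>n\<ge>N. padic_abs p (f m - f n) < e"
    using f unfolding padic_Cauchy_def by blast
  show "\<exists>M. \<forall>m\<ge>M. \<forall>n\<ge>M. dist (padic_abs p (f m)) (padic_abs p (f n)) < e"
    using N by (intro exI[of _ N])
      (auto simp: dist_real_def intro: le_less_trans[OF padic_abs_diff_abs[OF p]])
qed

lemma padic_Cauchy_bounded:
  assumes p: "prime p" and f: "padic_Cauchy p f"
  obtains B where "B > 0" "\<And>n. padic_abs p (f n) \<le> B"
proof -
  have "Bseq (\<lambda>n. padic_abs p (f n))"
    using padic_Cauchy_convergent[OF assms] by (rule convergent_imp_Bseq)
  then show thesis using that by (auto simp: Bseq_def)
qed

lemma padic_Cauchy_const: "padic_Cauchy p (\<lambda>n. c)"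
  by (auto simp: padic_Cauchy_def)

lemma padic_Cauchy_uminus:
  assumes "padic_Cauchy p f" shows "padic_Cauchy p (\<lambda>n. - f n)"
proof -
  have "padic_abs p (- f m - - f n) = padic_abs p (f m - f n)" for m n
    using padic_abs_minus[of p "f m - f n"] by simp
  then show ?thesis using assms by (simp only: padic_Cauchy_def)
qed

lemma padic_Cauchy_add:
  assumes p: "prime p" and f: "padic_Cauchy p f" and g: "padic_Cauchy p g"
  shows "padic_Cauchy p (\<lambda>n. f n + g n)"
  unfolding padic_Cauchy_def
proof (intro allI impI)
  fix e :: real assume e: "0 < e"
  obtain N where N: "\<forall>m\<ge>N. \<forall>n\<ge>N. padic_abs p (f m - f n) < e"
    using f e unfolding padic_Cauchy_def by blast
  obtain M where M: "\<forall>m\<ge>M. \<forall>n\<ge>M. padic_abs p (g m - g n) < e"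
    using g e unfolding padic_Cauchy_def by blast
  have "padic_abs p (f m + g m - (f n + g n)) < e" if "m \<ge> max N M" "n \<ge> max N M" for m n
  proof -
    have "padic_abs p ((f m - f n) + (g m - g n)) \<le> max (padic_abs p (f m - f n)) (padic_abs p (g m - g n))"
      by (rule padic_abs_add[OF p])
    also have "\<dots> < e" using N M that by simp
    finally show ?thesis by (simp add: algebra_simps)
  qed
  then show "\<exists>N. \<forall>m\<ge>N. \<forall>n\<ge>N. padic_abs p (f m + g m - (f n + g n)) < e" by blast
qed

lemma padic_Cauchy_mult:
  assumes p: "prime p" and f: "padic_Cauchy p f" and g: "padic_Cauchy p g"
  shows "padic_Cauchy p (\<lambda>n. f n * g n)"
  unfolding padic_Cauchy_def
proof (intro allI impI)
  fix e :: real assume e: "0 < e"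
  obtain A where A: "A > 0" "\<And>n. padic_abs p (f n) \<le> A" using padic_Cauchy_bounded[OF p f] by blast
  obtain B where B: "B > 0" "\<And>n. padic_abs p (g n) \<le> B" using padic_Cauchy_bounded[OF p g] by blast
  obtain N where N: "\<forall>m\<ge>N. \<forall>n\<ge>N. padic_abs p (f m - f n) < e / B"
    using f e B unfolding padic_Cauchy_def by (meson divide_pos_pos)
  obtain M where M: "\<forall>m\<ge>M. \<forall>n\<ge>M. padic_abs p (g m - g n) < e / A"
    using g e A unfolding padic_Cauchy_def by (meson divide_pos_pos)
  have "padic_abs p (f m * g m - f n * g n) < e" if "m \<ge> max N M" "n \<ge> max N M" for m n
  proof -
    have "f m * g m - f n * g n = f m * (g m - g n) + (f m - f n) * g n" by (simp add: algebra_simps)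
    then have "padic_abs p (f m * g m - f n * g n)
        \<le> max (padic_abs p (f m) * padic_abs p (g m - g n)) (padic_abs p (f m - f n) * padic_abs p (g n))"
      using padic_abs_add[OF p] by (metis padic_abs_mult[OF p])
    moreover have "padic_abs p (f m) * padic_abs p (g m - g n) < e"
    proof -
      have "padic_abs p (f m) * padic_abs p (g m - g n) \<le> A * padic_abs p (g m - g n)"
        using A by (intro mult_right_mono) auto
      also have "\<dots> < e" using M that A by (simp add: field_simps)
      finally show ?thesis .
    qed
    moreover have "padic_abs p (f m - f n) * padic_abs p (g n) < e"
    proof -
      have "padic_abs p (f m - f n) * padic_abs p (g n) \<le> padic_abs p (f m - f n) * B"
        using B by (intro mult_left_mono) auto
      also have "\<dots> < e" using N that B by (simp add: field_simps)
      finally show ?thesis .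
    qed
    ultimately show ?thesis by simp
  qed
  then show "\<exists>N. \<forall>m\<ge>N. \<forall>n\<ge>N. padic_abs p (f m * g m - f n * g n) < e" by blast
qed

lemma padic_null_Cauchy:
  assumes p: "prime p" and f: "padic_null p f" shows "padic_Cauchy p f"
  unfolding padic_Cauchy_def
proof (intro allI impI)
  fix e :: real assume e: "0 < e"
  obtain N where N: "\<forall>n\<ge>N. padic_abs p (f n) < e"
    using f e unfolding padic_null_def by (fastforce simp: LIMSEQ_def dist_real_def)
  have "padic_abs p (f m - f n) < e" if "m \<ge> N" "n \<ge> N" for m n
    using padic_abs_add[OF p, of "f m" "- f n"] N[rule_format, OF that(1)] N[rule_format, OF that(2)]
    by (auto simp: max_def split: if_splits)
  then show "\<exists>N. \<forall>m\<ge>N. \<forall>n\<ge>N. padic_abs p (f m - f n) < e" by blast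
qed

lemma padic_null_0: "padic_null p (\<lambda>n. 0)"
  by (simp add: padic_null_def)

lemma padic_null_add:
  assumes p: "prime p" and f: "padic_null p f" and g: "padic_null p g"
  shows "padic_null p (\<lambda>n. f n + g n)"
  unfolding padic_null_def
proof (rule tendsto_sandwich[where f = "\<lambda>n. 0" and h = "\<lambda>n. padic_abs p (f n) + padic_abs p (g n)"])
  show "(\<lambda>n. padic_abs p (f n) + padic_abs p (g n)) \<longlonglongrightarrow> 0"
    using tendsto_add[OF f[unfolded padic_null_def] g[unfolded padic_null_def]] by simp
qed (auto simp: padic_abs_add_le[OF p])

lemma padic_null_mult:
  assumes p: "prime p" and f: "padic_null p f" and g: "padic_Cauchy p g"
  shows "padic_null p (\<lambda>n. f n * g n)"
proof -
  obtain L where "(\<lambda>n. padic_abs p (g n)) \<longlonglongrightarrow> L"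
    using padic_Cauchy_convergent[OF p g] by (auto simp: convergent_def)
  from tendsto_mult[OF f[unfolded padic_null_def] this]
  show ?thesis by (simp add: padic_null_def padic_abs_mult[OF p])
qed

lemma cring_padic_Cauchy_ring:
  assumes p: "prime p" shows "cring (padic_Cauchy_ring p)"
proof (rule cringI)
  show "abelian_group (padic_Cauchy_ring p)"
  proof (rule abelian_groupI)
    fix x assume "x \<in> carrier (padic_Cauchy_ring p)"
    then show "\<exists>y\<in>carrier (padic_Cauchy_ring p). y \<oplus>\<^bsub>padic_Cauchy_ring p\<^esub> x = \<zero>\<^bsub>padic_Cauchy_ring p\<^esub>"
      by (intro bexI[of _ "\<lambda>n. - x n"]) (auto simp: padic_Cauchy_ring_def padic_Cauchy_uminus)
  qed (auto simp: padic_Cauchy_ring_def padic_Cauchy_const padic_Cauchy_add[OF p] algebra_simps)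
  show "Group.comm_monoid (padic_Cauchy_ring p)"
    by (rule Group.comm_monoidI)
      (auto simp: padic_Cauchy_ring_def padic_Cauchy_const padic_Cauchy_mult[OF p] algebra_simps)
qed (auto simp: padic_Cauchy_ring_def algebra_simps)

lemma ideal_padic_null_ideal:
  assumes p: "prime p" shows "ideal (padic_null_ideal p) (padic_Cauchy_ring p)"
proof -
  interpret cring "padic_Cauchy_ring p" using p by (rule cring_padic_Cauchy_ring)
  show ?thesis
  proof (rule idealI[OF ring_axioms])
    have minv: "\<ominus>\<^bsub>padic_Cauchy_ring p\<^esub> x \<in> padic_null_ideal p"
      if x: "x \<in> padic_null_ideal p" for x
    proof -
      have x': "padic_null p x" using x by (simp add: padic_null_ideal_def)
      have eq: "\<ominus>\<^bsub>padic_Cauchy_ring p\<^esub> x = (\<lambda>n. - x n)"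
        by (rule minus_equality)
          (use x' in \<open>auto simp: padic_Cauchy_ring_def padic_null_Cauchy[OF p] padic_Cauchy_uminus\<close>)
      show ?thesis unfolding eq using x' by (simp add: padic_null_ideal_def padic_null_def)
    qed
    have "additive_subgroup (padic_null_ideal p) (padic_Cauchy_ring p)"
    proof (rule additive_subgroup.intro, rule subgroup.intro)
      show "\<And>a. a \<in> padic_null_ideal p \<Longrightarrow> inv\<^bsub>add_monoid (padic_Cauchy_ring p)\<^esub> a \<in> padic_null_ideal p"
        using minv by (simp add: a_inv_def)
    qed (auto simp: padic_null_ideal_def padic_Cauchy_ring_def padic_null_Cauchy[OF p] padic_null_add[OF p] padic_null_0)
    then show "subgroup (padic_null_ideal p) (add_monoid (padic_Cauchy_ring p))"
      by (rule additive_subgroup.a_subgroup)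
  next
    fix a x assume "a \<in> padic_null_ideal p" "x \<in> carrier (padic_Cauchy_ring p)"
    then have "padic_null p (\<lambda>n. a n * x n)"
      using padic_null_mult[OF p] by (auto simp: padic_null_ideal_def padic_Cauchy_ring_def)
    then show "x \<otimes>\<^bsub>padic_Cauchy_ring p\<^esub> a \<in> padic_null_ideal p" "a \<otimes>\<^bsub>padic_Cauchy_ring p\<^esub> x \<in> padic_null_ideal p"
      by (auto simp: padic_null_ideal_def padic_Cauchy_ring_def mult.commute)
  qed
qed

lemma cring_Q_p: "prime p \<Longrightarrow> cring (Q_p p)"
  unfolding Q_p_def
  by (intro ideal.quotient_is_cring ideal_padic_null_ideal cring_padic_Cauchy_ring)

lemma Q_p_elemE:
  assumes p: "prime p" and X: "X \<in> carrier (Q_p p)"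
  obtains f where "padic_Cauchy p f" "X = padic_null_ideal p +>\<^bsub>padic_Cauchy_ring p\<^esub> f"
  using X by (auto simp: Q_p_def FactRing_def A_RCOSETS_def' padic_Cauchy_ring_def)

lemma Q_p_coset_carrier:
  assumes "padic_Cauchy p f"
  shows "padic_null_ideal p +>\<^bsub>padic_Cauchy_ring p\<^esub> f \<in> carrier (Q_p p)"
  using assms by (auto simp: Q_p_def FactRing_def A_RCOSETS_def' padic_Cauchy_ring_def)

lemma Q_p_abs_coset:
  assumes p: "prime p" and f: "padic_Cauchy p f"
  shows "(\<lambda>n. padic_abs p (f n)) \<longlonglongrightarrow> Q_p_abs p (padic_null_ideal p +>\<^bsub>padic_Cauchy_ring p\<^esub> f)"
proof -
  let ?X = "padic_null_ideal p +>\<^bsub>padic_Cauchy_ring p\<^esub> f"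
  obtain L where L: "(\<lambda>n. padic_abs p (f n)) \<longlonglongrightarrow> L"
    using padic_Cauchy_convergent[OF p f] by (auto simp: convergent_def)
  have mem: "g \<in> ?X \<longleftrightarrow> (\<exists>h. padic_null p h \<and> g = (\<lambda>n. h n + f n))" for g
    by (auto simp: a_r_coset_def' padic_Cauchy_ring_def padic_null_ideal_def)
  have lim: "(\<lambda>n. padic_abs p (g n)) \<longlonglongrightarrow> L" if gX: "g \<in> ?X" for g
  proof -
    obtain h where h: "padic_null p h" "g = (\<lambda>n. h n + f n)" using gX unfolding mem by blast
    have "(\<lambda>n. padic_abs p (g n) - padic_abs p (f n)) \<longlonglongrightarrow> 0"
    proof (rule tendsto_0_le[where f = "\<lambda>n. padic_abs p (h n)" and K = 1])
      show "\<forall>\<^sub>F n in sequentially. norm (padic_abs p (g n) - padic_abs p (f n)) \<le> norm (padic_abs p (h n)) * 1"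
      proof (intro always_eventually allI)
        fix n show "norm (padic_abs p (g n) - padic_abs p (f n)) \<le> norm (padic_abs p (h n)) * 1"
          using padic_abs_diff_abs[OF p, of "g n" "f n"] by (simp add: h(2))
      qed
    qed (use h in \<open>simp add: padic_null_def\<close>)
    from tendsto_add[OF this L] show ?thesis by simp
  qed
  have "f \<in> ?X" unfolding mem by (rule exI[of _ "\<lambda>n. 0"]) (auto simp: padic_null_def)
  then have "Q_p_abs p ?X = L"
    unfolding Q_p_abs_def
    by (intro the_equality bexI[of _ f] L) (auto dest: lim intro: LIMSEQ_unique)
  with L show ?thesis by simp
qed

lemma Q_p_add_coset:
  assumes p: "prime p" and f: "padic_Cauchy p f" and g: "padic_Cauchy p g"
  shows "(padic_null_ideal p +>\<^bsub>padic_Cauchy_ring p\<^esub> f) \<oplus>\<^bsub>Q_p p\<^esub> (padic_null_ideal p +>\<^bsub>padic_Cauchy_ring p\<^esub> g)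
    = padic_null_ideal p +>\<^bsub>padic_Cauchy_ring p\<^esub> (\<lambda>n. f n + g n)"
proof -
  interpret ideal "padic_null_ideal p" "padic_Cauchy_ring p" using p by (rule ideal_padic_null_ideal)
  show ?thesis
    using a_rcos_sum[of f g] f g by (simp add: Q_p_def FactRing_def padic_Cauchy_ring_def)
qed

lemma Q_p_mult_coset:
  assumes p: "prime p" and f: "padic_Cauchy p f" and g: "padic_Cauchy p g"
  shows "(padic_null_ideal p +>\<^bsub>padic_Cauchy_ring p\<^esub> f) \<otimes>\<^bsub>Q_p p\<^esub> (padic_null_ideal p +>\<^bsub>padic_Cauchy_ring p\<^esub> g)
    = padic_null_ideal p +>\<^bsub>padic_Cauchy_ring p\<^esub> (\<lambda>n. f n * g n)"
proof -
  interpret ideal "padic_null_ideal p" "padic_Cauchy_ring p" using p by (rule ideal_padic_null_ideal)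
  show ?thesis
    using rcoset_mult_add[of f g] f g by (simp add: Q_p_def FactRing_def padic_Cauchy_ring_def)
qed

lemma Q_p_of_rat_closed: "Q_p_of_rat p x \<in> carrier (Q_p p)"
  unfolding Q_p_of_rat_def by (intro Q_p_coset_carrier padic_Cauchy_const)

lemma Q_p_abs_of_rat:
  assumes "prime p" shows "Q_p_abs p (Q_p_of_rat p x) = padic_abs p x"
  using Q_p_abs_coset[OF assms padic_Cauchy_const, of x] LIMSEQ_unique[OF tendsto_const]
  unfolding Q_p_of_rat_def by metis

lemma Q_p_zero: "\<zero>\<^bsub>Q_p p\<^esub> = Q_p_of_rat p 0"
  by (simp add: Q_p_of_rat_def Q_p_def FactRing_def padic_Cauchy_ring_def a_r_coset_def')

lemma Q_p_one: "\<one>\<^bsub>Q_p p\<^esub> = Q_p_of_rat p 1"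
  by (simp add: Q_p_of_rat_def Q_p_def FactRing_def padic_Cauchy_ring_def)

lemma Z_p_of_int:
  assumes "prime p" shows "Q_p_of_rat p (of_int a) \<in> Z_p p"
  using assms by (simp add: Z_p_def Q_p_abs_of_rat Q_p_of_rat_closed padic_abs_of_int_le)

lemma Z_p_add:
  assumes p: "prime p" and "X \<in> Z_p p" "Y \<in> Z_p p" shows "X \<oplus>\<^bsub>Q_p p\<^esub> Y \<in> Z_p p"
proof -
  from assms have X: "X \<in> carrier (Q_p p)" "Q_p_abs p X \<le> 1"
    and Y: "Y \<in> carrier (Q_p p)" "Q_p_abs p Y \<le> 1" by (auto simp: Z_p_def)
  obtain f where f: "padic_Cauchy p f" "X = padic_null_ideal p +>\<^bsub>padic_Cauchy_ring p\<^esub> f"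
    using Q_p_elemE[OF p X(1)] .
  obtain g where g: "padic_Cauchy p g" "Y = padic_null_ideal p +>\<^bsub>padic_Cauchy_ring p\<^esub> g"
    using Q_p_elemE[OF p Y(1)] .
  have "Q_p_abs p (X \<oplus>\<^bsub>Q_p p\<^esub> Y) \<le> max (Q_p_abs p X) (Q_p_abs p Y)"
    unfolding f(2) g(2) Q_p_add_coset[OF p f(1) g(1)]
    by (rule LIMSEQ_le[OF Q_p_abs_coset[OF p padic_Cauchy_add[OF p f(1) g(1)]]
          tendsto_max[OF Q_p_abs_coset[OF p f(1)] Q_p_abs_coset[OF p g(1)]]])
       (simp add: padic_abs_add[OF p])
  with X Y show ?thesis
    by (auto simp: Z_p_def intro: cring.cring_simprules(1)[OF cring_Q_p[OF p]])
qed

lemma Z_p_mult: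
  assumes p: "prime p" and "X \<in> Z_p p" "Y \<in> Z_p p" shows "X \<otimes>\<^bsub>Q_p p\<^esub> Y \<in> Z_p p"
proof -
  from assms have X: "X \<in> carrier (Q_p p)" "Q_p_abs p X \<le> 1"
    and Y: "Y \<in> carrier (Q_p p)" "Q_p_abs p Y \<le> 1" by (auto simp: Z_p_def)
  obtain f where f: "padic_Cauchy p f" "X = padic_null_ideal p +>\<^bsub>padic_Cauchy_ring p\<^esub> f"
    using Q_p_elemE[OF p X(1)] .
  obtain g where g: "padic_Cauchy p g" "Y = padic_null_ideal p +>\<^bsub>padic_Cauchy_ring p\<^esub> g"
    using Q_p_elemE[OF p Y(1)] .
  have "(\<lambda>n. padic_abs p (f n * g n)) \<longlonglongrightarrow> Q_p_abs p X * Q_p_abs p Y"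
    using tendsto_mult[OF Q_p_abs_coset[OF p f(1)] Q_p_abs_coset[OF p g(1)]]
    by (simp add: f(2) g(2) padic_abs_mult[OF p])
  then have "Q_p_abs p (X \<otimes>\<^bsub>Q_p p\<^esub> Y) = Q_p_abs p X * Q_p_abs p Y"
    unfolding f(2) g(2) Q_p_mult_coset[OF p f(1) g(1)]
    using Q_p_abs_coset[OF p padic_Cauchy_mult[OF p f(1) g(1)]] LIMSEQ_unique by blast
  moreover have "0 \<le> Q_p_abs p Y"
    unfolding g(2) by (rule LIMSEQ_le_const[OF Q_p_abs_coset[OF p g(1)]]) auto
  ultimately have "Q_p_abs p (X \<otimes>\<^bsub>Q_p p\<^esub> Y) \<le> 1"
    using X Y by (auto intro: mult_le_one)
  with X Y show ?thesis
    by (auto simp: Z_p_def intro: cring.cring_simprules(5)[OF cring_Q_p[OF p]])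
qed

lemma Q_p_minus_eq:
  assumes p: "prime p" and X: "X \<in> carrier (Q_p p)"
  shows "\<ominus>\<^bsub>Q_p p\<^esub> X = Q_p_of_rat p (of_int (-1)) \<otimes>\<^bsub>Q_p p\<^esub> X"
proof -
  interpret cring "Q_p p" using p by (rule cring_Q_p)
  obtain f where f: "padic_Cauchy p f" "X = padic_null_ideal p +>\<^bsub>padic_Cauchy_ring p\<^esub> f"
    using Q_p_elemE[OF p X] .
  let ?c = "Q_p_of_rat p (of_int (-1))"
  have c: "?c \<in> carrier (Q_p p)" by (rule Q_p_of_rat_closed)
  have "?c \<oplus>\<^bsub>Q_p p\<^esub> \<one>\<^bsub>Q_p p\<^esub> = \<zero>\<^bsub>Q_p p\<^esub>"
    unfolding Q_p_one Q_p_zero Q_p_of_rat_def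
    by (subst Q_p_add_coset[OF p padic_Cauchy_const padic_Cauchy_const]) simp
  then have "(?c \<otimes>\<^bsub>Q_p p\<^esub> X) \<oplus>\<^bsub>Q_p p\<^esub> X = \<zero>\<^bsub>Q_p p\<^esub>"
    using l_distr[OF c one_closed X] X by simp
  then show ?thesis using c X by (intro minus_equality) auto
qed

lemma Z_p_uminus:
  assumes p: "prime p" and X: "X \<in> Z_p p" shows "\<ominus>\<^bsub>Q_p p\<^esub> X \<in> Z_p p"
proof -
  have "X \<in> carrier (Q_p p)" using X by (simp add: Z_p_def)
  then show ?thesis using Z_p_mult[OF p Z_p_of_int[OF p] X] Q_p_minus_eq[OF p] by metis
qed


section \<open>The ring of adeles of the rationals\<close>

definition finite_adeles :: "(nat \<Rightarrow> (nat \<Rightarrow> rat) set) set" where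
  "finite_adeles = {f \<in> (\<Pi>\<^sub>E p\<in>{p. prime p}. carrier (Q_p p)). finite {p. prime p \<and> f p \<notin> Z_p p}}"

lemma finite_adeles_closed: "f \<in> finite_adeles \<Longrightarrow> prime p \<Longrightarrow> f p \<in> carrier (Q_p p)"
  by (auto simp: finite_adeles_def)

lemma finite_adeles_of_rat: "(\<lambda>p\<in>{p. prime p}. Q_p_of_rat p x) \<in> finite_adeles"
proof -
  obtain a b where ab: "quotient_of x = (a, b)" by (cases "quotient_of x") auto
  have b: "b > 0" using ab by (rule quotient_of_denom_pos)
  have x: "x = of_int a / of_int b" using ab by (rule quotient_of_div)
  have "{p. prime p \<and> (\<lambda>p\<in>{p. prime p}. Q_p_of_rat p x) p \<notin> Z_p p} \<subseteq> {..nat b}"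
  proof safe
    fix p :: nat
    assume p: "prime p" and "(\<lambda>p\<in>{p. prime p}. Q_p_of_rat p x) p \<notin> Z_p p"
    then have gt: "padic_abs p x > 1"
      by (simp add: Z_p_def Q_p_abs_of_rat Q_p_of_rat_closed)
    have "int p dvd b"
    proof (rule ccontr)
      assume "\<not> int p dvd b"
      then have m: "multiplicity (int p) b = 0" by (rule not_dvd_imp_multiplicity_0)
      have "a \<noteq> 0" using gt x by auto
      then have "padic_abs p x = padic_abs p (of_int a)"
        using padic_abs_fract[OF p, of a b] padic_abs_fract[OF p, of a 1] b m x by simp
      with gt padic_abs_of_int_le[OF p, of a] show False by simp
    qed
    with b have "int p \<le> b" by (intro zdvd_imp_le) auto
    then show "p \<le> nat b" using b by linarith
  qed
  then have "finite {p. prime p \<and> (\<lambda>p\<in>{p. prime p}. Q_p_of_rat p x) p \<notin> Z_p p}"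
    by (rule finite_subset) simp
  then show ?thesis
    unfolding finite_adeles_def by (simp add: Q_p_of_rat_closed)
qed

lemma finite_adeles_add:
  assumes f: "f \<in> finite_adeles" and g: "g \<in> finite_adeles"
  shows "(\<lambda>p\<in>{p. prime p}. f p \<oplus>\<^bsub>Q_p p\<^esub> g p) \<in> finite_adeles" (is "?h \<in> _")
proof -
  have "{p. prime p \<and> ?h p \<notin> Z_p p} \<subseteq> {p. prime p \<and> f p \<notin> Z_p p} \<union> {p. prime p \<and> g p \<notin> Z_p p}"
    using Z_p_add by auto
  then have "finite {p. prime p \<and> ?h p \<notin> Z_p p}"
    by (rule finite_subset) (use f g in \<open>simp add: finite_adeles_def\<close>)
  moreover have "?h \<in> (\<Pi>\<^sub>E p\<in>{p. prime p}. carrier (Q_p p))"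
    using finite_adeles_closed[OF f] finite_adeles_closed[OF g]
    by (intro restrict_PiE[THEN iffD2] Pi_I) (auto intro: cring.cring_simprules(1)[OF cring_Q_p])
  ultimately show ?thesis unfolding finite_adeles_def by blast
qed

lemma finite_adeles_mult:
  assumes f: "f \<in> finite_adeles" and g: "g \<in> finite_adeles"
  shows "(\<lambda>p\<in>{p. prime p}. f p \<otimes>\<^bsub>Q_p p\<^esub> g p) \<in> finite_adeles" (is "?h \<in> _")
proof -
  have "{p. prime p \<and> ?h p \<notin> Z_p p} \<subseteq> {p. prime p \<and> f p \<notin> Z_p p} \<union> {p. prime p \<and> g p \<notin> Z_p p}"
    using Z_p_mult by auto
  then have "finite {p. prime p \<and> ?h p \<notin> Z_p p}"
    by (rule finite_subset) (use f g in \<open>simp add: finite_adeles_def\<close>)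
  moreover have "?h \<in> (\<Pi>\<^sub>E p\<in>{p. prime p}. carrier (Q_p p))"
    using finite_adeles_closed[OF f] finite_adeles_closed[OF g]
    by (intro restrict_PiE[THEN iffD2] Pi_I) (auto intro: cring.cring_simprules(5)[OF cring_Q_p])
  ultimately show ?thesis unfolding finite_adeles_def by blast
qed

lemma finite_adeles_uminus:
  assumes f: "f \<in> finite_adeles"
  shows "(\<lambda>p\<in>{p. prime p}. \<ominus>\<^bsub>Q_p p\<^esub> f p) \<in> finite_adeles" (is "?h \<in> _")
proof -
  have "{p. prime p \<and> ?h p \<notin> Z_p p} \<subseteq> {p. prime p \<and> f p \<notin> Z_p p}"
    using Z_p_uminus by auto
  then have "finite {p. prime p \<and> ?h p \<notin> Z_p p}"
    by (rule finite_subset) (use f in \<open>simp add: finite_adeles_def\<close>)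
  moreover have "?h \<in> (\<Pi>\<^sub>E p\<in>{p. prime p}. carrier (Q_p p))"
    using finite_adeles_closed[OF f]
    by (intro restrict_PiE[THEN iffD2] Pi_I) (auto intro: cring.cring_simprules(3)[OF cring_Q_p])
  ultimately show ?thesis unfolding finite_adeles_def by blast
qed

text \<open>An adele is a pair of its real component and the family of its p-adic components.\<close>

typedef adele = "(UNIV :: real set) \<times> finite_adeles"
  using finite_adeles_of_rat by blast

setup_lifting type_definition_adele

lift_definition adele_real :: "adele \<Rightarrow> real" is fst .

lift_definition adele_padic :: "adele \<Rightarrow> nat \<Rightarrow> (nat \<Rightarrow> rat) set" is snd .

lift_definition adele_of_rat :: "rat \<Rightarrow> adele" is
  "\<lambda>x. (of_rat x, \<lambda>p\<in>{p. prime p}. Q_p_of_rat p x)"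
  using finite_adeles_of_rat by blast

lemma adele_eqI:
  assumes "adele_real a = adele_real b" "\<And>p. prime p \<Longrightarrow> adele_padic a p = adele_padic b p"
  shows "a = b"
  using assms
proof transfer
  fix a b :: "real \<times> (nat \<Rightarrow> (nat \<Rightarrow> rat) set)"
  assume ab: "a \<in> UNIV \<times> finite_adeles" "b \<in> UNIV \<times> finite_adeles" "fst a = fst b"
    and eq: "\<And>p. prime p \<Longrightarrow> snd a p = snd b p"
  have "snd a = snd b"
    using ab eq unfolding finite_adeles_def by (intro PiE_ext[of _ "{p. prime p}"]) auto
  with ab(3) show "a = b" by (rule prod_eqI)
qed

lemma adele_padic_closed: "prime p \<Longrightarrow> adele_padic a p \<in> carrier (Q_p p)"
  by transfer (auto simp: mem_Times_iff intro: finite_adeles_closed)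

instantiation adele :: comm_ring_1
begin

lift_definition zero_adele :: adele is "(0, \<lambda>p\<in>{p. prime p}. \<zero>\<^bsub>Q_p p\<^esub>)"
  using finite_adeles_of_rat unfolding Q_p_zero by blast

lift_definition one_adele :: adele is "(1, \<lambda>p\<in>{p. prime p}. \<one>\<^bsub>Q_p p\<^esub>)"
  using finite_adeles_of_rat unfolding Q_p_one by blast

lift_definition plus_adele :: "adele \<Rightarrow> adele \<Rightarrow> adele" is
  "\<lambda>a b. (fst a + fst b, \<lambda>p\<in>{p. prime p}. snd a p \<oplus>\<^bsub>Q_p p\<^esub> snd b p)"
  using finite_adeles_add by (simp add: mem_Times_iff)

lift_definition times_adele :: "adele \<Rightarrow> adele \<Rightarrow> adele" is
  "\<lambda>a b. (fst a * fst b, \<lambda>p\<in>{p. prime p}. snd a p \<otimes>\<^bsub>Q_p p\<^esub> snd b p)"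
  using finite_adeles_mult by (simp add: mem_Times_iff)

lift_definition uminus_adele :: "adele \<Rightarrow> adele" is
  "\<lambda>a. (- fst a, \<lambda>p\<in>{p. prime p}. \<ominus>\<^bsub>Q_p p\<^esub> snd a p)"
  using finite_adeles_uminus by (simp add: mem_Times_iff)

definition minus_adele :: "adele \<Rightarrow> adele \<Rightarrow> adele" where
  "minus_adele x y = x + - y"

lemma adele_real_simps [simp]:
  "adele_real 0 = 0" "adele_real 1 = 1"
  "adele_real (a + b) = adele_real a + adele_real b"
  "adele_real (a * b) = adele_real a * adele_real b"
  "adele_real (- a) = - adele_real a"
  by (transfer, simp)+

lemma adele_padic_simps [simp]:
  assumes "prime p"
  shows "adele_padic 0 p = \<zero>\<^bsub>Q_p p\<^esub>" "adele_padic 1 p = \<one>\<^bsub>Q_p p\<^esub>"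
    "adele_padic (a + b) p = adele_padic a p \<oplus>\<^bsub>Q_p p\<^esub> adele_padic b p"
    "adele_padic (a * b) p = adele_padic a p \<otimes>\<^bsub>Q_p p\<^esub> adele_padic b p"
    "adele_padic (- a) p = \<ominus>\<^bsub>Q_p p\<^esub> adele_padic a p"
  using assms by (transfer, simp)+

instance
proof
  fix a b c :: adele
  note R = cring.cring_simprules[OF cring_Q_p]
  show "a + b + c = a + (b + c)"
    by (rule adele_eqI) (simp_all add: R(7) adele_padic_closed)
  show "a + b = b + a"
    by (rule adele_eqI) (simp_all add: R(10)[OF _ adele_padic_closed[of _ a] adele_padic_closed[of _ b]])
  show "0 + a = a"
    by (rule adele_eqI) (simp_all add: R(8) adele_padic_closed)
  show "- a + a = 0"
    by (rule adele_eqI) (simp_all add: R(9) adele_padic_closed)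
  show "a - b = a + - b" by (rule minus_adele_def)
  show "a * b * c = a * (b * c)"
    by (rule adele_eqI) (simp_all add: R(11) adele_padic_closed)
  show "a * b = b * a"
    by (rule adele_eqI) (simp_all add: R(14)[OF _ adele_padic_closed[of _ a] adele_padic_closed[of _ b]])
  show "1 * a = a"
    by (rule adele_eqI) (simp_all add: R(12) adele_padic_closed)
  show "(a + b) * c = a * c + b * c"
    by (rule adele_eqI) (simp_all add: R(13) adele_padic_closed distrib_right)
  show "(0::adele) \<noteq> 1"
    using adele_real_simps(1,2) by (metis zero_neq_one)
qed

end

text \<open>The product is finite when \<open>x\<close> is an idele, the only case of interest.\<close>

definition adele_abs :: "adele \<Rightarrow> real" where
  "adele_abs x = \<bar>adele_real x\<bar> *
    (\<Prod>p \<in> {p. prime p \<and> Q_p_abs p (adele_padic x p) \<noteq> 1}. Q_p_abs p (adele_padic x p))"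

section \<open>The special linear group\<close>

definition SL :: "nat \<Rightarrow> 'a :: comm_ring_1 mat set" where
  "SL r = {g \<in> carrier_mat r r. det g = 1}"

definition mat_inv :: "'a :: comm_ring_1 mat \<Rightarrow> 'a mat" where
  "mat_inv g = (THE h. h \<in> carrier_mat (dim_row g) (dim_row g) \<and> inverts_mat g h \<and> inverts_mat h g)"

definition maximal_compact :: "nat \<Rightarrow> adele mat set" where
  "maximal_compact r = {k \<in> SL r.
     (\<forall>p. prime p \<longrightarrow> (\<forall>i<r. \<forall>j<r. adele_padic (k $$ (i, j)) p \<in> Z_p p)) \<and>
     transpose_mat (map_mat adele_real k) * map_mat adele_real k = 1\<^sub>m r}"

section \<open>Euclidean lattices and the canonical polygon\<close>

text \<open>A Euclidean lattice is realised as a discrete subgroup, possibly not of full rank, of the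
  standard Euclidean space of dimension \<open>r\<close>.\<close>

definition lattice_basis :: "nat \<Rightarrow> real vec list \<Rightarrow> real vec set \<Rightarrow> bool" where
  "lattice_basis r bs L \<longleftrightarrow> set bs \<subseteq> carrier_vec r \<and>
     (\<forall>c \<in> carrier_vec (length bs). mat_of_cols r bs *\<^sub>v c = 0\<^sub>v r \<longrightarrow> c = 0\<^sub>v (length bs)) \<and>
     L = {mat_of_cols r bs *\<^sub>v map_vec of_int c |c :: int vec. c \<in> carrier_vec (length bs)}"

definition is_lattice :: "nat \<Rightarrow> real vec set \<Rightarrow> bool" where
  "is_lattice r L \<longleftrightarrow> (\<exists>bs. lattice_basis r bs L)"

definition some_basis :: "nat \<Rightarrow> real vec set \<Rightarrow> real vec list" where
  "some_basis r L = (SOME bs. lattice_basis r bs L)"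

definition lattice_rank :: "nat \<Rightarrow> real vec set \<Rightarrow> nat" where
  "lattice_rank r L = length (some_basis r L)"

text \<open>The covolume in the real span, from the Gram matrix of a basis; the zero lattice has volume 1.\<close>

definition lattice_vol :: "nat \<Rightarrow> real vec set \<Rightarrow> real" where
  "lattice_vol r L = (let B = mat_of_cols r (some_basis r L) in sqrt (det (transpose_mat B * B)))"

definition lattice_deg :: "nat \<Rightarrow> real vec set \<Rightarrow> real" where
  "lattice_deg r L = - ln (lattice_vol r L)"

definition lattice_slope :: "nat \<Rightarrow> real vec set \<Rightarrow> real" where
  "lattice_slope r L = lattice_deg r L / real (lattice_rank r L)"

definition real_span :: "nat \<Rightarrow> real vec set \<Rightarrow> real vec set" where
  "real_span r M = {mat_of_cols r bs *\<^sub>v c |bs c. set bs \<subseteq> M \<and> c \<in> carrier_vec (length bs)}"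

definition sublattice :: "nat \<Rightarrow> real vec set \<Rightarrow> real vec set \<Rightarrow> bool" where
  "sublattice r M L \<longleftrightarrow> is_lattice r M \<and> M \<subseteq> L"

definition saturated_sublattice :: "nat \<Rightarrow> real vec set \<Rightarrow> real vec set \<Rightarrow> bool" where
  "saturated_sublattice r M L \<longleftrightarrow> sublattice r M L \<and>
     (\<forall>x\<in>L. \<forall>n::int. n \<noteq> 0 \<longrightarrow> of_int n \<cdot>\<^sub>v x \<in> M \<longrightarrow> x \<in> M)"

text \<open>The quotient \<open>L / M\<close> with the quotient norm, as the orthogonal projection of \<open>L\<close> to the
  orthogonal complement of \<open>M\<close>.\<close>

definition quotient_lattice :: "nat \<Rightarrow> real vec set \<Rightarrow> real vec set \<Rightarrow> real vec set" where
  "quotient_lattice r L M = {z \<in> carrier_vec r.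
     (\<forall>m\<in>M. z \<bullet> m = 0) \<and> (\<exists>x\<in>L. x - z \<in> real_span r M)}"

definition semistable :: "nat \<Rightarrow> real vec set \<Rightarrow> bool" where
  "semistable r L \<longleftrightarrow> is_lattice r L \<and>
     (\<forall>M. sublattice r M L \<and> M \<noteq> {0\<^sub>v r} \<longrightarrow> lattice_slope r M \<le> lattice_slope r L)"

definition HN_filtration :: "nat \<Rightarrow> real vec set \<Rightarrow> real vec set list \<Rightarrow> bool" where
  "HN_filtration r L F \<longleftrightarrow> F \<noteq> [] \<and> hd F = {0\<^sub>v r} \<and> last F = L \<and>
     (\<forall>i<length F. saturated_sublattice r (F ! i) L) \<and>
     (\<forall>i. Suc i < length F \<longrightarrow> F ! i \<subset> F ! Suc i \<and>
        semistable r (quotient_lattice r (F ! Suc i) (F ! i))) \<and>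
     (\<forall>i. Suc (Suc i) < length F \<longrightarrow>
        lattice_slope r (quotient_lattice r (F ! Suc (Suc i)) (F ! Suc i))
          < lattice_slope r (quotient_lattice r (F ! Suc i) (F ! i)))"

definition canonical_filtration :: "nat \<Rightarrow> real vec set \<Rightarrow> real vec set list" where
  "canonical_filtration r L = (THE F. HN_filtration r L F)"

definition canonical_polygon :: "nat \<Rightarrow> real vec set \<Rightarrow> real \<Rightarrow> real" where
  "canonical_polygon r L t = (let F = canonical_filtration r L;
       i = (LEAST i. t \<le> real (lattice_rank r (F ! Suc i)));
       s = real (lattice_rank r (F ! i)); s' = real (lattice_rank r (F ! Suc i))
     in lattice_deg r (F ! i)
          + (t - s) / (s' - s) * (lattice_deg r (F ! Suc i) - lattice_deg r (F ! i)))"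

definition adelic_lattice :: "nat \<Rightarrow> adele mat \<Rightarrow> rat vec set" where
  "adelic_lattice r g = {x \<in> carrier_vec r. \<forall>p. prime p \<longrightarrow>
     (\<forall>i<r. adele_padic ((mat_inv g *\<^sub>v map_vec adele_of_rat x) $ i) p \<in> Z_p p)}"

text \<open>The norm on the adelic lattice attached to \<open>g\<close> is the Euclidean norm of the image under the
  inverse of the real component of \<open>g\<close>.\<close>

definition euclidean_adelic_lattice :: "nat \<Rightarrow> adele mat \<Rightarrow> real vec set" where
  "euclidean_adelic_lattice r g =
     (\<lambda>x. mat_inv (map_mat adele_real g) *\<^sub>v map_vec of_rat x) ` adelic_lattice r g"

section \<open>Polygons\<close>

definition polygon :: "nat \<Rightarrow> (real \<Rightarrow> real) \<Rightarrow> bool" where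
  "polygon r p \<longleftrightarrow> continuous_on {0..real r} p \<and>
     (\<forall>i\<in>{1..r}. \<exists>a b. \<forall>t\<in>{real i - 1..real i}. p t = a * t + b)"

definition normalized_polygon :: "nat \<Rightarrow> (real \<Rightarrow> real) \<Rightarrow> bool" where
  "normalized_polygon r p \<longleftrightarrow> polygon r p \<and> p 0 = 0 \<and> p (real r) = 0"

text \<open>Convexity in the sense of Harder and Narasimhan: such polygons are concave functions.\<close>

definition convex_polygon :: "nat \<Rightarrow> (real \<Rightarrow> real) \<Rightarrow> bool" where
  "convex_polygon r p \<longleftrightarrow> polygon r p \<and>
     (\<forall>i\<in>{1..<r}. p (real i + 1) - p (real i) \<le> p (real i) - p (real i - 1))"

section \<open>Arthur's truncation\<close>

text \<open>Coordinates of vectors in this section are numbered from 0.\<close>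

definition a0 :: "nat \<Rightarrow> real vec set" where
  "a0 r = {H \<in> carrier_vec r. (\<Sum>i<r. H $ i) = 0}"

definition simple_root :: "nat \<Rightarrow> real vec \<Rightarrow> real" where
  "simple_root i H = H $ (i - 1) - H $ i"

definition simple_weight :: "nat \<Rightarrow> real vec \<Rightarrow> real" where
  "simple_weight i H = (\<Sum>j<i. H $ j)"

definition T_of_polygon :: "nat \<Rightarrow> (real \<Rightarrow> real) \<Rightarrow> real vec" where
  "T_of_polygon r p = vec r (\<lambda>i. if i = 0 then p 1
     else if i = r - 1 then - p (real r - 1) else p (real i + 1) - p (real i))"

definition iwasawa :: "nat \<Rightarrow> adele mat \<Rightarrow> adele mat \<Rightarrow> adele mat \<Rightarrow> adele mat \<Rightarrow> bool" where
  "iwasawa r g n a k \<longleftrightarrow> g = n * a * k \<and>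
     n \<in> carrier_mat r r \<and> upper_triangular n \<and> (\<forall>i<r. n $$ (i, i) = 1) \<and>
     a \<in> SL r \<and> diagonal_mat a \<and> k \<in> maximal_compact r"

definition H0 :: "nat \<Rightarrow> adele mat \<Rightarrow> real vec" where
  "H0 r g = (THE H. \<exists>n a k. iwasawa r g n a k \<and> H = vec r (\<lambda>i. ln (adele_abs (a $$ (i, i)))))"

definition ordered_partitions :: "nat \<Rightarrow> nat list set" where
  "ordered_partitions r = {ds. sum_list ds = r \<and> 0 \<notin> set ds}"

definition partial_sum :: "nat list \<Rightarrow> nat \<Rightarrow> nat" where
  "partial_sum ds i = sum_list (take i ds)"

definition SL_Q :: "nat \<Rightarrow> rat mat monoid" where
  "SL_Q r = \<lparr>carrier = SL r, monoid.mult = (*), one = 1\<^sub>m r\<rparr>"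

text \<open>Rational points of the standard parabolic subgroup: block upper triangular matrices.\<close>

definition parabolic_Q :: "nat \<Rightarrow> nat list \<Rightarrow> rat mat set" where
  "parabolic_Q r ds = {\<delta> \<in> SL r. \<forall>m\<in>{1..<length ds}. \<forall>i j.
     j < partial_sum ds m \<and> partial_sum ds m \<le> i \<and> i < r \<longrightarrow> \<delta> $$ (i, j) = 0}"

definition tau_hat :: "nat \<Rightarrow> nat list \<Rightarrow> real vec \<Rightarrow> real" where
  "tau_hat r ds = indicator {H \<in> a0 r. \<forall>i\<in>{1..<length ds}. simple_weight (partial_sum ds i) H > 0}"

text \<open>The summand does not depend on the representative of the coset, and only finitely many
  summands are non-zero.\<close>

definition arthur_truncation_one :: "nat \<Rightarrow> real vec \<Rightarrow> adele mat \<Rightarrow> real" where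
  "arthur_truncation_one r T g = (\<Sum>ds\<in>ordered_partitions r. (- 1) ^ (length ds - 1) *
     (\<Sum>\<^sub>\<infinity>C \<in> rcosets\<^bsub>SL_Q r\<^esub> (parabolic_Q r ds).
        tau_hat r ds (H0 r (map_mat adele_of_rat (SOME \<delta>. \<delta> \<in> C) * g) - T)))"

end

theory Submission
  imports Defs "HOL-Library.Infinite_Set"
begin

text \<open>Let \<open>\<Lambda>\<close> be the lattice of \<open>g\<close> and let \<open>X\<close> be the set of its saturated sublattices \<open>M\<close> with
  \<open>f(M) = deg M - p(rank M) > 0\<close>. A coset in \<open>P(\<rat>) \ G(\<rat>)\<close> is a flag of saturated sublattices of
  \<open>\<Lambda>\<close> with ranks \<open>r\<^sub>i\<close>, and the weight of \<open>H(\<delta>g)\<close> at \<open>r\<^sub>i\<close> is the degree of its member of rank \<open>r\<^sub>i\<close>;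
  so the truncation is the sum of \<open>(-1)^|c|\<close> over the chains \<open>c\<close> in \<open>X\<close>. The canonical polygon lies
  below \<open>p\<close> if and only if \<open>X\<close> is empty, and then the sum is 1. Otherwise let \<open>V \<in> X\<close> maximise \<open>f\<close>.
  Since the degree is submodular and \<open>p\<close> is concave,
  \<open>f(W) + f(V) \<le> f(W \<inter> V) + f(W + V)\<close>, whence \<open>W \<inter> V \<in> X\<close> for every \<open>W \<in> X\<close>: the order complex of
  \<open>X\<close> is contractible, and the alternating sum vanishes.\<close>

section \<open>Gram determinants\<close>

text \<open>The inequality for \<open>f\<close> yields \<open>W \<inter> V \<in> X\<close> because
  \<open>f(W + V) \<le> f(V)\<close> by the choice of \<open>V\<close>, so that
  \<open>f(W \<inter> V) \<ge> f(W) > 0\<close>. For degrees it is Fischer's inequality for Gram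
  determinants, applied modulo the span of the intersection; a sum of saturated sublattices need not
  be saturated, but saturating does not lower its degree. The length of the proof comes from the
  definitions: rank, volume, \<open>H0\<close>, the canonical filtration and coset representatives
  are given by choice or definite description and must each be tied to an explicit matrix.
  Divisibility arguments are made in \<open>\<rat>^r\<close>, where denominators can be cleared, and
  carried to Euclidean space by an injective map. Weights meet degrees through a triangular rational
  basis of the lattice with determinant one, found by additive strong approximation and a comparison
  of determinants. At ranks 0 and \<open>r\<close> degree and polygon both vanish, so
  \<open>X\<close> only has members of the ranks that occur in flags. The coset sum is finite
  because \<open>X\<close> is: minors of bounded size and bounded denominator are finite in
  number.\<close>

definition mat_inj :: "'a :: comm_ring_1 mat \<Rightarrow> bool" where
  "mat_inj A \<longleftrightarrow>
     (\<forall>c\<in>carrier_vec (dim_col A). A *\<^sub>v c = 0\<^sub>v (dim_row A) \<longrightarrow> c = 0\<^sub>v (dim_col A))"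

text \<open>For independent real columns, the squared covolume of the lattice they generate. It is
  defined over any commutative ring so that it can be computed for a rational basis and transferred
  by \<open>gram_real_of_rat\<close>.\<close>

definition gram :: "'a :: comm_ring_1 mat \<Rightarrow> 'a" where
  "gram A = det (transpose_mat A * A)"

definition hcat :: "'a :: zero mat \<Rightarrow> 'a mat \<Rightarrow> 'a mat" where
  "hcat A B = mat (dim_row A) (dim_col A + dim_col B)
     (\<lambda>(i, j). if j < dim_col A then A $$ (i, j) else B $$ (i, j - dim_col A))"

definition first_cols :: "nat \<Rightarrow> 'a mat \<Rightarrow> 'a mat" where
  "first_cols k A = mat (dim_row A) k (\<lambda>(i, j). A $$ (i, j))"

lemma mat_injD:
  "mat_inj A \<Longrightarrow> A \<in> carrier_mat r k \<Longrightarrow> c \<in> carrier_vec k \<Longrightarrow> A *\<^sub>v c = 0\<^sub>v r \<Longrightarrow> c = 0\<^sub>v k"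
  unfolding mat_inj_def by auto

lemma mat_injI:
  assumes "A \<in> carrier_mat r k"
    "\<And>c. c \<in> carrier_vec k \<Longrightarrow> A *\<^sub>v c = 0\<^sub>v r \<Longrightarrow> c = 0\<^sub>v k"
  shows "mat_inj A"
  using assms unfolding mat_inj_def by auto

lemma mat_inj_eqD:
  assumes "mat_inj (A :: 'a :: comm_ring_1 mat)" and A: "A \<in> carrier_mat r k"
    and c: "c \<in> carrier_vec k" and d: "d \<in> carrier_vec k" and eq: "A *\<^sub>v c = A *\<^sub>v d"
  shows "c = d"
proof -
  have "A *\<^sub>v (c - d) = 0\<^sub>v r"
    using A c d eq by (simp add: mult_minus_distrib_mat_vec[OF A c d])
  then have "c - d = 0\<^sub>v k" using assms(1) A c d by (intro mat_injD[of A r k]) auto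
  then show ?thesis using c d by (auto simp: vec_eq_iff)
qed

lemma hcat_carrier [simp]:
  "A \<in> carrier_mat r k \<Longrightarrow> B \<in> carrier_mat r m \<Longrightarrow> hcat A B \<in> carrier_mat r (k + m)"
  by (auto simp: hcat_def)

lemma first_cols_carrier [simp]: "A \<in> carrier_mat r n \<Longrightarrow> first_cols k A \<in> carrier_mat r k"
  by (auto simp: first_cols_def)

text \<open>A concatenation is a block matrix whose two lower blocks have no rows; products,
  transposes and actions on vectors are inherited from the block matrix calculus.\<close>

lemma hcat_four_block:
  assumes "A \<in> carrier_mat r k" "B \<in> carrier_mat r m"
  shows "hcat A B = four_block_mat A B (0\<^sub>m 0 k) (0\<^sub>m 0 m)"
  using assms by (intro eq_matI) (auto simp: hcat_def)

lemma hcat_mult_vec: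
  assumes A: "A \<in> carrier_mat r k" and B: "B \<in> carrier_mat r m"
    and c: "c \<in> carrier_vec k" and d: "d \<in> carrier_vec m"
  shows "hcat A B *\<^sub>v (c @\<^sub>v d) = A *\<^sub>v c + B *\<^sub>v d"
  unfolding hcat_four_block[OF A B]
  by (subst four_block_mat_mult_vec[of _ r k _ m _ 0]) (use assms in \<open>auto intro!: eq_vecI\<close>)

lemma four_block_no_rows:
  assumes "A \<in> carrier_mat r k" "B \<in> carrier_mat r m" "C \<in> carrier_mat 0 k" "D \<in> carrier_mat 0 m"
  shows "four_block_mat A B C D = hcat A B"
  using assms by (intro eq_matI) (auto simp: hcat_def)

lemma hcat_mult_four_block:
  assumes A: "A \<in> carrier_mat r k" and B: "B \<in> carrier_mat r m"
    and c: "P \<in> carrier_mat k k'" "Q \<in> carrier_mat k m'" "R \<in> carrier_mat m k'" "S \<in> carrier_mat m m'"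
  shows "hcat A B * four_block_mat P Q R S = hcat (A * P + B * R) (A * Q + B * S)"
proof -
  have "hcat A B * four_block_mat P Q R S
    = four_block_mat (A * P + B * R) (A * Q + B * S) (0\<^sub>m 0 k * P + 0\<^sub>m 0 m * R) (0\<^sub>m 0 k * Q + 0\<^sub>m 0 m * S)"
    unfolding hcat_four_block[OF A B]
    by (rule mult_four_block_mat[of _ r k _ m _ 0]) (use assms in auto)
  also have "\<dots> = hcat (A * P + B * R) (A * Q + B * S)"
    by (rule four_block_no_rows) (use assms in auto)
  finally show ?thesis .
qed

lemma mult_hcat:
  assumes "P \<in> carrier_mat n r" "A \<in> carrier_mat r k" "B \<in> carrier_mat r m"
  shows "P * hcat A B = hcat (P * A) (P * B)"
proof (rule eq_matI)
  fix i j assume ij: "i < dim_row (hcat (P * A) (P * B))" "j < dim_col (hcat (P * A) (P * B))"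
  have "col (hcat A B) j = (if j < k then col A j else col B (j - k))"
    using ij assms by (auto simp: hcat_def intro!: eq_vecI)
  then show "(P * hcat A B) $$ (i, j) = hcat (P * A) (P * B) $$ (i, j)"
    using ij assms by (auto simp: hcat_def)
qed (use assms in \<open>auto simp: hcat_def\<close>)

lemma map_hcat:
  "A \<in> carrier_mat r k \<Longrightarrow> B \<in> carrier_mat r m \<Longrightarrow> map_mat f (hcat A B) = hcat (map_mat f A) (map_mat f B)"
  by (rule eq_matI) (auto simp: hcat_def)

lemma hcat_assoc:
  "A \<in> carrier_mat r k \<Longrightarrow> B \<in> carrier_mat r m \<Longrightarrow> C \<in> carrier_mat r n \<Longrightarrow>
   hcat (hcat A B) C = hcat A (hcat B C)"
  by (rule eq_matI) (auto simp: hcat_def)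

lemma hcat_first_last:
  assumes "A \<in> carrier_mat r (Suc k)"
  shows "A = hcat (first_cols k A) (mat_of_cols r [col A k])"
  using assms by (intro eq_matI)
    (auto simp: hcat_def first_cols_def mat_of_cols_index less_Suc_eq)

lemma mat_of_cols_mult_vec:
  assumes "v \<in> carrier_vec r" "c \<in> carrier_vec 1"
  shows "mat_of_cols r [v] *\<^sub>v c = (c $ 0) \<cdot>\<^sub>v (v :: 'a :: comm_ring_1 vec)"
  using assms by (intro eq_vecI) (auto simp: scalar_prod_def mat_of_cols_index row_def)

lemma hcat_gram_block:
  assumes A: "A \<in> carrier_mat r k" and B: "B \<in> carrier_mat r m"
  shows "transpose_mat (hcat A B) * hcat A B =
    four_block_mat (transpose_mat A * A) (transpose_mat A * B) (transpose_mat B * A)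
      (transpose_mat B * (B :: 'a :: comm_ring_1 mat))"
  unfolding hcat_four_block[OF A B]
  apply (subst transpose_four_block_mat[of _ r k _ m _ 0])
      apply (use assms in auto)[4]
  apply (subst mult_four_block_mat[of _ k r _ 0 _ m])
          apply (use assms in auto)
  done

text \<open>The Gram matrix changes by congruence. With \<open>det M\<close> equal to 1 or -1 this
  is independence of the basis; for an integral invertible \<open>M\<close> the factor is the
  squared index of a sublattice.\<close>

lemma gram_mult:
  assumes B: "B \<in> carrier_mat r k" and M: "M \<in> carrier_mat k k"
  shows "gram (B * M) = (det M)^2 * gram B"
proof -
  have "transpose_mat (B * M) * (B * M) = transpose_mat M * ((transpose_mat B * B) * M)"
    using assms by (simp add: transpose_mult[OF B M] assoc_mult_mat[of _ k r _ k] assoc_mult_mat[of _ k k _ r]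
      assoc_mult_mat[of "transpose_mat M" k k "transpose_mat B" r "B * M" k])
  also have "det \<dots> = det M * (det (transpose_mat B * B) * det M)"
  proof -
    have G: "transpose_mat B * B \<in> carrier_mat k k" using B by auto
    show ?thesis
      unfolding det_mult[OF transpose_carrier_mat[THEN iffD2, OF M] mult_carrier_mat[OF G M]]
        det_mult[OF G M] det_transpose[OF M] ..
  qed
  finally show ?thesis by (simp add: gram_def power2_eq_square mult_ac)
qed

lemma gram_hcat_orthogonal:
  assumes A: "A \<in> carrier_mat r k" and B: "B \<in> carrier_mat r m"
    and orth: "transpose_mat A * B = 0\<^sub>m k m"
  shows "gram (hcat A B) = gram A * gram (B :: 'a :: idom mat)"
  unfolding gram_def hcat_gram_block[OF A B]
  by (rule det_four_block_mat_upper_right_zero) (use assms in auto)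

section \<open>Definiteness, orthogonal projection and volume inequalities over ordered
  fields\<close>

lemma scalar_prod_self_nonneg: "0 \<le> v \<bullet> (v :: 'a :: linordered_idom vec)"
  by (auto simp: scalar_prod_def intro!: sum_nonneg)

lemma scalar_prod_self_eq_0:
  fixes v :: "'a :: linordered_idom vec"
  assumes "v \<in> carrier_vec n"
  shows "v \<bullet> v = 0 \<longleftrightarrow> v = 0\<^sub>v n"
proof
  assume "v \<bullet> v = 0"
  then have "(\<Sum>i\<in>{0..<n}. v $ i * v $ i) = 0" using assms by (simp add: scalar_prod_def)
  then have "\<forall>i\<in>{0..<n}. v $ i * v $ i = 0" by (subst (asm) sum_nonneg_eq_0_iff) auto
  then show "v = 0\<^sub>v n" using assms by (auto intro!: eq_vecI)
qed (use assms in simp)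

lemma transpose_mult_vec_scalar_prod:
  assumes "A \<in> carrier_mat r k" "B \<in> carrier_mat r m" "c \<in> carrier_vec k" "d \<in> carrier_vec m"
  shows "(A *\<^sub>v c) \<bullet> (B *\<^sub>v d) = c \<bullet> ((transpose_mat A * B) *\<^sub>v (d :: 'a :: comm_ring_1 vec))"
proof -
  have "c \<bullet> ((transpose_mat A * B) *\<^sub>v d) = c \<bullet> (transpose_mat A *\<^sub>v (B *\<^sub>v d))"
    using assms by (simp add: assoc_mult_mat_vec[of _ k r _ m])
  also have "\<dots> = (A *\<^sub>v c) \<bullet> (B *\<^sub>v d)"
    using assms transpose_vec_mult_scalar[OF assms(1,3), of "B *\<^sub>v d"]
    by (simp add: comm_scalar_prod[of _ k] comm_scalar_prod[of _ r])
  finally show ?thesis by simp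
qed

text \<open>Over an ordered field \<open>A\<close> and \<open>transpose_mat A * A\<close> have the
  same kernel, since pairing \<open>v\<close> with its image under the second gives the squared
  length of \<open>A *\<^sub>v v\<close>.\<close>

lemma mat_inj_iff_gram:
  assumes A: "A \<in> carrier_mat r k"
  shows "mat_inj A \<longleftrightarrow> gram A \<noteq> (0 :: 'a :: linordered_field)"
proof -
  have C: "transpose_mat A * A \<in> carrier_mat k k" using A by auto
  have "(\<exists>v\<in>carrier_vec k. v \<noteq> 0\<^sub>v k \<and> (transpose_mat A * A) *\<^sub>v v = 0\<^sub>v k)
    \<longleftrightarrow> (\<exists>v\<in>carrier_vec k. v \<noteq> 0\<^sub>v k \<and> A *\<^sub>v v = 0\<^sub>v r)"
  proof (intro bex_cong refl conj_cong iffI)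
    fix v assume v: "v \<in> carrier_vec k" and "(transpose_mat A * A) *\<^sub>v v = 0\<^sub>v k"
    then have "(A *\<^sub>v v) \<bullet> (A *\<^sub>v v) = 0" by (simp add: transpose_mult_vec_scalar_prod[OF A A v v])
    then show "A *\<^sub>v v = 0\<^sub>v r" using A v scalar_prod_self_eq_0[of "A *\<^sub>v v" r] by auto
  next
    fix v assume v: "v \<in> carrier_vec k" and "A *\<^sub>v v = 0\<^sub>v r"
    then show "(transpose_mat A * A) *\<^sub>v v = 0\<^sub>v k"
      using A by (subst assoc_mult_mat_vec[of _ k r _ k]) auto
  qed
  then show ?thesis
    unfolding gram_def using det_0_iff_vec_prod_zero_field[OF C] A unfolding mat_inj_def by auto
qed

text \<open>Block Gram-Schmidt without normalization: \<open>C\<close> solves the normal equations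
  by Cramer's rule, so no square roots occur and the lemma also serves over the rationals.\<close>

lemma orthogonal_residual:
  assumes A: "A \<in> carrier_mat r k" and B: "B \<in> carrier_mat r m"
    and inj: "mat_inj (A :: 'a :: linordered_field mat)"
  obtains C where "C \<in> carrier_mat k m" "transpose_mat A * (B - A * C) = 0\<^sub>m k m"
proof -
  define G where "G = transpose_mat A * A"
  have G: "G \<in> carrier_mat k k" using A by (auto simp: G_def)
  have d: "det G \<noteq> 0" using inj mat_inj_iff_gram[OF A] by (simp add: gram_def G_def)
  define C where "C = (inverse (det G) \<cdot>\<^sub>m adj_mat G) * (transpose_mat A * B)"
  have adj: "adj_mat G \<in> carrier_mat k k" "G * adj_mat G = det G \<cdot>\<^sub>m 1\<^sub>m k" using adj_mat[OF G] by auto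
  have AB: "transpose_mat A * B \<in> carrier_mat k m" using A B by auto
  have C: "C \<in> carrier_mat k m" using adj A B by (auto simp: C_def)
  have "G * C = (G * (inverse (det G) \<cdot>\<^sub>m adj_mat G)) * (transpose_mat A * B)"
    unfolding C_def using G adj AB by (subst assoc_mult_mat[of _ k k _ k]) auto
  also have "G * (inverse (det G) \<cdot>\<^sub>m adj_mat G) = inverse (det G) \<cdot>\<^sub>m (G * adj_mat G)"
    using G adj by (simp add: mult_smult_distrib[of _ k k _ k])
  also have "\<dots> = 1\<^sub>m k" unfolding adj(2) using d by (auto intro!: eq_matI)
  finally have GC: "G * C = transpose_mat A * B" using A B by auto
  have "transpose_mat A * (B - A * C) = transpose_mat A * B - transpose_mat A * (A * C)"
    using A B C by (subst mult_minus_distrib_mat[of _ k r _ m]) auto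
  also have "transpose_mat A * (A * C) = G * C"
    unfolding G_def using A C by (subst assoc_mult_mat[of _ k r _ k]) auto
  finally have "transpose_mat A * (B - A * C) = 0\<^sub>m k m" using A B GC by auto
  with C that show thesis by blast
qed

text \<open>A unipotent block column operation turns \<open>B\<close> into its residual, which is
  orthogonal to \<open>A\<close>. For lattices: the covolume is that of the part spanned by
  \<open>A\<close> times that of the projection to its orthogonal complement.\<close>

lemma gram_hcat_residual:
  assumes A: "A \<in> carrier_mat r k" and B: "B \<in> carrier_mat r m" and C: "C \<in> carrier_mat k m"
    and orth: "transpose_mat A * (B - A * C) = 0\<^sub>m k m"
  shows "gram (hcat A B) = gram A * gram (B - A * C :: 'a :: idom mat)"
proof -
  let ?M = "four_block_mat (1\<^sub>m k) C (0\<^sub>m m k) (1\<^sub>m m)"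
  have U: "B - A * C \<in> carrier_mat r m" using assms by auto
  have M: "?M \<in> carrier_mat (k + m) (k + m)" using C by auto
  have "hcat A (B - A * C) * ?M = hcat (A * 1\<^sub>m k + (B - A * C) * 0\<^sub>m m k) (A * C + (B - A * C) * 1\<^sub>m m)"
    by (rule hcat_mult_four_block) (use assms in auto)
  also have "A * 1\<^sub>m k + (B - A * C) * 0\<^sub>m m k = A" using A U by (simp add: right_mult_zero_mat[OF U])
  also have "A * C + (B - A * C) * 1\<^sub>m m = B" using A B C U by (auto intro!: eq_matI)
  finally have "hcat A B = hcat A (B - A * C) * ?M" ..
  moreover have "det ?M = 1"
    using C by (subst det_four_block_mat_lower_left_zero[of _ k _ m]) auto
  ultimately show ?thesis
    using gram_mult[OF hcat_carrier[OF A U] M] gram_hcat_orthogonal[OF A U orth] by simp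
qed

lemma gram_single: "v \<in> carrier_vec r \<Longrightarrow> gram (mat_of_cols r [v]) = v \<bullet> v"
  unfolding gram_def
  by (subst det_single) (auto simp: scalar_prod_def mat_of_cols_index)

lemma mat_inj_hcatD:
  assumes A: "A \<in> carrier_mat r k" and B: "B \<in> carrier_mat r m"
    and inj: "mat_inj (hcat A B :: 'a :: comm_ring_1 mat)"
  shows "mat_inj A"
proof (rule mat_injI[OF A])
  fix c assume c: "c \<in> carrier_vec k" and 0: "A *\<^sub>v c = 0\<^sub>v r"
  have "hcat A B *\<^sub>v (c @\<^sub>v 0\<^sub>v m) = 0\<^sub>v r"
    using A B c 0 by (subst hcat_mult_vec[OF A B c]) (auto intro!: eq_vecI)
  then have "c @\<^sub>v 0\<^sub>v m = 0\<^sub>v (k + m)"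
    using A B c by (intro mat_injD[OF inj hcat_carrier[OF A B]]) auto
  moreover have "0\<^sub>v (k + m) = 0\<^sub>v k @\<^sub>v (0\<^sub>v m :: 'a vec)" by (auto intro!: eq_vecI)
  ultimately show "c = 0\<^sub>v k"
    using append_vec_eq[OF c zero_carrier_vec, of "0\<^sub>v m" "0\<^sub>v m"] by simp
qed

lemma pythagoras:
  fixes A :: "'a :: comm_ring_1 mat"
  assumes A: "A \<in> carrier_mat r k" and R: "R \<in> carrier_mat r m"
    and orth: "transpose_mat A * R = 0\<^sub>m k m"
    and c: "c \<in> carrier_vec k" and d: "d \<in> carrier_vec m"
  shows "(A *\<^sub>v c + R *\<^sub>v d) \<bullet> (A *\<^sub>v c + R *\<^sub>v d) = (A *\<^sub>v c) \<bullet> (A *\<^sub>v c) + (R *\<^sub>v d) \<bullet> (R *\<^sub>v d)"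
proof -
  have AR: "A *\<^sub>v c \<in> carrier_vec r" "R *\<^sub>v d \<in> carrier_vec r" using A R c d by auto
  have "(A *\<^sub>v c) \<bullet> (R *\<^sub>v d) = 0"
    unfolding transpose_mult_vec_scalar_prod[OF A R c d] orth
    using c d by (auto simp: scalar_prod_def)
  moreover have "(R *\<^sub>v d) \<bullet> (A *\<^sub>v c) = (A *\<^sub>v c) \<bullet> (R *\<^sub>v d)"
    using AR by (intro comm_scalar_prod[of _ r]) auto
  ultimately show ?thesis
    using AR by (simp add: add_scalar_prod_distrib[of _ r] scalar_prod_add_distrib[of _ r])
qed

lemma gram_one_col:
  assumes "A \<in> carrier_mat r 1"
  shows "gram A = (A *\<^sub>v vec 1 (\<lambda>_. 1)) \<bullet> (A *\<^sub>v vec 1 (\<lambda>_. 1))"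
proof -
  have "A *\<^sub>v vec 1 (\<lambda>_. 1) = col A 0"
    using assms by (intro eq_vecI) (auto simp: scalar_prod_def)
  moreover have "A = mat_of_cols r [col A 0]"
    using assms by (intro eq_matI) (auto simp: mat_of_cols_index)
  ultimately show ?thesis using gram_single[of "col A 0" r] assms by auto
qed

text \<open>Splitting off the last column multiplies by the squared length of its residual;
  dependent columns give 0.\<close>

lemma gram_nonneg: "A \<in> carrier_mat r k \<Longrightarrow> 0 \<le> gram (A :: 'a :: linordered_field mat)"
proof (induction k arbitrary: A)
  case 0
  then show ?case by (simp add: gram_def det_dim_zero)
next
  case (Suc k)
  define A' where "A' = first_cols k A"
  define v where "v = mat_of_cols r [col A k]"
  have A': "A' \<in> carrier_mat r k" and v: "v \<in> carrier_mat r 1"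
    using Suc.prems by (auto simp: A'_def v_def)
  have A: "A = hcat A' v" unfolding A'_def v_def by (rule hcat_first_last[OF Suc.prems])
  show ?case
  proof (cases "mat_inj A")
    case True
    then have "mat_inj A'" using mat_inj_hcatD[OF A' v] A by simp
    then obtain C where C: "C \<in> carrier_mat k 1" "transpose_mat A' * (v - A' * C) = 0\<^sub>m k 1"
      using orthogonal_residual[OF A' v] by blast
    have R: "v - A' * C \<in> carrier_mat r 1" using C A' v by auto
    show ?thesis unfolding A gram_hcat_residual[OF A' v C] gram_one_col[OF R]
      by (intro mult_nonneg_nonneg Suc.IH[OF A'] scalar_prod_self_nonneg)
  next
    case False
    then show ?thesis using mat_inj_iff_gram[OF Suc.prems] by simp
  qed
qed

lemma gram_pos: "A \<in> carrier_mat r k \<Longrightarrow> mat_inj A \<Longrightarrow> 0 < gram (A :: 'a :: linordered_field mat)"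
  using gram_nonneg[of A r k] mat_inj_iff_gram[of A r k] by auto

text \<open>The induction compares the residuals of the last columns. That of \<open>U\<close> is
  the shortest vector in its class modulo \<open>U'\<close>, hence no longer than the combination of
  columns of \<open>U\<close> whose counterpart for \<open>T\<close> is the residual of
  \<open>T\<close>; the hypothesis bounds that combination.\<close>

lemma gram_contraction:
  fixes T U :: "'a :: linordered_field mat"
  assumes "T \<in> carrier_mat r k" "U \<in> carrier_mat s k" "q \<ge> 0"
    "\<And>c. c \<in> carrier_vec k \<Longrightarrow> (U *\<^sub>v c) \<bullet> (U *\<^sub>v c) \<le> q * ((T *\<^sub>v c) \<bullet> (T *\<^sub>v c))"
  shows "gram U \<le> q ^ k * gram T"
  using assms
proof (induction k arbitrary: T U)
  case 0
  then show ?case by (simp add: gram_def det_dim_zero)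
next
  case (Suc k)
  define T' where "T' = first_cols k T"
  define v where "v = mat_of_cols r [col T k]"
  define U' where "U' = first_cols k U"
  define w where "w = mat_of_cols s [col U k]"
  have T': "T' \<in> carrier_mat r k" and v: "v \<in> carrier_mat r 1"
    and U': "U' \<in> carrier_mat s k" and w: "w \<in> carrier_mat s 1"
    using Suc.prems by (auto simp: T'_def v_def U'_def w_def)
  have T: "T = hcat T' v" unfolding T'_def v_def by (rule hcat_first_last[OF Suc.prems(1)])
  have U: "U = hcat U' w" unfolding U'_def w_def by (rule hcat_first_last[OF Suc.prems(2)])
  show ?case
  proof (cases "mat_inj U")
    case False
    then have "gram U = 0" using mat_inj_iff_gram[OF Suc.prems(2)] by simp
    then show ?thesis using gram_nonneg[OF Suc.prems(1)] Suc.prems(3) by simp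
  next
    case True
    have "mat_inj T"
    proof (rule mat_injI[OF Suc.prems(1)])
      fix c assume c: "c \<in> carrier_vec (Suc k)" and "T *\<^sub>v c = 0\<^sub>v r"
      then have "(U *\<^sub>v c) \<bullet> (U *\<^sub>v c) \<le> 0" using Suc.prems(4)[OF c] by simp
      then have "(U *\<^sub>v c) \<bullet> (U *\<^sub>v c) = 0" using scalar_prod_self_nonneg[of "U *\<^sub>v c"] by simp
      moreover have "U *\<^sub>v c \<in> carrier_vec s" using Suc.prems(2) c by (rule mult_mat_vec_carrier)
      ultimately have "U *\<^sub>v c = 0\<^sub>v s" using scalar_prod_self_eq_0 by blast
      then show "c = 0\<^sub>v (Suc k)" by (rule mat_injD[OF True Suc.prems(2) c])
    qed
    then have "mat_inj T'" using mat_inj_hcatD[OF T' v] unfolding T by blast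
    then obtain C where C: "C \<in> carrier_mat k 1" "transpose_mat T' * (v - T' * C) = 0\<^sub>m k 1"
      using orthogonal_residual[OF T' v] by blast
    have "mat_inj U'" using mat_inj_hcatD[OF U' w] True unfolding U by blast
    then obtain D where D: "D \<in> carrier_mat k 1" "transpose_mat U' * (w - U' * D) = 0\<^sub>m k 1"
      using orthogonal_residual[OF U' w] by blast
    define e :: "'a vec" where "e = vec 1 (\<lambda>_. 1)"
    have e: "e \<in> carrier_vec 1" by (simp add: e_def)
    \<comment> \<open>The coefficients \<open>(- C e, e)\<close>, with \<open>e\<close> the
      one-dimensional vector 1, extract \<open>x - A * C\<close> from the concatenation.\<close>
    have split: "(hcat A x) *\<^sub>v ((- (C *\<^sub>v e)) @\<^sub>v e) = (x - A * C) *\<^sub>v e"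
      if A: "A \<in> carrier_mat n k" and x: "x \<in> carrier_mat n 1" for A x and n
    proof -
      have "(hcat A x) *\<^sub>v ((- (C *\<^sub>v e)) @\<^sub>v e) = - (A *\<^sub>v (C *\<^sub>v e)) + x *\<^sub>v e"
        using A x C e by (subst hcat_mult_vec[OF A x]) auto
      also have "\<dots> = x *\<^sub>v e - (A * C) *\<^sub>v e" using A x C e by (auto intro!: eq_vecI)
      also have "\<dots> = (x - A * C) *\<^sub>v e" using A x C e by (subst minus_mult_distrib_mat_vec[of x n 1]) auto
      finally show ?thesis .
    qed
    have mem: "(- (C *\<^sub>v e)) @\<^sub>v e \<in> carrier_vec (Suc k)"
      using append_carrier_vec[of "- (C *\<^sub>v e)" k e 1] C(1) e by simp
    have R: "w - U' * D \<in> carrier_mat s 1" "v - T' * C \<in> carrier_mat r 1" "w - U' * C \<in> carrier_mat s 1"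
      using U' w D T' v C by auto
    have 1: "gram (w - U' * C) \<le> q * gram (v - T' * C)"
      using Suc.prems(4)[OF mem] unfolding U T
      unfolding gram_one_col[OF R(2), folded e_def] gram_one_col[OF R(3), folded e_def]
        split[OF U' w] split[OF T' v] .
    \<comment> \<open>\<open>C\<close> is optimal for \<open>T\<close> and \<open>D\<close> for
      \<open>U\<close>: by Pythagoras, using \<open>C\<close> in place of \<open>D\<close> can only
      lengthen the residual of \<open>w\<close>.\<close>
    have 2: "gram (w - U' * D) \<le> gram (w - U' * C)"
    proof -
      have "(w - U' * C) *\<^sub>v e = w *\<^sub>v e - U' *\<^sub>v (C *\<^sub>v e)"
        using U' w C e by (subst minus_mult_distrib_mat_vec[of _ s 1]) (auto simp: assoc_mult_mat_vec[of _ s k _ 1])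
      also have "\<dots> = U' *\<^sub>v (D *\<^sub>v e - C *\<^sub>v e) + (w *\<^sub>v e - U' *\<^sub>v (D *\<^sub>v e))"
        using U' w C D e by (subst mult_minus_distrib_mat_vec[OF U']) (auto intro!: eq_vecI)
      also have "w *\<^sub>v e - U' *\<^sub>v (D *\<^sub>v e) = (w - U' * D) *\<^sub>v e"
        using U' w D e by (subst minus_mult_distrib_mat_vec[of _ s 1]) (auto simp: assoc_mult_mat_vec[of _ s k _ 1])
      finally have "((w - U' * C) *\<^sub>v e) \<bullet> ((w - U' * C) *\<^sub>v e)
          = (U' *\<^sub>v (D *\<^sub>v e - C *\<^sub>v e)) \<bullet> (U' *\<^sub>v (D *\<^sub>v e - C *\<^sub>v e)) + ((w - U' * D) *\<^sub>v e) \<bullet> ((w - U' * D) *\<^sub>v e)"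
        using C D e by (simp add: pythagoras[OF U' R(1) D(2)])
      then show ?thesis
        using scalar_prod_self_nonneg[of "U' *\<^sub>v (D *\<^sub>v e - C *\<^sub>v e)"]
        unfolding gram_one_col[OF R(1), folded e_def] gram_one_col[OF R(3), folded e_def] by linarith
    qed
    have 3: "gram U' \<le> q ^ k * gram T'"
    proof (rule Suc.IH[OF T' U' Suc.prems(3)])
      fix c :: "'a vec" assume c: "c \<in> carrier_vec k"
      have mem: "c @\<^sub>v 0\<^sub>v 1 \<in> carrier_vec (Suc k)"
        using append_carrier_vec[OF c, of "0\<^sub>v 1" 1] by simp
      have *: "hcat A x *\<^sub>v (c @\<^sub>v 0\<^sub>v 1) = A *\<^sub>v c"
        if "A \<in> carrier_mat n k" "x \<in> carrier_mat n 1" for A x and n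
        using that c by (subst hcat_mult_vec[OF that]) (auto intro!: eq_vecI)
      show "(U' *\<^sub>v c) \<bullet> (U' *\<^sub>v c) \<le> q * ((T' *\<^sub>v c) \<bullet> (T' *\<^sub>v c))"
        using Suc.prems(4)[OF mem] unfolding U T *[OF U' w] *[OF T' v] .
    qed
    have "gram U = gram U' * gram (w - U' * D)" unfolding U by (rule gram_hcat_residual[OF U' w D])
    also have "\<dots> \<le> (q ^ k * gram T') * (q * gram (v - T' * C))"
      by (rule mult_mono) (use 1 2 3 gram_nonneg[OF R(1)] gram_nonneg[OF T'] Suc.prems(3) in auto)
    also have "\<dots> = q ^ Suc k * gram T" unfolding T gram_hcat_residual[OF T' v C] by simp
    finally show ?thesis .
  qed
qed

text \<open>Orthogonal projection shortens vectors, so \<open>gram_contraction\<close> applies with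
  factor 1.\<close>

lemma gram_residual_le:
  fixes A :: "'a :: linordered_field mat"
  assumes A: "A \<in> carrier_mat r k" and B: "B \<in> carrier_mat r m" and C: "C \<in> carrier_mat k m"
    and orth: "transpose_mat A * (B - A * C) = 0\<^sub>m k m"
  shows "gram (B - A * C) \<le> gram B"
proof -
  have R: "B - A * C \<in> carrier_mat r m" using A B C by auto
  have "gram (B - A * C) \<le> 1 ^ m * gram B"
  proof (rule gram_contraction[OF B R])
    fix c :: "'a vec" assume c: "c \<in> carrier_vec m"
    have "B *\<^sub>v c = A *\<^sub>v (C *\<^sub>v c) + (B - A * C) *\<^sub>v c"
      using A B C c by (subst minus_mult_distrib_mat_vec[of _ r m]) (auto intro!: eq_vecI)
    then have "(B *\<^sub>v c) \<bullet> (B *\<^sub>v c) = (A *\<^sub>v (C *\<^sub>v c)) \<bullet> (A *\<^sub>v (C *\<^sub>v c)) + ((B - A * C) *\<^sub>v c) \<bullet> ((B - A * C) *\<^sub>v c)"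
      using pythagoras[OF A R orth _ c, of "C *\<^sub>v c"] C c by simp
    then show "((B - A * C) *\<^sub>v c) \<bullet> ((B - A * C) *\<^sub>v c) \<le> 1 * ((B *\<^sub>v c) \<bullet> (B *\<^sub>v c))"
      using scalar_prod_self_nonneg[of "A *\<^sub>v (C *\<^sub>v c)"] by simp
  qed auto
  then show ?thesis by simp
qed

text \<open>Fischer's inequality: only the part of \<open>B\<close> orthogonal to \<open>A\<close>
  counts, and projecting does not increase the Gram determinant.\<close>

lemma gram_hcat_le:
  fixes A :: "'a :: linordered_field mat"
  assumes A: "A \<in> carrier_mat r k" and B: "B \<in> carrier_mat r m"
  shows "gram (hcat A B) \<le> gram A * gram B"
proof (cases "mat_inj A")
  case True
  then obtain C where C: "C \<in> carrier_mat k m" "transpose_mat A * (B - A * C) = 0\<^sub>m k m"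
    using orthogonal_residual[OF A B] by blast
  show ?thesis unfolding gram_hcat_residual[OF A B C]
    by (intro mult_left_mono gram_residual_le[OF A B C] gram_nonneg[OF A])
next
  case False
  then have "\<not> mat_inj (hcat A B)" using mat_inj_hcatD[OF A B] by blast
  then have "gram (hcat A B) = 0" using mat_inj_iff_gram[OF hcat_carrier[OF A B]] by simp
  then show ?thesis using gram_nonneg[OF A] gram_nonneg[OF B] by simp
qed

text \<open>Modulo \<open>A\<close> both blocks may be replaced by their residuals, where Fischer's
  inequality applies. With \<open>A\<close> a basis of an intersection, logarithms turn this into
  the inequality for degrees.\<close>

lemma gram_submodular:
  fixes A :: "'a :: linordered_field mat"
  assumes A: "A \<in> carrier_mat r k" and B: "B \<in> carrier_mat r m" and C: "C \<in> carrier_mat r n"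
    and inj: "mat_inj A"
  shows "gram A * gram (hcat (hcat A B) C) \<le> gram (hcat A B) * gram (hcat A C)"
proof -
  obtain X where X: "X \<in> carrier_mat k m" "transpose_mat A * (B - A * X) = 0\<^sub>m k m"
    using orthogonal_residual[OF A B inj] by blast
  obtain Y where Y: "Y \<in> carrier_mat k n" "transpose_mat A * (C - A * Y) = 0\<^sub>m k n"
    using orthogonal_residual[OF A C inj] by blast
  have R: "B - A * X \<in> carrier_mat r m" "C - A * Y \<in> carrier_mat r n" using A B C X Y by auto
  have res: "hcat B C - A * hcat X Y = hcat (B - A * X) (C - A * Y)"
    unfolding mult_hcat[OF A X(1) Y(1)] using A B C X Y by (intro eq_matI) (auto simp: hcat_def)
  have 0: "transpose_mat A * (hcat B C - A * hcat X Y) = 0\<^sub>m k (m + n)"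
    unfolding res using A R X Y
    by (subst mult_hcat[of _ k r _ m _ n]) (auto simp: hcat_def intro!: eq_matI)
  have "gram (hcat (hcat A B) C) = gram A * gram (hcat (B - A * X) (C - A * Y))"
    unfolding hcat_assoc[OF A B C]
    by (subst gram_hcat_residual[OF A hcat_carrier[OF B C] hcat_carrier[OF X(1) Y(1)] 0]) (simp add: res)
  also have "\<dots> \<le> gram A * (gram (B - A * X) * gram (C - A * Y))"
    by (intro mult_left_mono gram_hcat_le[OF R] gram_nonneg[OF A])
  finally have "gram A * gram (hcat (hcat A B) C) \<le> gram A * (gram A * (gram (B - A * X) * gram (C - A * Y)))"
    by (intro mult_left_mono gram_nonneg[OF A])
  then show ?thesis
    unfolding gram_hcat_residual[OF A B X] gram_hcat_residual[OF A C Y] by (simp only: mult_ac)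
qed

text \<open>Right multiplication by an upper triangular matrix respects the flag of spans of initial
  columns; this is why weights of an Iwasawa diagonal read off volumes of flag members.\<close>

lemma first_cols_mult_upper:
  fixes A :: "'a :: comm_ring_1 mat"
  assumes A: "A \<in> carrier_mat r n" and U: "U \<in> carrier_mat n n" "upper_triangular U" and i: "i \<le> n"
  shows "first_cols i (A * U) = first_cols i A * mat i i (\<lambda>(a, b). U $$ (a, b))"
proof (rule eq_matI)
  fix a b assume "a < dim_row (first_cols i A * mat i i (\<lambda>(a, b). U $$ (a, b)))"
    "b < dim_col (first_cols i A * mat i i (\<lambda>(a, b). U $$ (a, b)))"
  then have ab: "a < r" "b < i" using A by (auto simp: first_cols_def)
  have "(\<Sum>l\<in>{0..<n}. A $$ (a, l) * U $$ (l, b)) = (\<Sum>l\<in>{0..<i}. A $$ (a, l) * U $$ (l, b))"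
    using i ab U by (intro sum.mono_neutral_right) (auto simp: upper_triangular_def)
  then show "first_cols i (A * U) $$ (a, b) = (first_cols i A * mat i i (\<lambda>(a, b). U $$ (a, b))) $$ (a, b)"
    using ab A U i by (simp add: first_cols_def scalar_prod_def)
qed (use A in \<open>auto simp: first_cols_def\<close>)

lemma det_upper_block:
  assumes U: "U \<in> carrier_mat n n" "upper_triangular U" and i: "i \<le> n"
  shows "det (mat i i (\<lambda>(a, b). U $$ (a, b))) = (\<Prod>j<i. U $$ (j, j) :: 'a :: comm_ring_1)"
proof -
  have "upper_triangular (mat i i (\<lambda>(a, b). U $$ (a, b)))"
    using assms by (auto simp: upper_triangular_def)
  then show ?thesis
    by (subst det_upper_triangular[of _ i]) (auto simp: prod_list_diag_prod lessThan_atLeast0)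
qed


text \<open>Gram-Schmidt written as a right factor; positivity of the diagonal later makes the real
  Iwasawa component explicit.\<close>

lemma orthonormalize:
  fixes P :: "real mat"
  assumes "P \<in> carrier_mat r k" "mat_inj P"
  shows "\<exists>U\<in>carrier_mat k k. upper_triangular U \<and> (\<forall>i<k. U $$ (i, i) > 0) \<and>
    transpose_mat (P * U) * (P * U) = 1\<^sub>m k"
  using assms
proof (induction k arbitrary: P)
  case 0
  show ?case by (rule bexI[of _ "1\<^sub>m 0"]) (use 0 in \<open>auto intro!: eq_matI\<close>)
next
  case (Suc k)
  define P' where "P' = first_cols k P"
  define v where "v = mat_of_cols r [col P k]"
  have P': "P' \<in> carrier_mat r k" and v: "v \<in> carrier_mat r 1"
    using Suc.prems by (auto simp: P'_def v_def)
  have P: "P = hcat P' v" unfolding P'_def v_def by (rule hcat_first_last[OF Suc.prems(1)])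
  have inj: "mat_inj P'" using mat_inj_hcatD[OF P' v] Suc.prems(2) P by simp
  obtain U' where U': "U' \<in> carrier_mat k k" "upper_triangular U'" "\<forall>i<k. U' $$ (i, i) > 0"
    "transpose_mat (P' * U') * (P' * U') = 1\<^sub>m k" using Suc.IH[OF P' inj] by auto
  define Q where "Q = P' * U'"
  have Q: "Q \<in> carrier_mat r k" using P' U' by (simp add: Q_def)
  have "gram Q = 1" using U'(4) by (simp add: gram_def Q_def)
  then have "mat_inj Q" using mat_inj_iff_gram[OF Q] by simp
  then obtain C where C: "C \<in> carrier_mat k 1" "transpose_mat Q * (v - Q * C) = 0\<^sub>m k 1"
    using orthogonal_residual[OF Q v] by blast
  define w where "w = v - Q * C"
  have w: "w \<in> carrier_mat r 1" using v Q C by (auto simp: w_def)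
  have UC: "U' * C \<in> carrier_mat k 1" using U' C by auto
  have QC: "Q * C = P' * (U' * C)" unfolding Q_def using P' U' C by (simp add: assoc_mult_mat[of _ r k])
  have "gram P = gram P' * gram w"
  proof -
    \<comment> \<open>\<open>w\<close> is orthogonal to \<open>Q = P' * U'\<close>; cancelling the
      invertible \<open>transpose_mat U'\<close> makes it orthogonal to \<open>P'\<close>.\<close>
    have "transpose_mat P' * (v - P' * (U' * C)) = 0\<^sub>m k 1"
    proof -
      have "transpose_mat U' * (transpose_mat P' * w) = 0\<^sub>m k 1"
        using C(2) U' P' w unfolding w_def[symmetric]
        by (simp add: Q_def transpose_mult[OF P' U'(1)] assoc_mult_mat[of _ k k _ r _ 1])
      moreover have "det (transpose_mat U') \<noteq> 0"
      proof -
        have "gram Q = (det U')^2 * gram P'" unfolding Q_def by (rule gram_mult[OF P' U'(1)])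
        then show ?thesis using \<open>gram Q = 1\<close> by (auto simp: det_transpose[OF U'(1)])
      qed
      ultimately have "(adj_mat (transpose_mat U') * transpose_mat U') * (transpose_mat P' * w) = 0\<^sub>m k 1"
        using U'(1) P' w adj_mat(1)[of "transpose_mat U'" k]
        by (subst assoc_mult_mat[of _ k k _ k _ 1]) auto
      then have "det (transpose_mat U') \<cdot>\<^sub>m (transpose_mat P' * w) = 0\<^sub>m k 1"
        using U'(1) P' w by (subst (asm) adj_mat(3)[of _ k])
          (auto simp: mult_smult_assoc_mat[of "1\<^sub>m k" k k _ 1])
      then have "transpose_mat P' * w = 0\<^sub>m k 1"
        using \<open>det (transpose_mat U') \<noteq> 0\<close> P' w
        by (intro eq_matI) (auto dest!: arg_cong[where f = "\<lambda>A. A $$ (_, 0)"] simp: mat_eq_iff)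
      then show ?thesis unfolding w_def QC .
    qed
    from gram_hcat_residual[OF P' v UC this] show ?thesis unfolding P w_def QC .
  qed
  then have gw: "gram w > 0"
    using Suc.prems mat_inj_iff_gram[OF Suc.prems(1)] gram_nonneg[OF w] by (auto simp: less_le)
  define s where "s = 1 / sqrt (gram w)"
  have s: "s > 0" "s * s * gram w = 1" using gw by (auto simp: s_def real_sqrt_mult_self)
  \<comment> \<open>The last column expresses the normalized residual \<open>s (v - Q C)\<close> in
    the original columns of \<open>P\<close>.\<close>
  define U where "U = four_block_mat U' ((- s) \<cdot>\<^sub>m (U' * C)) (0\<^sub>m 1 k) (s \<cdot>\<^sub>m 1\<^sub>m 1)"
  have U: "U \<in> carrier_mat (Suc k) (Suc k)"
    using four_block_carrier_mat[OF U'(1), of "s \<cdot>\<^sub>m 1\<^sub>m 1" 1 1] by (simp add: U_def)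
  have PU: "P * U = hcat Q (s \<cdot>\<^sub>m w)"
  proof -
    have "P * U = hcat (P' * U' + v * 0\<^sub>m 1 k) (P' * ((- s) \<cdot>\<^sub>m (U' * C)) + v * (s \<cdot>\<^sub>m 1\<^sub>m 1))"
      unfolding P U_def by (rule hcat_mult_four_block[OF P' v]) (use U' C in auto)
    also have "P' * U' + v * 0\<^sub>m 1 k = Q"
      using P' U' v unfolding Q_def by (subst right_mult_zero_mat[OF v]) auto
    also have "P' * ((- s) \<cdot>\<^sub>m (U' * C)) + v * (s \<cdot>\<^sub>m 1\<^sub>m 1) = s \<cdot>\<^sub>m w"
      unfolding w_def QC using P' v UC
      by (subst mult_smult_distrib[OF P' UC], subst mult_smult_distrib[OF v, of _ 1])
         (auto intro!: eq_matI simp: algebra_simps)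
    finally show ?thesis .
  qed
  have "transpose_mat w * w = mat 1 1 (\<lambda>_. gram w)"
    using w by (intro eq_matI) (auto simp: gram_def det_single)
  then have "transpose_mat (s \<cdot>\<^sub>m w) * (s \<cdot>\<^sub>m w) = 1\<^sub>m 1"
    using w s by (intro eq_matI) (auto simp: scalar_prod_def sum_distrib_left[symmetric] mult_ac mat_eq_iff)
  moreover have "transpose_mat Q * (s \<cdot>\<^sub>m w) = 0\<^sub>m k 1"
    using C(2) Q w unfolding w_def[symmetric] by (subst mult_smult_distrib[of _ k r _ 1]) auto
  moreover have "transpose_mat (s \<cdot>\<^sub>m w) * Q = transpose_mat (transpose_mat Q * (s \<cdot>\<^sub>m w))"
    using Q w by (subst transpose_mult[of _ k r _ 1]) auto
  ultimately have "transpose_mat (P * U) * (P * U) = 1\<^sub>m (Suc k)"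
    unfolding PU using U'(4) w
    by (subst hcat_gram_block[OF Q, of _ 1]) (auto simp flip: Q_def intro!: eq_matI)
  moreover have "upper_triangular U"
    unfolding upper_triangular_def U_def using U' C by auto
  moreover have "\<forall>i<Suc k. U $$ (i, i) > 0"
    unfolding U_def using U' C s by auto
  ultimately show ?case using U by blast
qed

section \<open>Lattices and their bases\<close>

definition zspan :: "'a :: comm_ring_1 mat \<Rightarrow> 'a vec set" where
  "zspan A = {A *\<^sub>v map_vec of_int c |c :: int vec. c \<in> carrier_vec (dim_col A)}"

definition int_module :: "nat \<Rightarrow> 'a :: comm_ring_1 vec set \<Rightarrow> bool" where
  "int_module r T \<longleftrightarrow> T \<subseteq> carrier_vec r \<and> 0\<^sub>v r \<in> T \<and>
     (\<forall>x\<in>T. \<forall>y\<in>T. \<forall>n :: int. x + of_int n \<cdot>\<^sub>v y \<in> T)"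

definition saturated_in :: "nat \<Rightarrow> 'a :: comm_ring_1 vec set \<Rightarrow> 'a vec set \<Rightarrow> bool" where
  "saturated_in r T S \<longleftrightarrow> int_module r S \<and> S \<subseteq> T \<and>
     (\<forall>x\<in>T. \<forall>n :: int. n \<noteq> 0 \<longrightarrow> of_int n \<cdot>\<^sub>v x \<in> S \<longrightarrow> x \<in> S)"

text \<open>Stands in for finite generation: it keeps a subgroup of \<open>\<rat>^r\<close>
  discrete, so that a smallest positive projection exists when a basis vector is chosen.\<close>

definition bounded_denominators :: "nat \<Rightarrow> rat vec set \<Rightarrow> bool" where
  "bounded_denominators r T \<longleftrightarrow> (\<exists>N :: int. N > 0 \<and> (\<forall>x\<in>T. \<forall>i<r. of_int N * x $ i \<in> \<int>))"

lemma mult_mat_smult_vec: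
  fixes A :: "'a :: comm_ring_1 mat"
  assumes "A \<in> carrier_mat r k" "v \<in> carrier_vec k"
  shows "A *\<^sub>v (n \<cdot>\<^sub>v v) = n \<cdot>\<^sub>v (A *\<^sub>v v)"
  using assms by (intro eq_vecI) (auto simp: scalar_prod_def sum_distrib_left mult_ac)

lemma mult_mat_unit_vec:
  fixes A :: "'a :: comm_ring_1 mat"
  assumes "A \<in> carrier_mat r k" "j < k"
  shows "A *\<^sub>v unit_vec k j = col A j"
  using assms by (intro eq_vecI) (auto simp: scalar_prod_right_unit)

lemma int_module_carrier: "int_module r T \<Longrightarrow> x \<in> T \<Longrightarrow> x \<in> carrier_vec r"
  by (auto simp: int_module_def)

lemma int_module_add_smult:
  "int_module r T \<Longrightarrow> x \<in> T \<Longrightarrow> y \<in> T \<Longrightarrow> x + of_int n \<cdot>\<^sub>v y \<in> T"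
  by (auto simp: int_module_def)

lemma int_module_smult: "int_module r T \<Longrightarrow> y \<in> T \<Longrightarrow> of_int n \<cdot>\<^sub>v y \<in> T"
  using int_module_add_smult[of r T "0\<^sub>v r" y n] int_module_carrier[of r T y]
  by (auto simp: int_module_def)

lemma int_module_add: "int_module r T \<Longrightarrow> x \<in> T \<Longrightarrow> y \<in> T \<Longrightarrow> x + y \<in> T"
  using int_module_add_smult[of r T x y 1] by simp

lemma zspanI: "A \<in> carrier_mat r k \<Longrightarrow> c \<in> carrier_vec k \<Longrightarrow> A *\<^sub>v map_vec of_int c \<in> zspan A"
  by (auto simp: zspan_def)

lemma zspanE:
  assumes "A \<in> carrier_mat r k" "x \<in> zspan A"
  obtains c where "c \<in> carrier_vec k" "x = A *\<^sub>v map_vec of_int c"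
  using assms by (auto simp: zspan_def)

lemma zspan_carrier: "A \<in> carrier_mat r k \<Longrightarrow> zspan A \<subseteq> carrier_vec r"
  by (auto simp: zspan_def)

lemma int_module_zspan: "A \<in> carrier_mat r k \<Longrightarrow> int_module r (zspan A)"
  unfolding int_module_def
proof (intro conjI ballI allI)
  assume A: "A \<in> carrier_mat r k"
  show "zspan A \<subseteq> carrier_vec r" by (rule zspan_carrier[OF A])
  have "A *\<^sub>v map_vec of_int (0\<^sub>v k) = 0\<^sub>v r" using A by (auto intro!: eq_vecI simp: scalar_prod_def)
  then show "0\<^sub>v r \<in> zspan A" using zspanI[OF A, of "0\<^sub>v k"] by simp
  fix x y and n :: int assume "x \<in> zspan A" "y \<in> zspan A"
  then obtain c d where c: "c \<in> carrier_vec k" "x = A *\<^sub>v map_vec of_int c"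
    and d: "d \<in> carrier_vec k" "y = A *\<^sub>v map_vec of_int d" using zspanE[OF A] by metis
  have "map_vec of_int (c + n \<cdot>\<^sub>v d) = map_vec of_int c + of_int n \<cdot>\<^sub>v (map_vec of_int d :: 'a vec)"
    using c d by (intro eq_vecI) auto
  then have "A *\<^sub>v map_vec of_int (c + n \<cdot>\<^sub>v d) = x + of_int n \<cdot>\<^sub>v y"
    using A c d by (simp add: mult_add_distrib_mat_vec[OF A] mult_mat_smult_vec[OF A])
  then show "x + of_int n \<cdot>\<^sub>v y \<in> zspan A" using zspanI[OF A, of "c + n \<cdot>\<^sub>v d"] c d by simp
qed

lemma zspan_hcat:
  assumes A: "A \<in> carrier_mat r k" and B: "B \<in> carrier_mat r m"
  shows "zspan (hcat A B) = {x + y |x y. x \<in> zspan A \<and> y \<in> zspan B}"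
proof safe
  fix x assume "x \<in> zspan (hcat A B)"
  then obtain c where c: "c \<in> carrier_vec (k + m)" "x = hcat A B *\<^sub>v map_vec of_int c"
    by (rule zspanE[OF hcat_carrier[OF A B]])
  have "map_vec of_int c = map_vec of_int (vec_first c k) @\<^sub>v (map_vec of_int (vec_last c m) :: 'a vec)"
    using c vec_first_last_append[OF c(1)] by (intro eq_vecI) (auto simp: vec_first_def vec_last_def)
  then have "x = A *\<^sub>v map_vec of_int (vec_first c k) + B *\<^sub>v map_vec of_int (vec_last c m)"
    unfolding c(2) by (simp add: hcat_mult_vec[OF A B])
  then show "\<exists>a b. x = a + b \<and> a \<in> zspan A \<and> b \<in> zspan B"
    using zspanI[OF A, of "vec_first c k"] zspanI[OF B, of "vec_last c m"] by auto
next
  fix x y assume "x \<in> zspan A" "y \<in> zspan B"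
  then obtain c d where c: "c \<in> carrier_vec k" "x = A *\<^sub>v map_vec of_int c"
    and d: "d \<in> carrier_vec m" "y = B *\<^sub>v map_vec of_int d" using zspanE[OF A] zspanE[OF B] by metis
  have "map_vec of_int (c @\<^sub>v d) = map_vec of_int c @\<^sub>v (map_vec of_int d :: 'a vec)"
    using c d by (intro eq_vecI) auto
  then have "x + y = hcat A B *\<^sub>v map_vec of_int (c @\<^sub>v d)"
    using c d by (simp add: hcat_mult_vec[OF A B])
  then show "x + y \<in> zspan (hcat A B)"
    using zspanI[OF hcat_carrier[OF A B], of "c @\<^sub>v d"] c d by simp
qed

lemma zspan_single:
  assumes v: "v \<in> carrier_vec r"
  shows "zspan (mat_of_cols r [v]) = {of_int n \<cdot>\<^sub>v v |n. True}"
proof safe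
  fix x assume "x \<in> zspan (mat_of_cols r [v])"
  then obtain c where c: "c \<in> carrier_vec 1" "x = mat_of_cols r [v] *\<^sub>v map_vec of_int c"
    by (auto simp: zspan_def)
  then have "x = of_int (c $ 0) \<cdot>\<^sub>v v" by (simp add: mat_of_cols_mult_vec[OF v])
  then show "\<exists>n. x = of_int n \<cdot>\<^sub>v v \<and> True" by blast
next
  fix n :: int
  have "mat_of_cols r [v] *\<^sub>v map_vec of_int (vec 1 (\<lambda>_. n)) = of_int n \<cdot>\<^sub>v v"
    by (subst mat_of_cols_mult_vec[OF v]) auto
  moreover have "mat_of_cols r [v] \<in> carrier_mat r 1" by (simp add: mat_of_cols_def)
  ultimately show "of_int n \<cdot>\<^sub>v v \<in> zspan (mat_of_cols r [v])"
    using zspanI[of "mat_of_cols r [v]" r 1 "vec 1 (\<lambda>_. n)"] by (metis vec_carrier)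
qed

lemma zspan_subset:
  assumes T: "int_module r T" and "A \<in> carrier_mat r k" "\<And>j. j < k \<Longrightarrow> col A j \<in> T"
  shows "zspan A \<subseteq> T"
  using assms(2,3)
proof (induction k arbitrary: A)
  case 0
  have "A *\<^sub>v c = 0\<^sub>v r" if "c \<in> carrier_vec 0" for c
    using 0 that by (intro eq_vecI) (auto simp: scalar_prod_def)
  then show ?case using 0 T by (auto simp: zspan_def int_module_def)
next
  case (Suc k)
  define A' where "A' = first_cols k A"
  have A': "A' \<in> carrier_mat r k" using Suc.prems(1) by (simp add: A'_def)
  have v: "col A k \<in> carrier_vec r" "mat_of_cols r [col A k] \<in> carrier_mat r 1" using Suc.prems(1) by auto
  have "col A' j = col A j" if "j < k" for j
    using that Suc.prems(1) by (auto simp: A'_def first_cols_def)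
  then have IH: "zspan A' \<subseteq> T" using Suc.IH[OF A'] Suc.prems(2) by auto
  have "A = hcat A' (mat_of_cols r [col A k])"
    unfolding A'_def by (rule hcat_first_last[OF Suc.prems(1)])
  then have "zspan A = {x + y |x y. x \<in> zspan A' \<and> y \<in> zspan (mat_of_cols r [col A k])}"
    using zspan_hcat[OF A' v(2)] by metis
  then show ?case
    using IH int_module_add_smult[OF T, of _ "col A k"] Suc.prems(2) by (auto simp: zspan_single[OF v(1)])
qed

lemma col_in_zspan: "A \<in> carrier_mat r k \<Longrightarrow> j < k \<Longrightarrow> col A j \<in> zspan A"
proof -
  assume A: "A \<in> carrier_mat r k" and j: "j < k"
  have "A *\<^sub>v map_vec of_int (unit_vec k j) = col A j"
  proof -
    have "map_vec of_int (unit_vec k j) = (unit_vec k j :: 'a vec)" by (intro eq_vecI) (auto simp: unit_vec_def)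
    then show ?thesis using A j by (simp add: mult_mat_unit_vec)
  qed
  then show ?thesis using zspanI[OF A, of "unit_vec k j"] by simp
qed

lemma mat_of_cols_in_zspan:
  assumes A: "A \<in> carrier_mat r k" and B: "B \<in> carrier_mat r m"
    and mem: "\<And>j. j < m \<Longrightarrow> col B j \<in> zspan A"
  obtains M :: "int mat" where "M \<in> carrier_mat k m" "B = A * map_mat of_int M"
proof -
  have "\<forall>j. \<exists>c. j < m \<longrightarrow> c \<in> carrier_vec k \<and> col B j = A *\<^sub>v map_vec of_int c"
    using mem zspanE[OF A] by metis
  then obtain c where c: "\<And>j. j < m \<Longrightarrow> c j \<in> carrier_vec k \<and> col B j = A *\<^sub>v map_vec of_int (c j)"
    by metis
  define M where "M = mat k m (\<lambda>(i, j). c j $ i)"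
  have M: "M \<in> carrier_mat k m" by (simp add: M_def)
  have "B = A * map_mat of_int M"
  proof (rule eq_matI)
    fix i j assume "i < dim_row (A * map_mat of_int M)" "j < dim_col (A * map_mat of_int M)"
    then have ij: "i < r" "j < m" using A M by auto
    have "col (map_mat of_int M) j = (map_vec of_int (c j) :: 'a vec)"
      using ij c[of j] by (intro eq_vecI) (auto simp: M_def)
    then have "(A * map_mat of_int M) $$ (i, j) = (A *\<^sub>v map_vec of_int (c j)) $ i"
      using ij A M by simp
    also have "\<dots> = B $$ (i, j)" using c[of j] ij B by (metis index_col carrier_matD)
    finally show "B $$ (i, j) = (A * map_mat of_int M) $$ (i, j)" ..
  qed (use A B M in auto)
  with M that show thesis by blast
qed

lemma mat_inj_card_le:
  fixes A :: "'a :: idom mat"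
  assumes A: "A \<in> carrier_mat r k" and inj: "mat_inj A"
  shows "k \<le> r"
proof (rule ccontr)
  assume "\<not> k \<le> r"
  \<comment> \<open>Extended by zero rows to a square matrix, \<open>A\<close> acquires a vanishing
    last row, so the determinant is 0 and a kernel vector exists.\<close>
  define B where "B = mat k k (\<lambda>(i, j). if i < r then A $$ (i, j) else 0)"
  have B: "B \<in> carrier_mat k k" by (simp add: B_def)
  have "transpose_mat B *\<^sub>v unit_vec k (k - 1) = 0\<^sub>v k"
    using \<open>\<not> k \<le> r\<close> by (subst mult_mat_unit_vec[of _ k k]) (auto simp: B_def intro!: eq_vecI)
  moreover have "unit_vec k (k - 1) \<noteq> (0\<^sub>v k :: 'a vec)" using \<open>\<not> k \<le> r\<close> by simp
  ultimately have "det (transpose_mat B) = 0"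
    using det_0_iff_vec_prod_zero[of "transpose_mat B" k] unit_vec_carrier[of k "k - 1"] B
    by (metis transpose_carrier_mat)
  then have "det B = 0" using det_transpose[OF B] by simp
  then obtain c where c: "c \<in> carrier_vec k" "c \<noteq> 0\<^sub>v k" "B *\<^sub>v c = 0\<^sub>v k"
    using det_0_iff_vec_prod_zero[OF B] by auto
  have "A *\<^sub>v c = 0\<^sub>v r"
  proof (rule eq_vecI)
    fix i assume "i < dim_vec (0\<^sub>v r :: 'a vec)"
    then have i: "i < r" by simp
    then have "row A i = row B i" using A \<open>\<not> k \<le> r\<close> by (intro eq_vecI) (auto simp: B_def)
    then have "(A *\<^sub>v c) $ i = (B *\<^sub>v c) $ i" using i A B \<open>\<not> k \<le> r\<close> by simp
    then show "(A *\<^sub>v c) $ i = 0\<^sub>v r $ i" using c i \<open>\<not> k \<le> r\<close> by simp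
  qed (use A in simp)
  then show False using mat_injD[OF inj A c(1)] c(2) by blast
qed

text \<open>Each basis is an integral combination of the other, and by injectivity the transition
  matrices invert each other; hence equal length and a determinant of square 1. Rank and volume,
  which are defined from a chosen basis, thus do not depend on it.\<close>

lemma zspan_eq_imp:
  fixes A :: "'a :: linordered_field mat"
  assumes A: "A \<in> carrier_mat r k" "mat_inj A" and B: "B \<in> carrier_mat r m" "mat_inj B"
    and eq: "zspan A = zspan B"
  shows "k = m \<and> gram A = gram B"
proof -
  have *: "k \<le> m \<and> (\<exists>M::int mat. M \<in> carrier_mat k m \<and> B = A * map_mat of_int M \<and> (k = m \<longrightarrow> (det M)^2 = 1))"
    if A: "A \<in> carrier_mat r k" "mat_inj A" and B: "B \<in> carrier_mat r m" "mat_inj B"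
      and eq: "zspan A = zspan B" for A B :: "'a mat" and k m
  proof -
    obtain M where M: "M \<in> carrier_mat k m" "B = A * map_mat of_int M"
      using mat_of_cols_in_zspan[OF A(1) B(1)] col_in_zspan[OF B(1)] eq by metis
    obtain M' where M': "M' \<in> carrier_mat m k" "A = B * map_mat of_int M'"
      using mat_of_cols_in_zspan[OF B(1) A(1)] col_in_zspan[OF A(1)] eq by metis
    define P Q :: "'a mat" where "P = map_mat of_int M" "Q = map_mat of_int M'"
    have P: "P \<in> carrier_mat k m" and Q: "Q \<in> carrier_mat m k" using M M' by (auto simp: P_Q_def)
    have APQ: "A *\<^sub>v (P *\<^sub>v (Q *\<^sub>v c)) = A *\<^sub>v c" if c: "c \<in> carrier_vec k" for c
    proof -
      have "A *\<^sub>v c = (A * P * Q) *\<^sub>v c" using M(2) M'(2) unfolding P_Q_def by simp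
      also have "\<dots> = A *\<^sub>v (P *\<^sub>v (Q *\<^sub>v c))"
        using assoc_mult_mat_vec[OF mult_carrier_mat[OF A(1) P] Q c]
          assoc_mult_mat_vec[OF A(1) P mult_mat_vec_carrier[OF Q c]] by simp
      finally show ?thesis ..
    qed
    have PQ: "P *\<^sub>v (Q *\<^sub>v c) = c" if c: "c \<in> carrier_vec k" for c
      using mat_inj_eqD[OF A(2,1) _ c APQ[OF c]] P Q c by auto
    have "mat_inj Q"
    proof (rule mat_injI[OF Q])
      fix c assume c: "c \<in> carrier_vec k" "Q *\<^sub>v c = 0\<^sub>v m"
      then have "c = P *\<^sub>v 0\<^sub>v m" using PQ by metis
      then show "c = 0\<^sub>v k" using P by (auto intro!: eq_vecI)
    qed
    then have "k \<le> m" using mat_inj_card_le[OF Q] by blast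
    moreover have "(det M)^2 = 1" if "k = m"
    proof -
      have "P * Q = 1\<^sub>m k"
      proof (rule eq_matI)
        fix i j assume "i < dim_row (1\<^sub>m k :: 'a mat)" "j < dim_col (1\<^sub>m k :: 'a mat)"
        then have ij: "i < k" "j < k" by auto
        have "col Q j = Q *\<^sub>v unit_vec k j" using mult_mat_unit_vec[OF Q ij(2)] by simp
        then have "(P * Q) $$ (i, j) = (P *\<^sub>v (Q *\<^sub>v unit_vec k j)) $ i" using P Q ij by simp
        then show "(P * Q) $$ (i, j) = 1\<^sub>m k $$ (i, j)" using PQ ij by (simp add: unit_vec_def)
      qed (use P Q in auto)
      then have "det P * det Q = 1" using P Q that by (metis det_mult det_one)
      then have "(of_int (det M * det M') :: 'a) = 1"
        unfolding P_Q_def by (simp add: of_int_hom.hom_det)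
      then have "det M * det M' = 1" by (simp only: of_int_eq_1_iff)
      then have "\<bar>det M\<bar> = 1" using zmult_eq_1_iff by fastforce
      then show ?thesis by (metis power2_abs power_one)
    qed
    ultimately show ?thesis using M by blast
  qed
  have km: "k = m" using *[OF A B eq] *[OF B A eq[symmetric]] by simp
  then obtain M :: "int mat" where M: "M \<in> carrier_mat k k" "B = A * map_mat of_int M" "(det M)^2 = 1"
    using *[OF A B eq] by auto
  have "gram B = (det (map_mat of_int M))^2 * gram A"
    unfolding M(2) using M(1) by (intro gram_mult[OF A(1)]) auto
  also have "det (map_mat of_int M) = (of_int (det M) :: 'a)" by (simp add: of_int_hom.hom_det)
  also have "(of_int (det M) :: 'a)^2 = of_int ((det M)^2)" by simp
  finally show ?thesis using km M(3) by simp
qed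

lemma lattice_basis_iff:
  "lattice_basis r bs L \<longleftrightarrow>
     set bs \<subseteq> carrier_vec r \<and> mat_inj (mat_of_cols r bs) \<and> L = zspan (mat_of_cols r bs)"
  unfolding lattice_basis_def mat_inj_def zspan_def by simp

lemma is_lattice_iff: "is_lattice r L \<longleftrightarrow> (\<exists>k. \<exists>A\<in>carrier_mat r k. mat_inj A \<and> L = zspan A)"
proof
  assume "is_lattice r L"
  then show "\<exists>k. \<exists>A\<in>carrier_mat r k. mat_inj A \<and> L = zspan A"
    unfolding is_lattice_def lattice_basis_iff using mat_of_cols_carrier(1) by blast
next
  assume "\<exists>k. \<exists>A\<in>carrier_mat r k. mat_inj A \<and> L = zspan A"
  then obtain k A where A: "A \<in> carrier_mat r k" "mat_inj A" "L = zspan A" by blast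
  then have "lattice_basis r (cols A) L"
    unfolding lattice_basis_iff using mat_of_cols_cols[of A] cols_dim[of A] by auto
  then show "is_lattice r L" unfolding is_lattice_def by blast
qed

text \<open>Frees rank, volume and degree from the choice made in \<open>some_basis\<close>, so that
  they can be computed from any explicit matrix.\<close>

lemma lattice_zspan:
  fixes A :: "real mat"
  assumes A: "A \<in> carrier_mat r k" "mat_inj A"
  shows "is_lattice r (zspan A)" "lattice_rank r (zspan A) = k" "lattice_vol r (zspan A) = sqrt (gram A)"
    "lattice_deg r (zspan A) = - ln (gram A) / 2"
proof -
  show L: "is_lattice r (zspan A)" using A is_lattice_iff by blast
  define bs where "bs = some_basis r (zspan A)"
  have "lattice_basis r bs (zspan A)"
    unfolding bs_def some_basis_def using L unfolding is_lattice_def by (rule someI_ex)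
  then have B: "mat_inj (mat_of_cols r bs)" "zspan A = zspan (mat_of_cols r bs)"
    unfolding lattice_basis_iff by auto
  have eq: "k = length bs \<and> gram A = gram (mat_of_cols r bs)"
    using zspan_eq_imp[OF A mat_of_cols_carrier(1) B] .
  then show "lattice_rank r (zspan A) = k" by (simp add: lattice_rank_def bs_def)
  show vol: "lattice_vol r (zspan A) = sqrt (gram A)"
    using eq by (simp add: lattice_vol_def bs_def gram_def Let_def)
  show "lattice_deg r (zspan A) = - ln (gram A) / 2"
    using gram_pos[OF A] by (simp add: lattice_deg_def vol ln_sqrt)
qed

section \<open>Clearing denominators, saturated subgroups and extension of bases\<close>

lemma int_multiple_rat_vec:
  fixes c :: "rat vec"
  obtains n :: int and d :: "int vec" where "n > 0" "d \<in> carrier_vec (dim_vec c)" "of_int n \<cdot>\<^sub>v c = map_vec of_int d"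
proof -
  have "\<exists>n::int. n > 0 \<and> (\<forall>i<m. of_int n * c $ i \<in> \<int>)" for m
  proof (induction m)
    case 0 show ?case by (rule exI[of _ 1]) simp
  next
    case (Suc m)
    then obtain n :: int where n: "n > 0" "\<forall>i<m. of_int n * c $ i \<in> \<int>" by blast
    obtain a b where ab: "quotient_of (c $ m) = (a, b)" by (cases "quotient_of (c $ m)") auto
    have b: "b > 0" and cm: "c $ m = of_int a / of_int b"
      using quotient_of_denom_pos[OF ab] quotient_of_div[OF ab] by auto
    have 1: "of_int (n * b) * c $ m = of_int (n * a)" using b cm by simp
    have 2: "of_int (n * b) * c $ i = of_int b * (of_int n * c $ i)" for i by simp
    have "of_int (n * b) * c $ i \<in> \<int>" if "i < Suc m" for i
    proof (cases "i = m")
      case True then show ?thesis using 1 Ints_of_int by metis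
    next
      case False
      then have "of_int n * c $ i \<in> \<int>" using n that by simp
      then show ?thesis unfolding 2 by (rule Ints_mult[OF Ints_of_int])
    qed
    then show ?case using n b by (intro exI[of _ "n * b"]) simp
  qed
  then obtain n :: int where n: "n > 0" "\<forall>i<dim_vec c. of_int n * c $ i \<in> \<int>" by blast
  show thesis
  proof (rule that[of n "vec (dim_vec c) (\<lambda>i. \<lfloor>of_int n * c $ i\<rfloor>)"])
    show "of_int n \<cdot>\<^sub>v c = map_vec of_int (vec (dim_vec c) (\<lambda>i. \<lfloor>of_int n * c $ i\<rfloor>))"
    proof (rule eq_vecI)
      fix i assume "i < dim_vec (map_vec of_int (vec (dim_vec c) (\<lambda>i. \<lfloor>of_int n * c $ i\<rfloor>)) :: rat vec)"
      then have i: "i < dim_vec c" by simp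
      have "of_int n * c $ i \<in> \<int>" using n i by blast
      then obtain z :: int where "of_int n * c $ i = of_int z" by (elim Ints_cases)
      then show "(of_int n \<cdot>\<^sub>v c) $ i = map_vec of_int (vec (dim_vec c) (\<lambda>i. \<lfloor>of_int n * c $ i\<rfloor>)) $ i"
        using i by simp
    qed simp
  qed (use n in auto)
qed

text \<open>Clearing the denominators of \<open>c\<close> moves a multiple of \<open>x\<close> into
  \<open>zspan A\<close>, and saturation divides it back: a saturated subgroup is the intersection
  of \<open>T\<close> with its rational span.\<close>

lemma saturated_in_zspan_rational:
  assumes A: "A \<in> carrier_mat r k" and sat: "saturated_in r T (zspan A)"
    and x: "x \<in> T" "x = A *\<^sub>v c" "c \<in> carrier_vec k"
  shows "x \<in> zspan (A :: rat mat)"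
proof -
  obtain n and d :: "int vec" where n: "n > 0" "d \<in> carrier_vec k" "of_int n \<cdot>\<^sub>v c = map_vec of_int d"
    using int_multiple_rat_vec[of c] x(3) by auto
  have "of_int n \<cdot>\<^sub>v x = A *\<^sub>v map_vec of_int d"
    unfolding n(3)[symmetric] x(2) using A x(3) by (simp add: mult_mat_smult_vec[OF A])
  then have "of_int n \<cdot>\<^sub>v x \<in> zspan A" using zspanI[OF A n(2)] by simp
  moreover have "n \<noteq> 0" using n by simp
  ultimately show ?thesis using sat x(1) unfolding saturated_in_def by blast
qed

text \<open>In the part of \<open>T\<close> lying in the rational span of \<open>A\<close> and one
  new vector, a vector \<open>v1\<close> with smallest positive projection to the residual direction
  \<open>w\<close> is adjoined. Discreteness of the projections makes it exist; division with
  remainder shows that it generates that part together with \<open>zspan A\<close>.\<close>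

lemma saturated_extend_one:
  fixes A :: "rat mat"
  assumes T: "int_module r T" and bd: "bounded_denominators r T"
    and A: "A \<in> carrier_mat r k" and inj: "mat_inj A"
    and sat: "saturated_in r T (zspan A)" and ne: "zspan A \<noteq> T"
  shows "\<exists>v\<in>T. mat_inj (hcat A (mat_of_cols r [v])) \<and>
    saturated_in r T (zspan (hcat A (mat_of_cols r [v])))"
proof -
  have AT: "zspan A \<subseteq> T" using sat by (simp add: saturated_in_def)
  then obtain v0 where v0: "v0 \<in> T" "v0 \<notin> zspan A" using ne by blast
  have v0c: "v0 \<in> carrier_vec r" using int_module_carrier[OF T v0(1)] .
  have V: "mat_of_cols r [v0] \<in> carrier_mat r 1" by (simp add: mat_of_cols_def)
  obtain C where C: "C \<in> carrier_mat k 1" "transpose_mat A * (mat_of_cols r [v0] - A * C) = 0\<^sub>m k 1"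
    using orthogonal_residual[OF A V inj] by blast
  define W where "W = mat_of_cols r [v0] - A * C"
  define w where "w = col W 0"
  define c0 where "c0 = col C 0"
  have W: "W \<in> carrier_mat r 1" using A C V by (auto simp: W_def)
  have w: "w \<in> carrier_vec r" using W by (auto simp: w_def)
  have c0: "c0 \<in> carrier_vec k" using C by (auto simp: c0_def)
  have Ac0: "A *\<^sub>v c0 \<in> carrier_vec r" using A c0 by auto
  have col_AC: "col (A * C) 0 = A *\<^sub>v c0" using A C by (intro eq_vecI) (auto simp: c0_def)
  have v0_eq: "v0 = A *\<^sub>v c0 + w"
  proof (rule eq_vecI)
    fix i assume "i < dim_vec (A *\<^sub>v c0 + w)"
    then have i: "i < r" using w by auto
    have "w $ i = v0 $ i - (A * C) $$ (i, 0)"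
      using i A C V v0c unfolding w_def W_def by (simp add: mat_of_cols_index)
    also have "(A * C) $$ (i, 0) = (A *\<^sub>v c0) $ i"
      using i A C by (simp add: c0_def)
    finally show "v0 $ i = (A *\<^sub>v c0 + w) $ i" using i w by simp
  qed (use v0c w in auto)
  have Aw: "(A *\<^sub>v a) \<bullet> w = 0" if a: "a \<in> carrier_vec k" for a
  proof -
    have "transpose_mat A *\<^sub>v w = col (transpose_mat A * W) 0"
      using A W by (intro eq_vecI) (auto simp: w_def)
    also have "\<dots> = 0\<^sub>v k" using C(2) unfolding W_def[symmetric] by (auto intro!: eq_vecI)
    finally have "w \<bullet> (A *\<^sub>v a) = 0" using transpose_vec_mult_scalar[OF A a w] a by simp
    then show ?thesis using A a w by (subst comm_scalar_prod[of _ r]) auto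
  qed
  have w0: "w \<noteq> 0\<^sub>v r"
  proof
    assume "w = 0\<^sub>v r"
    then have "v0 = A *\<^sub>v c0" using v0_eq Ac0 by simp
    then show False using saturated_in_zspan_rational[OF A sat v0(1) _ c0] v0(2) by blast
  qed
  have ww: "w \<bullet> w > 0" using scalar_prod_self_eq_0[OF w] w0 scalar_prod_self_nonneg[of w] by linarith
  have v0w: "v0 \<bullet> w = w \<bullet> w"
    unfolding v0_eq using Ac0 w Aw[OF c0] by (subst add_scalar_prod_distrib[of _ r]) auto
  obtain N :: int where N: "N > 0" "\<forall>x\<in>T. \<forall>i<r. of_int N * x $ i \<in> \<int>"
    using bd unfolding bounded_denominators_def by blast
  obtain D :: int and d where D: "D > 0" "d \<in> carrier_vec r" "of_int D \<cdot>\<^sub>v w = map_vec of_int d"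
    using int_multiple_rat_vec[of w] w by auto
  \<comment> \<open>\<open>N\<close> clears the denominators of elements of \<open>T\<close> and
    \<open>D\<close> those of \<open>w\<close>, so \<open>K * (x \<bullet> w)\<close> is an integer
    for every \<open>x \<in> T\<close>.\<close>
  define K where "K = N * D"
  have K: "K > 0" using N D by (simp add: K_def)
  have int: "of_int K * (x \<bullet> w) \<in> \<int>" if x: "x \<in> T" for x
  proof -
    have "of_int K * (x \<bullet> w) = (\<Sum>i\<in>{0..<r}. (of_int N * x $ i) * (of_int D * w $ i))"
      using w by (simp add: scalar_prod_def K_def sum_distrib_left mult_ac)
    also have "\<dots> \<in> \<int>"
    proof (rule Ints_sum)
      fix i assume "i \<in> {0..<r}"
      then have i: "i < r" by simp
      have 1: "of_int N * x $ i \<in> \<int>" using N x i by blast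
      have "of_int D * w $ i = (of_int D \<cdot>\<^sub>v w) $ i" using i w by simp
      also have "\<dots> = of_int (d $ i)" unfolding D(3) using i D(2) by simp
      finally have "of_int D * w $ i \<in> \<int>" by simp
      with 1 show "of_int N * x $ i * (of_int D * w $ i) \<in> \<int>" by (rule Ints_mult)
    qed
    finally show ?thesis .
  qed
  \<comment> \<open>\<open>T1\<close> is the intersection of \<open>T\<close> with the rational span
    of \<open>A\<close> and \<open>v0\<close>; saturation of the new lattice comes down to
    membership in it.\<close>
  define T1 where "T1 = {x \<in> T. \<exists>a\<in>carrier_vec k. \<exists>b. x = A *\<^sub>v a + b \<cdot>\<^sub>v v0}"
  have T1w: "(A *\<^sub>v a + b \<cdot>\<^sub>v v0) \<bullet> w = b * (w \<bullet> w)" if "a \<in> carrier_vec k" for a b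
    using Aw[OF that] A that v0c w v0w by (subst add_scalar_prod_distrib[of _ r]) auto
  have T1_sub: "x + of_int m \<cdot>\<^sub>v y \<in> T1" if x: "x \<in> T1" and y: "y \<in> T1" for x y and m :: int
  proof -
    obtain a b a' b' where ab: "a \<in> carrier_vec k" "x = A *\<^sub>v a + b \<cdot>\<^sub>v v0"
      "a' \<in> carrier_vec k" "y = A *\<^sub>v a' + b' \<cdot>\<^sub>v v0" using x y unfolding T1_def by blast
    have "A *\<^sub>v (a + of_int m \<cdot>\<^sub>v a') = A *\<^sub>v a + of_int m \<cdot>\<^sub>v (A *\<^sub>v a')"
      using ab by (simp add: mult_add_distrib_mat_vec[OF A] mult_mat_smult_vec[OF A])
    then have "x + of_int m \<cdot>\<^sub>v y = A *\<^sub>v (a + of_int m \<cdot>\<^sub>v a') + (b + of_int m * b') \<cdot>\<^sub>v v0"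
      using ab A v0c by (intro eq_vecI) (auto simp: algebra_simps)
    moreover have "x + of_int m \<cdot>\<^sub>v y \<in> T" using x y T1_def int_module_add_smult[OF T] by auto
    moreover have "a + of_int m \<cdot>\<^sub>v a' \<in> carrier_vec k" using ab by auto
    ultimately show ?thesis unfolding T1_def by blast
  qed
  define P where "P n \<longleftrightarrow> (\<exists>x\<in>T1. x \<bullet> w > 0 \<and> of_int K * (x \<bullet> w) = of_nat n)" for n
  have PI: "P (nat z)" if "x \<in> T1" "x \<bullet> w > 0" "of_int K * (x \<bullet> w) = of_int z" for x z
  proof -
    have "of_int K * (x \<bullet> w) > 0" using that(2) K by simp
    then have "z > 0" unfolding that(3) by simp
    then show ?thesis unfolding P_def using that by (intro bexI[of _ x]) auto
  qed
  have "v0 = A *\<^sub>v 0\<^sub>v k + 1 \<cdot>\<^sub>v v0" using A v0c by (intro eq_vecI) (auto simp: scalar_prod_def)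
  then have v0T1: "v0 \<in> T1" unfolding T1_def using v0(1) zero_carrier_vec by blast
  obtain z0 :: int where "of_int K * (v0 \<bullet> w) = of_int z0" using int[OF v0(1)] by (elim Ints_cases)
  then have "P (nat z0)" using PI[OF v0T1] v0w ww by simp
  then have "P (LEAST n. P n)" by (rule LeastI)
  then obtain v1 where v1: "v1 \<in> T1" "v1 \<bullet> w > 0" "of_int K * (v1 \<bullet> w) = of_nat (LEAST n. P n)"
    unfolding P_def by blast
  have v1T: "v1 \<in> T" using v1 by (simp add: T1_def)
  have v1c: "v1 \<in> carrier_vec r" using int_module_carrier[OF T v1T] .
  have dec: "\<exists>y\<in>zspan A. \<exists>m :: int. x = y + of_int m \<cdot>\<^sub>v v1" if x: "x \<in> T1" for x
  proof -
    have xT: "x \<in> T" and xc: "x \<in> carrier_vec r" using x int_module_carrier[OF T] by (auto simp: T1_def)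
    \<comment> \<open>Division with remainder: the projection of \<open>y\<close> is non-negative
      and below that of \<open>v1\<close>, so minimality forces it to be 0 and \<open>y\<close>
      falls into \<open>zspan A\<close>.\<close>
    define m where "m = \<lfloor>(x \<bullet> w) / (v1 \<bullet> w)\<rfloor>"
    define y where "y = x + of_int (- m) \<cdot>\<^sub>v v1"
    have y: "y \<in> T1" unfolding y_def by (rule T1_sub[OF x v1(1)])
    then have yT: "y \<in> T" by (simp add: T1_def)
    have yw: "y \<bullet> w = x \<bullet> w - of_int m * (v1 \<bullet> w)"
      unfolding y_def using xc v1c w by (subst add_scalar_prod_distrib[of _ r]) auto
    have "of_int m \<le> (x \<bullet> w) / (v1 \<bullet> w)" "(x \<bullet> w) / (v1 \<bullet> w) < of_int m + 1"
      unfolding m_def by linarith+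
    then have bnd: "0 \<le> y \<bullet> w" "y \<bullet> w < v1 \<bullet> w"
      unfolding yw using v1(2) by (auto simp: field_simps)
    have "y \<bullet> w = 0"
    proof (rule ccontr)
      assume "y \<bullet> w \<noteq> 0"
      then have pos: "y \<bullet> w > 0" using bnd by simp
      obtain z :: int where z: "of_int K * (y \<bullet> w) = of_int z" using int[OF yT] by (elim Ints_cases)
      have "of_int K * (y \<bullet> w) < of_int K * (v1 \<bullet> w)" using bnd K by simp
      then have "(of_int z :: rat) < of_int (int (LEAST n. P n))" using z v1(3) by simp
      then have "z < int (LEAST n. P n)" by (simp only: of_int_less_iff)
      moreover have "(0 :: rat) < of_int z" unfolding z[symmetric] using pos K by simp
      ultimately have "nat z < (LEAST n. P n)" by simp
      then show False using not_less_Least[of "nat z" P] PI[OF y pos z] by blast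
    qed
    obtain a b where ab: "a \<in> carrier_vec k" "y = A *\<^sub>v a + b \<cdot>\<^sub>v v0" using y unfolding T1_def by blast
    have "b = 0" using T1w[OF ab(1), of b] \<open>y \<bullet> w = 0\<close> ww unfolding ab(2) by simp
    then have "y = A *\<^sub>v a" using ab A v0c by (intro eq_vecI) auto
    then have "y \<in> zspan A" using saturated_in_zspan_rational[OF A sat yT _ ab(1)] by blast
    moreover have "x = y + of_int m \<cdot>\<^sub>v v1" unfolding y_def using xc v1c by (intro eq_vecI) auto
    ultimately show ?thesis by blast
  qed
  have V1: "mat_of_cols r [v1] \<in> carrier_mat r 1" by (simp add: mat_of_cols_def)
  have zs: "zspan (hcat A (mat_of_cols r [v1])) = {x + of_int n \<cdot>\<^sub>v v1 |x n. x \<in> zspan A}"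
    unfolding zspan_hcat[OF A V1] zspan_single[OF v1c] by auto
  obtain a1 b1 where v1_eq: "a1 \<in> carrier_vec k" "v1 = A *\<^sub>v a1 + b1 \<cdot>\<^sub>v v0" using v1(1) unfolding T1_def by blast
  have "mat_inj (hcat A (mat_of_cols r [v1]))"
  proof (rule mat_injI[OF hcat_carrier[OF A V1]])
    fix c assume c: "c \<in> carrier_vec (k + 1)" and 0: "hcat A (mat_of_cols r [v1]) *\<^sub>v c = 0\<^sub>v r"
    define a b where "a = vec_first c k" "b = vec_last c 1"
    have ab: "a \<in> carrier_vec k" "b \<in> carrier_vec 1" "c = a @\<^sub>v b"
      using vec_first_last_append[OF c] by (simp_all add: a_b_def)
    have eq: "A *\<^sub>v a + (b $ 0) \<cdot>\<^sub>v v1 = 0\<^sub>v r"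
      using 0 unfolding ab(3) hcat_mult_vec[OF A V1 ab(1,2)] mat_of_cols_mult_vec[OF v1c ab(2)] .
    then have "(A *\<^sub>v a + (b $ 0) \<cdot>\<^sub>v v1) \<bullet> w = 0" using w by simp
    then have "(b $ 0) * (v1 \<bullet> w) = 0"
      using A ab(1) v1c w Aw[OF ab(1)] by (subst (asm) add_scalar_prod_distrib[of _ r]) auto
    then have b0: "b $ 0 = 0" using v1(2) by simp
    then have "A *\<^sub>v a = 0\<^sub>v r"
      using eq A ab(1) v1c by (auto simp: vec_eq_iff)
    then have "a = 0\<^sub>v k" using mat_injD[OF inj A ab(1)] by blast
    then show "c = 0\<^sub>v (k + 1)" unfolding ab(3) using b0 ab(2) by (intro eq_vecI) (auto simp: less_Suc_eq)
  qed
  moreover have "saturated_in r T (zspan (hcat A (mat_of_cols r [v1])))"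
    unfolding saturated_in_def
  proof (intro conjI ballI allI impI)
    show "int_module r (zspan (hcat A (mat_of_cols r [v1])))"
      by (rule int_module_zspan[OF hcat_carrier[OF A V1]])
    show "zspan (hcat A (mat_of_cols r [v1])) \<subseteq> T"
      unfolding zs using AT int_module_add_smult[OF T _ v1T] by auto
    fix x and n :: int assume x: "x \<in> T" and n: "n \<noteq> 0" "of_int n \<cdot>\<^sub>v x \<in> zspan (hcat A (mat_of_cols r [v1]))"
    have xc: "x \<in> carrier_vec r" using int_module_carrier[OF T x] .
    obtain y and l :: int where y: "y \<in> zspan A" "of_int n \<cdot>\<^sub>v x = y + of_int l \<cdot>\<^sub>v v1" using n(2) unfolding zs by blast
    obtain c where c: "c \<in> carrier_vec k" "y = A *\<^sub>v map_vec of_int c" using zspanE[OF A y(1)] .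
    \<comment> \<open>Dividing by \<open>n\<close> shows that \<open>x\<close> lies in the rational
      span of \<open>A\<close> and \<open>v0\<close>, hence in \<open>T1\<close>.\<close>
    define s :: rat where "s = 1 / of_int n"
    have s: "s * of_int n = 1" using n by (simp add: s_def)
    let ?a = "s \<cdot>\<^sub>v (map_vec of_int c + of_int l \<cdot>\<^sub>v a1)"
    have a: "?a \<in> carrier_vec k" using c v1_eq by auto
    have "A *\<^sub>v ?a = s \<cdot>\<^sub>v (y + of_int l \<cdot>\<^sub>v (A *\<^sub>v a1))"
      unfolding c(2) using c(1) v1_eq(1)
      by (simp add: mult_add_distrib_mat_vec[OF A] mult_mat_smult_vec[OF A])
    moreover have "x = s \<cdot>\<^sub>v (of_int n \<cdot>\<^sub>v x)" using s by (simp add: smult_smult_assoc)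
    ultimately have "x = A *\<^sub>v ?a + (s * of_int l * b1) \<cdot>\<^sub>v v0"
      unfolding y(2) v1_eq(2) using A v1_eq(1) v0c c by (intro eq_vecI) (auto simp: algebra_simps)
    then have "x \<in> T1" unfolding T1_def using x a by blast
    then show "x \<in> zspan (hcat A (mat_of_cols r [v1]))" using dec unfolding zs by blast
  qed
  ultimately show ?thesis using v1T by blast
qed

text \<open>One column is adjoined at a time; at most \<open>r\<close> columns are independent, so
  the process stops.\<close>

lemma extend_basis:
  fixes A :: "rat mat"
  assumes T: "int_module r T" and bd: "bounded_denominators r T"
    and "A \<in> carrier_mat r k" "mat_inj A" "saturated_in r T (zspan A)"
  shows "\<exists>m. \<exists>B\<in>carrier_mat r m. mat_inj (hcat A B) \<and> zspan (hcat A B) = T"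
  using assms(3-)
proof (induction "r - k" arbitrary: A k rule: less_induct)
  case less
  show ?case
  proof (cases "zspan A = T")
    case True
    have "hcat A (0\<^sub>m r 0) = A" using less.prems(1) by (intro eq_matI) (auto simp: hcat_def)
    then show ?thesis using True less.prems(2) zero_carrier_mat[of r 0] by metis
  next
    case False
    then obtain v where v: "v \<in> T" "mat_inj (hcat A (mat_of_cols r [v]))"
      "saturated_in r T (zspan (hcat A (mat_of_cols r [v])))"
      using saturated_extend_one[OF T bd less.prems] by blast
    have V: "mat_of_cols r [v] \<in> carrier_mat r 1" by (simp add: mat_of_cols_def)
    have "k + 1 \<le> r" by (rule mat_inj_card_le[OF hcat_carrier[OF less.prems(1) V] v(2)])
    then have "r - (k + 1) < r - k" by simp
    from less.hyps[OF this hcat_carrier[OF less.prems(1) V] v(2,3)]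
    obtain m B where B: "B \<in> carrier_mat r m" "mat_inj (hcat (hcat A (mat_of_cols r [v])) B)"
      "zspan (hcat (hcat A (mat_of_cols r [v])) B) = T" by blast
    then show ?thesis
      using hcat_assoc[OF less.prems(1) V B(1)] hcat_carrier[OF V B(1)] by metis
  qed
qed

lemma saturated_in_zero:
  fixes T :: "rat vec set"
  assumes T: "int_module r T"
  shows "saturated_in r T {0\<^sub>v r}"
  unfolding saturated_in_def
proof (intro conjI ballI allI impI)
  show "int_module r {0\<^sub>v r :: rat vec}" by (auto simp: int_module_def)
  show "{0\<^sub>v r} \<subseteq> T" using T by (auto simp: int_module_def)
  fix x and n :: int assume x: "x \<in> T" "n \<noteq> 0" "of_int n \<cdot>\<^sub>v x \<in> {0\<^sub>v r}"
  have "x \<in> carrier_vec r" using int_module_carrier[OF T x(1)] .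
  then show "x \<in> {0\<^sub>v r}" using x by (auto simp: vec_eq_iff)
qed

lemma zspan_no_cols: "A \<in> carrier_mat r 0 \<Longrightarrow> zspan A = {0\<^sub>v r}"
proof -
  assume A: "A \<in> carrier_mat r 0"
  have "A *\<^sub>v map_vec of_int c = 0\<^sub>v r" if "c \<in> carrier_vec 0" for c
    using A that by (intro eq_vecI) (auto simp: scalar_prod_def)
  then have "zspan A \<subseteq> {0\<^sub>v r}" using A by (auto simp: zspan_def)
  moreover have "0\<^sub>v r \<in> zspan A" using int_module_zspan[OF A] by (simp add: int_module_def)
  ultimately show ?thesis by blast
qed

lemma bounded_denominators_mono: "bounded_denominators r T \<Longrightarrow> S \<subseteq> T \<Longrightarrow> bounded_denominators r S"
  unfolding bounded_denominators_def by blast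

lemma saturated_in_restrict: "saturated_in r T S \<Longrightarrow> S \<subseteq> U \<Longrightarrow> U \<subseteq> T \<Longrightarrow> saturated_in r U S"
  unfolding saturated_in_def by blast

lemma first_cols_hcat_le:
  "A \<in> carrier_mat r k \<Longrightarrow> B \<in> carrier_mat r m \<Longrightarrow> i \<le> k \<Longrightarrow> first_cols i (hcat A B) = first_cols i A"
  by (rule eq_matI) (auto simp: hcat_def first_cols_def)

lemma first_cols_all: "A \<in> carrier_mat r k \<Longrightarrow> first_cols k A = A"
  by (rule eq_matI) (auto simp: first_cols_def)

text \<open>Every member is saturated in the next one, so a basis extends along the chain and
  initial columns are never changed again. The empty list starts from the zero subgroup.\<close>

lemma adapted_basis_aux:
  fixes T :: "rat vec set"
  assumes T: "int_module r T" and bd: "bounded_denominators r T"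
  shows "sorted_wrt (\<subseteq>) Ss \<Longrightarrow> \<forall>S\<in>set Ss. saturated_in r T S \<Longrightarrow>
    \<exists>k. \<exists>A\<in>carrier_mat r k. mat_inj A \<and> zspan A = (if Ss = [] then {0\<^sub>v r} else last Ss) \<and>
      (\<forall>S\<in>set Ss. \<exists>i\<le>k. zspan (first_cols i A) = S)"
proof (induction Ss rule: rev_induct)
  case Nil
  have "mat_inj (0\<^sub>m r 0 :: rat mat)" by (rule mat_injI) auto
  then show ?case using zspan_no_cols[of "0\<^sub>m r 0" r] by (intro exI[of _ 0] bexI[of _ "0\<^sub>m r 0"]) auto
next
  case (snoc S Ss)
  then obtain k A where A: "A \<in> carrier_mat r k" "mat_inj A"
    "zspan A = (if Ss = [] then {0\<^sub>v r} else last Ss)" "\<forall>S\<in>set Ss. \<exists>i\<le>k. zspan (first_cols i A) = S"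
    by (auto simp: sorted_wrt_append)
  have S: "saturated_in r T S" "int_module r S" "S \<subseteq> T" using snoc.prems by (auto simp: saturated_in_def)
  have "saturated_in r T (zspan A)"
    unfolding A(3) using saturated_in_zero[OF T] snoc.prems(2) by auto
  moreover have "zspan A \<subseteq> S"
    unfolding A(3) using snoc.prems(1) S(2) by (auto simp: sorted_wrt_append int_module_def)
  ultimately have "saturated_in r S (zspan A)" using saturated_in_restrict S(3) by blast
  then obtain m B where B: "B \<in> carrier_mat r m" "mat_inj (hcat A B)" "zspan (hcat A B) = S"
    using extend_basis[OF S(2) bounded_denominators_mono[OF bd S(3)] A(1,2)] by blast
  have "\<exists>i\<le>k + m. zspan (first_cols i (hcat A B)) = S'" if "S' \<in> set (Ss @ [S])" for S'
  proof (cases "S' \<in> set Ss")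
    case True
    then show ?thesis using A(4) first_cols_hcat_le[OF A(1) B(1)] by (metis trans_le_add1)
  next
    case False
    then have "S' = S" using that by simp
    then show ?thesis using B(3) first_cols_all[OF hcat_carrier[OF A(1) B(1)]] by auto
  qed
  then show ?case using B hcat_carrier[OF A(1) B(1)]
    by (intro exI[of _ "k + m"] bexI[of _ "hcat A B"]) auto
qed

lemma adapted_basis:
  fixes T :: "rat vec set"
  assumes T: "int_module r T" and bd: "bounded_denominators r T"
    and Ss: "sorted_wrt (\<subseteq>) Ss" "\<And>S. S \<in> set Ss \<Longrightarrow> saturated_in r T S"
  obtains k A where "A \<in> carrier_mat r k" "mat_inj A" "zspan A = T"
    "\<And>S. S \<in> set Ss \<Longrightarrow> \<exists>i\<le>k. zspan (first_cols i A) = S"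
proof -
  have T': "saturated_in r T T" using T by (auto simp: saturated_in_def)
  \<comment> \<open>Appending \<open>T\<close> makes the final basis span all of
    \<open>T\<close>.\<close>
  have "sorted_wrt (\<subseteq>) (Ss @ [T])" using Ss by (auto simp: sorted_wrt_append saturated_in_def)
  moreover have "\<forall>S\<in>set (Ss @ [T]). saturated_in r T S" using Ss(2) T' by auto
  ultimately have "\<exists>k. \<exists>A\<in>carrier_mat r k. mat_inj A \<and> zspan A = T \<and>
      (\<forall>S\<in>set (Ss @ [T]). \<exists>i\<le>k. zspan (first_cols i A) = S)"
    using adapted_basis_aux[OF T bd, of "Ss @ [T]"] by simp
  then show thesis using that by auto
qed

section \<open>Coordinate flags and triangular bases\<close>

definition coord_flag :: "nat \<Rightarrow> 'a :: zero vec set \<Rightarrow> nat \<Rightarrow> 'a vec set" where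
  "coord_flag r T i = {x \<in> T. \<forall>j\<in>{i..<r}. x $ j = 0}"

lemma coord_flag_saturated:
  fixes T :: "rat vec set"
  assumes T: "int_module r T"
  shows "saturated_in r T (coord_flag r T i)"
  unfolding saturated_in_def
proof (intro conjI ballI allI impI)
  show "int_module r (coord_flag r T i)"
    unfolding int_module_def
  proof (intro conjI ballI allI)
    show "coord_flag r T i \<subseteq> carrier_vec r" "0\<^sub>v r \<in> coord_flag r T i"
      using T by (auto simp: coord_flag_def int_module_def)
    fix x y and n :: int assume xy: "x \<in> coord_flag r T i" "y \<in> coord_flag r T i"
    then have "x \<in> carrier_vec r" "y \<in> carrier_vec r"
      using int_module_carrier[OF T] by (auto simp: coord_flag_def)
    then show "x + of_int n \<cdot>\<^sub>v y \<in> coord_flag r T i"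
      using xy int_module_add_smult[OF T] by (auto simp: coord_flag_def)
  qed
  show "coord_flag r T i \<subseteq> T" by (auto simp: coord_flag_def)
  fix x and n :: int assume x: "x \<in> T" "n \<noteq> 0" "of_int n \<cdot>\<^sub>v x \<in> coord_flag r T i"
  have "x \<in> carrier_vec r" using int_module_carrier[OF T x(1)] .
  then show "x \<in> coord_flag r T i" using x by (auto simp: coord_flag_def)
qed

lemma zspan_first_cols_mono:
  assumes "A \<in> carrier_mat r k" "i \<le> j"
  shows "zspan (first_cols i A) \<subseteq> zspan (first_cols j A)"
proof (rule zspan_subset[OF int_module_zspan])
  show "first_cols i A \<in> carrier_mat r i" "first_cols j A \<in> carrier_mat r j" using assms by auto
  fix l assume l: "l < i"
  have "col (first_cols i A) l = col (first_cols j A) l"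
    using l assms by (intro eq_vecI) (auto simp: first_cols_def)
  then show "col (first_cols i A) l \<in> zspan (first_cols j A)"
    using col_in_zspan[OF first_cols_carrier[OF assms(1)], of l j] l assms(2) by simp
qed

text \<open>A Hermite normal form obtained from an adapted basis: \<open>full\<close> makes the
  \<open>r\<close> inclusions of the coordinate flag strict, and at most \<open>r\<close> columns
  are available, so the \<open>i\<close>-th member is spanned by exactly the first \<open>i\<close>
  columns.\<close>

lemma triangular_basis:
  fixes T :: "rat vec set"
  assumes T: "int_module r T" and bd: "bounded_denominators r T"
    and full: "\<And>i. i < r \<Longrightarrow> \<exists>x\<in>T. x $ i \<noteq> 0 \<and> (\<forall>j\<in>{i<..<r}. x $ j = 0)"
  obtains A where "A \<in> carrier_mat r r" "mat_inj A" "zspan A = T"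
    "\<And>i. i \<le> r \<Longrightarrow> zspan (first_cols i A) = coord_flag r T i" "upper_triangular A"
proof -
  define Ss where "Ss = map (coord_flag r T) [0..<Suc r]"
  have "sorted_wrt (\<subseteq>) Ss"
    unfolding Ss_def sorted_wrt_map by (rule sorted_wrt_mono_rel[OF _ sorted_wrt_upt]) (auto simp: coord_flag_def)
  then obtain k A where A: "A \<in> carrier_mat r k" "mat_inj A" "zspan A = T"
    "\<And>S. S \<in> set Ss \<Longrightarrow> \<exists>i\<le>k. zspan (first_cols i A) = S"
    by (rule adapted_basis[OF T bd]) (use coord_flag_saturated[OF T] in \<open>auto simp: Ss_def\<close>)
  have "\<forall>i. \<exists>l. i \<le> r \<longrightarrow> l \<le> k \<and> zspan (first_cols l A) = coord_flag r T i"
  proof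
    fix i
    have "coord_flag r T i \<in> set Ss" if "i \<le> r" using that unfolding Ss_def by (simp del: upt_Suc)
    then show "\<exists>l. i \<le> r \<longrightarrow> l \<le> k \<and> zspan (first_cols l A) = coord_flag r T i" using A(4) by metis
  qed
  then obtain f where f: "\<And>i. i \<le> r \<Longrightarrow> f i \<le> k \<and> zspan (first_cols (f i) A) = coord_flag r T i" by metis
  have less: "f i < f (Suc i)" if i: "i < r" for i
  proof (rule ccontr)
    assume "\<not> f i < f (Suc i)"
    then have "coord_flag r T (Suc i) \<subseteq> coord_flag r T i"
      using zspan_first_cols_mono[OF A(1), of "f (Suc i)" "f i"] f[of i] f[of "Suc i"] i by simp
    moreover obtain x where "x \<in> T" "x $ i \<noteq> 0" "\<forall>j\<in>{i<..<r}. x $ j = 0" using full[OF i] by blast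
    then have "x \<in> coord_flag r T (Suc i)" "x \<notin> coord_flag r T i" using i by (auto simp: coord_flag_def)
    ultimately show False by blast
  qed
  \<comment> \<open>Counting from below gives \<open>i \<le> f i\<close>; the count from above that
    follows gives \<open>f i \<le> i\<close>.\<close>
  have up: "i \<le> r \<Longrightarrow> i \<le> f i" for i
    by (induction i) (use less in \<open>fastforce dest: Suc_le_lessD\<close>)+
  have down: "i \<le> r \<Longrightarrow> f (r - i) + i \<le> k" for i
  proof (induction i)
    case 0 then show ?case using f[of r] by simp
  next
    case (Suc i)
    then have "f (r - Suc i) < f (r - i)" using less[of "r - Suc i"] by (simp add: Suc_diff_Suc)
    then show ?case using Suc by simp
  qed
  have kr: "k \<le> r" by (rule mat_inj_card_le[OF A(1,2)])
  have fi: "f i = i" if "i \<le> r" for i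
    using up[OF that] down[of "r - i"] that kr by simp
  have k: "k = r" using kr up[of r] f[of r] by simp
  have flag: "zspan (first_cols i A) = coord_flag r T i" if "i \<le> r" for i using f[OF that] fi[OF that] by simp
  have "upper_triangular A"
  proof
    fix i j assume ji: "j < i" and "i < dim_row A"
    then have i: "i < r" using A(1) by simp
    have "col (first_cols (Suc j) A) j \<in> zspan (first_cols (Suc j) A)"
      by (rule col_in_zspan[OF first_cols_carrier[OF A(1)]]) simp
    then have "col (first_cols (Suc j) A) j \<in> coord_flag r T (Suc j)" using flag[of "Suc j"] ji i by simp
    then have "col (first_cols (Suc j) A) j $ i = 0" using ji i by (auto simp: coord_flag_def)
    then show "A $$ (i, j) = 0" using A(1) i ji by (simp add: first_cols_def)
  qed
  then show thesis using that[of A] A flag k by blast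
qed

lemma mult_vec_split:
  assumes A: "A \<in> carrier_mat r k" and B: "B \<in> carrier_mat r m" and c: "c \<in> carrier_vec (k + m)"
  obtains a b where "a \<in> carrier_vec k" "b \<in> carrier_vec m" "c = a @\<^sub>v b"
    "hcat A B *\<^sub>v c = A *\<^sub>v a + B *\<^sub>v (b :: 'a :: comm_ring_1 vec)"
proof -
  have "vec_first c k \<in> carrier_vec k" "vec_last c m \<in> carrier_vec m" "c = vec_first c k @\<^sub>v vec_last c m"
    using vec_first_last_append[OF c] by simp_all
  then show thesis using that hcat_mult_vec[OF A B] by metis
qed

lemma subset_bases:
  fixes S T \<Lambda> :: "rat vec set"
  assumes bd: "bounded_denominators r \<Lambda>" and S: "saturated_in r \<Lambda> S" and T: "saturated_in r \<Lambda> T" and sub: "S \<subseteq> T"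
  obtains k m A B where "A \<in> carrier_mat r k" "B \<in> carrier_mat r m" "mat_inj (hcat A B)"
    "mat_inj A" "zspan A = S" "zspan (hcat A B) = T"
proof -
  have ST: "int_module r S" "int_module r T" "T \<subseteq> \<Lambda>" "S \<subseteq> \<Lambda>" using S T by (auto simp: saturated_in_def)
  obtain k A where A: "A \<in> carrier_mat r k" "mat_inj A" "zspan A = S"
    by (rule adapted_basis[OF ST(1) bounded_denominators_mono[OF bd ST(4)], of "[]"]) auto
  have "saturated_in r T (zspan A)" unfolding A(3) using saturated_in_restrict[OF S sub ST(3)] .
  then show thesis
    using extend_basis[OF ST(2) bounded_denominators_mono[OF bd ST(3)] A(1,2)] A that by blast
qed

text \<open>A relation among the columns of \<open>C\<close>, \<open>A\<close>, \<open>B\<close>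
  exhibits, after clearing denominators, an element of \<open>zspan B\<close> in the rational span
  of \<open>hcat C A\<close>. By saturation it lies in the intersection \<open>zspan C\<close>, and
  independence of \<open>hcat C B\<close> makes it vanish.\<close>

lemma extend_common_basis:
  fixes A B C :: "rat mat"
  assumes S: "saturated_in r \<Lambda> (zspan (hcat C A))" and T: "zspan (hcat C B) \<subseteq> \<Lambda>"
    and C: "C \<in> carrier_mat r k" and A: "A \<in> carrier_mat r m" and B: "B \<in> carrier_mat r n"
    and inj: "mat_inj (hcat C A)" "mat_inj (hcat C B)"
    and int: "zspan (hcat C A) \<inter> zspan (hcat C B) = zspan C"
  shows "mat_inj (hcat (hcat C A) B)"
proof (rule mat_injI)
  note CA = hcat_carrier[OF C A] and CB = hcat_carrier[OF C B]
  show "hcat (hcat C A) B \<in> carrier_mat r (k + m + n)" by (rule hcat_carrier[OF CA B])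
  fix c assume c: "c \<in> carrier_vec (k + m + n)" and 0: "hcat (hcat C A) B *\<^sub>v c = 0\<^sub>v r"
  obtain a b where ab: "a \<in> carrier_vec (k + m)" "b \<in> carrier_vec n" "c = a @\<^sub>v b"
    "hcat (hcat C A) B *\<^sub>v c = hcat C A *\<^sub>v a + B *\<^sub>v b" by (rule mult_vec_split[OF CA B c])
  obtain l and d :: "int vec" where l: "l > 0" "d \<in> carrier_vec n" "of_int l \<cdot>\<^sub>v b = map_vec of_int d"
    using int_multiple_rat_vec[of b] ab(2) by auto
  define y where "y = B *\<^sub>v map_vec of_int d"
  have z0: "C *\<^sub>v 0\<^sub>v k = 0\<^sub>v r" using C by (auto intro!: eq_vecI)
  have yc: "y \<in> carrier_vec r" using B l(2) by (auto simp: y_def)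
  have "y \<in> zspan B" unfolding y_def by (rule zspanI[OF B l(2)])
  moreover have "0\<^sub>v r \<in> zspan C" using int_module_zspan[OF C] by (simp add: int_module_def)
  ultimately have "0\<^sub>v r + y \<in> zspan (hcat C B)" unfolding zspan_hcat[OF C B] by blast
  then have yT: "y \<in> zspan (hcat C B)" using yc by simp
  have ly: "y = of_int l \<cdot>\<^sub>v (B *\<^sub>v b)"
    unfolding y_def l(3)[symmetric] by (rule mult_mat_smult_vec[OF B ab(2)])
  have Bb: "B *\<^sub>v b = - (hcat C A *\<^sub>v a)"
    using 0 ab(4) CA B ab(1,2) by (auto simp: vec_eq_iff add_eq_0_iff)
  have "y = hcat C A *\<^sub>v ((- of_int l) \<cdot>\<^sub>v a)"
    unfolding ly Bb mult_mat_smult_vec[OF CA ab(1)] using CA ab(1) by (intro eq_vecI) auto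
  then have "y \<in> zspan (hcat C A)"
    using saturated_in_zspan_rational[OF CA S, of y "(- of_int l) \<cdot>\<^sub>v a"] yT T ab(1) by auto
  then have "y \<in> zspan C" using yT int by blast
  then obtain e where e: "e \<in> carrier_vec k" "y = C *\<^sub>v map_vec of_int e" using zspanE[OF C] by blast
  have "hcat C B *\<^sub>v (map_vec of_int e @\<^sub>v 0\<^sub>v n) = y"
    using C B e by (subst hcat_mult_vec[OF C B]) (auto intro!: eq_vecI)
  moreover have "hcat C B *\<^sub>v (0\<^sub>v k @\<^sub>v map_vec of_int d) = y"
    using C B l(2) by (subst hcat_mult_vec[OF C B]) (auto simp: y_def z0 intro!: eq_vecI)
  ultimately have "hcat C B *\<^sub>v (map_vec of_int e @\<^sub>v 0\<^sub>v n) = hcat C B *\<^sub>v (0\<^sub>v k @\<^sub>v map_vec of_int d)" by simp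
  from mat_inj_eqD[OF inj(2) CB _ _ this]
  have "map_vec of_int e = 0\<^sub>v k \<and> 0\<^sub>v n = (map_vec of_int d :: rat vec)"
    using append_vec_eq[of "map_vec of_int e" k "0\<^sub>v k :: rat vec" "0\<^sub>v n" "map_vec of_int d"] e(1) l(2)
    by fastforce
  then have "map_vec of_int d = (0\<^sub>v n :: rat vec)" by (rule conjunct2[THEN sym])
  then have lb: "of_int l \<cdot>\<^sub>v b = 0\<^sub>v n" using l(3) by simp
  then have b: "b = 0\<^sub>v n" using l(1) ab(2) by (auto simp: vec_eq_iff)
  have "hcat C A *\<^sub>v a = 0\<^sub>v r"
    using 0 unfolding ab(4) b using CA B ab(1) by (auto simp: vec_eq_iff)
  then have "a = 0\<^sub>v (k + m)" using mat_injD[OF inj(1) CA ab(1)] by blast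
  then show "c = 0\<^sub>v (k + m + n)" unfolding ab(3) b by (intro eq_vecI) auto
qed

section \<open>Saturation of a sublattice and its index\<close>

definition saturation :: "'a :: comm_ring_1 vec set \<Rightarrow> 'a vec set \<Rightarrow> 'a vec set" where
  "saturation T S = {x \<in> T. \<exists>n :: int. n \<noteq> 0 \<and> of_int n \<cdot>\<^sub>v x \<in> S}"

lemma saturated_in_saturation:
  fixes T :: "rat vec set"
  assumes T: "int_module r T" and S: "int_module r S" "S \<subseteq> T"
  shows "saturated_in r T (saturation T S)"
  unfolding saturated_in_def
proof (intro conjI ballI allI impI)
  show "int_module r (saturation T S)"
    unfolding int_module_def
  proof (intro conjI ballI allI)
    show "saturation T S \<subseteq> carrier_vec r" using T by (auto simp: saturation_def int_module_def)
    have "of_int 1 \<cdot>\<^sub>v 0\<^sub>v r \<in> S" using S by (auto simp: int_module_def)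
    then show "0\<^sub>v r \<in> saturation T S"
      using T unfolding saturation_def int_module_def by (auto intro!: exI[of _ 1])
    fix x y and l :: int assume xy: "x \<in> saturation T S" "y \<in> saturation T S"
    then obtain n m :: int where n: "n \<noteq> 0" "of_int n \<cdot>\<^sub>v x \<in> S" and m: "m \<noteq> 0" "of_int m \<cdot>\<^sub>v y \<in> S"
      and xyT: "x \<in> T" "y \<in> T" unfolding saturation_def by blast
    have c: "x \<in> carrier_vec r" "y \<in> carrier_vec r" using int_module_carrier[OF T] xyT by auto
    have "of_int (n * m) \<cdot>\<^sub>v (x + of_int l \<cdot>\<^sub>v y)
        = of_int m \<cdot>\<^sub>v (of_int n \<cdot>\<^sub>v x) + of_int (n * l) \<cdot>\<^sub>v (of_int m \<cdot>\<^sub>v y)"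
      using c by (intro eq_vecI) (auto simp: algebra_simps)
    also have "\<dots> \<in> S" using int_module_add_smult[OF S(1) int_module_smult[OF S(1) n(2)] m(2)] .
    finally have "of_int (n * m) \<cdot>\<^sub>v (x + of_int l \<cdot>\<^sub>v y) \<in> S" .
    moreover have "n * m \<noteq> 0" using n m by simp
    ultimately show "x + of_int l \<cdot>\<^sub>v y \<in> saturation T S"
      using int_module_add_smult[OF T xyT] unfolding saturation_def by blast
  qed
  show "saturation T S \<subseteq> T" by (auto simp: saturation_def)
  fix x and n :: int assume x: "x \<in> T" "n \<noteq> 0" "of_int n \<cdot>\<^sub>v x \<in> saturation T S"
  then obtain m :: int where m: "m \<noteq> 0" "of_int m \<cdot>\<^sub>v (of_int n \<cdot>\<^sub>v x) \<in> S" unfolding saturation_def by blast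
  then have "of_int (m * n) \<cdot>\<^sub>v x \<in> S" by (simp add: smult_smult_assoc)
  then show "x \<in> saturation T S" using x m unfolding saturation_def by (metis (mono_tags, lifting) mem_Collect_eq mult_eq_0_iff)
qed

lemma subset_saturation: "S \<subseteq> T \<Longrightarrow> S \<subseteq> saturation T (S :: 'a :: comm_ring_1 vec set)"
  unfolding saturation_def by (auto intro!: exI[of _ 1])

lemma saturation_least: "saturated_in r T U \<Longrightarrow> S \<subseteq> U \<Longrightarrow> saturation T S \<subseteq> U"
  unfolding saturation_def saturated_in_def by blast

text \<open>\<open>D\<close> and a basis \<open>D'\<close> of the saturation span the same rational
  space, so they have equal length; \<open>D\<close> is \<open>D'\<close> times an integral matrix
  whose determinant is the index up to sign.\<close>

lemma saturation_basis:
  fixes D :: "rat mat"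
  assumes \<Lambda>: "int_module r \<Lambda>" and bd: "bounded_denominators r \<Lambda>"
    and D: "D \<in> carrier_mat r n" "mat_inj D" "zspan D \<subseteq> \<Lambda>"
  obtains D' and E :: "int mat" where "D' \<in> carrier_mat r n" "mat_inj D'" "zspan D' = saturation \<Lambda> (zspan D)"
    "E \<in> carrier_mat n n" "D = D' * map_mat of_int E" "det E \<noteq> 0"
proof -
  define J where "J = saturation \<Lambda> (zspan D)"
  have J: "saturated_in r \<Lambda> J"
    unfolding J_def by (rule saturated_in_saturation[OF \<Lambda> int_module_zspan[OF D(1)] D(3)])
  then have J': "int_module r J" "J \<subseteq> \<Lambda>" by (auto simp: saturated_in_def)
  obtain n' D' where D': "D' \<in> carrier_mat r n'" "mat_inj D'" "zspan D' = J"
    by (rule adapted_basis[OF J'(1) bounded_denominators_mono[OF bd J'(2)], of "[]"]) auto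
  have "zspan D \<subseteq> J" unfolding J_def by (rule subset_saturation[OF D(3)])
  then obtain E :: "int mat" where E: "E \<in> carrier_mat n' n" "D = D' * map_mat of_int E"
    using mat_of_cols_in_zspan[OF D'(1) D(1)] col_in_zspan[OF D(1)] D'(3) by (metis subsetD)
  define P :: "rat mat" where "P = map_mat of_int E"
  have P: "P \<in> carrier_mat n' n" using E by (simp add: P_def)
  have DP: "D = D' * P" using E(2) by (simp add: P_def)
  have "mat_inj P"
  proof (rule mat_injI[OF P])
    fix c assume c: "c \<in> carrier_vec n" "P *\<^sub>v c = 0\<^sub>v n'"
    have "D *\<^sub>v c = D' *\<^sub>v 0\<^sub>v n'"
      unfolding DP c(2)[symmetric] by (rule assoc_mult_mat_vec[OF D'(1) P c(1)])
    then have "D *\<^sub>v c = 0\<^sub>v r" using D'(1) by (auto intro!: eq_vecI)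
    then show "c = 0\<^sub>v n" using mat_injD[OF D(2,1) c(1)] by blast
  qed
  then have 1: "n \<le> n'" using mat_inj_card_le[OF P] by blast
  have "\<forall>j. \<exists>f. j < n' \<longrightarrow> f \<in> carrier_vec n \<and> col D' j = D *\<^sub>v f"
  proof
    fix j
    show "\<exists>f. j < n' \<longrightarrow> f \<in> carrier_vec n \<and> col D' j = D *\<^sub>v f"
    proof (cases "j < n'")
      case True
      then have "col D' j \<in> J" using col_in_zspan[OF D'(1)] D'(3) by blast
      then obtain m :: int where m: "m \<noteq> 0" "of_int m \<cdot>\<^sub>v col D' j \<in> zspan D"
        unfolding J_def saturation_def by blast
      obtain c where c: "c \<in> carrier_vec n" "of_int m \<cdot>\<^sub>v col D' j = D *\<^sub>v map_vec of_int c"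
        using zspanE[OF D(1) m(2)] .
      have "col D' j = (1 / of_int m) \<cdot>\<^sub>v (of_int m \<cdot>\<^sub>v col D' j)"
        using m(1) by (simp add: smult_smult_assoc)
      also have "\<dots> = D *\<^sub>v ((1 / of_int m) \<cdot>\<^sub>v map_vec of_int c)"
        unfolding c(2) using c(1) by (simp add: mult_mat_smult_vec[OF D(1)])
      finally show ?thesis using c(1) by (intro exI[of _ "(1 / of_int m) \<cdot>\<^sub>v map_vec of_int c"]) auto
    qed auto
  qed
  then obtain f where f: "\<And>j. j < n' \<Longrightarrow> f j \<in> carrier_vec n \<and> col D' j = D *\<^sub>v f j" by metis
  \<comment> \<open>\<open>F\<close> holds the rational coefficients of \<open>D'\<close> in terms
    of \<open>D\<close>; its injectivity gives \<open>n' \<le> n\<close>, as that of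
    \<open>P\<close> gave \<open>n \<le> n'\<close>.\<close>
  define F where "F = mat n n' (\<lambda>(i, j). f j $ i)"
  have F: "F \<in> carrier_mat n n'" by (simp add: F_def)
  have DF: "D' = D * F"
  proof (rule eq_matI)
    fix i j assume "i < dim_row (D * F)" "j < dim_col (D * F)"
    then have ij: "i < r" "j < n'" using D F by auto
    have "col F j = f j" using ij f[of j] by (intro eq_vecI) (auto simp: F_def)
    then have "(D * F) $$ (i, j) = (D *\<^sub>v f j) $ i" using ij D(1) F by simp
    also have "\<dots> = D' $$ (i, j)" using f[of j] ij D'(1) by (metis index_col carrier_matD)
    finally show "D' $$ (i, j) = (D * F) $$ (i, j)" ..
  qed (use D D' F in auto)
  have "mat_inj F"
  proof (rule mat_injI[OF F])
    fix c assume c: "c \<in> carrier_vec n'" "F *\<^sub>v c = 0\<^sub>v n"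
    have "D' *\<^sub>v c = D *\<^sub>v 0\<^sub>v n"
      unfolding DF c(2)[symmetric] by (rule assoc_mult_mat_vec[OF D(1) F c(1)])
    then have "D' *\<^sub>v c = 0\<^sub>v r" using D(1) by (auto intro!: eq_vecI)
    then show "c = 0\<^sub>v n'" using mat_injD[OF D'(2,1) c(1)] by blast
  qed
  then have "n' \<le> n" using mat_inj_card_le[OF F] by blast
  with 1 have n: "n' = n" by simp
  have "gram D = (det P)^2 * gram D'" unfolding DP using P D'(1) n by (intro gram_mult) auto
  moreover have "gram D \<noteq> 0" using D(2) mat_inj_iff_gram[OF D(1)] by simp
  ultimately have "det P \<noteq> 0" by auto
  then have "det E \<noteq> 0" unfolding P_def by (simp add: of_int_hom.hom_det)
  then show thesis using that[of D' E] D' E n J_def by simp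
qed

section \<open>Finiteness\<close>

definition select_rows :: "nat \<Rightarrow> (nat \<Rightarrow> nat) \<Rightarrow> 'a mat \<Rightarrow> 'a mat" where
  "select_rows k f A = mat k (dim_col A) (\<lambda>(i, j). A $$ (f i, j))"

text \<open>Induction on columns: clearing the last column on the chosen rows by Cramer's rule
  leaves a non-zero residual, and a row where it does not vanish completes the minor.\<close>

lemma exists_nonzero_minor:
  fixes A :: "'a :: linordered_field mat"
  assumes "A \<in> carrier_mat r k" "mat_inj A"
  shows "\<exists>f. (\<forall>i<k. f i < r) \<and> det (select_rows k f A) \<noteq> 0"
  using assms
proof (induction k arbitrary: A)
  case 0
  have "select_rows 0 f A \<in> carrier_mat 0 0" for f using 0 by (auto simp: select_rows_def)
  then show ?case by (simp add: det_dim_zero)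
next
  case (Suc k)
  define B where "B = first_cols k A"
  define v where "v = mat_of_cols r [col A k]"
  have B: "B \<in> carrier_mat r k" and v: "v \<in> carrier_mat r 1"
    using Suc.prems(1) by (auto simp: B_def v_def)
  have A: "A = hcat B v" unfolding B_def v_def by (rule hcat_first_last[OF Suc.prems(1)])
  have "mat_inj B" using mat_inj_hcatD[OF B v] Suc.prems(2) A by simp
  then obtain f where f: "\<forall>i<k. f i < r" "det (select_rows k f B) \<noteq> 0" using Suc.IH[OF B] by blast
  define G where "G = select_rows k f B"
  define w where "w = select_rows k f v"
  have G: "G \<in> carrier_mat k k" and w: "w \<in> carrier_mat k 1" using B v by (auto simp: G_def w_def select_rows_def)
  have dG: "det G \<noteq> 0" using f by (simp add: G_def)
  define x where "x = (1 / det G) \<cdot>\<^sub>m (adj_mat G * w)"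
  have aG: "adj_mat G \<in> carrier_mat k k" by (rule adj_mat(1)[OF G])
  have x: "x \<in> carrier_mat k 1" using aG w by (auto simp: x_def)
  have Gx: "G * x = w"
  proof -
    have "G * x = (1 / det G) \<cdot>\<^sub>m (G * (adj_mat G * w))"
      unfolding x_def using aG w by (subst mult_smult_distrib[OF G]) auto
    also have "G * (adj_mat G * w) = (G * adj_mat G) * w" using assoc_mult_mat[OF G aG w] by simp
    also have "\<dots> = det G \<cdot>\<^sub>m w"
      unfolding adj_mat(2)[OF G] using w by (subst mult_smult_assoc_mat[of _ k k _ 1]) auto
    finally show ?thesis using dG w by (auto intro!: eq_matI)
  qed
  define u where "u = v - B * x"
  have u: "u \<in> carrier_mat r 1" using v B x by (auto simp: u_def)
  have "\<exists>i<r. u $$ (i, 0) \<noteq> 0"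
  proof (rule ccontr)
    assume "\<not> ?thesis"
    then have "u = 0\<^sub>m r 1" using u by (intro eq_matI) auto
    define e :: "'a vec" where "e = vec 1 (\<lambda>_. 1)"
    have e: "e \<in> carrier_vec 1" by (simp add: e_def)
    have "B *\<^sub>v (- (x *\<^sub>v e)) + v *\<^sub>v e = u *\<^sub>v e"
      unfolding u_def using v B x e
      by (subst minus_mult_distrib_mat_vec[of v r 1]) (auto intro!: eq_vecI)
    also have "\<dots> = 0\<^sub>v r" unfolding \<open>u = 0\<^sub>m r 1\<close> using e by (auto intro!: eq_vecI simp: scalar_prod_def)
    finally have "A *\<^sub>v (- (x *\<^sub>v e) @\<^sub>v e) = 0\<^sub>v r"
      unfolding A using x e by (subst hcat_mult_vec[OF B v]) auto
    moreover have mem: "- (x *\<^sub>v e) @\<^sub>v e \<in> carrier_vec (Suc k)"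
      using append_carrier_vec[of "- (x *\<^sub>v e)" k e 1] x e by simp
    ultimately have "- (x *\<^sub>v e) @\<^sub>v e = 0\<^sub>v (Suc k)" using mat_injD[OF Suc.prems(2,1)] by blast
    then have "(- (x *\<^sub>v e) @\<^sub>v e) $ k = 0" by simp
    then show False using x by (simp add: e_def)
  qed
  then obtain i where i: "i < r" "u $$ (i, 0) \<noteq> 0" by blast
  define g where "g = f(k := i)"
  have dec: "select_rows (Suc k) g A = four_block_mat G w (mat 1 k (\<lambda>(_, j). B $$ (i, j))) (mat 1 1 (\<lambda>_. v $$ (i, 0)))"
  proof (rule eq_matI)
    fix a b
    assume "a < dim_row (four_block_mat G w (mat 1 k (\<lambda>(_, j). B $$ (i, j))) (mat 1 1 (\<lambda>_. v $$ (i, 0))))"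
      "b < dim_col (four_block_mat G w (mat 1 k (\<lambda>(_, j). B $$ (i, j))) (mat 1 1 (\<lambda>_. v $$ (i, 0))))"
    then have ab: "a < Suc k" "b < Suc k" using G w by auto
    have ga: "g a < r" using f(1) i(1) ab(1) by (cases "a = k") (auto simp: g_def)
    have "select_rows (Suc k) g A $$ (a, b) = hcat B v $$ (g a, b)"
      using ab Suc.prems(1) unfolding A[symmetric] by (simp add: select_rows_def)
    also have "\<dots> = (if b < k then B $$ (g a, b) else v $$ (g a, 0))"
      using ga ab(2) B v by (auto simp: hcat_def less_Suc_eq)
    finally show "select_rows (Suc k) g A $$ (a, b) =
        four_block_mat G w (mat 1 k (\<lambda>(_, j). B $$ (i, j))) (mat 1 1 (\<lambda>_. v $$ (i, 0))) $$ (a, b)"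
      using ab G w B v by (auto simp: G_def w_def select_rows_def g_def less_Suc_eq)
  qed (use G w Suc.prems(1) in \<open>auto simp: select_rows_def\<close>)
  \<comment> \<open>The unipotent \<open>M\<close> subtracts the combination \<open>x\<close> of the
    other columns from the last one and makes the selected matrix block triangular with corner
    \<open>u $$ (i, 0)\<close>.\<close>
  define M where "M = four_block_mat (1\<^sub>m k) (- x) (0\<^sub>m 1 k) (1\<^sub>m 1 :: 'a mat)"
  have "select_rows (Suc k) g A * M =
      four_block_mat (G * 1\<^sub>m k + w * 0\<^sub>m 1 k) (G * (- x) + w * 1\<^sub>m 1)
       (mat 1 k (\<lambda>(_, j). B $$ (i, j)) * 1\<^sub>m k + mat 1 1 (\<lambda>_. v $$ (i, 0)) * 0\<^sub>m 1 k)
       (mat 1 k (\<lambda>(_, j). B $$ (i, j)) * (- x) + mat 1 1 (\<lambda>_. v $$ (i, 0)) * 1\<^sub>m 1)"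
    unfolding dec M_def by (rule mult_four_block_mat[of _ k k _ 1 _ 1]) (use G w x in auto)
  also have "G * 1\<^sub>m k + w * 0\<^sub>m 1 k = G" using G w by (simp add: right_mult_zero_mat[OF w])
  also have "G * (- x) + w * 1\<^sub>m 1 = 0\<^sub>m k 1"
    using G w x Gx by (auto intro!: eq_matI simp: uminus_mult_right_mat)
  also have "mat 1 k (\<lambda>(_, j). B $$ (i, j)) * (- x) + mat 1 1 (\<lambda>_. v $$ (i, 0)) * 1\<^sub>m 1 = mat 1 1 (\<lambda>_. u $$ (i, 0))"
  proof -
    have r: "row B i = vec k (\<lambda>j. B $$ (i, j))" using B i by (intro eq_vecI) auto
    show ?thesis
      using B v x i by (intro eq_matI) (auto simp: u_def r scalar_prod_def sum_negf)
  qed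
  finally have "det (select_rows (Suc k) g A * M) = det (four_block_mat G (0\<^sub>m k 1)
      (mat 1 k (\<lambda>(_, j). B $$ (i, j)) * 1\<^sub>m k + mat 1 1 (\<lambda>_. v $$ (i, 0)) * 0\<^sub>m 1 k) (mat 1 1 (\<lambda>_. u $$ (i, 0))))"
    by simp
  also have "\<dots> = det G * det (mat 1 1 (\<lambda>_. u $$ (i, 0)))"
    by (rule det_four_block_mat_upper_right_zero[OF G refl]) auto
  also have "det (mat 1 1 (\<lambda>_. u $$ (i, 0))) = u $$ (i, 0)" by (subst det_single) auto
  finally have "det (select_rows (Suc k) g A * M) = det G * u $$ (i, 0)" .
  moreover have "det M = 1"
    unfolding M_def using x by (subst det_four_block_mat_lower_left_zero[of _ k _ 1]) auto
  moreover have "select_rows (Suc k) g A \<in> carrier_mat (Suc k) (Suc k)"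
    using Suc.prems(1) by (auto simp: select_rows_def)
  moreover have "M \<in> carrier_mat (Suc k) (Suc k)"
    using four_block_carrier_mat[of "1\<^sub>m k" k k "1\<^sub>m 1" 1 1] by (simp add: M_def)
  ultimately have "det (select_rows (Suc k) g A) \<noteq> 0"
    using dG i(2) det_mult by (metis mult_cancel_left2 mult.comm_neutral mult_eq_0_iff)
  moreover have "\<forall>j<Suc k. g j < r" using f i by (auto simp: g_def less_Suc_eq)
  ultimately show ?case by blast
qed

text \<open>Laplace expansion along the replaced row. The entries of \<open>A * adj_mat G\<close>
  are thus maximal minors of \<open>A\<close>: Pluecker coordinates determine the column span once
  \<open>G\<close> is invertible.\<close>

lemma mult_adj_select_rows:
  fixes A :: "'a :: comm_ring_1 mat"
  assumes A: "A \<in> carrier_mat r k" and i: "i < r" and j: "j < k"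
  shows "(A * adj_mat (select_rows k f A)) $$ (i, j) = det (select_rows k (f(j := i)) A)"
proof -
  let ?G = "select_rows k f A" and ?H = "select_rows k (f(j := i)) A"
  have G: "?G \<in> carrier_mat k k" and H: "?H \<in> carrier_mat k k" using A by (auto simp: select_rows_def)
  have cof: "cofactor ?H j l = cofactor ?G j l" if "l < k" for l
  proof -
    have "mat_delete ?H j l = mat_delete ?G j l"
      unfolding mat_delete_def using A j by (intro eq_matI) (auto simp: select_rows_def)
    then show ?thesis by (simp add: cofactor_def)
  qed
  have "(A * adj_mat ?G) $$ (i, j) = (\<Sum>l<k. A $$ (i, l) * cofactor ?G j l)"
    using A i j adj_mat(1)[OF G] by (simp add: scalar_prod_def adj_mat_def select_rows_def lessThan_atLeast0)
  also have "\<dots> = (\<Sum>l<k. ?H $$ (j, l) * cofactor ?H j l)"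
    using A j cof by (intro sum.cong) (auto simp: select_rows_def)
  also have "\<dots> = det ?H" using laplace_expansion_row[OF H j] by simp
  finally show ?thesis .
qed

section \<open>Euclidean realizations of rational lattices\<close>

lemma det_real_of_rat: "A \<in> carrier_mat n n \<Longrightarrow> det (map_mat of_rat A) = (of_rat (det A) :: real)"
  by simp

lemma map_of_rat_mult:
  "A \<in> carrier_mat n m \<Longrightarrow> B \<in> carrier_mat m k \<Longrightarrow>
   map_mat of_rat (A * B) = map_mat of_rat A * (map_mat of_rat B :: real mat)"
  by (rule of_rat_hom.mat_hom_mult)

lemma map_of_rat_mult_vec:
  "A \<in> carrier_mat n m \<Longrightarrow> v \<in> carrier_vec m \<Longrightarrow>
   map_vec of_rat (A *\<^sub>v v) = map_mat of_rat A *\<^sub>v (map_vec of_rat v :: real vec)"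
  by (rule of_rat_hom.mult_mat_vec_hom)

lemma gram_real_of_rat:
  assumes A: "A \<in> carrier_mat n k"
  shows "gram (map_mat of_rat A) = (of_rat (gram A) :: real)"
proof -
  have "transpose_mat (map_mat of_rat A) * (map_mat of_rat A :: real mat) = map_mat of_rat (transpose_mat A * A)"
    using A by (subst map_of_rat_mult[of _ k n _ k]) (auto intro!: arg_cong2[where f = "(*)"])
  then show ?thesis unfolding gram_def using A by (simp add: det_real_of_rat[of _ k])
qed

lemma real_span_zspan:
  assumes P: "P \<in> carrier_mat r k"
  shows "real_span r (zspan P) = {P *\<^sub>v c |c. c \<in> carrier_vec k}"
proof (intro equalityI subsetI)
  fix x assume "x \<in> real_span r (zspan P)"
  then obtain bs c where bs: "set bs \<subseteq> zspan P" "c \<in> carrier_vec (length bs)" "x = mat_of_cols r bs *\<^sub>v c"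
    unfolding real_span_def by blast
  have bc: "set bs \<subseteq> carrier_vec r" using bs(1) zspan_carrier[OF P] by blast
  have "col (mat_of_cols r bs) j \<in> zspan P" if "j < length bs" for j
  proof -
    have "bs ! j \<in> set bs" using that by simp
    then show ?thesis using bs(1) bc that by (subst col_mat_of_cols) auto
  qed
  then obtain M :: "int mat" where M: "M \<in> carrier_mat k (length bs)" "mat_of_cols r bs = P * map_mat of_int M"
    using mat_of_cols_in_zspan[OF P mat_of_cols_carrier(1)] by metis
  have M': "map_mat real_of_int M \<in> carrier_mat k (length bs)" using M by simp
  have "x = P *\<^sub>v (map_mat of_int M *\<^sub>v c)"
    unfolding bs(3) M(2) by (rule assoc_mult_mat_vec[OF P M' bs(2)])
  then show "x \<in> {P *\<^sub>v c |c. c \<in> carrier_vec k}" using mult_mat_vec_carrier[OF M' bs(2)] by blast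
next
  fix x assume "x \<in> {P *\<^sub>v c |c. c \<in> carrier_vec k}"
  then obtain c where c: "c \<in> carrier_vec k" "x = P *\<^sub>v c" by blast
  have "set (cols P) \<subseteq> zspan P" using col_in_zspan[OF P] P by (auto simp: cols_def)
  moreover have "mat_of_cols r (cols P) = P" using P mat_of_cols_cols[of P] by simp
  moreover have "length (cols P) = k" using P by simp
  ultimately have "set (cols P) \<subseteq> zspan P \<and> x = mat_of_cols r (cols P) *\<^sub>v c \<and> c \<in> carrier_vec (length (cols P))"
    using c by simp
  then show "x \<in> real_span r (zspan P)" unfolding real_span_def by blast
qed

text \<open>The residual of \<open>Q\<close> modulo \<open>P\<close> consists of the orthogonal
  projections of its columns, so it generates the projected lattice.\<close>

lemma quotient_zspan:
  fixes P Q :: "real mat"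
  assumes P: "P \<in> carrier_mat r k" and Q: "Q \<in> carrier_mat r m" and C: "C \<in> carrier_mat k m"
    and orth: "transpose_mat P * (Q - P * C) = 0\<^sub>m k m"
  shows "quotient_lattice r (zspan (hcat P Q)) (zspan P) = zspan (Q - P * C)"
proof (intro equalityI subsetI)
  define U where "U = Q - P * C"
  have U: "U \<in> carrier_mat r m" using P Q C by (auto simp: U_def)
  have PQ: "hcat P Q \<in> carrier_mat r (k + m)" by (rule hcat_carrier[OF P Q])
  have Q_eq: "Q *\<^sub>v b = P *\<^sub>v (C *\<^sub>v b) + U *\<^sub>v b" if b: "b \<in> carrier_vec m" for b
    unfolding U_def using P Q C b by (subst minus_mult_distrib_mat_vec[of _ r m]) (auto intro!: eq_vecI)
  have orthU: "(P *\<^sub>v a) \<bullet> (U *\<^sub>v b) = 0" if "a \<in> carrier_vec k" "b \<in> carrier_vec m" for a b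
    unfolding transpose_mult_vec_scalar_prod[OF P U that] using orth that by (simp add: U_def[symmetric] scalar_prod_def)
  {
    fix z assume "z \<in> quotient_lattice r (zspan (hcat P Q)) (zspan P)"
    then obtain x where z: "z \<in> carrier_vec r" "\<forall>m\<in>zspan P. z \<bullet> m = 0" and x: "x \<in> zspan (hcat P Q)"
      "x - z \<in> real_span r (zspan P)" unfolding quotient_lattice_def by blast
    obtain y w where yw: "y \<in> zspan P" "w \<in> zspan Q" "x = y + w" using x(1) unfolding zspan_hcat[OF P Q] by blast
    obtain a :: "int vec" where a: "a \<in> carrier_vec k" "y = P *\<^sub>v map_vec of_int a" using zspanE[OF P yw(1)] .
    obtain b :: "int vec" where b: "b \<in> carrier_vec m" "w = Q *\<^sub>v map_vec of_int b" using zspanE[OF Q yw(2)] .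
    obtain c where c: "c \<in> carrier_vec k" "x - z = P *\<^sub>v c" using x(2) unfolding real_span_zspan[OF P] by blast
    \<comment> \<open>\<open>d\<close> collects the coefficients of the component of
      \<open>z\<close> in the span of \<open>P\<close>; orthogonality of \<open>z\<close> to
      \<open>P\<close> forces \<open>P *\<^sub>v d = 0\<^sub>v r\<close>.\<close>
    define d where "d = map_vec of_int a + C *\<^sub>v map_vec of_int b - c"
    have d: "d \<in> carrier_vec k" using a b c C by (auto simp: d_def)
    have xc: "x \<in> carrier_vec r" using x(1) zspan_carrier[OF PQ] by blast
    have "P *\<^sub>v d = P *\<^sub>v map_vec of_int a + P *\<^sub>v (C *\<^sub>v map_vec of_int b) - P *\<^sub>v c"
      unfolding d_def using P C a b c
      by (subst mult_minus_distrib_mat_vec[OF P]) (auto simp: mult_add_distrib_mat_vec[OF P])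
    moreover have "z = x - P *\<^sub>v c" unfolding c(2)[symmetric] using z(1) xc by (auto intro!: eq_vecI)
    ultimately have z_eq: "z = P *\<^sub>v d + U *\<^sub>v map_vec of_int b"
      unfolding yw(3) a(2) b(2) using Q_eq[of "map_vec of_int b"] a b c P U C by (auto intro!: eq_vecI)
    have zP: "z \<bullet> (P *\<^sub>v e) = 0" if e: "e \<in> carrier_vec k" for e
    proof -
      have "transpose_mat P *\<^sub>v z = 0\<^sub>v k"
      proof (rule eq_vecI)
        fix i assume "i < dim_vec (0\<^sub>v k :: real vec)"
        then have i: "i < k" by simp
        have "z \<bullet> col P i = 0" using z(2) col_in_zspan[OF P i] by blast
        then have "col P i \<bullet> z = 0" using z(1) P i by (subst comm_scalar_prod[of _ r]) auto
        then show "(transpose_mat P *\<^sub>v z) $ i = 0\<^sub>v k $ i" using P i by simp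
      qed (use P in simp)
      then show ?thesis using transpose_vec_mult_scalar[OF P e z(1)] e by simp
    qed
    have "z \<bullet> (P *\<^sub>v d) = (P *\<^sub>v d) \<bullet> (P *\<^sub>v d) + (U *\<^sub>v map_vec of_int b) \<bullet> (P *\<^sub>v d)"
      unfolding z_eq using P U d b by (subst add_scalar_prod_distrib[of _ r]) auto
    also have "(U *\<^sub>v map_vec of_int b) \<bullet> (P *\<^sub>v d) = (P *\<^sub>v d) \<bullet> (U *\<^sub>v map_vec of_int b)"
      using P U d b by (subst comm_scalar_prod[of _ r]) auto
    also have "\<dots> = 0" using orthU[OF d] b by simp
    finally have "(P *\<^sub>v d) \<bullet> (P *\<^sub>v d) = 0" using zP[OF d] by simp
    then have "P *\<^sub>v d = 0\<^sub>v r" using scalar_prod_self_eq_0[OF mult_mat_vec_carrier[OF P d]] by blast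
    then have "z = U *\<^sub>v map_vec of_int b" using z_eq U b(1) by (auto intro!: eq_vecI)
    then show "z \<in> zspan (Q - P * C)" using zspanI[OF U b(1)] unfolding U_def by simp
  next
    fix z assume "z \<in> zspan (Q - P * C)"
    then obtain b :: "int vec" where b: "b \<in> carrier_vec m" "z = U *\<^sub>v map_vec of_int b"
      using zspanE[OF U] unfolding U_def by blast
    have zc: "z \<in> carrier_vec r" using U b by auto
    have 1: "z \<bullet> y = 0" if yP: "y \<in> zspan P" for y
    proof -
      obtain a :: "int vec" where a: "a \<in> carrier_vec k" "y = P *\<^sub>v map_vec of_int a" using zspanE[OF P yP] .
      have "y \<bullet> z = 0" unfolding a(2) b(2) using a b by (intro orthU) auto
      then show ?thesis using zc P a by (subst comm_scalar_prod[of _ r]) auto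
    qed
    define x where "x = Q *\<^sub>v map_vec of_int b"
    have "0\<^sub>v r \<in> zspan P" using int_module_zspan[OF P] by (simp add: int_module_def)
    moreover have "x \<in> zspan Q" unfolding x_def by (rule zspanI[OF Q b(1)])
    moreover have "x = 0\<^sub>v r + x" using Q b by (auto simp: x_def intro!: eq_vecI)
    ultimately have "x \<in> zspan (hcat P Q)" unfolding zspan_hcat[OF P Q] by blast
    moreover have "x - z = P *\<^sub>v (C *\<^sub>v map_vec of_int b)"
      unfolding x_def b(2) using Q_eq[of "map_vec of_int b"] b(1) P U C by (auto intro!: eq_vecI)
    moreover have "C *\<^sub>v map_vec of_int b \<in> carrier_vec k" using C b by auto
    ultimately show "z \<in> quotient_lattice r (zspan (hcat P Q)) (zspan P)"
      unfolding quotient_lattice_def real_span_zspan[OF P] using zc 1 by blast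
  }
qed

lemma saturated_in_Int:
  assumes S: "saturated_in r \<Lambda> S" and T: "saturated_in r \<Lambda> T"
  shows "saturated_in r \<Lambda> (S \<inter> T)"
  unfolding saturated_in_def
proof (intro conjI ballI allI impI)
  have ST: "int_module r S" "int_module r T" using S T by (auto simp: saturated_in_def)
  then show "int_module r (S \<inter> T)"
    using int_module_add_smult[OF ST(1)] int_module_add_smult[OF ST(2)] by (auto simp: int_module_def)
  show "S \<inter> T \<subseteq> \<Lambda>" using S by (auto simp: saturated_in_def)
  fix x and n :: int assume "x \<in> \<Lambda>" "n \<noteq> 0" "of_int n \<cdot>\<^sub>v x \<in> S \<inter> T"
  then show "x \<in> S \<inter> T" using S T unfolding saturated_in_def by auto
qed

lemma quotient_lattice_mono: "V \<subseteq> T \<Longrightarrow> quotient_lattice r V S \<subseteq> quotient_lattice r T S"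
  unfolding quotient_lattice_def by blast

text \<open>\<open>zspan \<beta>\<close> is a lattice of determinant one in \<open>\<rat>^r\<close>
  and \<open>h\<close> places it in Euclidean space. Saturation is handled before applying
  \<open>h\<close>, volumes afterwards.\<close>

locale euclidean_realization =
  fixes r :: nat and \<beta> :: "rat mat" and h :: "real mat"
  assumes h: "h \<in> carrier_mat r r" "det h = 1"
    and \<beta>: "\<beta> \<in> carrier_mat r r" "det \<beta> = 1"
    and bounded: "bounded_denominators r (zspan \<beta>)"
begin

abbreviation "\<Lambda> \<equiv> zspan \<beta>"

definition emb :: "rat mat \<Rightarrow> real mat" where "emb A = h * map_mat of_rat A"

definition ev :: "rat vec \<Rightarrow> real vec" where "ev x = h *\<^sub>v map_vec of_rat x"

definition rk :: "real vec set \<Rightarrow> nat" where "rk M = lattice_rank r M"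

definition dg :: "real vec set \<Rightarrow> real" where "dg M = lattice_deg r M"

abbreviation "sat S \<equiv> saturated_in r \<Lambda> S"

lemma int_module_\<Lambda>: "int_module r \<Lambda>" by (rule int_module_zspan[OF \<beta>(1)])

lemma emb_carrier [simp]: "A \<in> carrier_mat r k \<Longrightarrow> emb A \<in> carrier_mat r k"
  using h by (auto simp: emb_def)

lemma emb_hcat: "A \<in> carrier_mat r k \<Longrightarrow> B \<in> carrier_mat r m \<Longrightarrow> emb (hcat A B) = hcat (emb A) (emb B)"
  unfolding emb_def using h by (simp add: map_hcat mult_hcat[of _ r r _ k _ m])

lemma emb_mult_int:
  assumes "A \<in> carrier_mat r k" "M \<in> carrier_mat k m"
  shows "emb (A * map_mat of_int M) = emb A * map_mat of_int M"
proof -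
  have "map_mat of_rat (map_mat of_int M) = (map_mat of_int M :: real mat)" by (intro eq_matI) auto
  then show ?thesis unfolding emb_def
    using assms h by (simp add: map_of_rat_mult[of _ r k _ m] assoc_mult_mat[of _ r r _ k _ m])
qed

lemma ev_mult:
  assumes "A \<in> carrier_mat r k" "c \<in> carrier_vec k"
  shows "ev (A *\<^sub>v c) = emb A *\<^sub>v map_vec of_rat c"
  unfolding ev_def emb_def using assms h
  by (simp add: map_of_rat_mult_vec[of _ r k] assoc_mult_mat_vec[of _ r r _ k])

lemma ev_zspan: "A \<in> carrier_mat r k \<Longrightarrow> ev ` zspan A = zspan (emb A)"
proof -
  assume A: "A \<in> carrier_mat r k"
  have "map_vec of_rat (map_vec of_int c) = (map_vec of_int c :: real vec)" for c by (intro eq_vecI) auto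
  then have *: "ev (A *\<^sub>v map_vec of_int c) = emb A *\<^sub>v map_vec of_int c" if "c \<in> carrier_vec k" for c
    using ev_mult[OF A, of "map_vec of_int c"] that by simp
  show ?thesis
  proof (intro equalityI subsetI)
    fix y assume "y \<in> ev ` zspan A"
    then obtain x where x: "x \<in> zspan A" "y = ev x" by blast
    then show "y \<in> zspan (emb A)" using zspanE[OF A x(1)] * zspanI[OF emb_carrier[OF A]] by metis
  next
    fix y assume "y \<in> zspan (emb A)"
    then obtain c where "c \<in> carrier_vec k" "y = emb A *\<^sub>v map_vec of_int c" using zspanE[OF emb_carrier[OF A]] by blast
    then show "y \<in> ev ` zspan A" using * zspanI[OF A] by (metis image_eqI)
  qed
qed

lemma h_inj: "mat_inj h"
proof (rule mat_injI[OF h(1)])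
  fix c assume c: "c \<in> carrier_vec r" "h *\<^sub>v c = 0\<^sub>v r"
  then show "c = 0\<^sub>v r" using det_0_iff_vec_prod_zero_field[OF h(1)] h(2) by auto
qed

lemma emb_inj_iff: "A \<in> carrier_mat r k \<Longrightarrow> mat_inj (emb A) \<longleftrightarrow> mat_inj A"
proof -
  assume A: "A \<in> carrier_mat r k"
  have RA: "(map_mat of_rat A :: real mat) \<in> carrier_mat r k" using A by simp
  have "mat_inj A \<longleftrightarrow> mat_inj (map_mat of_rat A :: real mat)"
    using mat_inj_iff_gram[OF A] mat_inj_iff_gram[OF RA] gram_real_of_rat[OF A] by simp
  also have "\<dots> \<longleftrightarrow> mat_inj (emb A)"
  proof
    assume inj: "mat_inj (map_mat of_rat A :: real mat)"
    show "mat_inj (emb A)"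
    proof (rule mat_injI[OF emb_carrier[OF A]])
      fix c assume c: "c \<in> carrier_vec k" and 0: "emb A *\<^sub>v c = 0\<^sub>v r"
      have "h *\<^sub>v (map_mat of_rat A *\<^sub>v c) = 0\<^sub>v r"
        using 0 unfolding emb_def assoc_mult_mat_vec[OF h(1) RA c] .
      then have "map_mat of_rat A *\<^sub>v c = 0\<^sub>v r"
        using mat_injD[OF h_inj h(1) mult_mat_vec_carrier[OF RA c]] by blast
      then show "c = 0\<^sub>v k" using mat_injD[OF inj RA c] by blast
    qed
  next
    assume inj: "mat_inj (emb A)"
    show "mat_inj (map_mat of_rat A :: real mat)"
    proof (rule mat_injI[OF RA])
      fix c assume c: "c \<in> carrier_vec k" and 0: "map_mat of_rat A *\<^sub>v c = (0\<^sub>v r :: real vec)"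
      have "emb A *\<^sub>v c = h *\<^sub>v (map_mat of_rat A *\<^sub>v c)"
        unfolding emb_def by (rule assoc_mult_mat_vec[OF h(1) RA c])
      also have "\<dots> = 0\<^sub>v r" unfolding 0 using h(1) by (auto intro!: eq_vecI)
      finally show "c = 0\<^sub>v k" using mat_injD[OF inj emb_carrier[OF A] c] by blast
    qed
  qed
  finally show ?thesis by simp
qed

lemma ev_inj: "inj_on ev (carrier_vec r)"
proof (rule inj_onI)
  fix x y assume xy: "x \<in> carrier_vec r" "y \<in> carrier_vec r" "ev x = ev y"
  have "map_vec of_rat x = (map_vec of_rat y :: real vec)"
    by (rule mat_inj_eqD[OF h_inj h(1) _ _ xy(3)[unfolded ev_def]]) (use xy in auto)
  then show "x = y" using xy by (auto simp: vec_eq_iff)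
qed

lemma ev_add_smult:
  assumes "x \<in> carrier_vec r" "y \<in> carrier_vec r"
  shows "ev (x + of_int n \<cdot>\<^sub>v y) = ev x + of_int n \<cdot>\<^sub>v ev y"
proof -
  have "map_vec of_rat (x + of_int n \<cdot>\<^sub>v y) = map_vec of_rat x + of_int n \<cdot>\<^sub>v (map_vec of_rat y :: real vec)"
    using assms by (intro eq_vecI) (auto simp: of_rat_add of_rat_mult)
  then show ?thesis unfolding ev_def
    using assms by (simp add: mult_add_distrib_mat_vec[OF h(1)] mult_mat_smult_vec[OF h(1)])
qed

lemma ev_smult: "x \<in> carrier_vec r \<Longrightarrow> ev (of_int n \<cdot>\<^sub>v x) = of_int n \<cdot>\<^sub>v ev x"
proof -
  assume x: "x \<in> carrier_vec r"
  have "map_vec of_rat (of_int n \<cdot>\<^sub>v x) = of_int n \<cdot>\<^sub>v (map_vec of_rat x :: real vec)"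
    using x by (intro eq_vecI) (auto simp: of_rat_mult)
  then show ?thesis unfolding ev_def using x by (simp add: mult_mat_smult_vec[OF h(1)])
qed

lemma rk_dg:
  assumes "A \<in> carrier_mat r k" "mat_inj A"
  shows "is_lattice r (ev ` zspan A)" "rk (ev ` zspan A) = k" "dg (ev ` zspan A) = - ln (gram (emb A)) / 2"
  using lattice_zspan[OF emb_carrier[OF assms(1)]] emb_inj_iff[OF assms(1)] assms(2)
  by (simp_all add: ev_zspan[OF assms(1)] rk_def dg_def)

lemma saturated_carrier: "sat S \<Longrightarrow> S \<subseteq> carrier_vec r"
  unfolding saturated_in_def int_module_def by blast

lemma saturated_basis:
  assumes "sat S"
  obtains k A where "A \<in> carrier_mat r k" "mat_inj A" "zspan A = S"
  by (rule subset_bases[OF bounded assms assms subset_refl]) (rule that)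

text \<open>Pulls saturation in real space back to rational subgroups, where saturated subgroups are
  known to have bases. Such a basis also supplies the \<open>is_lattice\<close> part of the
  converse.\<close>

lemma saturated_sublattice_iff:
  "saturated_sublattice r M (ev ` \<Lambda>) \<longleftrightarrow> (\<exists>S. sat S \<and> M = ev ` S)"
proof
  assume "saturated_sublattice r M (ev ` \<Lambda>)"
  then have M: "is_lattice r M" "M \<subseteq> ev ` \<Lambda>"
    and satM: "\<And>x n. x \<in> ev ` \<Lambda> \<Longrightarrow> n \<noteq> (0 :: int) \<Longrightarrow> of_int n \<cdot>\<^sub>v x \<in> M \<Longrightarrow> x \<in> M"
    unfolding saturated_sublattice_def sublattice_def by auto
  have modM: "int_module r M" using M(1) int_module_zspan unfolding is_lattice_iff by blast
  define S where "S = {x \<in> \<Lambda>. ev x \<in> M}"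
  have \<Lambda>c: "x \<in> carrier_vec r" if "x \<in> \<Lambda>" for x using that zspan_carrier[OF \<beta>(1)] by blast
  have "M = ev ` S" using M(2) unfolding S_def by blast
  moreover have "sat S"
    unfolding saturated_in_def
  proof (intro conjI ballI allI impI)
    show "int_module r S"
      unfolding int_module_def
    proof (intro conjI ballI allI)
      show "S \<subseteq> carrier_vec r" using \<Lambda>c by (auto simp: S_def)
      have "ev (0\<^sub>v r) = 0\<^sub>v r" unfolding ev_def using h(1) by (auto intro!: eq_vecI simp: scalar_prod_def)
      then show "0\<^sub>v r \<in> S" using modM int_module_\<Lambda> by (auto simp: S_def int_module_def)
      fix x y and n :: int assume "x \<in> S" "y \<in> S"
      then show "x + of_int n \<cdot>\<^sub>v y \<in> S"
        using int_module_add_smult[OF int_module_\<Lambda>] int_module_add_smult[OF modM] \<Lambda>c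
        by (auto simp: S_def ev_add_smult)
    qed
    show "S \<subseteq> \<Lambda>" by (auto simp: S_def)
    fix x and n :: int assume x: "x \<in> \<Lambda>" "n \<noteq> 0" "of_int n \<cdot>\<^sub>v x \<in> S"
    then have "of_int n \<cdot>\<^sub>v ev x \<in> M" using \<Lambda>c[OF x(1)] by (simp add: S_def ev_smult)
    then show "x \<in> S" using satM[OF _ x(2)] x(1) by (auto simp: S_def)
  qed
  ultimately show "\<exists>S. sat S \<and> M = ev ` S" by blast
next
  assume "\<exists>S. sat S \<and> M = ev ` S"
  then obtain S where S: "sat S" "M = ev ` S" by blast
  obtain k A where A: "A \<in> carrier_mat r k" "mat_inj A" "zspan A = S" using saturated_basis[OF S(1)] .
  have "is_lattice r M" unfolding S(2) A(3)[symmetric] by (rule rk_dg[OF A(1,2)])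
  moreover have "M \<subseteq> ev ` \<Lambda>" using S unfolding saturated_in_def by blast
  moreover have "y \<in> M" if y: "y \<in> ev ` \<Lambda>" "n \<noteq> 0" "of_int n \<cdot>\<^sub>v y \<in> M" for y and n :: int
  proof -
    obtain x where x: "x \<in> \<Lambda>" "y = ev x" using y(1) by blast
    have xc: "x \<in> carrier_vec r" using x(1) zspan_carrier[OF \<beta>(1)] by blast
    then have "ev (of_int n \<cdot>\<^sub>v x) \<in> ev ` S" using y(3) x(2) S(2) by (simp add: ev_smult)
    then have "of_int n \<cdot>\<^sub>v x \<in> S"
      using inj_on_image_mem_iff[OF ev_inj _ saturated_carrier[OF S(1)]] xc by simp
    then have "x \<in> S" using S(1) x(1) y(2) unfolding saturated_in_def by blast
    then show ?thesis using x(2) S(2) by blast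
  qed
  ultimately show "saturated_sublattice r M (ev ` \<Lambda>)" unfolding saturated_sublattice_def sublattice_def by blast
qed

text \<open>Passing to the saturation divides the Gram determinant by the squared index, an integer
  at least 1, so the degree does not drop.\<close>

lemma dg_saturation:
  assumes D: "D \<in> carrier_mat r n" "mat_inj D" "zspan D \<subseteq> \<Lambda>"
  shows "sat (saturation \<Lambda> (zspan D))" "rk (ev ` saturation \<Lambda> (zspan D)) = n"
    "- ln (gram (emb D)) / 2 \<le> dg (ev ` saturation \<Lambda> (zspan D))"
proof -
  show "sat (saturation \<Lambda> (zspan D))"
    by (rule saturated_in_saturation[OF int_module_\<Lambda> int_module_zspan[OF D(1)] D(3)])
  obtain D' and E :: "int mat" where D': "D' \<in> carrier_mat r n" "mat_inj D'" "zspan D' = saturation \<Lambda> (zspan D)"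
    "E \<in> carrier_mat n n" "D = D' * map_mat of_int E" "det E \<noteq> 0"
    using saturation_basis[OF int_module_\<Lambda> bounded D] .
  show "rk (ev ` saturation \<Lambda> (zspan D)) = n" using rk_dg(2)[OF D'(1,2)] D'(3) by simp
  have pos: "gram (emb D') > 0" using gram_pos[OF emb_carrier[OF D'(1)]] emb_inj_iff[OF D'(1)] D'(2) by simp
  have "gram (emb D) = (det (map_mat of_int E))^2 * gram (emb D')"
    unfolding D'(5) emb_mult_int[OF D'(1,4)] by (rule gram_mult[OF emb_carrier[OF D'(1)]]) (use D'(4) in simp)
  also have "(det (map_mat of_int E))^2 = real_of_int ((det E)^2)" by (simp add: of_int_hom.hom_det)
  finally have g: "gram (emb D) = real_of_int ((det E)^2) * gram (emb D')" .
  have "(det E)^2 \<noteq> 0" using D'(6) by simp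
  then have "1 \<le> (det E)^2" using zero_le_power2[of "det E"] by linarith
  then have "1 \<le> real_of_int ((det E)^2)" by linarith
  then have "gram (emb D') \<le> gram (emb D)" unfolding g using pos by simp
  then show "- ln (gram (emb D)) / 2 \<le> dg (ev ` saturation \<Lambda> (zspan D))"
    unfolding D'(3)[symmetric] rk_dg(3)[OF D'(1,2)] using pos by simp
qed

text \<open>\<open>J\<close> is the saturation of \<open>S + T\<close>. A basis \<open>C\<close> of
  the intersection, extended by \<open>A\<close> to \<open>S\<close> and by \<open>B\<close> to
  \<open>T\<close>, gives independent generators of the sum; \<open>gram_submodular\<close> compares
  the four volumes, and saturating does not lower the degree.\<close>

lemma join_exists:
  assumes S: "sat S" and T: "sat T"
  obtains J where "sat J" "S \<subseteq> J" "T \<subseteq> J" "\<forall>U. sat U \<longrightarrow> S \<subseteq> U \<longrightarrow> T \<subseteq> U \<longrightarrow> J \<subseteq> U"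
    "rk (ev ` (S \<inter> T)) + rk (ev ` J) = rk (ev ` S) + rk (ev ` T)"
    "dg (ev ` S) + dg (ev ` T) \<le> dg (ev ` (S \<inter> T)) + dg (ev ` J)" "sat (S \<inter> T)"
proof -
  have ST: "sat (S \<inter> T)" by (rule saturated_in_Int[OF S T])
  obtain k m C A where C: "C \<in> carrier_mat r k" "A \<in> carrier_mat r m" "mat_inj (hcat C A)" "mat_inj C"
    "zspan C = S \<inter> T" "zspan (hcat C A) = S"
    by (rule subset_bases[OF bounded ST S Int_lower1])
  have sST: "saturated_in r T (zspan C)"
    unfolding C(5) by (rule saturated_in_restrict[OF ST]) (use T in \<open>auto simp: saturated_in_def\<close>)
  have T\<Lambda>: "int_module r T" "T \<subseteq> \<Lambda>" using T by (auto simp: saturated_in_def)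
  obtain n B where B: "B \<in> carrier_mat r n" "mat_inj (hcat C B)" "zspan (hcat C B) = T"
    using extend_basis[OF T\<Lambda>(1) bounded_denominators_mono[OF bounded T\<Lambda>(2)] C(1,4) sST] by blast
  define D where "D = hcat (hcat C A) B"
  note CA = hcat_carrier[OF C(1,2)] and CB = hcat_carrier[OF C(1) B(1)]
  have D: "D \<in> carrier_mat r (k + m + n)" unfolding D_def by (rule hcat_carrier[OF CA B(1)])
  have inj: "mat_inj D"
    unfolding D_def
    by (rule extend_common_basis[of r \<Lambda>, OF _ _ C(1,2) B(1) C(3) B(2)]) (use S T\<Lambda> C B in auto)
  have zD: "zspan D = {x + y |x y. x \<in> S \<and> y \<in> zspan B}" unfolding D_def zspan_hcat[OF CA B(1)] C(6) ..
  have S\<Lambda>: "int_module r S" "S \<subseteq> \<Lambda>" using S by (auto simp: saturated_in_def)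
  have "zspan B \<subseteq> zspan (hcat C B)"
  proof
    fix y assume y: "y \<in> zspan B"
    have "0\<^sub>v r \<in> zspan C" using int_module_zspan[OF C(1)] by (simp add: int_module_def)
    moreover have "y = 0\<^sub>v r + y" using y zspan_carrier[OF B(1)] by auto
    ultimately show "y \<in> zspan (hcat C B)" unfolding zspan_hcat[OF C(1) B(1)] using y by blast
  qed
  then have BT: "zspan B \<subseteq> T" using B(3) by simp
  have D_sub: "zspan D \<subseteq> U" if "int_module r U" "S \<subseteq> U" "T \<subseteq> U" for U
    unfolding zD using int_module_add[OF that(1)] that BT by blast
  have S_D: "S \<subseteq> zspan D"
  proof
    fix x assume x: "x \<in> S"
    have "0\<^sub>v r \<in> zspan B" using int_module_zspan[OF B(1)] by (simp add: int_module_def)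
    moreover have "x = x + 0\<^sub>v r" using x int_module_carrier[OF S\<Lambda>(1)] by auto
    ultimately show "x \<in> zspan D" unfolding zD using x by blast
  qed
  have T_D: "T \<subseteq> zspan D"
  proof
    fix x assume "x \<in> T"
    then obtain y z where "y \<in> zspan C" "z \<in> zspan B" "x = y + z"
      unfolding B(3)[symmetric] zspan_hcat[OF C(1) B(1)] by blast
    then show "x \<in> zspan D" unfolding zD C(5) by blast
  qed
  have D\<Lambda>: "zspan D \<subseteq> \<Lambda>" by (rule D_sub[OF int_module_\<Lambda> S\<Lambda>(2) T\<Lambda>(2)])
  define J where "J = saturation \<Lambda> (zspan D)"
  have J: "sat J" "rk (ev ` J) = k + m + n" "- ln (gram (emb D)) / 2 \<le> dg (ev ` J)"
    unfolding J_def using dg_saturation[OF D inj D\<Lambda>] by auto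
  have DJ: "zspan D \<subseteq> J" unfolding J_def by (rule subset_saturation[OF D\<Lambda>])
  show thesis
  proof (rule that[OF J(1)])
    show "S \<subseteq> J" "T \<subseteq> J" using S_D T_D DJ by auto
    have "J \<subseteq> U" if U: "sat U" "S \<subseteq> U" "T \<subseteq> U" for U
    proof -
      have "zspan D \<subseteq> U" using D_sub[of U] U by (simp add: saturated_in_def)
      then show ?thesis unfolding J_def using saturation_least[OF U(1)] by blast
    qed
    then show "\<forall>U. sat U \<longrightarrow> S \<subseteq> U \<longrightarrow> T \<subseteq> U \<longrightarrow> J \<subseteq> U" by blast
  next
    have 1: "rk (ev ` (S \<inter> T)) = k" "dg (ev ` (S \<inter> T)) = - ln (gram (emb C)) / 2"
      using rk_dg[OF C(1,4)] C(5) by simp_all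
    have 2: "rk (ev ` S) = k + m" "dg (ev ` S) = - ln (gram (emb (hcat C A))) / 2"
      using rk_dg[OF CA C(3)] C(6) by simp_all
    have 3: "rk (ev ` T) = k + n" "dg (ev ` T) = - ln (gram (emb (hcat C B))) / 2"
      using rk_dg[OF CB B(2)] B(3) by simp_all
    show "rk (ev ` (S \<inter> T)) + rk (ev ` J) = rk (ev ` S) + rk (ev ` T)" using 1 2 3 J by simp
    have pos: "gram (emb C) > 0" "gram (emb (hcat C A)) > 0" "gram (emb (hcat C B)) > 0" "gram (emb D) > 0"
      using gram_pos emb_carrier[OF C(1)] emb_carrier[OF CA] emb_carrier[OF CB] emb_carrier[OF D]
        emb_inj_iff[OF C(1)] emb_inj_iff[OF CA] emb_inj_iff[OF CB] emb_inj_iff[OF D] C(3,4) B(2) inj by blast+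
    have "mat_inj (emb C)" using emb_inj_iff[OF C(1)] C(4) by simp
    from gram_submodular[OF emb_carrier[OF C(1)] emb_carrier[OF C(2)] emb_carrier[OF B(1)] this]
    have "gram (emb C) * gram (emb D) \<le> gram (emb (hcat C A)) * gram (emb (hcat C B))"
      unfolding D_def emb_hcat[OF CA B(1)] emb_hcat[OF C(1,2)] emb_hcat[OF C(1) B(1)] .
    then have "ln (gram (emb C) * gram (emb D)) \<le> ln (gram (emb (hcat C A)) * gram (emb (hcat C B)))"
      using pos by simp
    then have "ln (gram (emb C)) + ln (gram (emb D)) \<le> ln (gram (emb (hcat C A))) + ln (gram (emb (hcat C B)))"
      using pos by (simp add: ln_mult)
    then show "dg (ev ` S) + dg (ev ` T) \<le> dg (ev ` (S \<inter> T)) + dg (ev ` J)"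
      using J(3) unfolding 1 2 3 by linarith
    show "sat (S \<inter> T)" by (rule ST)
  qed
qed

text \<open>Covolume is multiplicative along the orthogonal projection that realizes the quotient,
  hence rank and degree are additive.\<close>

lemma quotient_facts:
  assumes S: "sat S" and T: "sat T" and sub: "S \<subseteq> T"
  shows "is_lattice r (quotient_lattice r (ev ` T) (ev ` S))"
    "rk (quotient_lattice r (ev ` T) (ev ` S)) + rk (ev ` S) = rk (ev ` T)"
    "dg (quotient_lattice r (ev ` T) (ev ` S)) = dg (ev ` T) - dg (ev ` S)"
proof -
  obtain k m A B where A: "A \<in> carrier_mat r k" "B \<in> carrier_mat r m" "mat_inj (hcat A B)"
    "mat_inj A" "zspan A = S" "zspan (hcat A B) = T"
    by (rule subset_bases[OF bounded S T sub])
  note AB = hcat_carrier[OF A(1,2)]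
  have inj: "mat_inj (emb A)" "mat_inj (emb (hcat A B))"
    using emb_inj_iff[OF A(1)] emb_inj_iff[OF AB] A(3,4) by auto
  obtain C where C: "C \<in> carrier_mat k m" "transpose_mat (emb A) * (emb B - emb A * C) = 0\<^sub>m k m"
    using orthogonal_residual[OF emb_carrier[OF A(1)] emb_carrier[OF A(2)] inj(1)] by blast
  define U where "U = emb B - emb A * C"
  have U: "U \<in> carrier_mat r m" using emb_carrier[OF A(1)] emb_carrier[OF A(2)] C(1) by (auto simp: U_def)
  have q: "quotient_lattice r (ev ` T) (ev ` S) = zspan U"
    unfolding A(5)[symmetric] A(6)[symmetric] ev_zspan[OF A(1)] ev_zspan[OF AB] emb_hcat[OF A(1,2)] U_def
    by (rule quotient_zspan[OF emb_carrier[OF A(1)] emb_carrier[OF A(2)] C])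
  have g: "gram (emb (hcat A B)) = gram (emb A) * gram U"
    unfolding emb_hcat[OF A(1,2)] U_def
    by (rule gram_hcat_residual[OF emb_carrier[OF A(1)] emb_carrier[OF A(2)] C])
  have "gram U \<noteq> 0" using g inj(2) mat_inj_iff_gram[OF emb_carrier[OF AB]] by auto
  then have Ui: "mat_inj U" using mat_inj_iff_gram[OF U] by simp
  show "is_lattice r (quotient_lattice r (ev ` T) (ev ` S))" unfolding q by (rule lattice_zspan[OF U Ui])
  show "rk (quotient_lattice r (ev ` T) (ev ` S)) + rk (ev ` S) = rk (ev ` T)"
    using lattice_zspan(2)[OF U Ui] rk_dg(2)[OF A(1,4)] rk_dg(2)[OF AB A(3)] unfolding q A(5,6) by (simp add: rk_def)
  have "gram (emb A) > 0" "gram U > 0" using gram_pos[OF emb_carrier[OF A(1)] inj(1)] gram_pos[OF U Ui] by auto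
  then show "dg (quotient_lattice r (ev ` T) (ev ` S)) = dg (ev ` T) - dg (ev ` S)"
    using lattice_zspan(4)[OF U Ui] rk_dg(3)[OF A(1,4)] rk_dg(3)[OF AB A(3)] unfolding q A(5,6) g
    by (simp add: dg_def ln_mult field_simps)
qed

text \<open>A basis of \<open>M\<close> is lifted by the integral matrix \<open>E\<close> and joined
  to a basis of \<open>S\<close>; the result is then saturated, which is where equality of degrees
  becomes an inequality. Semistability can thereby be tested on saturated sublattices between
  \<open>S\<close> and \<open>T\<close>.\<close>

lemma sublattice_of_quotient:
  assumes S: "sat S" and T: "sat T" and sub: "S \<subseteq> T"
    and M: "sublattice r M (quotient_lattice r (ev ` T) (ev ` S))"
  obtains V where "sat V" "S \<subseteq> V" "V \<subseteq> T" "rk (ev ` V) = rk (ev ` S) + rk M" "dg M \<le> dg (ev ` V) - dg (ev ` S)"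
proof -
  obtain k m A B where A: "A \<in> carrier_mat r k" "B \<in> carrier_mat r m" "mat_inj (hcat A B)"
    "mat_inj A" "zspan A = S" "zspan (hcat A B) = T"
    by (rule subset_bases[OF bounded S T sub])
  note AB = hcat_carrier[OF A(1,2)]
  note eA = emb_carrier[OF A(1)] and eB = emb_carrier[OF A(2)]
  have inj: "mat_inj (emb A)" using emb_inj_iff[OF A(1)] A(4) by auto
  obtain C where C: "C \<in> carrier_mat k m" "transpose_mat (emb A) * (emb B - emb A * C) = 0\<^sub>m k m"
    using orthogonal_residual[OF eA eB inj(1)] by blast
  define U where "U = emb B - emb A * C"
  have U: "U \<in> carrier_mat r m" using eA eB C(1) by (auto simp: U_def)
  have q: "quotient_lattice r (ev ` T) (ev ` S) = zspan U"
    unfolding A(5)[symmetric] A(6)[symmetric] ev_zspan[OF A(1)] ev_zspan[OF AB] emb_hcat[OF A(1,2)] U_def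
    by (rule quotient_zspan[OF eA eB C])
  obtain l W where W: "W \<in> carrier_mat r l" "mat_inj W" "M = zspan W" "zspan W \<subseteq> zspan U"
    using M unfolding sublattice_def is_lattice_iff q by blast
  obtain E :: "int mat" where E: "E \<in> carrier_mat m l" "W = U * map_mat of_int E"
    using mat_of_cols_in_zspan[OF U W(1)] col_in_zspan[OF W(1)] W(4) by (metis subsetD)
  define ER :: "real mat" where "ER = map_mat of_int E"
  have ER: "ER \<in> carrier_mat m l" using E by (simp add: ER_def)
  define BE where "BE = B * map_mat of_int E"
  have BE: "BE \<in> carrier_mat r l" using A(2) E(1) by (simp add: BE_def)
  have eBE: "emb BE = emb B * ER" unfolding BE_def ER_def by (rule emb_mult_int[OF A(2) E(1)])
  have CE: "C * ER \<in> carrier_mat k l" using C(1) ER by simp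
  have res: "emb BE - emb A * (C * ER) = W"
  proof -
    have "W = emb B * ER - emb A * C * ER"
      unfolding E(2) U_def ER_def[symmetric] using eA eB C(1) ER by (subst minus_mult_distrib_mat[of _ r m _ _ l]) auto
    then show ?thesis unfolding eBE using assoc_mult_mat[OF eA C(1) ER] by simp
  qed
  have orth: "transpose_mat (emb A) * (emb BE - emb A * (C * ER)) = 0\<^sub>m k l"
  proof -
    have "transpose_mat (emb A) * (U * ER) = (transpose_mat (emb A) * U) * ER"
      using assoc_mult_mat[of "transpose_mat (emb A)" k r U m ER l] eA U ER by simp
    also have "\<dots> = 0\<^sub>m k l" using C(2) ER unfolding U_def[symmetric] by simp
    finally show ?thesis unfolding res by (simp add: E(2) ER_def)
  qed
  define D where "D = hcat A BE"
  have D: "D \<in> carrier_mat r (k + l)" unfolding D_def by (rule hcat_carrier[OF A(1) BE])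
  have g: "gram (emb D) = gram (emb A) * gram W"
    unfolding D_def emb_hcat[OF A(1) BE] gram_hcat_residual[OF eA emb_carrier[OF BE] CE orth] res ..
  have pos: "gram (emb A) > 0" "gram W > 0" using gram_pos[OF eA inj] gram_pos[OF W(1,2)] by auto
  then have "gram (emb D) \<noteq> 0" unfolding g by simp
  then have Di: "mat_inj D" using mat_inj_iff_gram[OF emb_carrier[OF D]] emb_inj_iff[OF D] by simp
  have DT: "zspan D \<subseteq> T"
  proof -
    have "zspan BE \<subseteq> T"
    proof
      fix x assume "x \<in> zspan BE"
      then obtain c where c: "c \<in> carrier_vec l" "x = BE *\<^sub>v map_vec of_int c" using zspanE[OF BE] by blast
      have "x = B *\<^sub>v (map_mat of_int E *\<^sub>v map_vec of_int c)"
        unfolding c(2) BE_def using assoc_mult_mat_vec[of B r m "map_mat of_int E" l] A(2) E(1) c(1) by simp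
      also have "map_mat of_int E *\<^sub>v map_vec of_int c = (map_vec of_int (E *\<^sub>v c) :: rat vec)"
        by (rule of_int_hom.mult_mat_vec_hom[OF E(1) c(1), symmetric])
      finally have "x \<in> zspan B" using zspanI[OF A(2), of "E *\<^sub>v c"] E(1) c(1) by auto
      moreover have "0\<^sub>v r \<in> zspan A" using int_module_zspan[OF A(1)] by (simp add: int_module_def)
      moreover have "x = 0\<^sub>v r + x" using calculation(1) zspan_carrier[OF A(2)] by auto
      ultimately show "x \<in> T" unfolding A(6)[symmetric] zspan_hcat[OF A(1,2)] by blast
    qed
    moreover have "int_module r T" using T by (simp add: saturated_in_def)
    ultimately show ?thesis
      unfolding D_def zspan_hcat[OF A(1) BE] A(5) using int_module_add[of r T] sub by blast
  qed
  have D\<Lambda>: "zspan D \<subseteq> \<Lambda>" using DT T unfolding saturated_in_def by blast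
  define V where "V = saturation \<Lambda> (zspan D)"
  have V: "sat V" "rk (ev ` V) = k + l" "- ln (gram (emb D)) / 2 \<le> dg (ev ` V)"
    unfolding V_def using dg_saturation[OF D Di D\<Lambda>] by auto
  have "V \<subseteq> T" unfolding V_def by (rule saturation_least[OF T DT])
  moreover have "S \<subseteq> V"
  proof -
    have "S \<subseteq> zspan D"
    proof
      fix x assume x: "x \<in> S"
      have "0\<^sub>v r \<in> zspan BE" using int_module_zspan[OF BE] by (simp add: int_module_def)
      moreover have "x = x + 0\<^sub>v r" using x saturated_carrier[OF S] by auto
      ultimately show "x \<in> zspan D" unfolding D_def zspan_hcat[OF A(1) BE] A(5) using x by blast
    qed
    then show ?thesis using subset_saturation[OF D\<Lambda>] unfolding V_def by blast
  qed
  moreover have "rk (ev ` V) = rk (ev ` S) + rk M"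
    using V(2) rk_dg(2)[OF A(1,4)] lattice_zspan(2)[OF W(1,2)] unfolding A(5) W(3) by (simp add: rk_def)
  moreover have "dg M \<le> dg (ev ` V) - dg (ev ` S)"
    using V(3) rk_dg(3)[OF A(1,4)] lattice_zspan(4)[OF W(1,2)] pos unfolding A(5) W(3) g
    by (simp add: dg_def ln_mult field_simps)
  ultimately show thesis using that V(1) by blast
qed

end

section \<open>Finiteness of saturated sublattices with degree bounded below\<close>

lemma finite_mats:
  assumes "finite V"
  shows "finite {P \<in> carrier_mat n k. \<forall>i<n. \<forall>j<k. P $$ (i, j) \<in> V}" (is "finite ?M")
proof (rule finite_subset)
  show "?M \<subseteq> mat n k ` (PiE ({..<n} \<times> {..<k}) (\<lambda>_. V))"
  proof
    fix P assume P: "P \<in> ?M"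
    have "P = mat n k (restrict (\<lambda>ij. P $$ ij) ({..<n} \<times> {..<k}))" using P by (intro eq_matI) auto
    moreover have "restrict (\<lambda>ij. P $$ ij) ({..<n} \<times> {..<k}) \<in> PiE ({..<n} \<times> {..<k}) (\<lambda>_. V)" using P by auto
    ultimately show "P \<in> mat n k ` (PiE ({..<n} \<times> {..<k}) (\<lambda>_. V))" by blast
  qed
  show "finite (mat n k ` (PiE ({..<n} \<times> {..<k}) (\<lambda>_. V)))"
    using assms by (intro finite_imageI finite_PiE) auto
qed

lemma smult_mat_mult_vec:
  fixes A :: "'a :: comm_ring_1 mat"
  assumes "A \<in> carrier_mat n m" "v \<in> carrier_vec m"
  shows "(c \<cdot>\<^sub>m A) *\<^sub>v v = c \<cdot>\<^sub>v (A *\<^sub>v v)"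
  using assms by (intro eq_vecI) (auto simp: scalar_prod_def sum_distrib_left mult_ac)

lemma mat_bounded:
  fixes A :: "real mat"
  assumes A: "A \<in> carrier_mat n m"
  obtains q where "q \<ge> 0" "\<And>v. v \<in> carrier_vec m \<Longrightarrow> (A *\<^sub>v v) \<bullet> (A *\<^sub>v v) \<le> q * (v \<bullet> v)"
proof
  \<comment> \<open>A crude operator bound: the sum of the squared absolute row sums.\<close>
  define q where "q = (\<Sum>i<n. (\<Sum>j\<in>{0..<m}. \<bar>A $$ (i, j)\<bar>)\<^sup>2)"
  show "q \<ge> 0" unfolding q_def by (intro sum_nonneg) auto
  fix v :: "real vec" assume v: "v \<in> carrier_vec m"
  have vj: "\<bar>v $ j\<bar> \<le> sqrt (v \<bullet> v)" if "j \<in> {0..<m}" for j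
  proof -
    have "(v $ j)\<^sup>2 \<le> (\<Sum>j\<in>{0..<m}. (v $ j)\<^sup>2)" using that by (intro member_le_sum) auto
    then show ?thesis using v by (intro real_le_rsqrt) (simp add: scalar_prod_def power2_eq_square)
  qed
  have "(row A i \<bullet> v)\<^sup>2 \<le> (\<Sum>j\<in>{0..<m}. \<bar>A $$ (i, j)\<bar>)\<^sup>2 * (v \<bullet> v)" if "i < n" for i
  proof -
    have "\<bar>row A i \<bullet> v\<bar> = \<bar>\<Sum>j\<in>{0..<m}. A $$ (i, j) * v $ j\<bar>" using A v that by (simp add: scalar_prod_def)
    also have "\<dots> \<le> (\<Sum>j\<in>{0..<m}. \<bar>A $$ (i, j)\<bar> * \<bar>v $ j\<bar>)"
      using sum_abs[of "\<lambda>j. A $$ (i, j) * v $ j" "{0..<m}"] by (simp add: abs_mult)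
    also have "\<dots> \<le> (\<Sum>j\<in>{0..<m}. \<bar>A $$ (i, j)\<bar> * sqrt (v \<bullet> v))"
      using vj by (intro sum_mono mult_left_mono) auto
    finally have "\<bar>row A i \<bullet> v\<bar> \<le> (\<Sum>j\<in>{0..<m}. \<bar>A $$ (i, j)\<bar>) * sqrt (v \<bullet> v)"
      by (simp add: sum_distrib_right)
    then have "\<bar>row A i \<bullet> v\<bar>\<^sup>2 \<le> ((\<Sum>j\<in>{0..<m}. \<bar>A $$ (i, j)\<bar>) * sqrt (v \<bullet> v))\<^sup>2"
      by (intro power_mono) auto
    then show ?thesis using scalar_prod_self_nonneg[of v] by (simp add: power_mult_distrib)
  qed
  then have "(\<Sum>i<n. (row A i \<bullet> v)\<^sup>2) \<le> (\<Sum>i<n. (\<Sum>j\<in>{0..<m}. \<bar>A $$ (i, j)\<bar>)\<^sup>2 * (v \<bullet> v))"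
    by (intro sum_mono) auto
  moreover have "(A *\<^sub>v v) \<bullet> (A *\<^sub>v v) = (\<Sum>i<n. (row A i \<bullet> v)\<^sup>2)"
    using A by (simp add: scalar_prod_def[of "A *\<^sub>v v"] power2_eq_square lessThan_atLeast0)
  ultimately show "(A *\<^sub>v v) \<bullet> (A *\<^sub>v v) \<le> q * (v \<bullet> v)" unfolding q_def by (simp add: sum_distrib_right)
qed

context euclidean_realization
begin

text \<open>Selecting \<open>k\<close> coordinates multiplies squared length by at most
  \<open>k\<close>, undoing \<open>h\<close> by at most \<open>q\<close>;
  \<open>gram_contraction\<close> turns this into a bound for the minor.\<close>

lemma minor_bound:
  assumes q: "q \<ge> 0" "\<And>v. v \<in> carrier_vec r \<Longrightarrow> v \<bullet> v \<le> q * ((h *\<^sub>v v) \<bullet> (h *\<^sub>v v))"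
    and A: "A \<in> carrier_mat r k" and f: "\<And>i. i < k \<Longrightarrow> f i < r"
  shows "(of_rat (det (select_rows k f A)))\<^sup>2 \<le> (real k * q) ^ k * gram (emb A)"
proof -
  define U where "U = (map_mat of_rat (select_rows k f A) :: real mat)"
  define AR where "AR = (map_mat of_rat A :: real mat)"
  have AR: "AR \<in> carrier_mat r k" using A by (simp add: AR_def)
  have U: "U \<in> carrier_mat k k" using A by (auto simp: U_def select_rows_def)
  have "gram U = (det U)\<^sup>2"
    unfolding gram_def using U by (subst det_mult[of _ k]) (auto simp: det_transpose power2_eq_square)
  also have "det U = of_rat (det (select_rows k f A))"
    unfolding U_def by (rule det_real_of_rat) (use A in \<open>auto simp: select_rows_def\<close>)
  finally have "(of_rat (det (select_rows k f A)))\<^sup>2 = gram U" ..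
  also have "\<dots> \<le> (real k * q) ^ k * gram (emb A)"
  proof (rule gram_contraction[OF emb_carrier[OF A] U])
    fix c :: "real vec" assume c: "c \<in> carrier_vec k"
    define y where "y = AR *\<^sub>v c"
    have y: "y \<in> carrier_vec r" using AR c by (simp add: y_def)
    have Uc: "(U *\<^sub>v c) $ i = y $ f i" if "i < k" for i
    proof -
      have "row U i = row AR (f i)" using that A f by (intro eq_vecI) (auto simp: U_def AR_def select_rows_def)
      then show ?thesis using that U AR f by (simp add: y_def)
    qed
    have le: "(y $ f i)\<^sup>2 \<le> y \<bullet> y" if "i < k" for i
    proof -
      have "(y $ f i)\<^sup>2 \<le> (\<Sum>j\<in>{0..<r}. (y $ j)\<^sup>2)" using f[OF that] by (intro member_le_sum) auto
      then show ?thesis using y by (simp add: scalar_prod_def power2_eq_square)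
    qed
    have "(U *\<^sub>v c) \<bullet> (U *\<^sub>v c) = (\<Sum>i\<in>{0..<k}. (y $ f i)\<^sup>2)"
      unfolding scalar_prod_def using U Uc by (intro sum.cong) (auto simp: power2_eq_square simp del: index_mult_mat_vec)
    also have "\<dots> \<le> (\<Sum>i\<in>{0..<k}. y \<bullet> y)" using le by (intro sum_mono) auto
    also have "\<dots> = real k * (y \<bullet> y)" by simp
    also have "\<dots> \<le> real k * (q * ((h *\<^sub>v y) \<bullet> (h *\<^sub>v y)))" using q(2)[OF y] by (intro mult_left_mono) auto
    also have "h *\<^sub>v y = emb A *\<^sub>v c"
      unfolding y_def emb_def AR_def[symmetric] by (rule assoc_mult_mat_vec[OF h(1) AR c, symmetric])
    finally show "(U *\<^sub>v c) \<bullet> (U *\<^sub>v c) \<le> real k * q * ((emb A *\<^sub>v c) \<bullet> (emb A *\<^sub>v c))" by (simp add: mult_ac)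
  qed (use q in auto)
  finally show ?thesis .
qed

text \<open>For given rank the Pluecker coordinates are rationals with bounded denominators, and a
  lower bound for the degree bounds their size. So finitely many matrices of minors occur, and a
  sublattice is recovered as the intersection of \<open>\<Lambda>\<close> with the column span of
  its matrix.\<close>

lemma finite_saturated: "finite {M. saturated_sublattice r M (ev ` \<Lambda>) \<and> dg M > c}"
proof -
  define g where "g = adj_mat h"
  have g: "g \<in> carrier_mat r r" "g * h = 1\<^sub>m r"
    using adj_mat[OF h(1)] h(2) by (auto simp: g_def)
  obtain q where q: "q \<ge> 0" "\<And>v. v \<in> carrier_vec r \<Longrightarrow> (g *\<^sub>v v) \<bullet> (g *\<^sub>v v) \<le> q * (v \<bullet> v)"
    using mat_bounded[OF g(1)] by blast
  have q': "v \<bullet> v \<le> q * ((h *\<^sub>v v) \<bullet> (h *\<^sub>v v))" if v: "v \<in> carrier_vec r" for v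
  proof -
    have "g *\<^sub>v (h *\<^sub>v v) = v" using assoc_mult_mat_vec[OF g(1) h(1) v] g(2) v by simp
    then show ?thesis using q(2)[of "h *\<^sub>v v"] h(1) v by simp
  qed
  obtain N :: int where N: "N > 0" "\<forall>x\<in>\<Lambda>. \<forall>i<r. of_int N * x $ i \<in> \<int>"
    using bounded unfolding bounded_denominators_def by blast
  have "finite {S. sat S \<and> rk (ev ` S) = k \<and> dg (ev ` S) > c}" for k
  proof -
    \<comment> \<open>A degree above \<open>c\<close> means a Gram determinant below
      \<open>exp (- 2 * c)\<close>; \<open>R\<close> is the resulting bound for the
      \<open>k\<close>-minors.\<close>
    define R where "R = sqrt ((real k * q) ^ k * exp (- 2 * c))"
    define V :: "rat set" where "V = {x. \<exists>z::int. x = of_int z / of_int (N ^ k) \<and> \<bar>real_of_rat x\<bar> \<le> R}"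
    have "V \<subseteq> (\<lambda>z::int. of_int z / of_int (N ^ k)) ` {- \<lceil>R * N ^ k\<rceil>..\<lceil>R * N ^ k\<rceil>}"
    proof
      fix x assume "x \<in> V"
      then obtain z :: int where z: "x = of_int z / of_int (N ^ k)" "\<bar>real_of_rat x\<bar> \<le> R" unfolding V_def by blast
      have "real_of_rat x = of_int z / of_int (N ^ k)" unfolding z(1) by (simp add: of_rat_divide of_rat_power)
      then have "\<bar>of_int z\<bar> = \<bar>real_of_rat x\<bar> * N ^ k" using N(1) by (simp add: abs_mult)
      also have "\<dots> \<le> R * N ^ k" using z(2) N(1) by (intro mult_right_mono) auto
      finally have "\<bar>of_int z\<bar> \<le> R * N ^ k" .
      then have "z \<in> {- \<lceil>R * N ^ k\<rceil>..\<lceil>R * N ^ k\<rceil>}" by simp linarith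
      then show "x \<in> (\<lambda>z::int. of_int z / of_int (N ^ k)) ` {- \<lceil>R * N ^ k\<rceil>..\<lceil>R * N ^ k\<rceil>}" using z(1) by blast
    qed
    then have finV: "finite V" by (rule finite_subset) auto
    have "{S. sat S \<and> rk (ev ` S) = k \<and> dg (ev ` S) > c} \<subseteq>
        (\<lambda>P. {x \<in> \<Lambda>. \<exists>d\<in>carrier_vec k. x = P *\<^sub>v d}) ` {P \<in> carrier_mat r k. \<forall>i<r. \<forall>j<k. P $$ (i, j) \<in> V}"
    proof
      fix S assume "S \<in> {S. sat S \<and> rk (ev ` S) = k \<and> dg (ev ` S) > c}"
      then have S: "sat S" "rk (ev ` S) = k" "dg (ev ` S) > c" by auto
      obtain k' A where A': "A \<in> carrier_mat r k'" "mat_inj A" "zspan A = S" using saturated_basis[OF S(1)] .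
      have "k' = k" using rk_dg(2)[OF A'(1,2)] S(2) A'(3) by simp
      note A = A'[unfolded this]
      have pos: "gram (emb A) > 0" using gram_pos[OF emb_carrier[OF A(1)]] emb_inj_iff[OF A(1)] A(2) by simp
      have "ln (gram (emb A)) < - 2 * c" using S(3) rk_dg(3)[OF A(1,2)] A(3) by simp
      then have gle: "gram (emb A) \<le> exp (- 2 * c)" using pos by (metis exp_le_cancel_iff exp_ln less_eq_real_def)
      have minor: "det (select_rows k f A) \<in> V" if f: "\<And>i. i < k \<Longrightarrow> f i < r" for f
      proof -
        have "(of_rat (det (select_rows k f A)))\<^sup>2 \<le> (real k * q) ^ k * gram (emb A)"
          by (rule minor_bound[OF q(1) q' A(1) f])
        also have "\<dots> \<le> (real k * q) ^ k * exp (- 2 * c)" using q(1) gle by (intro mult_left_mono) auto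
        finally have 1: "\<bar>real_of_rat (det (select_rows k f A))\<bar> \<le> R" unfolding R_def by (intro real_le_rsqrt) (simp only: power2_abs)
        have ent: "of_int N * A $$ (i, j) \<in> \<int>" if "i < r" "j < k" for i j
        proof -
          have "col A j \<in> \<Lambda>" using col_in_zspan[OF A(1) that(2)] A(3) S(1) unfolding saturated_in_def by blast
          then have "of_int N * col A j $ i \<in> \<int>" using N(2) that(1) by blast
          then show ?thesis using A(1) that by simp
        qed
        \<comment> \<open>\<open>N\<close> times the selected rows is integral, whence the
          denominator \<open>N ^ k\<close> of the minor.\<close>
        define Z where "Z = mat k k (\<lambda>(i, j). \<lfloor>of_int N * A $$ (f i, j)\<rfloor>)"
        have Z: "Z \<in> carrier_mat k k" by (simp add: Z_def)
        have "map_mat of_int Z = of_int N \<cdot>\<^sub>m select_rows k f A"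
        proof (rule eq_matI)
          fix i j assume "i < dim_row (of_int N \<cdot>\<^sub>m select_rows k f A)" "j < dim_col (of_int N \<cdot>\<^sub>m select_rows k f A)"
          then have ij: "i < k" "j < k" using A(1) by (auto simp: select_rows_def)
          have "of_int \<lfloor>of_int N * A $$ (f i, j)\<rfloor> = of_int N * A $$ (f i, j)"
            using ent[OF f[OF ij(1)] ij(2)] by (elim Ints_cases) simp
          then show "map_mat of_int Z $$ (i, j) = (of_int N \<cdot>\<^sub>m select_rows k f A) $$ (i, j)"
            using ij A(1) by (simp add: Z_def select_rows_def)
        qed (use A(1) in \<open>auto simp: Z_def select_rows_def\<close>)
        then have "of_int (det Z) = det (of_int N \<cdot>\<^sub>m select_rows k f A)"
          by (metis of_int_hom.hom_det)
        also have "\<dots> = of_int (N ^ k) * det (select_rows k f A)"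
          using A(1) by (subst det_smult) (auto simp: select_rows_def)
        finally have "det (select_rows k f A) = of_int (det Z) / of_int (N ^ k)" using N(1) by (simp add: field_simps)
        then show ?thesis using 1 unfolding V_def by blast
      qed
      obtain f where f: "\<forall>i<k. f i < r" "det (select_rows k f A) \<noteq> 0" using exists_nonzero_minor[OF A(1,2)] by blast
      define G where "G = select_rows k f A"
      define P where "P = A * adj_mat G"
      have G: "G \<in> carrier_mat k k" using A(1) by (auto simp: G_def select_rows_def)
      have aG: "adj_mat G \<in> carrier_mat k k" by (rule adj_mat(1)[OF G])
      have P: "P \<in> carrier_mat r k" using A(1) aG by (simp add: P_def)
      have "P $$ (i, j) \<in> V" if ij: "i < r" "j < k" for i j
        unfolding P_def G_def mult_adj_select_rows[OF A(1) ij] by (rule minor) (use f ij in auto)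
      \<comment> \<open>\<open>P\<close> and \<open>A\<close> have the same rational column span
        since \<open>adj_mat G\<close> is invertible; saturation makes \<open>S\<close> the full
        intersection with it.\<close>
      moreover have "S = {x \<in> \<Lambda>. \<exists>d\<in>carrier_vec k. x = P *\<^sub>v d}"
      proof (intro equalityI subsetI)
        fix x assume x: "x \<in> S"
        obtain a where a: "a \<in> carrier_vec k" "x = A *\<^sub>v map_vec of_int a" using zspanE[OF A(1)] x A(3) by blast
        define d where "d = (1 / det G) \<cdot>\<^sub>v (G *\<^sub>v map_vec of_int a)"
        have Ga: "G *\<^sub>v map_vec of_int a \<in> carrier_vec k" using G a by auto
        have "P *\<^sub>v d = (1 / det G) \<cdot>\<^sub>v (P *\<^sub>v (G *\<^sub>v map_vec of_int a))"
          unfolding d_def by (rule mult_mat_smult_vec[OF P Ga])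
        also have "P *\<^sub>v (G *\<^sub>v map_vec of_int a) = A *\<^sub>v (adj_mat G *\<^sub>v (G *\<^sub>v map_vec of_int a))"
          unfolding P_def by (rule assoc_mult_mat_vec[OF A(1) aG Ga])
        also have "adj_mat G *\<^sub>v (G *\<^sub>v map_vec of_int a) = (adj_mat G * G) *\<^sub>v map_vec of_int a"
          by (rule assoc_mult_mat_vec[OF aG G, symmetric]) (use a in simp)
        also have "\<dots> = det G \<cdot>\<^sub>v map_vec of_int a"
          unfolding adj_mat(3)[OF G] using a
          by (subst smult_mat_mult_vec[of "1\<^sub>m k" k k]) auto
        also have "A *\<^sub>v (det G \<cdot>\<^sub>v map_vec of_int a) = det G \<cdot>\<^sub>v x"
          unfolding a(2) using a(1) by (intro mult_mat_smult_vec[OF A(1)]) simp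
        finally have "P *\<^sub>v d = x" using f(2) by (simp add: G_def smult_smult_assoc)
        moreover have "d \<in> carrier_vec k" using Ga by (simp add: d_def)
        ultimately show "x \<in> {x \<in> \<Lambda>. \<exists>d\<in>carrier_vec k. x = P *\<^sub>v d}"
          using x S(1) unfolding saturated_in_def by blast
      next
        fix x assume "x \<in> {x \<in> \<Lambda>. \<exists>d\<in>carrier_vec k. x = P *\<^sub>v d}"
        then obtain d where d: "x \<in> \<Lambda>" "d \<in> carrier_vec k" "x = P *\<^sub>v d" by blast
        have "x = A *\<^sub>v (adj_mat G *\<^sub>v d)" unfolding d(3) P_def by (rule assoc_mult_mat_vec[OF A(1) aG d(2)])
        then show "x \<in> S"
          using saturated_in_zspan_rational[OF A(1), of \<Lambda> x "adj_mat G *\<^sub>v d"] S(1) A(3) d(1) aG d(2) by auto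
      qed
      ultimately show "S \<in> (\<lambda>P. {x \<in> \<Lambda>. \<exists>d\<in>carrier_vec k. x = P *\<^sub>v d}) ` {P \<in> carrier_mat r k. \<forall>i<r. \<forall>j<k. P $$ (i, j) \<in> V}"
        using P by blast
    qed
    then show ?thesis by (rule finite_subset) (intro finite_imageI finite_mats finV)
  qed
  then have "finite (\<Union>k\<le>r. (`) ev ` {S. sat S \<and> rk (ev ` S) = k \<and> dg (ev ` S) > c})" by blast
  moreover have "{M. saturated_sublattice r M (ev ` \<Lambda>) \<and> dg M > c}
      \<subseteq> (\<Union>k\<le>r. (`) ev ` {S. sat S \<and> rk (ev ` S) = k \<and> dg (ev ` S) > c})"
  proof
    fix M assume "M \<in> {M. saturated_sublattice r M (ev ` \<Lambda>) \<and> dg M > c}"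
    then obtain S where S: "sat S" "M = ev ` S" "dg M > c" using saturated_sublattice_iff by auto
    obtain k A where A: "A \<in> carrier_mat r k" "mat_inj A" "zspan A = S" using saturated_basis[OF S(1)] .
    have "rk (ev ` S) = k" "k \<le> r" using rk_dg(2)[OF A(1,2)] A(3) mat_inj_card_le[OF A(1,2)] by auto
    then show "M \<in> (\<Union>k\<le>r. (`) ev ` {S. sat S \<and> rk (ev ` S) = k \<and> dg (ev ` S) > c})" using S by blast
  qed
  ultimately show ?thesis by (rule rev_finite_subset)
qed

end

section \<open>The Harder--Narasimhan filtration in a lattice of sets\<close>

text \<open>Isolates what the filtration and the chain sum share: modular rank, the degree
  inequality, and finiteness above every bound. Meets are intersections, while joins are only
  asserted to exist, since a sum of saturated sublattices has to be saturated first.\<close>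

locale slope_lattice =
  fixes Sat :: "'a set set" and bt tp :: "'a set" and rk :: "'a set \<Rightarrow> nat" and dg :: "'a set \<Rightarrow> real"
  assumes bt: "bt \<in> Sat" and tp: "tp \<in> Sat"
    and bt_le: "\<And>S. S \<in> Sat \<Longrightarrow> bt \<subseteq> S" and le_tp: "\<And>S. S \<in> Sat \<Longrightarrow> S \<subseteq> tp"
    and Int_in: "\<And>S T. S \<in> Sat \<Longrightarrow> T \<in> Sat \<Longrightarrow> S \<inter> T \<in> Sat"
    and join: "\<And>S T. S \<in> Sat \<Longrightarrow> T \<in> Sat \<Longrightarrow> \<exists>J\<in>Sat. S \<subseteq> J \<and> T \<subseteq> J \<and>
      (\<forall>U\<in>Sat. S \<subseteq> U \<longrightarrow> T \<subseteq> U \<longrightarrow> J \<subseteq> U) \<and>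
      rk (S \<inter> T) + rk J = rk S + rk T \<and> dg S + dg T \<le> dg (S \<inter> T) + dg J"
    and rk_strict: "\<And>S T. S \<in> Sat \<Longrightarrow> T \<in> Sat \<Longrightarrow> S \<subset> T \<Longrightarrow> rk S < rk T"
    and finite_dg: "\<And>c. finite {S \<in> Sat. dg S > c}"
begin

lemma rk_mono: "S \<in> Sat \<Longrightarrow> T \<in> Sat \<Longrightarrow> S \<subseteq> T \<Longrightarrow> rk S \<le> rk T"
  using rk_strict[of S T] by (metis order.order_iff_strict)

lemma eq_of_rk: "S \<in> Sat \<Longrightarrow> T \<in> Sat \<Longrightarrow> S \<subseteq> T \<Longrightarrow> rk T \<le> rk S \<Longrightarrow> S = T"
  using rk_strict[of S T] by (metis linorder_not_less psubsetI)

definition slope :: "'a set \<Rightarrow> 'a set \<Rightarrow> real" where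
  "slope S T = (dg T - dg S) / (real (rk T) - real (rk S))"

text \<open>Semistability of the quotient \<open>T / S\<close>, multiplied out so that
  \<open>V = S\<close> needs no exception.\<close>

definition step :: "'a set \<Rightarrow> 'a set \<Rightarrow> bool" where
  "step S T \<longleftrightarrow> S \<in> Sat \<and> T \<in> Sat \<and> S \<subset> T \<and>
     (\<forall>V\<in>Sat. S \<subseteq> V \<longrightarrow> V \<subseteq> T \<longrightarrow> dg V - dg S \<le> slope S T * (real (rk V) - real (rk S)))"

text \<open>The starting point is arbitrary in order that existence can go by induction on the rank
  still to be covered.\<close>

definition HN_from :: "'a set \<Rightarrow> 'a set list \<Rightarrow> bool" where
  "HN_from S F \<longleftrightarrow> F \<noteq> [] \<and> hd F = S \<and> last F = tp \<and>
     (\<forall>i. Suc i < length F \<longrightarrow> step (F ! i) (F ! Suc i)) \<and>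
     (\<forall>i. Suc (Suc i) < length F \<longrightarrow> slope (F ! Suc i) (F ! Suc (Suc i)) < slope (F ! i) (F ! Suc i))"

text \<open>The maximal destabilizing member above \<open>S\<close>: largest slope, then largest
  rank. Only members whose slope is at least that of \<open>tp\<close> compete, and these have
  degree bounded below, so there are finitely many.\<close>

lemma maximal_step:
  assumes S: "S \<in> Sat" "S \<noteq> tp"
  obtains T where "step S T" "\<And>U. U \<in> Sat \<Longrightarrow> T \<subset> U \<Longrightarrow> slope S U < slope S T"
proof -
  define X where "X = {V \<in> Sat. S \<subset> V \<and> slope S tp \<le> slope S V}"
  have Stp: "S \<subset> tp" using le_tp[OF S(1)] S(2) by blast
  have rkd: "real (rk V) - real (rk S) > 0" if "V \<in> Sat" "S \<subset> V" for V
    using rk_strict[OF S(1) that] by simp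
  \<comment> \<open>The rank difference lies between 0 and \<open>rk tp\<close>, which bounds the
    degree below; the extra \<open>- 1\<close> makes the inequality strict.\<close>
  have "X \<subseteq> {V \<in> Sat. dg V > dg S - \<bar>slope S tp\<bar> * rk tp - 1}"
  proof
    fix V assume V: "V \<in> X"
    then have v: "V \<in> Sat" "S \<subset> V" "slope S tp \<le> slope S V" by (auto simp: X_def)
    have "slope S V * (real (rk V) - real (rk S)) = dg V - dg S"
      using rkd[OF v(1,2)] by (simp add: slope_def)
    moreover have "slope S tp * (real (rk V) - real (rk S)) \<le> slope S V * (real (rk V) - real (rk S))"
      using v(3) rkd[OF v(1,2)] by (intro mult_right_mono) auto
    moreover have "- \<bar>slope S tp\<bar> * rk tp \<le> slope S tp * (real (rk V) - real (rk S))"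
    proof -
      have "\<bar>slope S tp * (real (rk V) - real (rk S))\<bar> \<le> \<bar>slope S tp\<bar> * rk tp"
        unfolding abs_mult using rkd[OF v(1,2)] rk_mono[OF v(1) tp le_tp[OF v(1)]]
        by (intro mult_left_mono) auto
      then show ?thesis by linarith
    qed
    ultimately show "V \<in> {V \<in> Sat. dg V > dg S - \<bar>slope S tp\<bar> * rk tp - 1}" using v(1) by simp
  qed
  then have fin: "finite X" using finite_dg by (rule finite_subset)
  have ne: "X \<noteq> {}" using tp Stp by (auto simp: X_def)
  define m where "m = Max (slope S ` X)"
  define Y where "Y = {V \<in> X. slope S V = m}"
  have finY: "finite Y" using fin by (simp add: Y_def)
  have "m \<in> slope S ` X" unfolding m_def using fin ne by (intro Max_in) auto
  then have neY: "Y \<noteq> {}" by (auto simp: Y_def)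
  have "Max (rk ` Y) \<in> rk ` Y" using finY neY by (intro Max_in) auto
  then obtain T where T: "T \<in> Y" "rk T = Max (rk ` Y)" by auto
  have TS: "T \<in> Sat" "S \<subset> T" "slope S T = m" using T(1) by (auto simp: Y_def X_def)
  have tpm: "slope S tp \<le> m" using T(1) by (auto simp: Y_def X_def)
  have le_m: "slope S V \<le> m" if "V \<in> Sat" "S \<subset> V" for V
  proof (cases "V \<in> X")
    case True then show ?thesis unfolding m_def using fin by simp
  next
    case False then show ?thesis using that tpm by (auto simp: X_def)
  qed
  have "step S T"
    unfolding step_def
  proof (intro conjI ballI impI)
    fix V assume V: "V \<in> Sat" "S \<subseteq> V" "V \<subseteq> T"
    show "dg V - dg S \<le> slope S T * (real (rk V) - real (rk S))"
    proof (cases "V = S")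
      case False
      then have SV: "S \<subset> V" using V by blast
      have "slope S V * (real (rk V) - real (rk S)) = dg V - dg S"
        using rkd[OF V(1) SV] by (simp add: slope_def)
      moreover have "slope S V * (real (rk V) - real (rk S)) \<le> slope S T * (real (rk V) - real (rk S))"
        using le_m[OF V(1) SV] rkd[OF V(1) SV] unfolding TS(3) by (intro mult_right_mono) auto
      ultimately show ?thesis by simp
    qed simp
  qed (use S TS in auto)
  moreover have "slope S U < slope S T" if U: "U \<in> Sat" "T \<subset> U" for U
  proof (rule ccontr)
    assume "\<not> slope S U < slope S T"
    then have "slope S U = m" using le_m[of U] U TS by force
    then have "U \<in> Y" using U TS tpm by (auto simp: Y_def X_def)
    then have "rk U \<le> rk T" unfolding T(2) using finY by simp
    then show False using rk_strict[OF TS(1) U] by simp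
  qed
  ultimately show thesis using that by blast
qed

lemma HN_from_exists: "S \<in> Sat \<Longrightarrow> \<exists>F. HN_from S F"
proof (induction "rk tp - rk S" arbitrary: S rule: less_induct)
  case less
  show ?case
  proof (cases "S = tp")
    case True
    then show ?thesis by (intro exI[of _ "[tp]"]) (auto simp: HN_from_def)
  next
    case False
    obtain T where T: "step S T" "\<And>U. U \<in> Sat \<Longrightarrow> T \<subset> U \<Longrightarrow> slope S U < slope S T"
      using maximal_step[OF less.prems False] by blast
    have TS: "T \<in> Sat" "S \<subset> T" using T(1) by (auto simp: step_def)
    have rkST: "rk S < rk T" by (rule rk_strict[OF less.prems TS])
    then have "rk tp - rk T < rk tp - rk S" using rk_mono[OF TS(1) tp le_tp[OF TS(1)]] by simp
    from less.hyps[OF this TS(1)] obtain F where F: "HN_from T F" by blast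
    have F0: "F \<noteq> []" "F ! 0 = T" using F by (auto simp: HN_from_def hd_conv_nth)
    have "HN_from S (S # F)"
      unfolding HN_from_def
    proof (intro conjI allI impI)
      fix i assume i: "Suc i < length (S # F)"
      show "step ((S # F) ! i) ((S # F) ! Suc i)"
        using T(1) F F0 i by (cases i) (auto simp: HN_from_def)
    next
      fix i assume i: "Suc (Suc i) < length (S # F)"
      show "slope ((S # F) ! Suc i) ((S # F) ! Suc (Suc i)) < slope ((S # F) ! i) ((S # F) ! Suc i)"
      proof (cases i)
        case (Suc j) then show ?thesis using F i by (auto simp: HN_from_def)
      next
        case 0
        then have "step T (F ! 1)" using F i F0 by (auto simp: HN_from_def)
        then have U: "F ! 1 \<in> Sat" "T \<subset> F ! 1" by (auto simp: step_def)
        have rkU: "rk T < rk (F ! 1)" by (rule rk_strict[OF TS(1) U])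
        have lt: "slope S (F ! 1) < slope S T" by (rule T(2)[OF U])
        have 1: "dg (F ! 1) - dg S = slope S (F ! 1) * (real (rk (F ! 1)) - real (rk S))"
          "dg T - dg S = slope S T * (real (rk T) - real (rk S))"
          "dg (F ! 1) - dg T = slope T (F ! 1) * (real (rk (F ! 1)) - real (rk T))"
          using rkST rkU by (simp_all add: slope_def)
        \<comment> \<open>The slope from \<open>S\<close> to \<open>F ! 1\<close> is a weighted mean
          of the slopes of the two steps; lying below the first slope, it forces the second below
          the first as well.\<close>
        have "slope S (F ! 1) * (real (rk (F ! 1)) - real (rk S)) < slope S T * (real (rk (F ! 1)) - real (rk S))"
          using lt rkU rkST by (intro mult_strict_right_mono) auto
        then have "slope T (F ! 1) * (real (rk (F ! 1)) - real (rk T)) < slope S T * (real (rk (F ! 1)) - real (rk T))"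
          using 1 by (simp add: algebra_simps)
        then have "slope T (F ! 1) < slope S T" using rkU by simp
        then show ?thesis using 0 F0 by simp
      qed
    qed (use F F0 in \<open>auto simp: HN_from_def\<close>)
    then show ?thesis by blast
  qed
qed

lemma HN_mem:
  assumes F: "HN_from bt F" and i: "i < length F"
  shows "F ! i \<in> Sat"
proof (cases i)
  case 0 then show ?thesis using F bt by (auto simp: HN_from_def hd_conv_nth)
next
  case (Suc j) then show ?thesis using F i by (auto simp: HN_from_def step_def)
qed

lemma HN_slope_antimono:
  assumes F: "HN_from bt F" and ij: "i < j" "Suc j < length F"
  shows "slope (F ! j) (F ! Suc j) < slope (F ! i) (F ! Suc i)"
  using ij
proof (induction j)
  case (Suc j)
  have "slope (F ! Suc j) (F ! Suc (Suc j)) < slope (F ! j) (F ! Suc j)"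
    using F Suc.prems(2) by (auto simp: HN_from_def)
  then show ?case using Suc by (cases "i = j") auto
qed simp

lemma HN_nth_mono:
  assumes F: "HN_from bt F" and ij: "i < j" "j < length F"
  shows "F ! i \<subset> F ! j"
  using ij
proof (induction j)
  case (Suc j)
  have "F ! j \<subset> F ! Suc j" using F Suc.prems(2) by (auto simp: HN_from_def step_def)
  then show ?case using Suc by (cases "i = j") auto
qed simp

text \<open>The gain \<open>dg - x * rk\<close> of \<open>S\<close>, measured along the filtration, grows by at most
  \<open>(\<mu> - x) m\<close> in a step of slope \<open>\<mu>\<close>, where \<open>m\<close> is the rank that \<open>S\<close> contributes to the step.\<close>

lemma HN_bound:
  assumes F: "HN_from bt F" and S: "S \<in> Sat" and t: "t < length F" and e: "e \<ge> 0"
    and lo: "\<And>j. j < t \<Longrightarrow> x + e \<le> slope (F ! j) (F ! Suc j)"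
    and hi: "\<And>j. t \<le> j \<Longrightarrow> Suc j < length F \<Longrightarrow> slope (F ! j) (F ! Suc j) \<le> x - e"
  shows "dg S - x * rk S + e * (real (rk (F ! t)) + real (rk S) - 2 * real (rk (S \<inter> F ! t)))
    \<le> dg (F ! t) - x * rk (F ! t)"
proof -
  define g where "g V = dg V - x * rk V" for V
  have one: "dg (S \<inter> F ! Suc j) - dg (S \<inter> F ! j) \<le>
      slope (F ! j) (F ! Suc j) * (real (rk (S \<inter> F ! Suc j)) - real (rk (S \<inter> F ! j)))"
    "rk (S \<inter> F ! j) \<le> rk (S \<inter> F ! Suc j)"
    "real (rk (S \<inter> F ! Suc j)) - real (rk (S \<inter> F ! j)) \<le> real (rk (F ! Suc j)) - real (rk (F ! j))"
    if j: "Suc j < length F" for j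
  proof -
    have st: "step (F ! j) (F ! Suc j)" using F j by (auto simp: HN_from_def)
    have m: "F ! j \<in> Sat" "F ! Suc j \<in> Sat" "F ! j \<subset> F ! Suc j" using st by (auto simp: step_def)
    have A: "S \<inter> F ! Suc j \<in> Sat" by (rule Int_in[OF S m(2)])
    have I: "S \<inter> F ! Suc j \<inter> F ! j = S \<inter> F ! j" using m(3) by blast
    \<comment> \<open>The join of \<open>S \<inter> F ! Suc j\<close> with \<open>F ! j\<close>: as
      in the second isomorphism theorem, it represents the contribution of \<open>S\<close> inside
      the semistable step.\<close>
    obtain J where J0: "J \<in> Sat" "F ! j \<subseteq> J" "\<forall>U\<in>Sat. S \<inter> F ! Suc j \<subseteq> U \<longrightarrow> F ! j \<subseteq> U \<longrightarrow> J \<subseteq> U"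
      "rk (S \<inter> F ! j) + rk J = rk (S \<inter> F ! Suc j) + rk (F ! j)"
      "dg (S \<inter> F ! Suc j) + dg (F ! j) \<le> dg (S \<inter> F ! j) + dg J"
      using join[OF A m(1)] unfolding I by blast
    have "J \<subseteq> F ! Suc j" using J0(3) m(2,3) by blast
    note J = J0(1,2) this J0(4,5)
    have "dg J - dg (F ! j) \<le> slope (F ! j) (F ! Suc j) * (real (rk J) - real (rk (F ! j)))"
      using st J(1-3) by (auto simp: step_def)
    moreover have rJ: "real (rk J) - real (rk (F ! j)) = real (rk (S \<inter> F ! Suc j)) - real (rk (S \<inter> F ! j))"
      using J(4) by linarith
    ultimately show "dg (S \<inter> F ! Suc j) - dg (S \<inter> F ! j) \<le>
      slope (F ! j) (F ! Suc j) * (real (rk (S \<inter> F ! Suc j)) - real (rk (S \<inter> F ! j)))"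
      using J(5) by (simp add: rJ)
    show "rk (S \<inter> F ! j) \<le> rk (S \<inter> F ! Suc j)" using rJ rk_mono[OF m(1) J(1,2)] by linarith
    show "real (rk (S \<inter> F ! Suc j)) - real (rk (S \<inter> F ! j)) \<le> real (rk (F ! Suc j)) - real (rk (F ! j))"
      using rk_mono[OF J(1) m(2) J(3)] rJ by linarith
  qed
  \<comment> \<open>Steps before \<open>t\<close> have slope at least \<open>x + e\<close>, so
    \<open>F ! t\<close> gains over its part inside \<open>S\<close>; the later fact
    \<open>down\<close> treats the steps after \<open>t\<close>, where slopes at most
    \<open>x - e\<close> make \<open>S\<close> lose by extending beyond
    \<open>F ! t\<close>.\<close>
  have up: "i \<le> t \<Longrightarrow> g (S \<inter> F ! i) + e * (real (rk (F ! i)) - real (rk (S \<inter> F ! i))) \<le> g (F ! i)" for i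
  proof (induction i)
    case 0
    have "F ! 0 = bt" using F by (auto simp: HN_from_def hd_conv_nth)
    moreover have "S \<inter> bt = bt" using bt_le[OF S] by blast
    ultimately show ?case by simp
  next
    case (Suc i)
    have i: "Suc i < length F" using Suc.prems t by simp
    let ?mu = "slope (F ! i) (F ! Suc i)"
    let ?m = "real (rk (S \<inter> F ! Suc i)) - real (rk (S \<inter> F ! i))"
    let ?n = "real (rk (F ! Suc i)) - real (rk (F ! i))"
    have mu: "x + e \<le> ?mu" using lo Suc.prems by simp
    have "real (rk (F ! i)) < real (rk (F ! Suc i))"
      using F i rk_strict by (auto simp: HN_from_def step_def)
    then have n: "dg (F ! Suc i) - dg (F ! i) = ?mu * ?n" by (simp add: slope_def)
    have "e * (?n - ?m) \<le> (?mu - x) * (?n - ?m)"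
      using mu one(3)[OF i] by (intro mult_right_mono) auto
    then have "e * (?n - ?m) \<le> (?mu * ?n - x * ?n) - (?mu * ?m - x * ?m)" by (simp add: algebra_simps)
    moreover have "g (S \<inter> F ! Suc i) - g (S \<inter> F ! i) \<le> ?mu * ?m - x * ?m"
      using one(1)[OF i] unfolding g_def by (simp add: algebra_simps)
    moreover have "g (F ! Suc i) - g (F ! i) = ?mu * ?n - x * ?n"
      using n unfolding g_def by (simp add: algebra_simps)
    moreover have "g (S \<inter> F ! i) + e * (real (rk (F ! i)) - real (rk (S \<inter> F ! i))) \<le> g (F ! i)"
      using Suc by simp
    moreover have "e * (?n - ?m) = e * (real (rk (F ! Suc i)) - real (rk (S \<inter> F ! Suc i)))
        - e * (real (rk (F ! i)) - real (rk (S \<inter> F ! i)))" by (simp add: algebra_simps)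
    ultimately show ?case by linarith
  qed
  have down: "t + i < length F \<Longrightarrow>
      g (S \<inter> F ! (t + i)) + e * (real (rk (S \<inter> F ! (t + i))) - real (rk (S \<inter> F ! t))) \<le> g (S \<inter> F ! t)" for i
  proof (induction i)
    case (Suc i)
    have i: "Suc (t + i) < length F" using Suc.prems by simp
    let ?mu = "slope (F ! (t + i)) (F ! Suc (t + i))"
    let ?m = "real (rk (S \<inter> F ! Suc (t + i))) - real (rk (S \<inter> F ! (t + i)))"
    have "(?mu - x) * ?m \<le> (- e) * ?m"
      using hi[OF _ i] one(2)[OF i] by (intro mult_right_mono) auto
    then have "?mu * ?m - x * ?m + e * ?m \<le> 0" by (simp add: algebra_simps)
    moreover have "g (S \<inter> F ! Suc (t + i)) - g (S \<inter> F ! (t + i)) \<le> ?mu * ?m - x * ?m"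
      using one(1)[OF i] unfolding g_def by (simp add: algebra_simps)
    moreover have "e * ?m = e * (real (rk (S \<inter> F ! Suc (t + i))) - real (rk (S \<inter> F ! t)))
        - e * (real (rk (S \<inter> F ! (t + i))) - real (rk (S \<inter> F ! t)))" by (simp add: algebra_simps)
    ultimately show ?case using Suc by simp
  qed simp
  have "F ! (t + (length F - 1 - t)) = tp" using F t by (auto simp: HN_from_def last_conv_nth)
  moreover have "S \<inter> tp = S" using le_tp[OF S] by blast
  ultimately have "g S + e * (real (rk S) - real (rk (S \<inter> F ! t))) \<le> g (S \<inter> F ! t)"
    using down[of "length F - 1 - t"] t by simp
  then show ?thesis using up[of t] unfolding g_def by (simp add: algebra_simps)
qed

lemma HN_cut:
  assumes F: "HN_from bt F"
  obtains t where "t < length F" "\<And>j. j < t \<Longrightarrow> x \<le> slope (F ! j) (F ! Suc j)"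
    "\<And>j. t \<le> j \<Longrightarrow> Suc j < length F \<Longrightarrow> slope (F ! j) (F ! Suc j) \<le> x"
proof -
  \<comment> \<open>Vacuous at the last index, so a least index exists even if all slopes are at
    least \<open>x\<close>.\<close>
  define P where "P j \<longleftrightarrow> Suc j < length F \<longrightarrow> slope (F ! j) (F ! Suc j) < x" for j
  define t where "t = (LEAST j. P j)"
  have ne: "length F > 0" using F by (auto simp: HN_from_def)
  then have "P (length F - 1)" by (simp add: P_def)
  then have Pt: "P t" and le: "t \<le> length F - 1" unfolding t_def by (auto intro: LeastI Least_le)
  have tl: "t < length F" using le ne by linarith
  have "x \<le> slope (F ! j) (F ! Suc j)" if "j < t" for j
    using not_less_Least[of j P] that unfolding t_def P_def by auto
  moreover have "slope (F ! j) (F ! Suc j) \<le> x" if j: "t \<le> j" "Suc j < length F" for j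
  proof (cases "t = j")
    case True then show ?thesis using Pt j by (simp add: P_def)
  next
    case False
    then have "slope (F ! j) (F ! Suc j) < slope (F ! t) (F ! Suc t)" using HN_slope_antimono[OF F] j by simp
    moreover have "slope (F ! t) (F ! Suc t) < x" using Pt j by (simp add: P_def)
    ultimately show ?thesis by simp
  qed
  ultimately show thesis using that[OF tl] by blast
qed

text \<open>The case \<open>e = 0\<close> of \<open>HN_bound\<close>: in every direction
  \<open>x\<close> some member of the filtration lies at least as high as \<open>S\<close>, so the
  filtration traces the upper hull of all points of rank and degree.\<close>

lemma HN_dominates:
  fixes x :: real
  assumes F: "HN_from bt F" and S: "S \<in> Sat"
  obtains t where "t < length F" "dg S - x * rk S \<le> dg (F ! t) - x * rk (F ! t)"
proof -
  obtain t where t: "t < length F" "\<And>j. j < t \<Longrightarrow> x \<le> slope (F ! j) (F ! Suc j)"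
    "\<And>j. t \<le> j \<Longrightarrow> Suc j < length F \<Longrightarrow> slope (F ! j) (F ! Suc j) \<le> x"
    using HN_cut[OF F] by blast
  have "dg S - x * rk S + 0 * (real (rk (F ! t)) + real (rk S) - 2 * real (rk (S \<inter> F ! t)))
    \<le> dg (F ! t) - x * rk (F ! t)"
    by (rule HN_bound[OF F S t(1)]) (use t in auto)
  then show thesis using that t(1) by simp
qed

text \<open>For \<open>x\<close> strictly between the slopes on both sides of \<open>F ! t\<close>,
  this member maximizes \<open>dg - x * rk\<close>. If \<open>x\<close> also avoids the slopes of
  \<open>G\<close>, the cut \<open>G ! u\<close> is as high, and the positive gap \<open>e\<close>
  in \<open>HN_bound\<close> makes the two coincide.\<close>

lemma HN_subset:
  assumes F: "HN_from bt F" and G: "HN_from bt G"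
  shows "set F \<subseteq> set G"
proof
  fix S assume "S \<in> set F"
  then obtain t where t: "t < length F" "S = F ! t" by (auto simp: in_set_conv_nth)
  \<comment> \<open>At the ends of the filtration a neighbouring slope is absent; a unit distance
    serves instead to keep the interval non-empty.\<close>
  define lo where "lo = (if Suc t < length F then slope (F ! t) (F ! Suc t) else slope (F ! (t - 1)) (F ! t) - 1)"
  define hi where "hi = (if t > 0 then slope (F ! (t - 1)) (F ! t) else lo + 1)"
  have "lo < hi"
    using HN_slope_antimono[OF F, of "t - 1" t] t(1) by (auto simp: lo_def hi_def)
  define B where "B = (\<lambda>j. slope (G ! j) (G ! Suc j)) ` {..<length G}"
  have "finite B" by (simp add: B_def)
  moreover have "infinite {lo<..<hi}" using \<open>lo < hi\<close> by (simp add: infinite_Ioo)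
  ultimately have "infinite ({lo<..<hi} - B)" by (rule Diff_infinite_finite)
  then have "{lo<..<hi} - B \<noteq> {}" by (metis finite.emptyI)
  then obtain x where "x \<in> {lo<..<hi} - B" by blast
  then have x: "lo < x" "x < hi" "x \<notin> B" by auto
  have loF: "x \<le> slope (F ! j) (F ! Suc j)" if "j < t" for j
  proof -
    have "hi \<le> slope (F ! j) (F ! Suc j)"
    proof (cases "j = t - 1")
      case False
      then have "j < t - 1" using that by simp
      then show ?thesis using that HN_slope_antimono[OF F, of j "t - 1"] t(1) by (simp add: hi_def)
    qed (use that in \<open>auto simp: hi_def\<close>)
    then show ?thesis using x by simp
  qed
  have hiF: "slope (F ! j) (F ! Suc j) \<le> x" if "t \<le> j" "Suc j < length F" for j
  proof -
    have "slope (F ! j) (F ! Suc j) \<le> lo"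
      using that HN_slope_antimono[OF F, of t j] by (cases "j = t") (auto simp: lo_def)
    then show ?thesis using x by simp
  qed
  obtain u where u: "u < length G" "\<And>j. j < u \<Longrightarrow> x \<le> slope (G ! j) (G ! Suc j)"
    "\<And>j. u \<le> j \<Longrightarrow> Suc j < length G \<Longrightarrow> slope (G ! j) (G ! Suc j) \<le> x"
    using HN_cut[OF G] by blast
  \<comment> \<open>The smallest distance of \<open>x\<close> from the values in \<open>B\<close>,
    capped by 1.\<close>
  define e where "e = Min (insert 1 ((\<lambda>j. \<bar>slope (G ! j) (G ! Suc j) - x\<bar>) ` {..<length G}))"
  have e: "e > 0" unfolding e_def using x(3) by (subst Min_gr_iff) (auto simp: B_def)
  have e_le: "e \<le> \<bar>slope (G ! j) (G ! Suc j) - x\<bar>" if "j < length G" for j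
    unfolding e_def using that by (intro Min_le) auto
  have F1: "dg (G ! u) - x * rk (G ! u) \<le> dg (F ! t) - x * rk (F ! t)"
    using HN_bound[OF F HN_mem[OF G u(1)] t(1), of 0 x] loF hiF by simp
  have SS: "F ! t \<in> Sat" "G ! u \<in> Sat" using HN_mem F G t(1) u(1) by auto
  have "dg (F ! t) - x * rk (F ! t) + e * (real (rk (G ! u)) + real (rk (F ! t)) - 2 * real (rk (F ! t \<inter> G ! u)))
    \<le> dg (G ! u) - x * rk (G ! u)"
  proof (rule HN_bound[OF G SS(1) u(1)])
    show "x + e \<le> slope (G ! j) (G ! Suc j)" if "j < u" for j
      using u(2)[OF that] e_le[of j] that u(1) by simp
    show "slope (G ! j) (G ! Suc j) \<le> x - e" if "u \<le> j" "Suc j < length G" for j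
      using u(3)[OF that] e_le[of j] that by simp
  qed (use e in simp)
  with F1 have "e * (real (rk (G ! u)) + real (rk (F ! t)) - 2 * real (rk (F ! t \<inter> G ! u))) \<le> 0" by linarith
  then have le: "real (rk (G ! u)) + real (rk (F ! t)) \<le> 2 * real (rk (F ! t \<inter> G ! u))"
    using e by (simp add: mult_le_0_iff)
  have I: "F ! t \<inter> G ! u \<in> Sat" by (rule Int_in[OF SS])
  have r: "rk (F ! t \<inter> G ! u) \<le> rk (F ! t)" "rk (F ! t \<inter> G ! u) \<le> rk (G ! u)"
    using rk_mono[OF I SS(1)] rk_mono[OF I SS(2)] by auto
  have "F ! t \<inter> G ! u = F ! t" by (rule eq_of_rk[OF I SS(1)]) (use le r in auto)
  moreover have "F ! t \<inter> G ! u = G ! u" by (rule eq_of_rk[OF I SS(2)]) (use le r in auto)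
  ultimately show "S \<in> set G" using t u(1) by (metis nth_mem)
qed

text \<open>Both lists are strictly increasing in rank, so equality of their sets of members
  suffices.\<close>

lemma HN_unique:
  assumes F: "HN_from bt F" and G: "HN_from bt G"
  shows "F = G"
proof -
  have eq: "set F = set G" using HN_subset[OF F G] HN_subset[OF G F] by blast
  have srt: "sorted_wrt (<) (map rk F)" if F: "HN_from bt F" for F
    unfolding sorted_wrt_iff_nth_less using HN_nth_mono[OF F] HN_mem[OF F] rk_strict by auto
  have "set (map rk F) = set (map rk G)" using eq by simp
  then have "map rk F = map rk G"
    using strict_sorted_equal[OF srt[OF F] srt[OF G]] by simp
  moreover have "inj_on rk (set F \<union> set G)"
  proof (rule inj_onI)
    fix S T assume ST: "S \<in> set F \<union> set G" "T \<in> set F \<union> set G" "rk S = rk T"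
    then have "S \<in> set F" "T \<in> set F" using eq by auto
    then obtain i j where ij: "i < length F" "j < length F" "S = F ! i" "T = F ! j"
      by (metis in_set_conv_nth)
    show "S = T"
    proof (cases "i = j")
      case False
      then have "rk (F ! i) \<noteq> rk (F ! j)"
        using srt[OF F] ij(1,2) unfolding sorted_wrt_iff_nth_less by (metis length_map less_irrefl nat_neq_iff nth_map)
      then show ?thesis using ST ij by simp
    qed (use ij in simp)
  qed
  ultimately show ?thesis by (rule map_inj_on)
qed

end

section \<open>Alternating sums over chains\<close>

text \<open>The empty chain is included; it accounts for the summand of the parabolic subgroup
  \<open>G\<close> itself.\<close>

definition chains_in :: "'a set set \<Rightarrow> 'a set set set" where
  "chains_in X = {c. c \<subseteq> X \<and> (\<forall>S\<in>c. \<forall>T\<in>c. S \<subseteq> T \<or> T \<subseteq> S)}"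

text \<open>Sign-reversing involution: add or remove the meet of \<open>V\<close> with the smallest member of the
  chain that is not contained in \<open>V\<close>.\<close>

lemma alternating_chain_sum:
  fixes X :: "'a set set"
  assumes fin: "finite X" and V: "V \<in> X" and meet: "\<And>W. W \<in> X \<Longrightarrow> W \<inter> V \<in> X"
  shows "(\<Sum>c\<in>chains_in X. (- 1) ^ card c) = (0 :: real)"
proof -
  \<comment> \<open>If every member lies in \<open>V\<close>, the intersection is over the empty
    family and \<open>t c = V\<close>.\<close>
  define t where "t c = V \<inter> \<Inter> {W \<in> c. \<not> W \<subseteq> V}" for c
  define i where "i c = (if t c \<in> c then c - {t c} else insert (t c) c)" for c
  have tV: "t c \<subseteq> V" for c by (auto simp: t_def)
  \<comment> \<open>Since \<open>t c \<subseteq> V\<close>, toggling it does not alter the members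
    outside \<open>V\<close>, from which it is computed.\<close>
  have ti: "t (i c) = t c" for c
  proof -
    have "{W \<in> i c. \<not> W \<subseteq> V} = {W \<in> c. \<not> W \<subseteq> V}" using tV[of c] by (auto simp: i_def)
    then show ?thesis by (simp add: t_def)
  qed
  have ii: "i (i c) = c" for c
  proof (cases "t c \<in> c")
    case True
    then have ic: "i c = c - {t c}" by (simp add: i_def)
    then have "i (i c) = insert (t c) (i c)" using ti[of c] unfolding i_def[of "i c"] by simp
    then show ?thesis using True ic by auto
  next
    case False
    then have ic: "i c = insert (t c) c" by (simp add: i_def)
    then have "i (i c) = i c - {t c}" using ti[of c] unfolding i_def[of "i c"] by simp
    then show ?thesis using False ic by auto
  qed
  have fc: "finite c" if "c \<in> chains_in X" for c
    using that fin by (auto simp: chains_in_def intro: finite_subset)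
  have tX: "t c \<in> X" if c: "c \<in> chains_in X" for c
  proof (cases "{W \<in> c. \<not> W \<subseteq> V} = {}")
    case True then show ?thesis unfolding t_def True using V by simp
  next
    case False
    define N where "N = {W \<in> c. \<not> W \<subseteq> V}"
    have "finite N" unfolding N_def by (rule finite_subset[OF _ fc[OF c]]) blast
    moreover have "N \<noteq> {}" unfolding N_def by (rule False)
    ultimately have N: "finite N" "N \<noteq> {}" .
    obtain W where W: "W \<in> N" "\<forall>U\<in>N. U \<subseteq> W \<longrightarrow> W = U"
      using finite_has_minimal[OF N] by blast
    have "W \<subseteq> U" if U: "U \<in> N" for U
    proof -
      have "W \<subseteq> U \<or> U \<subseteq> W" using c U W(1) by (auto simp: chains_in_def N_def)
      then show ?thesis using W(2) U by blast
    qed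
    then have "\<Inter> N = W" using W(1) by blast
    then have "t c = W \<inter> V" by (auto simp: t_def N_def)
    then show ?thesis using meet[of W] W(1) c by (auto simp: chains_in_def N_def)
  qed
  have cmp: "U \<subseteq> t c \<or> t c \<subseteq> U" if c: "c \<in> chains_in X" and U: "U \<in> c" for c U
  proof (cases "U \<subseteq> V")
    case True
    have "U \<subseteq> W" if W: "W \<in> c" "\<not> W \<subseteq> V" for W
    proof -
      have "W \<subseteq> U \<or> U \<subseteq> W" using c U W(1) by (auto simp: chains_in_def)
      then show ?thesis using True W(2) by blast
    qed
    then show ?thesis using True by (auto simp: t_def)
  next
    case False then show ?thesis using U by (auto simp: t_def)
  qed
  have iC: "i c \<in> chains_in X" if c: "c \<in> chains_in X" for c
  proof (cases "t c \<in> c")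
    case True then show ?thesis using c by (simp add: i_def chains_in_def) blast
  next
    case False
    have "insert (t c) c \<subseteq> X" using tX[OF c] c by (auto simp: chains_in_def)
    moreover have "\<forall>S\<in>insert (t c) c. \<forall>T\<in>insert (t c) c. S \<subseteq> T \<or> T \<subseteq> S"
    proof (intro ballI)
      fix S T assume S: "S \<in> insert (t c) c" and T: "T \<in> insert (t c) c"
      show "S \<subseteq> T \<or> T \<subseteq> S"
      proof (cases "S = t c")
        case True then show ?thesis using cmp[OF c, of T] T by blast
      next
        case S': False
        show ?thesis
        proof (cases "T = t c")
          case True then show ?thesis using cmp[OF c, of S] S S' by blast
        next
          case False then show ?thesis using S S' T c unfolding chains_in_def by blast
        qed
      qed
    qed
    ultimately show ?thesis using False by (simp add: i_def chains_in_def)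
  qed
  have sgn: "(- 1 :: real) ^ card (i c) = - ((- 1) ^ card c)" if c: "c \<in> chains_in X" for c
  proof (cases "t c \<in> c")
    case True
    then have "card c = Suc (card (i c))" using card.remove[OF fc[OF c] True] by (simp add: i_def)
    then show ?thesis by simp
  next
    case False then show ?thesis using fc[OF c] by (simp add: i_def)
  qed
  have "(\<Sum>c\<in>chains_in X. (- 1 :: real) ^ card c) = (\<Sum>c\<in>chains_in X. - ((- 1) ^ card c))"
    by (rule sum.reindex_bij_witness[where i = i and j = i]) (use ii iC sgn in auto)
  then show ?thesis by (simp add: sum_negf)
qed

text \<open>\<open>conc\<close> is concavity of \<open>p\<close> in the form that fits modularity of
  the rank: \<open>i\<close> and \<open>j\<close> are the ranks of a meet and a join,
  \<open>a\<close> and \<open>b\<close> those of the two members.\<close>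

lemma (in slope_lattice) truncation_sum:
  fixes p :: "nat \<Rightarrow> real"
  assumes conc: "\<And>i a b j. i \<le> a \<Longrightarrow> i \<le> b \<Longrightarrow> j \<le> rk tp \<Longrightarrow> i + j = a + b \<Longrightarrow> p i + p j \<le> p a + p b"
  defines "X \<equiv> {S \<in> Sat. dg S > p (rk S)}"
  shows "finite X" "(\<Sum>c\<in>chains_in X. (- 1) ^ card c) = (if X = {} then 1 else 0 :: real)"
proof -
  \<comment> \<open>Membership in \<open>X\<close> bounds the degree below by the least value of
    \<open>p\<close>; subtracting 1 gives a strict bound.\<close>
  define c where "c = Min (p ` {..rk tp}) - 1"
  have "X \<subseteq> {S \<in> Sat. dg S > c}"
  proof
    fix S assume S: "S \<in> X"
    then have "rk S \<le> rk tp" using rk_mono[of S tp] tp le_tp by (auto simp: X_def)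
    then have "Min (p ` {..rk tp}) \<le> p (rk S)" by (intro Min_le) auto
    then show "S \<in> {S \<in> Sat. dg S > c}" using S by (auto simp: X_def c_def)
  qed
  then show fin: "finite X" using finite_dg by (rule finite_subset)
  show "(\<Sum>c\<in>chains_in X. (- 1) ^ card c) = (if X = {} then 1 else 0 :: real)"
  proof (cases "X = {}")
    case True
    then have "chains_in X = {{}}" by (auto simp: chains_in_def)
    then show ?thesis using True by simp
  next
    case False
    define f where "f S = dg S - p (rk S)" for S
    have "Max (f ` X) \<in> f ` X" using fin False by (intro Max_in) auto
    then obtain V where V: "V \<in> X" "f V = Max (f ` X)" by auto
    have VS: "V \<in> Sat" "f V > 0" using V(1) by (auto simp: X_def f_def)
    have fV: "f S \<le> f V" if "S \<in> Sat" for S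
    proof (cases "S \<in> X")
      case True then show ?thesis unfolding V(2) using fin by simp
    next
      case False then show ?thesis using that VS(2) by (auto simp: X_def f_def)
    qed
    have "W \<inter> V \<in> X" if W: "W \<in> X" for W
    proof -
      have WS: "W \<in> Sat" "f W > 0" using W by (auto simp: X_def f_def)
      obtain J where J: "J \<in> Sat" "W \<subseteq> J" "V \<subseteq> J" "rk (W \<inter> V) + rk J = rk W + rk V"
        "dg W + dg V \<le> dg (W \<inter> V) + dg J" using join[OF WS(1) VS(1)] by blast
      have I: "W \<inter> V \<in> Sat" by (rule Int_in[OF WS(1) VS(1)])
      have "p (rk (W \<inter> V)) + p (rk J) \<le> p (rk W) + p (rk V)"
        by (rule conc[OF _ _ _ J(4)]) (use rk_mono I WS VS J(1) tp le_tp in auto)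
      then have "f W + f V \<le> f (W \<inter> V) + f J" using J(5) by (simp add: f_def)
      then have "f (W \<inter> V) > 0" using fV[OF J(1)] WS(2) by linarith
      then show ?thesis using I by (simp add: X_def f_def)
    qed
    then show ?thesis using alternating_chain_sum[OF fin V(1)] False by simp
  qed
qed

text \<open>If \<open>p\<close> bounds the filtration, a supporting line of \<open>p\<close> at
  \<open>rk S\<close> passes above all its members, and by \<open>HN_dominates\<close> in the
  direction of that line also above \<open>S\<close>.\<close>

lemma (in slope_lattice) HN_le_iff:
  fixes p :: "nat \<Rightarrow> real"
  assumes F: "HN_from bt F"
    and super: "\<And>k. k \<le> rk tp \<Longrightarrow> \<exists>x. \<forall>j\<le>rk tp. p j \<le> p k + x * (real j - real k)"
  shows "(\<forall>i<length F. dg (F ! i) \<le> p (rk (F ! i))) \<longleftrightarrow> {S \<in> Sat. dg S > p (rk S)} = {}"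
proof
  assume le: "\<forall>i<length F. dg (F ! i) \<le> p (rk (F ! i))"
  have "dg S \<le> p (rk S)" if S: "S \<in> Sat" for S
  proof -
    obtain x where x: "\<forall>j\<le>rk tp. p j \<le> p (rk S) + x * (real j - real (rk S))"
      using super[OF rk_mono[OF S tp le_tp[OF S]]] by blast
    obtain t where t: "t < length F" "dg S - x * rk S \<le> dg (F ! t) - x * rk (F ! t)"
      using HN_dominates[OF F S] by blast
    have "rk (F ! t) \<le> rk tp" using HN_mem[OF F t(1)] rk_mono tp le_tp by blast
    then have "p (rk (F ! t)) \<le> p (rk S) + x * (real (rk (F ! t)) - real (rk S))" using x by blast
    moreover have "dg (F ! t) \<le> p (rk (F ! t))" using le t(1) by blast
    ultimately show ?thesis using t(2) by (simp add: algebra_simps)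
  qed
  then show "{S \<in> Sat. dg S > p (rk S)} = {}" by force
next
  assume "{S \<in> Sat. dg S > p (rk S)} = {}"
  then show "\<forall>i<length F. dg (F ! i) \<le> p (rk (F ! i))" using HN_mem[OF F] by force
qed

section \<open>Integrality and approximation for adeles\<close>

lemma Q_p_abs_mult:
  assumes p: "prime p" and X: "X \<in> carrier (Q_p p)" and Y: "Y \<in> carrier (Q_p p)"
  shows "Q_p_abs p (X \<otimes>\<^bsub>Q_p p\<^esub> Y) = Q_p_abs p X * Q_p_abs p Y"
proof -
  obtain f where f: "padic_Cauchy p f" "X = padic_null_ideal p +>\<^bsub>padic_Cauchy_ring p\<^esub> f"
    using Q_p_elemE[OF p X] .
  obtain g where g: "padic_Cauchy p g" "Y = padic_null_ideal p +>\<^bsub>padic_Cauchy_ring p\<^esub> g"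
    using Q_p_elemE[OF p Y] .
  have "(\<lambda>n. padic_abs p (f n * g n)) \<longlonglongrightarrow> Q_p_abs p X * Q_p_abs p Y"
    using tendsto_mult[OF Q_p_abs_coset[OF p f(1)] Q_p_abs_coset[OF p g(1)]]
    by (simp add: f(2) g(2) padic_abs_mult[OF p])
  then show ?thesis
    unfolding f(2) g(2) Q_p_mult_coset[OF p f(1) g(1)]
    using Q_p_abs_coset[OF p padic_Cauchy_mult[OF p f(1) g(1)]] LIMSEQ_unique by blast
qed

lemma Q_p_abs_nonneg:
  assumes p: "prime p" and X: "X \<in> carrier (Q_p p)"
  shows "0 \<le> Q_p_abs p X"
proof -
  obtain f where f: "padic_Cauchy p f" "X = padic_null_ideal p +>\<^bsub>padic_Cauchy_ring p\<^esub> f"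
    using Q_p_elemE[OF p X] .
  show ?thesis unfolding f(2) by (rule LIMSEQ_le_const[OF Q_p_abs_coset[OF p f(1)]]) auto
qed

text \<open>The real component is free of the rational embedded diagonally at the finite places;
  matrices with a prescribed real part are built from such adeles.\<close>

lift_definition adele_mk :: "real \<Rightarrow> rat \<Rightarrow> adele" is
  "\<lambda>x q. (x, \<lambda>p\<in>{p. prime p}. Q_p_of_rat p q)"
  using finite_adeles_of_rat by blast

lemma adele_real_mk [simp]: "adele_real (adele_mk x q) = x"
  by transfer simp

lemma adele_padic_mk [simp]: "prime p \<Longrightarrow> adele_padic (adele_mk x q) p = Q_p_of_rat p q"
  by transfer simp

lemma adele_of_rat_mk: "adele_of_rat q = adele_mk (of_rat q) q"
  by transfer simp

lemma Q_p_of_rat_add: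
  "prime p \<Longrightarrow> Q_p_of_rat p (x + y) = Q_p_of_rat p x \<oplus>\<^bsub>Q_p p\<^esub> Q_p_of_rat p y"
  unfolding Q_p_of_rat_def by (simp add: Q_p_add_coset[OF _ padic_Cauchy_const padic_Cauchy_const])

lemma Q_p_of_rat_mult:
  "prime p \<Longrightarrow> Q_p_of_rat p (x * y) = Q_p_of_rat p x \<otimes>\<^bsub>Q_p p\<^esub> Q_p_of_rat p y"
  unfolding Q_p_of_rat_def by (simp add: Q_p_mult_coset[OF _ padic_Cauchy_const padic_Cauchy_const])

lemma adele_mk_add: "adele_mk (x + y) (q + s) = adele_mk x q + adele_mk y s"
  by (rule adele_eqI) (auto simp: Q_p_of_rat_add)

lemma adele_mk_mult: "adele_mk (x * y) (q * s) = adele_mk x q * adele_mk y s"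
  by (rule adele_eqI) (auto simp: Q_p_of_rat_mult)

lemma adele_mk_0 [simp]: "adele_mk 0 0 = 0"
  by (rule adele_eqI) (auto simp: Q_p_zero)

lemma adele_mk_1 [simp]: "adele_mk 1 1 = 1"
  by (rule adele_eqI) (auto simp: Q_p_one)

lemma adele_mk_prod: "adele_mk (\<Prod>i\<in>A. f i) (\<Prod>i\<in>A. g i) = (\<Prod>i\<in>A. adele_mk (f i) (g i))"
  by (induction A rule: infinite_finite_induct) (auto simp: adele_mk_mult)

interpretation adele_real_hom: comm_ring_hom adele_real
  by unfold_locales auto

interpretation adele_of_rat_hom: comm_ring_hom adele_of_rat
  by unfold_locales (auto simp: adele_of_rat_mk of_rat_add of_rat_mult adele_mk_add adele_mk_mult)

text \<open>Integrality at the finite places only; the real component is unconstrained.\<close>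

definition zint :: "adele \<Rightarrow> bool" where
  "zint x \<longleftrightarrow> (\<forall>p. prime p \<longrightarrow> adele_padic x p \<in> Z_p p)"

lemma zint_add: "zint x \<Longrightarrow> zint y \<Longrightarrow> zint (x + y)"
  by (auto simp: zint_def intro: Z_p_add)

lemma zint_mult: "zint x \<Longrightarrow> zint y \<Longrightarrow> zint (x * y)"
  by (auto simp: zint_def intro: Z_p_mult)

lemma zint_uminus: "zint x \<Longrightarrow> zint (- x)"
  by (auto simp: zint_def intro: Z_p_uminus)

lemma zint_of_int_rat: "zint (adele_of_rat (of_int n))"
  by (auto simp: zint_def adele_of_rat_mk Z_p_of_int)

lemma zint_0 [simp]: "zint 0" and zint_1 [simp]: "zint 1"
  using zint_of_int_rat[of 0] zint_of_int_rat[of 1] by auto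

lemma adele_of_int: "(of_int n :: adele) = adele_of_rat (of_int n)"
  by (simp add: adele_of_rat_hom.hom_of_int)

lemma zint_of_int [simp]: "zint (of_int n)"
  unfolding adele_of_int by (rule zint_of_int_rat)

lemma zint_sum: "(\<And>i. i \<in> A \<Longrightarrow> zint (f i)) \<Longrightarrow> zint (\<Sum>i\<in>A. f i)"
  by (induction A rule: infinite_finite_induct) (auto intro: zint_add)

lemma zint_prod: "(\<And>i. i \<in> A \<Longrightarrow> zint (f i)) \<Longrightarrow> zint (\<Prod>i\<in>A. f i)"
  by (induction A rule: infinite_finite_induct) (auto intro: zint_mult)

definition zint_mat :: "adele mat \<Rightarrow> bool" where
  "zint_mat A \<longleftrightarrow> (\<forall>i<dim_row A. \<forall>j<dim_col A. zint (A $$ (i, j)))"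

lemma zint_matD: "zint_mat A \<Longrightarrow> A \<in> carrier_mat n m \<Longrightarrow> i < n \<Longrightarrow> j < m \<Longrightarrow> zint (A $$ (i, j))"
  by (auto simp: zint_mat_def)

lemma zint_mat_mult:
  assumes "A \<in> carrier_mat n m" "B \<in> carrier_mat m k" "zint_mat A" "zint_mat B"
  shows "zint_mat (A * B)"
  using assms unfolding zint_mat_def by (auto simp: scalar_prod_def intro!: zint_sum zint_mult)

lemma zint_det:
  assumes "zint_mat A"
  shows "zint (det A)"
proof -
  have "zint (of_int (sign p) * (\<Prod>i = 0..<dim_row A. A $$ (i, p i)))"
    if "p permutes {0..<dim_row A}" "dim_row A = dim_col A" for p
  proof (intro zint_mult zint_of_int zint_prod)
    fix i assume i: "i \<in> {0..<dim_row A}"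
    then have "p i \<in> {0..<dim_row A}" using permutes_in_image[OF that(1)] by blast
    then show "zint (A $$ (i, p i))" using assms i that(2) unfolding zint_mat_def by auto
  qed
  then show ?thesis unfolding det_def by (auto intro!: zint_sum)
qed

lemma zint_adj_mat:
  assumes A: "A \<in> carrier_mat n n" "zint_mat A"
  shows "zint_mat (adj_mat A)"
proof -
  have "zint (cofactor A i j)" if ij: "i < n" "j < n" for i j
  proof -
    have "zint_mat (mat_delete A i j)"
      unfolding zint_mat_def
    proof (intro allI impI)
      fix a b assume "a < dim_row (mat_delete A i j)" "b < dim_col (mat_delete A i j)"
      then have ab: "a < n - 1" "b < n - 1" using A(1) by (auto simp: mat_delete_def)
      then have "mat_delete A i j $$ (a, b) = A $$ (if a < i then a else Suc a, if b < j then b else Suc b)"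
        using A(1) by (simp add: mat_delete_def)
      moreover have "(if a < i then a else Suc a) < n" "(if b < j then b else Suc b) < n" using ab by auto
      ultimately show "zint (mat_delete A i j $$ (a, b))" using A unfolding zint_mat_def by auto
    qed
    moreover have "zint ((- 1) ^ (i + j))" using zint_of_int[of "(- 1) ^ (i + j)"] by simp
    ultimately show ?thesis unfolding cofactor_def by (intro zint_mult zint_det)
  qed
  then show ?thesis using A(1) unfolding zint_mat_def adj_mat_def by auto
qed

section \<open>Rational approximation at the finite places\<close>

lemma padic_abs_le_1:
  assumes p: "prime p" and b: "\<not> int p dvd b"
  shows "padic_abs p (of_int a / of_int b) \<le> 1"
proof (cases "a = 0")
  case False
  have "b \<noteq> 0" using b by auto
  have "multiplicity (int p) b = 0" using b by (rule not_dvd_imp_multiplicity_0)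
  then have "padic_abs p (of_int a / of_int b) = padic_abs p (of_int a / of_int 1)"
    using padic_abs_fract[OF p False \<open>b \<noteq> 0\<close>] padic_abs_fract[OF p False, of 1] by simp
  then show ?thesis using padic_abs_of_int_le[OF p, of a] by simp
qed simp

lemma zint_of_rat_iff: "zint (adele_of_rat q) \<longleftrightarrow> (\<forall>p. prime p \<longrightarrow> padic_abs p q \<le> 1)"
  by (simp add: zint_def adele_of_rat_mk Z_p_def Q_p_of_rat_closed Q_p_abs_of_rat)

text \<open>A prime dividing the reduced denominator would give an absolute value above 1. This is
  where local integrality becomes global.\<close>

lemma zint_of_rat_Ints: "zint (adele_of_rat q) \<Longrightarrow> q \<in> \<int>"
proof -
  assume "zint (adele_of_rat q)"
  then have le: "\<And>p. prime p \<Longrightarrow> padic_abs p q \<le> 1" unfolding zint_of_rat_iff by blast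
  obtain a b where ab: "quotient_of q = (a, b)" by (cases "quotient_of q") auto
  have b: "b > 0" and cop: "coprime a b" and q: "q = of_int a / of_int b"
    using quotient_of_denom_pos[OF ab] quotient_of_coprime[OF ab] quotient_of_div[OF ab] by auto
  have "b = 1"
  proof (rule ccontr)
    assume "b \<noteq> 1"
    then have "nat b \<noteq> 1" using b by simp
    then obtain p where p: "prime p" "p dvd nat b" using prime_factor_nat by blast
    then have pb: "int p dvd b" using b by (metis int_dvd_int_iff int_nat_eq less_imp_le)
    have pu: "\<not> is_unit (int p)" using p(1) by auto
    have pa: "\<not> int p dvd a" using cop pb pu by (meson coprime_common_divisor)
    then have a: "a \<noteq> 0" by auto
    have "multiplicity (int p) a = 0" using pa by (rule not_dvd_imp_multiplicity_0)
    moreover have "multiplicity (int p) b \<ge> 1" using pb pu b by (intro multiplicity_geI) auto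
    ultimately have "padic_abs p q = real p ^ multiplicity (int p) b"
      unfolding q using padic_abs_fract[OF p(1) a, of b] b by simp
    moreover have "real p > 1" using prime_gt_1_nat[OF p(1)] by simp
    ultimately have "padic_abs p q > 1" using \<open>multiplicity (int p) b \<ge> 1\<close> by (simp add: one_less_power)
    then show False using le[OF p(1)] by simp
  qed
  then show ?thesis using q by simp
qed

text \<open>Partial fractions: Bezout splits a fraction with denominator \<open>p^m c\<close> into a
  part with denominator \<open>p^m\<close> and a part with denominator prime to
  \<open>p\<close>.\<close>

lemma padic_principal_part:
  fixes y :: rat
  assumes p: "prime p"
  obtains q where "padic_abs p (y - q) \<le> 1" "\<And>l. prime l \<Longrightarrow> l \<noteq> p \<Longrightarrow> padic_abs l q \<le> 1"
proof -
  obtain a b where ab: "quotient_of y = (a, b)" by (cases "quotient_of y") auto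
  have b: "b > 0" and y: "y = of_int a / of_int b"
    using quotient_of_denom_pos[OF ab] quotient_of_div[OF ab] by auto
  have pu: "\<not> is_unit (int p)" using p by auto
  obtain c where c: "b = int p ^ multiplicity (int p) b * c" "\<not> int p dvd c"
    using multiplicity_decompose'[of b "int p"] b pu by auto
  define m where "m = multiplicity (int p) b"
  have bc: "b = int p ^ m * c" using c by (simp add: m_def)
  have c0: "c \<noteq> 0" using c(2) by auto
  have p0: "int p \<noteq> 0" using p by auto
  have "prime (int p)" using p by simp
  then have "coprime (int p) c" using c(2) by (simp add: prime_imp_coprime)
  then have "coprime c (int p ^ m)" by (simp add: coprime_commute)
  then obtain u v where uv: "u * c + v * int p ^ m = 1" using bezout_int[of c "int p ^ m"] by auto
  define q :: rat where "q = of_int (a * u) / of_int (int p ^ m)"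
  have "a * u * c + a * v * int p ^ m = a * (u * c + v * int p ^ m)" by (simp add: algebra_simps)
  then have a_eq: "a * u * c + a * v * int p ^ m = a" unfolding uv by simp
  have "y - q = of_int (a * v) / of_int c"
  proof -
    have "(of_int a :: rat) = of_int (a * u) * of_int c + of_int (a * v) * of_int (int p ^ m)"
      using a_eq by (metis of_int_add of_int_mult)
    moreover have "(of_int b :: rat) = of_int (int p ^ m) * of_int c" unfolding bc by simp
    moreover have "(of_int (int p ^ m) :: rat) \<noteq> 0" "(of_int c :: rat) \<noteq> 0" using c0 p0 by auto
    ultimately show ?thesis unfolding y q_def by (simp only: diff_divide_distrib add_divide_distrib) simp
  qed
  then have "padic_abs p (y - q) \<le> 1" using padic_abs_le_1[OF p c(2), of "a * v"] by simp
  moreover have "padic_abs l q \<le> 1" if l: "prime l" "l \<noteq> p" for l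
  proof -
    have "\<not> int l dvd int p ^ m" using l p by (metis int_dvd_int_iff of_nat_power prime_dvd_power primes_dvd_imp_eq)
    then show ?thesis unfolding q_def by (rule padic_abs_le_1[OF l(1)])
  qed
  ultimately show thesis using that by blast
qed

text \<open>A late term of a Cauchy sequence is within distance 1 of the \<open>p\<close>-adic
  component; its principal part does the rest without disturbing other primes.\<close>

lemma adele_local_approximation:
  assumes p: "prime p"
  obtains q where "adele_padic (x - adele_of_rat q) p \<in> Z_p p"
    "\<And>l. prime l \<Longrightarrow> l \<noteq> p \<Longrightarrow> adele_padic (adele_of_rat q) l \<in> Z_p l"
proof -
  define X where "X = adele_padic x p"
  have X: "X \<in> carrier (Q_p p)" unfolding X_def by (rule adele_padic_closed[OF p])
  obtain f where f: "padic_Cauchy p f" "X = padic_null_ideal p +>\<^bsub>padic_Cauchy_ring p\<^esub> f"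
    using Q_p_elemE[OF p X] .
  obtain N where N: "\<And>m n. m \<ge> N \<Longrightarrow> n \<ge> N \<Longrightarrow> padic_abs p (f m - f n) < 1"
    using f(1)[unfolded padic_Cauchy_def, THEN spec[of _ 1]] by auto
  obtain q where q: "padic_abs p (f N - q) \<le> 1" "\<And>l. prime l \<Longrightarrow> l \<noteq> p \<Longrightarrow> padic_abs l q \<le> 1"
    using padic_principal_part[OF p] by blast
  have "padic_abs p (f n + - q) \<le> 1" if "n \<ge> N" for n
  proof -
    have "padic_abs p ((f n - f N) + (f N - q)) \<le> max (padic_abs p (f n - f N)) (padic_abs p (f N - q))"
      by (rule padic_abs_add[OF p])
    also have "\<dots> \<le> 1" using N[OF that order_refl] q(1) by simp
    finally show ?thesis by simp
  qed
  then have ev: "\<forall>n\<ge>N. padic_abs p (f n + - q) \<le> 1" by blast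
  have eq: "adele_padic (x - adele_of_rat q) p = padic_null_ideal p +>\<^bsub>padic_Cauchy_ring p\<^esub> (\<lambda>n. f n + - q)"
  proof -
    have "x - adele_of_rat q = x + adele_of_rat (- q)" by (simp add: adele_of_rat_hom.hom_uminus)
    then have "adele_padic (x - adele_of_rat q) p = X \<oplus>\<^bsub>Q_p p\<^esub> Q_p_of_rat p (- q)"
      by (simp only: adele_padic_simps[OF p] X_def adele_of_rat_mk adele_padic_mk[OF p])
    then show ?thesis unfolding f(2) Q_p_of_rat_def using Q_p_add_coset[OF p f(1) padic_Cauchy_const] by simp
  qed
  have C: "padic_Cauchy p (\<lambda>n. f n + - q)" by (rule padic_Cauchy_add[OF p f(1) padic_Cauchy_const])
  have "Q_p_abs p (adele_padic (x - adele_of_rat q) p) \<le> 1"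
    unfolding eq by (rule LIMSEQ_le_const2[OF Q_p_abs_coset[OF p C]]) (use ev in blast)
  then have "adele_padic (x - adele_of_rat q) p \<in> Z_p p"
    unfolding Z_p_def using adele_padic_closed[OF p] by blast
  moreover have "adele_padic (adele_of_rat q) l \<in> Z_p l" if "prime l" "l \<noteq> p" for l
    using q(2)[OF that] that(1) by (simp add: adele_of_rat_mk Z_p_def Q_p_of_rat_closed Q_p_abs_of_rat)
  ultimately show thesis using that by blast
qed

lemma adele_finite_bad: "finite {p. prime p \<and> adele_padic x p \<notin> Z_p p}"
  by transfer (auto simp: finite_adeles_def)

text \<open>Strong approximation for the additive group, by induction on the number of non-integral
  places: removing one principal part leaves integrality elsewhere unchanged.\<close>

lemma adele_approximation: "\<exists>q. zint (x - adele_of_rat q)"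
proof (induction "card {p. prime p \<and> adele_padic x p \<notin> Z_p p}" arbitrary: x)
  case 0
  then have "{p. prime p \<and> adele_padic x p \<notin> Z_p p} = {}" using adele_finite_bad[of x] by simp
  then have "zint x" unfolding zint_def by blast
  then show ?case by (intro exI[of _ 0]) simp
next
  case (Suc n)
  then have "{p. prime p \<and> adele_padic x p \<notin> Z_p p} \<noteq> {}" by (metis card.empty nat.distinct(1))
  then obtain p where p: "prime p" "adele_padic x p \<notin> Z_p p" by blast
  obtain q where q: "adele_padic (x - adele_of_rat q) p \<in> Z_p p"
    "\<And>l. prime l \<Longrightarrow> l \<noteq> p \<Longrightarrow> adele_padic (adele_of_rat q) l \<in> Z_p l"
    using adele_local_approximation[OF p(1)] by blast
  have iff: "adele_padic (x - adele_of_rat q) l \<in> Z_p l \<longleftrightarrow> adele_padic x l \<in> Z_p l"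
    if l: "prime l" "l \<noteq> p" for l
  proof -
    have ql: "adele_padic (- adele_of_rat q) l \<in> Z_p l"
      using Z_p_uminus[OF l(1) q(2)[OF l]] l(1) by simp
    have "adele_padic (x - adele_of_rat q) l \<in> Z_p l" if "adele_padic x l \<in> Z_p l"
      using Z_p_add[OF l(1) that ql] unfolding adele_padic_simps(3)[OF l(1), symmetric] by simp
    moreover have "adele_padic x l \<in> Z_p l" if "adele_padic (x - adele_of_rat q) l \<in> Z_p l"
    proof -
      have "adele_padic ((x - adele_of_rat q) + adele_of_rat q) l \<in> Z_p l"
        unfolding adele_padic_simps(3)[OF l(1)] by (rule Z_p_add[OF l(1) that q(2)[OF l]])
      then show ?thesis by simp
    qed
    ultimately show ?thesis by blast
  qed
  have "{l. prime l \<and> adele_padic (x - adele_of_rat q) l \<notin> Z_p l} = {l. prime l \<and> adele_padic x l \<notin> Z_p l} - {p}"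
    using iff q(1) by blast
  then have "card {l. prime l \<and> adele_padic (x - adele_of_rat q) l \<notin> Z_p l} = n"
    using Suc.hyps(2) adele_finite_bad[of x] p by (simp add: card_Diff_singleton)
  then obtain s where s: "zint (x - adele_of_rat q - adele_of_rat s)" using Suc.hyps(1) by blast
  have "x - adele_of_rat (q + s) = x - adele_of_rat q - adele_of_rat s"
    by (simp add: adele_of_rat_hom.hom_add)
  then show ?case using s by metis
qed

lemma adele_denominator: "\<exists>N::int. N > 0 \<and> zint (of_int N * x)"
proof -
  obtain q where q: "zint (x - adele_of_rat q)" using adele_approximation by blast
  obtain a b where ab: "quotient_of q = (a, b)" by (cases "quotient_of q") auto
  have b: "b > 0" and qe: "q = of_int a / of_int b"
    using quotient_of_denom_pos[OF ab] quotient_of_div[OF ab] by auto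
  have "of_int b * x = of_int b * (x - adele_of_rat q) + of_int b * adele_of_rat q" by (simp add: algebra_simps)
  also have "of_int b * adele_of_rat q = adele_of_rat (of_int b * q)"
    by (simp add: adele_of_int adele_of_rat_hom.hom_mult)
  also have "of_int b * q = of_int a" using b qe by simp
  finally have "zint (of_int b * x)" using zint_add[OF zint_mult[OF zint_of_int q] zint_of_int_rat] by simp
  then show ?thesis using b by blast
qed

lemma adele_mat_denominator: "\<exists>N::int. N > 0 \<and> zint_mat (of_int N \<cdot>\<^sub>m A)"
proof -
  obtain f where f: "\<And>ij. f ij > (0::int) \<and> zint (of_int (f ij) * A $$ ij)"
    using choice[of "\<lambda>ij N. N > 0 \<and> zint (of_int N * A $$ ij)"] adele_denominator by blast
  define I where "I = {..<dim_row A} \<times> {..<dim_col A}"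
  define N where "N = (\<Prod>ij\<in>I. f ij)"
  have "zint (of_int N * A $$ (i, j))" if "i < dim_row A" "j < dim_col A" for i j
  proof -
    have "N = (\<Prod>ij\<in>I - {(i, j)}. f ij) * f (i, j)"
      unfolding N_def using that by (subst prod.remove[of I "(i, j)"]) (auto simp: I_def)
    then have "of_int N * A $$ (i, j) = of_int (\<Prod>ij\<in>I - {(i, j)}. f ij) * (of_int (f (i, j)) * A $$ (i, j))"
      by (simp add: mult.assoc)
    then show ?thesis using f[of "(i, j)"] by (metis zint_mult zint_of_int)
  qed
  moreover have "N > 0" unfolding N_def using f by (intro prod_pos) auto
  ultimately show ?thesis unfolding zint_mat_def by (intro exI[of _ N]) auto
qed

section \<open>The idele norm\<close>

lemma prod_padic_int:
  assumes a: "a \<noteq> 0" and S: "finite S" "{p. prime p \<and> int p dvd a} \<subseteq> S" "\<And>p. p \<in> S \<Longrightarrow> prime p"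
  shows "(\<Prod>p\<in>S. real p ^ multiplicity (int p) a) = \<bar>real_of_int a\<bar>"
proof -
  define n where "n = nat \<bar>a\<bar>"
  have n: "n \<noteq> 0" using a by (simp add: n_def)
  have dvd: "int p ^ k dvd a \<longleftrightarrow> p ^ k dvd n" for p k
  proof -
    have "int p ^ k dvd a \<longleftrightarrow> int (p ^ k) dvd \<bar>a\<bar>" by simp
    also have "\<dots> \<longleftrightarrow> p ^ k dvd n" unfolding n_def by (metis abs_ge_zero int_dvd_int_iff int_nat_eq)
    finally show ?thesis .
  qed
  have mult: "multiplicity (int p) a = multiplicity p n" for p
    unfolding multiplicity_def using dvd a n by simp
  have sub: "prime_factors n \<subseteq> S"
  proof
    fix p assume "p \<in> prime_factors n"
    then have "prime p" "p dvd n" by auto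
    then show "p \<in> S" using S(2) dvd[of p 1] by auto
  qed
  have "(\<Prod>p\<in>S. p ^ multiplicity p n) = (\<Prod>p\<in>prime_factors n. p ^ multiplicity p n)"
  proof (rule prod.mono_neutral_right[OF S(1) sub], intro ballI)
    fix p assume p: "p \<in> S - prime_factors n"
    then have "\<not> p dvd n" using S(3)[of p] n by (auto simp: in_prime_factors_iff)
    then show "p ^ multiplicity p n = 1" by (simp add: not_dvd_imp_multiplicity_0)
  qed
  also have "\<dots> = n" using prod_prime_factors[OF n] by simp
  finally have "real (\<Prod>p\<in>S. p ^ multiplicity p n) = real n" by simp
  then show ?thesis unfolding mult by (simp add: n_def)
qed

text \<open>Product formula: the finite places contribute the inverse of the real absolute value of
  \<open>q\<close>.\<close>

lemma adele_abs_mk: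
  assumes q: "q \<noteq> 0"
  shows "adele_abs (adele_mk t q) = \<bar>t\<bar> / \<bar>of_rat q\<bar>"
proof -
  obtain a b where ab: "a \<noteq> 0" "b \<noteq> 0" "q = of_int a / of_int b" by (rule rat_fractE[OF q])
  define S where "S = {p. prime p \<and> (int p dvd a \<or> int p dvd b)}"
  have "finite {p :: nat. int p dvd c}" if "c \<noteq> 0" for c :: int
  proof (rule finite_subset)
    show "{p :: nat. int p dvd c} \<subseteq> {..nat \<bar>c\<bar>}"
    proof
      fix p assume "p \<in> {p :: nat. int p dvd c}"
      then have "\<bar>int p\<bar> \<le> \<bar>c\<bar>" using dvd_imp_le_int[OF that] by blast
      then show "p \<in> {..nat \<bar>c\<bar>}" by simp
    qed
  qed simp
  then have S: "finite S" using ab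
    by (auto simp: S_def intro!: finite_subset[of _ "{p :: nat. int p dvd a} \<union> {p. int p dvd b}"])
  have abs: "padic_abs p q = real p ^ multiplicity (int p) b / real p ^ multiplicity (int p) a" if "prime p" for p
    unfolding ab(3) padic_abs_fract[OF that ab(1,2)] using that by (subst power_int_diff) (auto simp: prime_gt_0_nat)
  have "(\<Prod>p | prime p \<and> padic_abs p q \<noteq> 1. padic_abs p q) = (\<Prod>p\<in>S. padic_abs p q)"
  proof (rule prod.mono_neutral_left[OF S])
    show "{p. prime p \<and> padic_abs p q \<noteq> 1} \<subseteq> S"
    proof
      fix p assume "p \<in> {p. prime p \<and> padic_abs p q \<noteq> 1}"
      then have p: "prime p" "padic_abs p q \<noteq> 1" by auto
      have "padic_abs p q = 1" if "\<not> int p dvd a" "\<not> int p dvd b"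
        unfolding abs[OF p(1)] not_dvd_imp_multiplicity_0[OF that(1)] not_dvd_imp_multiplicity_0[OF that(2)] by simp
      then show "p \<in> S" using p by (auto simp: S_def)
    qed
  qed (auto simp: S_def)
  also have "\<dots> = (\<Prod>p\<in>S. real p ^ multiplicity (int p) b / real p ^ multiplicity (int p) a)"
    using abs by (intro prod.cong) (auto simp: S_def)
  also have "\<dots> = \<bar>real_of_int b\<bar> / \<bar>real_of_int a\<bar>"
    unfolding prod_dividef using ab S by (subst (1 2) prod_padic_int) (auto simp: S_def)
  also have "\<dots> = 1 / \<bar>of_rat q\<bar>" unfolding ab(3) by (simp add: of_rat_divide)
  finally have prod: "(\<Prod>p | prime p \<and> padic_abs p q \<noteq> 1. padic_abs p q) = 1 / \<bar>of_rat q\<bar>" .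
  have set: "{p. prime p \<and> Q_p_abs p (adele_padic (adele_mk t q) p) \<noteq> 1} = {p. prime p \<and> padic_abs p q \<noteq> 1}"
    by (auto simp: Q_p_abs_of_rat)
  have "adele_abs (adele_mk t q) = \<bar>t\<bar> * (\<Prod>p | prime p \<and> padic_abs p q \<noteq> 1. Q_p_abs p (adele_padic (adele_mk t q) p))"
    unfolding adele_abs_def set by simp
  also have "(\<Prod>p | prime p \<and> padic_abs p q \<noteq> 1. Q_p_abs p (adele_padic (adele_mk t q) p)) = 1 / \<bar>of_rat q\<bar>"
    unfolding prod[symmetric] by (intro prod.cong) (auto simp: Q_p_abs_of_rat)
  finally show ?thesis by simp
qed

lemma adele_abs_eqI:
  assumes "\<bar>adele_real x\<bar> = \<bar>adele_real y\<bar>"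
    "\<And>p. prime p \<Longrightarrow> Q_p_abs p (adele_padic x p) = Q_p_abs p (adele_padic y p)"
  shows "adele_abs x = adele_abs y"
proof -
  have "{p. prime p \<and> Q_p_abs p (adele_padic x p) \<noteq> 1} = {p. prime p \<and> Q_p_abs p (adele_padic y p) \<noteq> 1}"
    using assms(2) by auto
  then show ?thesis unfolding adele_abs_def using assms by (auto intro!: arg_cong2[where f = "(*)"] prod.cong)
qed

lemma Q_p_abs_zint_mult_le:
  assumes p: "prime p" and u: "zint u"
  shows "Q_p_abs p (adele_padic (x * u) p) \<le> Q_p_abs p (adele_padic x p)"
proof -
  have "Q_p_abs p (adele_padic u p) \<le> 1" using u p by (auto simp: zint_def Z_p_def)
  moreover have "Q_p_abs p (adele_padic (x * u) p) = Q_p_abs p (adele_padic x p) * Q_p_abs p (adele_padic u p)"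
    using p by (simp add: Q_p_abs_mult adele_padic_closed)
  ultimately show ?thesis
    using Q_p_abs_nonneg[OF p adele_padic_closed[OF p, of x]] by (simp add: mult_left_le)
qed

section \<open>The special linear group and the lattice of an adelic matrix\<close>

lemma SL_carrier: "g \<in> SL r \<Longrightarrow> g \<in> carrier_mat r r"
  by (simp add: SL_def)

lemma SL_adj:
  assumes "g \<in> SL r"
  shows "adj_mat g \<in> carrier_mat r r" "g * adj_mat g = 1\<^sub>m r" "adj_mat g * g = 1\<^sub>m r" "adj_mat g \<in> SL r"
proof -
  have g: "g \<in> carrier_mat r r" "det g = 1" using assms by (auto simp: SL_def)
  show a: "adj_mat g \<in> carrier_mat r r" by (rule adj_mat(1)[OF g(1)])
  show e: "g * adj_mat g = 1\<^sub>m r" "adj_mat g * g = 1\<^sub>m r" using adj_mat(2,3)[OF g(1)] g(2) by auto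
  have "det g * det (adj_mat g) = 1" using det_mult[OF g(1) a] e(1) by simp
  then show "adj_mat g \<in> SL r" using a g(2) by (simp add: SL_def)
qed

lemma SL_mult: "g \<in> SL r \<Longrightarrow> g' \<in> SL r \<Longrightarrow> g * g' \<in> SL r"
  by (auto simp: SL_def det_mult[of _ r])

lemma SL_inverse_unique:
  assumes g: "g \<in> SL r" and k: "k \<in> carrier_mat r r" and e: "g * k = 1\<^sub>m r"
  shows "k = adj_mat g"
proof -
  have "adj_mat g * (g * k) = (adj_mat g * g) * k"
    using assoc_mult_mat[OF SL_adj(1)[OF g] SL_carrier[OF g] k] by simp
  then show ?thesis using SL_adj[OF g] k e by simp
qed

text \<open>For determinant one the adjugate is the inverse. It makes sense over the adeles, which
  are not a field, and is compatible with ring homomorphisms.\<close>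

lemma mat_inv_SL:
  assumes g: "g \<in> SL r"
  shows "mat_inv g = adj_mat g"
proof -
  have d: "dim_row g = r" using SL_carrier[OF g] by simp
  have "(\<lambda>k. k \<in> carrier_mat r r \<and> inverts_mat g k \<and> inverts_mat k g) (adj_mat g)"
    using SL_adj[OF g] d by (auto simp: inverts_mat_def)
  then show ?thesis unfolding mat_inv_def d
    by (rule the_equality) (use SL_inverse_unique[OF g] d in \<open>auto simp: inverts_mat_def\<close>)
qed

lemma SL_adele_real: "g \<in> SL r \<Longrightarrow> map_mat adele_real g \<in> SL r"
  by (auto simp: SL_def)

lemma SL_adele_of_rat: "g \<in> SL r \<Longrightarrow> map_mat adele_of_rat g \<in> SL r"
  by (auto simp: SL_def)

lemma adj_adele_real: "g \<in> SL r \<Longrightarrow> map_mat adele_real (adj_mat g) = adj_mat (map_mat adele_real g)"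
  using adele_real_hom.mat_hom_mult[OF SL_carrier SL_adj(1), of g r g]
  by (intro SL_inverse_unique[OF SL_adele_real]) (auto simp: SL_adj adele_real_hom.mat_hom_one)

lemma adj_adele_of_rat: "g \<in> SL r \<Longrightarrow> map_mat adele_of_rat (adj_mat g) = adj_mat (map_mat adele_of_rat g)"
  using adele_of_rat_hom.mat_hom_mult[OF SL_carrier SL_adj(1), of g r g]
  by (intro SL_inverse_unique[OF SL_adele_of_rat]) (auto simp: SL_adj adele_of_rat_hom.mat_hom_one)

lemma adj_mult: "g \<in> SL r \<Longrightarrow> g' \<in> SL r \<Longrightarrow> adj_mat (g * g') = adj_mat g' * adj_mat g"
proof -
  assume g: "g \<in> SL r" and g': "g' \<in> SL r"
  have "(g * g') * (adj_mat g' * adj_mat g) = g * ((g' * adj_mat g') * adj_mat g)"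
    using SL_carrier[OF g] SL_carrier[OF g'] SL_adj(1)[OF g] SL_adj(1)[OF g']
    by (simp add: assoc_mult_mat[of _ r r _ r _ r])
  also have "\<dots> = 1\<^sub>m r" using SL_adj[OF g] SL_adj[OF g'] by simp
  finally show ?thesis
    using SL_inverse_unique[OF SL_mult[OF g g'], of "adj_mat g' * adj_mat g"] SL_adj(1)[OF g] SL_adj(1)[OF g'] by simp
qed

lemma adelic_lattice_zint:
  assumes g: "g \<in> SL r"
  shows "adelic_lattice r g =
    {x \<in> carrier_vec r. \<forall>i<r. zint ((adj_mat g *\<^sub>v map_vec adele_of_rat x) $ i)}"
  unfolding adelic_lattice_def mat_inv_SL[OF g] zint_def by blast

lemma adelic_lattice_col:
  assumes g: "g \<in> SL r" and B: "B \<in> carrier_mat r m"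
  shows "(\<forall>j<m. col B j \<in> adelic_lattice r g) \<longleftrightarrow> zint_mat (adj_mat g * map_mat adele_of_rat B)"
proof -
  have "(adj_mat g * map_mat adele_of_rat B) $$ (i, j) = (adj_mat g *\<^sub>v map_vec adele_of_rat (col B j)) $ i"
    if "i < r" "j < m" for i j
  proof -
    have "col (map_mat adele_of_rat B) j = map_vec adele_of_rat (col B j)" using B that by (intro eq_vecI) auto
    then show ?thesis using that B SL_adj(1)[OF g] by simp
  qed
  then show ?thesis
    unfolding adelic_lattice_zint[OF g] zint_mat_def using B SL_adj(1)[OF g] by auto
qed

lemma int_module_adelic_lattice:
  assumes g: "g \<in> SL r"
  shows "int_module r (adelic_lattice r g)"
  unfolding int_module_def
proof (intro conjI ballI allI)
  note a = SL_adj(1)[OF g]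
  show "adelic_lattice r g \<subseteq> carrier_vec r" by (auto simp: adelic_lattice_def)
  have "adj_mat g *\<^sub>v map_vec adele_of_rat (0\<^sub>v r) = 0\<^sub>v r"
    using a by (intro eq_vecI) (auto simp: scalar_prod_def)
  then show "0\<^sub>v r \<in> adelic_lattice r g" by (simp add: adelic_lattice_zint[OF g])
  fix x y and n :: int assume x: "x \<in> adelic_lattice r g" and y: "y \<in> adelic_lattice r g"
  then have c: "x \<in> carrier_vec r" "y \<in> carrier_vec r" by (auto simp: adelic_lattice_def)
  have "map_vec adele_of_rat (x + of_int n \<cdot>\<^sub>v y) = map_vec adele_of_rat x + of_int n \<cdot>\<^sub>v map_vec adele_of_rat y"
    using c by (intro eq_vecI) (auto simp: adele_of_rat_hom.hom_add adele_of_rat_hom.hom_mult adele_of_int)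
  then have "adj_mat g *\<^sub>v map_vec adele_of_rat (x + of_int n \<cdot>\<^sub>v y)
      = adj_mat g *\<^sub>v map_vec adele_of_rat x + of_int n \<cdot>\<^sub>v (adj_mat g *\<^sub>v map_vec adele_of_rat y)"
    using c by (simp add: mult_add_distrib_mat_vec[OF a] mult_mat_smult_vec[OF a])
  then have "(adj_mat g *\<^sub>v map_vec adele_of_rat (x + of_int n \<cdot>\<^sub>v y)) $ i
      = (adj_mat g *\<^sub>v map_vec adele_of_rat x) $ i + of_int n * (adj_mat g *\<^sub>v map_vec adele_of_rat y) $ i"
    if "i < r" for i
    using that a by simp
  then show "x + of_int n \<cdot>\<^sub>v y \<in> adelic_lattice r g"
    using x y c unfolding adelic_lattice_zint[OF g] by (simp add: zint_add zint_mult del: index_mult_mat_vec)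
qed

text \<open>\<open>x\<close> is \<open>g\<close> times a vector integral at the finite places, so a
  common denominator of the entries of \<open>g\<close> works for all \<open>x\<close>.\<close>

lemma bounded_adelic_lattice:
  assumes g: "g \<in> SL r"
  shows "bounded_denominators r (adelic_lattice r g)"
proof -
  note a = SL_adj(1)[OF g] and gc = SL_carrier[OF g]
  obtain N :: int where N: "N > 0" "zint_mat (of_int N \<cdot>\<^sub>m g)" using adele_mat_denominator by blast
  have "of_int N * x $ i \<in> \<int>" if x: "x \<in> adelic_lattice r g" and i: "i < r" for x i
  proof -
    have c: "x \<in> carrier_vec r" using x by (auto simp: adelic_lattice_def)
    define y where "y = adj_mat g *\<^sub>v map_vec adele_of_rat x"
    have y: "y \<in> carrier_vec r" using a c by (auto simp: y_def)
    have "g *\<^sub>v y = map_vec adele_of_rat x"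
      unfolding y_def using assoc_mult_mat_vec[OF gc a, of "map_vec adele_of_rat x"] SL_adj(2)[OF g] c by simp
    then have "adele_of_rat (x $ i) = (\<Sum>j\<in>{0..<r}. g $$ (i, j) * y $ j)"
      using i c gc y by (auto simp: vec_eq_iff scalar_prod_def)
    then have "adele_of_rat (of_int N * x $ i) = (\<Sum>j\<in>{0..<r}. (of_int N * g $$ (i, j)) * y $ j)"
      by (simp add: adele_of_rat_hom.hom_mult adele_of_int sum_distrib_left mult_ac)
    moreover have "zint (\<Sum>j\<in>{0..<r}. (of_int N * g $$ (i, j)) * y $ j)"
    proof (rule zint_sum, rule zint_mult)
      fix j assume "j \<in> {0..<r}"
      then have j: "j < r" by simp
      show "zint (of_int N * g $$ (i, j))" using N(2) i j gc by (auto simp: zint_mat_def)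
      show "zint (y $ j)" using x j unfolding y_def adelic_lattice_zint[OF g] by blast
    qed
    ultimately show ?thesis using zint_of_rat_Ints by metis
  qed
  then show ?thesis unfolding bounded_denominators_def using N(1) by blast
qed

text \<open>An \<open>N\<close> that clears the finite denominators of the inverse of
  \<open>g\<close> puts \<open>N\<close> times every unit vector into the lattice; this gives full
  rank.\<close>

lemma adelic_lattice_scaled_identity:
  assumes g: "g \<in> SL r"
  obtains N :: int where "N > 0" "zint_mat (of_int N \<cdot>\<^sub>m adj_mat g)"
    "\<And>j. j < r \<Longrightarrow> col (of_int N \<cdot>\<^sub>m 1\<^sub>m r) j \<in> adelic_lattice r g"
proof -
  note a = SL_adj(1)[OF g]
  obtain N :: int where N: "N > 0" "zint_mat (of_int N \<cdot>\<^sub>m adj_mat g)" using adele_mat_denominator by blast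
  have "map_mat adele_of_rat (of_int N \<cdot>\<^sub>m 1\<^sub>m r) = of_int N \<cdot>\<^sub>m 1\<^sub>m r"
    by (intro eq_matI) (auto simp: adele_of_int)
  then have "adj_mat g * map_mat adele_of_rat (of_int N \<cdot>\<^sub>m 1\<^sub>m r) = of_int N \<cdot>\<^sub>m adj_mat g"
    using a by (simp add: mult_smult_distrib[OF a, of "1\<^sub>m r" r])
  then have "\<forall>j<r. col (of_int N \<cdot>\<^sub>m 1\<^sub>m r) j \<in> adelic_lattice r g"
    using adelic_lattice_col[OF g, of "of_int N \<cdot>\<^sub>m 1\<^sub>m r" r] N(2) by simp
  then show thesis using that N by blast
qed

text \<open>Since the rationals are dense in the finite adeles, every column of \<open>g\<close> is an integral
  adelic combination of a basis \<open>B\<close> of the lattice.\<close>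

lemma adelic_matrix_factor:
  assumes g: "g \<in> SL r" and B: "B \<in> carrier_mat r k" "zspan B = adelic_lattice r g"
  obtains K where "K \<in> carrier_mat k r" "zint_mat K" "g = map_mat adele_of_rat B * K"
proof -
  note a = SL_adj(1)[OF g] and gc = SL_carrier[OF g]
  obtain N :: int where N: "N > 0" "zint_mat (of_int N \<cdot>\<^sub>m adj_mat g)"
    "\<And>j. j < r \<Longrightarrow> col (of_int N \<cdot>\<^sub>m 1\<^sub>m r) j \<in> adelic_lattice r g"
    using adelic_lattice_scaled_identity[OF g] by blast
  \<comment> \<open>\<open>s\<close> is \<open>1 / N\<close> as an adele: approximating
    \<open>g / N\<close> up to integral adeles approximates \<open>g\<close> up to \<open>N\<close>
    times integral ones.\<close>
  define s where "s = adele_of_rat (1 / of_int N)"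
  have sN: "of_int N * s = 1"
    unfolding s_def adele_of_int adele_of_rat_hom.hom_mult[symmetric] using N(1) by simp
  obtain q where q: "\<And>i j. zint (s * g $$ (i, j) - adele_of_rat (q (i, j)))"
    using choice[of "\<lambda>ij q. zint (s * g $$ ij - adele_of_rat q)"] adele_approximation by (metis (no_types))
  define Y where "Y = mat r r (\<lambda>ij. of_int N * q ij)"
  define E where "E = mat r r (\<lambda>ij. s * g $$ ij - adele_of_rat (q ij))"
  have Y: "Y \<in> carrier_mat r r" and E: "E \<in> carrier_mat r r" by (auto simp: Y_def E_def)
  have zE: "zint_mat E" using q by (auto simp: zint_mat_def E_def)
  have YA: "map_mat adele_of_rat Y = g - of_int N \<cdot>\<^sub>m E"
  proof (rule eq_matI)
    fix i j assume "i < dim_row (g - of_int N \<cdot>\<^sub>m E)" "j < dim_col (g - of_int N \<cdot>\<^sub>m E)"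
    then have ij: "i < r" "j < r" using E by auto
    have "g $$ (i, j) = (of_int N * s) * g $$ (i, j)" unfolding sN by simp
    then have "g $$ (i, j) - of_int N * (s * g $$ (i, j) - adele_of_rat (q (i, j))) = of_int N * adele_of_rat (q (i, j))"
      by (simp add: algebra_simps)
    then show "map_mat adele_of_rat Y $$ (i, j) = (g - of_int N \<cdot>\<^sub>m E) $$ (i, j)"
      using ij gc by (simp add: Y_def E_def adele_of_int adele_of_rat_hom.hom_mult)
  qed (use E Y gc in auto)
  \<comment> \<open>\<open>N\<close> also clears the denominators of the inverse of
    \<open>g\<close>, so the approximation \<open>Y\<close> has its columns in the lattice.\<close>
  have "adj_mat g * map_mat adele_of_rat Y = 1\<^sub>m r - (of_int N \<cdot>\<^sub>m adj_mat g) * E"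
    unfolding YA using a gc E
    by (simp add: mult_minus_distrib_mat[OF a] SL_adj[OF g] mult_smult_distrib[OF a E] mult_smult_assoc_mat[OF a E])
  moreover have "zint_mat (1\<^sub>m r - (of_int N \<cdot>\<^sub>m adj_mat g) * E)"
  proof -
    have P: "zint_mat ((of_int N \<cdot>\<^sub>m adj_mat g) * E)"
      by (rule zint_mat_mult[of _ r r _ r]) (use a E N(2) zE in auto)
    have PE: "(of_int N \<cdot>\<^sub>m adj_mat g) * E \<in> carrier_mat r r"
      by (rule mult_carrier_mat[OF smult_carrier_mat[OF a] E])
    have "zint (1\<^sub>m r $$ (i, j) - ((of_int N \<cdot>\<^sub>m adj_mat g) * E) $$ (i, j))" if "i < r" "j < r" for i j
      unfolding minus_adele_def
      by (intro zint_add zint_uminus zint_matD[OF P PE that]) (use that in simp)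
    then show ?thesis using a E unfolding zint_mat_def by (simp del: index_mult_mat add: index_mult_mat(2,3))
  qed
  ultimately have "\<forall>j<r. col Y j \<in> zspan B" using adelic_lattice_col[OF g Y] B(2) by simp
  then obtain Z1 :: "int mat" where Z1: "Z1 \<in> carrier_mat k r" "Y = B * map_mat of_int Z1"
    using mat_of_cols_in_zspan[OF B(1) Y] by metis
  have I: "of_int N \<cdot>\<^sub>m 1\<^sub>m r \<in> carrier_mat r r" for N :: int by simp
  obtain Z2 :: "int mat" where Z2: "Z2 \<in> carrier_mat k r" "of_int N \<cdot>\<^sub>m 1\<^sub>m r = B * map_mat of_int Z2"
    using mat_of_cols_in_zspan[OF B(1) I[of N]] N(3) B(2) by metis
  define BA where "BA = map_mat adele_of_rat B"
  define ZA1 :: "adele mat" where "ZA1 = map_mat of_int Z1"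
  define ZA2 :: "adele mat" where "ZA2 = map_mat of_int Z2"
  have cs: "BA \<in> carrier_mat r k" "ZA1 \<in> carrier_mat k r" "ZA2 \<in> carrier_mat k r"
    using B Z1 Z2 by (auto simp: BA_def ZA1_def ZA2_def)
  have conv: "map_mat adele_of_rat (B * map_mat of_int Z) = BA * map_mat of_int Z" if "Z \<in> carrier_mat k r" for Z
  proof -
    have "map_mat adele_of_rat (map_mat of_int Z) = (map_mat of_int Z :: adele mat)"
      by (intro eq_matI) (auto simp: adele_of_int)
    then show ?thesis unfolding BA_def using adele_of_rat_hom.mat_hom_mult[OF B(1), of "map_mat of_int Z" r] that by simp
  qed
  have 1: "map_mat adele_of_rat Y = BA * ZA1" unfolding Z1(2) ZA1_def by (rule conv[OF Z1(1)])
  have "of_int N \<cdot>\<^sub>m 1\<^sub>m r = map_mat adele_of_rat (of_int N \<cdot>\<^sub>m 1\<^sub>m r)"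
    by (intro eq_matI) (auto simp: adele_of_int)
  also have "\<dots> = BA * ZA2" unfolding Z2(2) ZA2_def by (rule conv[OF Z2(1)])
  finally have 2: "of_int N \<cdot>\<^sub>m 1\<^sub>m r = BA * ZA2" .
  have "g = (g - of_int N \<cdot>\<^sub>m E) + of_int N \<cdot>\<^sub>m E" using gc E by (intro eq_matI) auto
  also have "of_int N \<cdot>\<^sub>m E = (of_int N \<cdot>\<^sub>m 1\<^sub>m r) * E" using E by (simp add: mult_smult_assoc_mat[of _ r r])
  \<comment> \<open>Both \<open>Y\<close> and \<open>N\<close> times the identity factor through
    \<open>B\<close>, hence so does \<open>g = Y + N E\<close>.\<close>
  finally have "g = BA * ZA1 + BA * ZA2 * E" unfolding 2 YA[symmetric] 1 using E by (metis 1 2 YA left_mult_one_mat mult_smult_assoc_mat one_carrier_mat)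
  also have "\<dots> = BA * (ZA1 + ZA2 * E)"
    using cs E by (simp add: mult_add_distrib_mat[of _ r k _ r] assoc_mult_mat[of _ r k _ r _ r])
  finally have "g = BA * (ZA1 + ZA2 * E)" .
  moreover have "zint_mat (ZA1 + ZA2 * E)"
  proof -
    have "zint_mat ZA2" by (auto simp: zint_mat_def ZA2_def)
    then have P: "zint_mat (ZA2 * E)" using zint_mat_mult[OF cs(3) E] zE by blast
    have "zint (ZA1 $$ (i, j) + (ZA2 * E) $$ (i, j))" if "i < k" "j < r" for i j
      by (rule zint_add) (use P that cs E Z1 in \<open>auto simp: zint_mat_def ZA1_def simp del: index_mult_mat(1)\<close>)
    then show ?thesis using cs E unfolding zint_mat_def by (simp del: index_mult_mat(1))
  qed
  moreover have "ZA1 + ZA2 * E \<in> carrier_mat k r" using cs E by simp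
  ultimately show thesis using that unfolding BA_def by blast
qed

lemma upper_triangular_mult:
  fixes A :: "'a :: comm_ring_1 mat"
  assumes A: "A \<in> carrier_mat n n" "upper_triangular A" and B: "B \<in> carrier_mat n n" "upper_triangular B"
  shows "upper_triangular (A * B)" "\<And>i. i < n \<Longrightarrow> (A * B) $$ (i, i) = A $$ (i, i) * B $$ (i, i)"
proof -
  have e: "(A * B) $$ (i, j) = (\<Sum>l\<in>{0..<n}. A $$ (i, l) * B $$ (l, j))" if "i < n" "j < n" for i j
    using that A(1) B(1) by (simp add: scalar_prod_def)
  have Az: "A $$ (i, j) = 0" if "j < i" "i < n" for i j using A that by auto
  have Bz: "B $$ (i, j) = 0" if "j < i" "i < n" for i j using B that by auto
  show "upper_triangular (A * B)"
  proof
    fix i j assume ji: "j < i" and "i < dim_row (A * B)"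
    then have i: "i < n" using A(1) by simp
    have "A $$ (i, l) * B $$ (l, j) = 0" if "l < n" for l
      using Az[of l i] Bz[of j l] ji i that by (cases "l < i") auto
    then show "(A * B) $$ (i, j) = 0" using e[of i j] ji i by simp
  qed
  fix i assume i: "i < n"
  have "(\<Sum>l\<in>{0..<n}. A $$ (i, l) * B $$ (l, i)) = (\<Sum>l\<in>{i}. A $$ (i, l) * B $$ (l, i))"
  proof (rule sum.mono_neutral_right)
    show "\<forall>l\<in>{0..<n} - {i}. A $$ (i, l) * B $$ (l, i) = 0"
    proof
      fix l assume "l \<in> {0..<n} - {i}"
      then show "A $$ (i, l) * B $$ (l, i) = 0" using Az[of l i] Bz[of i l] i by (cases "l < i") auto
    qed
  qed (use i in auto)
  then show "(A * B) $$ (i, i) = A $$ (i, i) * B $$ (i, i)" using e[OF i i] by simp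
qed

lemma det_upper: "A \<in> carrier_mat n n \<Longrightarrow> upper_triangular A \<Longrightarrow> det A = (\<Prod>i<n. A $$ (i, i) :: 'a :: comm_ring_1)"
  using det_upper_triangular[of A n] by (simp add: prod_list_diag_prod lessThan_atLeast0)

text \<open>Only the sign of the last column is adjusted, which affects no span of initial
  columns.\<close>

lemma normalize_det:
  fixes B :: "rat mat"
  assumes B: "B \<in> carrier_mat r r" and d: "det B = of_int s" "\<bar>s\<bar> = 1" and r: "r > 0"
  obtains \<beta> where "\<beta> \<in> carrier_mat r r" "det \<beta> = 1" "upper_triangular B \<Longrightarrow> upper_triangular \<beta>"
    "\<And>i. i \<le> r \<Longrightarrow> zspan (first_cols i \<beta>) = zspan (first_cols i B)"
proof -
  define D :: "rat mat" where "D = mat r r (\<lambda>(i, j). if i = j then (if j = r - 1 then of_int s else 1) else 0)"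
  have D: "D \<in> carrier_mat r r" "upper_triangular D" by (auto simp: D_def upper_triangular_def)
  have ss: "s * s = 1" using d(2) by (metis abs_mult_self_eq mult_1)
  have "det D = (\<Prod>i<r. if i = r - 1 then of_int s else 1)"
    unfolding det_upper[OF D] by (intro prod.cong) (auto simp: D_def)
  then have dD: "det D = of_int s" using r by (simp add: prod.delta)
  define \<beta> where "\<beta> = B * D"
  have \<beta>: "\<beta> \<in> carrier_mat r r" using B D by (simp add: \<beta>_def)
  have "det \<beta> = of_int (s * s)" unfolding \<beta>_def det_mult[OF B D(1)] d(1) dD by simp
  then have det: "det \<beta> = 1" unfolding ss by simp
  have ent: "\<beta> $$ (i, j) = (if j = r - 1 then of_int s * B $$ (i, j) else B $$ (i, j))" if "i < r" "j < r" for i j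
  proof -
    have "\<beta> $$ (i, j) = (\<Sum>l\<in>{0..<r}. B $$ (i, l) * D $$ (l, j))"
      unfolding \<beta>_def using that B D(1) by (simp add: scalar_prod_def)
    also have "\<dots> = (\<Sum>l\<in>{j}. B $$ (i, l) * D $$ (l, j))"
      using that by (intro sum.mono_neutral_right) (auto simp: D_def)
    finally show ?thesis using that by (simp add: D_def)
  qed
  have sub: "zspan (first_cols i C) \<subseteq> zspan (first_cols i E)"
    if C: "C \<in> carrier_mat r r" and E: "E \<in> carrier_mat r r" and i: "i \<le> r"
      and CE: "\<And>j. j < r \<Longrightarrow> col C j = col E j \<or> col C j = of_int s \<cdot>\<^sub>v col E j" for C E :: "rat mat" and i
  proof (rule zspan_subset[OF int_module_zspan[OF first_cols_carrier[OF E]] first_cols_carrier[OF C]])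
    fix j assume j: "j < i"
    have fc: "col (first_cols i C) j = col C j" "col (first_cols i E) j = col E j"
      using C E j i by (auto simp: first_cols_def intro!: eq_vecI)
    have "col E j \<in> zspan (first_cols i E)" using col_in_zspan[OF first_cols_carrier[OF E] j] fc by simp
    then show "col (first_cols i C) j \<in> zspan (first_cols i E)"
      unfolding fc using CE[of j] j i int_module_smult[OF int_module_zspan[OF first_cols_carrier[OF E]]] by auto
  qed
  have c1: "col \<beta> j = col B j \<or> col \<beta> j = of_int s \<cdot>\<^sub>v col B j" if "j < r" for j
    using that B \<beta> ent by (cases "j = r - 1") (auto intro!: eq_vecI)
  have c2: "col B j = col \<beta> j \<or> col B j = of_int s \<cdot>\<^sub>v col \<beta> j" if j: "j < r" for j
  proof (cases "col \<beta> j = col B j")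
    case False
    then have "col \<beta> j = of_int s \<cdot>\<^sub>v col B j" using c1[OF j] by blast
    then have "of_int s \<cdot>\<^sub>v col \<beta> j = of_int (s * s) \<cdot>\<^sub>v col B j" by (simp add: smult_smult_assoc)
    then show ?thesis unfolding ss by simp
  qed simp
  have "zspan (first_cols i \<beta>) = zspan (first_cols i B)" if i: "i \<le> r" for i
    using sub[OF \<beta> B i c1] sub[OF B \<beta> i c2] by blast
  moreover have "upper_triangular \<beta>" if "upper_triangular B"
    unfolding \<beta>_def by (rule upper_triangular_mult(1)[OF B that D])
  ultimately show thesis using that[OF \<beta> det] by blast
qed

text \<open>Class number one: a triangular basis \<open>B\<close> satisfies \<open>g = B K\<close>
  with \<open>K\<close> integral at the finite places, while the inverse of \<open>g\<close> times
  \<open>B\<close> is integral by membership in the lattice. So \<open>det B\<close> and its inverse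
  are integers, and a sign change makes the determinant 1.\<close>

lemma adelic_triangular_basis:
  assumes g: "g \<in> SL r" and r: "r > 0"
  obtains \<beta> where "\<beta> \<in> carrier_mat r r" "det \<beta> = 1" "upper_triangular \<beta>" "zspan \<beta> = adelic_lattice r g"
    "\<And>i. i \<le> r \<Longrightarrow> zspan (first_cols i \<beta>) = coord_flag r (adelic_lattice r g) i"
proof -
  define \<Lambda> where "\<Lambda> = adelic_lattice r g"
  have T: "int_module r \<Lambda>" unfolding \<Lambda>_def by (rule int_module_adelic_lattice[OF g])
  have bd: "bounded_denominators r \<Lambda>" unfolding \<Lambda>_def by (rule bounded_adelic_lattice[OF g])
  obtain N :: int where N: "N > 0" "\<And>j. j < r \<Longrightarrow> col (of_int N \<cdot>\<^sub>m 1\<^sub>m r) j \<in> \<Lambda>"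
    using adelic_lattice_scaled_identity[OF g] unfolding \<Lambda>_def by metis
  \<comment> \<open>\<open>N\<close> times the \<open>i\<close>-th unit vector has its last non-zero
    coordinate at \<open>i\<close>.\<close>
  have full: "\<exists>x\<in>\<Lambda>. x $ i \<noteq> 0 \<and> (\<forall>j\<in>{i<..<r}. x $ j = 0)" if i: "i < r" for i
    using N(2)[OF i] N(1) i by (intro bexI[of _ "col (of_int N \<cdot>\<^sub>m 1\<^sub>m r) i"]) auto
  obtain B where B: "B \<in> carrier_mat r r" "mat_inj B" "zspan B = \<Lambda>"
    "\<And>i. i \<le> r \<Longrightarrow> zspan (first_cols i B) = coord_flag r \<Lambda> i" "upper_triangular B"
    using triangular_basis[OF T bd full] by blast
  have dB: "det B \<noteq> 0"
    using mat_inj_iff_gram[OF B(1)] B(2) gram_mult[of "1\<^sub>m r" r r B] B(1) by (auto simp: gram_def det_mult[of _ r] det_transpose)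
  define BA where "BA = map_mat adele_of_rat B"
  have BA: "BA \<in> carrier_mat r r" using B by (simp add: BA_def)
  have detBA: "det BA = adele_of_rat (det B)" unfolding BA_def using B(1) by simp
  obtain K where K: "K \<in> carrier_mat r r" "zint_mat K" "g = BA * K"
    using adelic_matrix_factor[OF g B(1)] B(3) unfolding \<Lambda>_def BA_def by blast
  have "det BA * det K = 1" using g det_mult[OF BA K(1)] K(3) by (simp add: SL_def)
  then have "adele_of_rat (1 / det B) * (det BA * det K) = adele_of_rat (1 / det B)" by simp
  then have "adele_of_rat (1 / det B * det B) * det K = adele_of_rat (1 / det B)"
    unfolding detBA by (simp only: adele_of_rat_hom.hom_mult mult.assoc)
  then have "det K = adele_of_rat (1 / det B)" using dB by simp
  then have 1: "1 / det B \<in> \<int>" using zint_det[OF K(2)] zint_of_rat_Ints by metis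
  have "zint_mat (adj_mat g * BA)"
    using adelic_lattice_col[OF g B(1)] col_in_zspan[OF B(1)] B(3) unfolding \<Lambda>_def BA_def by blast
  then have "zint (det (adj_mat g * BA))" by (rule zint_det)
  moreover have "det (adj_mat g * BA) = adele_of_rat (det B)"
    using det_mult[OF SL_adj(1)[OF g] BA] SL_adj(4)[OF g] detBA by (simp add: SL_def)
  ultimately have 2: "det B \<in> \<int>" using zint_of_rat_Ints by metis
  obtain m n :: int where mn: "det B = of_int m" "1 / det B = of_int n" using 1 2 by (elim Ints_cases)
  then have "of_int (m * n) = (1 :: rat)" using dB by (simp add: field_simps)
  then have "m * n = 1" by (simp only: of_int_eq_1_iff)
  then have m: "m = 1 \<or> m = - 1" using zmult_eq_1_iff by auto
  then have "\<bar>m\<bar> = 1" by auto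
  then obtain \<beta> where \<beta>: "\<beta> \<in> carrier_mat r r" "det \<beta> = 1" "upper_triangular B \<Longrightarrow> upper_triangular \<beta>"
    "\<And>i. i \<le> r \<Longrightarrow> zspan (first_cols i \<beta>) = zspan (first_cols i B)"
    using normalize_det[OF B(1) mn(1) _ r] by blast
  have "zspan \<beta> = zspan B"
    using \<beta>(4)[of r] by (simp add: first_cols_all[OF \<beta>(1)] first_cols_all[OF B(1)])
  then show thesis using that[OF \<beta>(1,2) \<beta>(3)[OF B(5)]] \<beta>(4) B(3,4) unfolding \<Lambda>_def by simp
qed

section \<open>The Iwasawa decomposition\<close>

lemma maximal_compact_zint:
  "k \<in> maximal_compact r \<longleftrightarrow> k \<in> SL r \<and> zint_mat k \<and>
     transpose_mat (map_mat adele_real k) * map_mat adele_real k = 1\<^sub>m r"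
  unfolding maximal_compact_def zint_mat_def zint_def SL_def by auto

lemma orthogonal_adj:
  fixes Q :: "real mat"
  assumes Q: "Q \<in> SL r" "transpose_mat Q * Q = 1\<^sub>m r"
  shows "adj_mat Q = transpose_mat Q" "Q * transpose_mat Q = 1\<^sub>m r"
proof -
  have c: "Q \<in> carrier_mat r r" "transpose_mat Q \<in> carrier_mat r r" using Q(1) by (auto simp: SL_def)
  show 1: "Q * transpose_mat Q = 1\<^sub>m r" by (rule mat_mult_left_right_inverse[OF c(2,1) Q(2)])
  show "adj_mat Q = transpose_mat Q" using SL_inverse_unique[OF Q(1) c(2) 1] by simp
qed

lemma maximal_compact_adj:
  assumes k: "k \<in> maximal_compact r"
  shows "adj_mat k \<in> maximal_compact r"
proof -
  have kk: "k \<in> SL r" "zint_mat k" "transpose_mat (map_mat adele_real k) * map_mat adele_real k = 1\<^sub>m r"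
    using k maximal_compact_zint by auto
  have o: "adj_mat (map_mat adele_real k) = transpose_mat (map_mat adele_real k)"
    "map_mat adele_real k * transpose_mat (map_mat adele_real k) = 1\<^sub>m r"
    using orthogonal_adj[OF SL_adele_real[OF kk(1)] kk(3)] by auto
  have "map_mat adele_real (adj_mat k) = transpose_mat (map_mat adele_real k)"
    using adj_adele_real[OF kk(1)] o(1) by simp
  then show ?thesis
    unfolding maximal_compact_zint using SL_adj(4)[OF kk(1)] zint_adj_mat[OF SL_carrier[OF kk(1)] kk(2)] o(2) by simp
qed

lemma maximal_compact_mult:
  assumes k: "k \<in> maximal_compact r" and l: "l \<in> maximal_compact r"
  shows "k * l \<in> maximal_compact r"
proof -
  have kk: "k \<in> SL r" "zint_mat k" "transpose_mat (map_mat adele_real k) * map_mat adele_real k = 1\<^sub>m r"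
    and ll: "l \<in> SL r" "zint_mat l" "transpose_mat (map_mat adele_real l) * map_mat adele_real l = 1\<^sub>m r"
    using k l maximal_compact_zint by auto
  define A where "A = map_mat adele_real k"
  define B where "B = map_mat adele_real l"
  have A: "A \<in> carrier_mat r r" and B: "B \<in> carrier_mat r r"
    using SL_carrier[OF kk(1)] SL_carrier[OF ll(1)] by (auto simp: A_def B_def)
  have "transpose_mat (A * B) * (A * B) = transpose_mat B * ((transpose_mat A * A) * B)"
    using A B by (simp add: transpose_mult[OF A B] assoc_mult_mat[of _ r r _ r _ r])
  also have "\<dots> = 1\<^sub>m r" using kk(3) ll(3) B by (simp add: A_def[symmetric] B_def[symmetric])
  finally have "transpose_mat (map_mat adele_real (k * l)) * map_mat adele_real (k * l) = 1\<^sub>m r"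
    unfolding A_def B_def using adele_real_hom.mat_hom_mult[OF SL_carrier[OF kk(1)] SL_carrier[OF ll(1)]] by simp
  then show ?thesis unfolding maximal_compact_zint
    using SL_mult[OF kk(1) ll(1)] zint_mat_mult[OF SL_carrier[OF kk(1)] SL_carrier[OF ll(1)] kk(2) ll(2)] by simp
qed

section \<open>Uniqueness of the idele norms and existence of the decomposition\<close>

lemma iwasawa_triangular:
  assumes "iwasawa r g n a k"
  shows "n * a \<in> carrier_mat r r" "upper_triangular (n * a)" "\<And>i. i < r \<Longrightarrow> (n * a) $$ (i, i) = a $$ (i, i)"
    "\<And>i. i < r \<Longrightarrow> \<exists>c. a $$ (i, i) * c = 1"
proof -
  have n: "n \<in> carrier_mat r r" "upper_triangular n" "\<forall>i<r. n $$ (i, i) = 1"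
    and a: "a \<in> carrier_mat r r" "det a = 1" "diagonal_mat a" using assms by (auto simp: iwasawa_def SL_def)
  have ua: "upper_triangular a" using a(1,3) by (auto simp: upper_triangular_def diagonal_mat_def)
  show "n * a \<in> carrier_mat r r" using n a by simp
  show "upper_triangular (n * a)" by (rule upper_triangular_mult(1)[OF n(1,2) a(1) ua])
  show "\<And>i. i < r \<Longrightarrow> (n * a) $$ (i, i) = a $$ (i, i)"
    using upper_triangular_mult(2)[OF n(1,2) a(1) ua] n(3) by simp
  fix i assume i: "i < r"
  have "(\<Prod>i<r. a $$ (i, i)) = 1" using det_upper[OF a(1) ua] a(2) by simp
  then have "a $$ (i, i) * (\<Prod>j\<in>{..<r} - {i}. a $$ (j, j)) = 1" using i by (subst (asm) prod.remove[of _ i]) auto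
  then show "\<exists>c. a $$ (i, i) * c = 1" by blast
qed

text \<open>Solving row by row from below, the entries of \<open>u\<close> under the diagonal vanish
  because the diagonal of \<open>N\<close> is invertible. Invertibility is stated explicitly since
  the adeles have zero divisors.\<close>

lemma triangular_quotient_diag:
  fixes N :: "'a :: comm_ring_1 mat"
  assumes N: "N \<in> carrier_mat n n" "upper_triangular N" "\<And>i. i < n \<Longrightarrow> \<exists>c. N $$ (i, i) * c = 1"
    and N': "N' \<in> carrier_mat n n" "upper_triangular N'" and u: "u \<in> carrier_mat n n" and e: "N * u = N'"
    and i: "i < n"
  shows "N' $$ (i, i) = N $$ (i, i) * u $$ (i, i)"
proof -
  have s: "N' $$ (i, j) = N $$ (i, i) * u $$ (i, j) + (\<Sum>l\<in>{Suc i..<n}. N $$ (i, l) * u $$ (l, j))"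
    if ij: "i < n" "j < n" for i j
  proof -
    have "N' $$ (i, j) = (\<Sum>l\<in>{0..<n}. N $$ (i, l) * u $$ (l, j))"
      unfolding e[symmetric] using ij N(1) u by (simp add: scalar_prod_def)
    also have "\<dots> = (\<Sum>l\<in>{i..<n}. N $$ (i, l) * u $$ (l, j))"
      using ij N(1,2) by (intro sum.mono_neutral_right) (auto simp: upper_triangular_def)
    finally show ?thesis using ij by (simp add: sum.atLeast_Suc_lessThan)
  qed
  have z: "\<forall>j<i. u $$ (i, j) = 0" if "i < n" for i
    using that
  proof (induction "n - i" arbitrary: i rule: less_induct)
    case less
    show ?case
    proof (intro allI impI)
      fix j assume j: "j < i"
      have "(\<Sum>l\<in>{Suc i..<n}. N $$ (i, l) * u $$ (l, j)) = 0"
      proof (intro sum.neutral ballI)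
        fix l assume l: "l \<in> {Suc i..<n}"
        then have "n - l < n - i" "l < n" using less.prems by auto
        then have "u $$ (l, j) = 0" using less.hyps[of l] l j by auto
        then show "N $$ (i, l) * u $$ (l, j) = 0" by simp
      qed
      moreover have "N' $$ (i, j) = 0" using less.prems j N' by (auto simp: upper_triangular_def)
      ultimately have "N $$ (i, i) * u $$ (i, j) = 0" using s[of i j] less.prems j by simp
      moreover obtain c where c: "N $$ (i, i) * c = 1" using N(3)[OF less.prems] by blast
      ultimately have "c * (N $$ (i, i) * u $$ (i, j)) = 0" by simp
      then have "(N $$ (i, i) * c) * u $$ (i, j) = 0" by (simp add: mult_ac)
      then show "u $$ (i, j) = 0" unfolding c by simp
    qed
  qed
  have "(\<Sum>l\<in>{Suc i..<n}. N $$ (i, l) * u $$ (l, i)) = 0"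
    using z by (intro sum.neutral) auto
  then show ?thesis using s[OF i i] by simp
qed

text \<open>Two decompositions differ by \<open>u = k k'\<^sup>-\<^sup>1\<close> in the maximal
  compact subgroup, which is also a quotient of triangular matrices. Its diagonal entries are
  integral at the finite places and at most 1 in size at the real one, as an orthogonal matrix has
  unit columns. Exchanging the roles gives equality.\<close>

lemma iwasawa_diag_le:
  assumes I: "iwasawa r g n a k" and I': "iwasawa r g n' a' k'" and i: "i < r"
  shows "\<bar>adele_real (a' $$ (i, i))\<bar> \<le> \<bar>adele_real (a $$ (i, i))\<bar>"
    "\<And>p. prime p \<Longrightarrow> Q_p_abs p (adele_padic (a' $$ (i, i)) p) \<le> Q_p_abs p (adele_padic (a $$ (i, i)) p)"
proof -
  define u where "u = k * adj_mat k'"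
  have k: "k \<in> maximal_compact r" "k' \<in> maximal_compact r" "g = n * a * k" "g = n' * a' * k'"
    using I I' by (auto simp: iwasawa_def)
  have kS: "k \<in> SL r" "k' \<in> SL r" using k(1,2) by (auto simp: maximal_compact_zint)
  have u: "u \<in> maximal_compact r" unfolding u_def by (rule maximal_compact_mult[OF k(1) maximal_compact_adj[OF k(2)]])
  then have uc: "u \<in> carrier_mat r r" "zint_mat u"
    "transpose_mat (map_mat adele_real u) * map_mat adele_real u = 1\<^sub>m r"
    by (auto simp: maximal_compact_zint SL_def)
  note N = iwasawa_triangular[OF I] and N' = iwasawa_triangular[OF I']
  have "n * a * u = (n * a * k) * adj_mat k'"
    unfolding u_def using assoc_mult_mat[OF N(1) SL_carrier[OF kS(1)] SL_adj(1)[OF kS(2)]] by simp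
  also have "\<dots> = n' * a' * (k' * adj_mat k')"
    unfolding k(3)[symmetric] k(4) using assoc_mult_mat[OF N'(1) SL_carrier[OF kS(2)] SL_adj(1)[OF kS(2)]] by simp
  also have "\<dots> = n' * a'" unfolding SL_adj(2)[OF kS(2)] by (rule right_mult_one_mat[OF N'(1)])
  finally have e: "n * a * u = n' * a'" .
  have "(n' * a') $$ (i, i) = (n * a) $$ (i, i) * u $$ (i, i)"
    by (rule triangular_quotient_diag[OF N(1,2) _ N'(1,2) uc(1) e i]) (use N(3,4) in auto)
  then have a': "a' $$ (i, i) = a $$ (i, i) * u $$ (i, i)" using N(3) N'(3) i by simp
  have "(\<Sum>l\<in>{0..<r}. (adele_real (u $$ (l, i)))\<^sup>2) = (transpose_mat (map_mat adele_real u) * map_mat adele_real u) $$ (i, i)"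
    using uc(1) i by (simp add: scalar_prod_def power2_eq_square)
  also have "\<dots> = 1" unfolding uc(3) using i by simp
  finally have "(adele_real (u $$ (i, i)))\<^sup>2 \<le> 1"
    using member_le_sum[of i "{0..<r}" "\<lambda>l. (adele_real (u $$ (l, i)))\<^sup>2"] i by simp
  then have "\<bar>adele_real (u $$ (i, i))\<bar> \<le> 1" by (simp add: abs_square_le_1)
  then show "\<bar>adele_real (a' $$ (i, i))\<bar> \<le> \<bar>adele_real (a $$ (i, i))\<bar>"
    unfolding a' by (simp add: abs_mult mult_left_le)
  fix p :: nat assume p: "prime p"
  have "zint (u $$ (i, i))" using uc(1,2) i by (auto simp: zint_mat_def)
  then show "Q_p_abs p (adele_padic (a' $$ (i, i)) p) \<le> Q_p_abs p (adele_padic (a $$ (i, i)) p)"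
    unfolding a' by (rule Q_p_abs_zint_mult_le[OF p])
qed

lemma iwasawa_abs_unique:
  assumes "iwasawa r g n a k" "iwasawa r g n' a' k'" "i < r"
  shows "adele_abs (a $$ (i, i)) = adele_abs (a' $$ (i, i))"
  by (rule adele_abs_eqI)
    (use iwasawa_diag_le[OF assms] iwasawa_diag_le[OF assms(2,1,3)] in \<open>auto intro: order_antisym\<close>)

text \<open>The triangular factor \<open>M\<close> has \<open>\<beta>\<close> at all finite places
  and \<open>\<beta> U\<close> at the real one. Then \<open>g\<^sup>-\<^sup>1 M\<close> is integral
  at the finite places because the columns of \<open>\<beta>\<close> lie in the lattice, and
  orthogonal at the real place by the choice of \<open>U\<close>. By the product formula the
  diagonal of \<open>\<beta>\<close> cancels in the idele norm, leaving that of
  \<open>U\<close>.\<close>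

lemma iwasawa_exists:
  fixes \<beta> :: "rat mat"
  assumes g: "g \<in> SL r" and \<beta>: "\<beta> \<in> carrier_mat r r" "det \<beta> = 1" "upper_triangular \<beta>" "zspan \<beta> \<subseteq> adelic_lattice r g"
    and U: "U \<in> carrier_mat r r" "upper_triangular U" "\<And>i. i < r \<Longrightarrow> U $$ (i, i) > 0"
    and orth: "transpose_mat (adj_mat (map_mat adele_real g) * map_mat of_rat \<beta> * U)
      * (adj_mat (map_mat adele_real g) * map_mat of_rat \<beta> * U) = 1\<^sub>m r"
  shows "\<exists>n a k. iwasawa r g n a k \<and> (\<forall>i<r. adele_abs (a $$ (i, i)) = U $$ (i, i))"
proof -
  define h where "h = adj_mat (map_mat adele_real g)"
  define \<beta>R :: "real mat" where "\<beta>R = map_mat of_rat \<beta>"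
  have hS: "h \<in> SL r" unfolding h_def by (rule SL_adj(4)[OF SL_adele_real[OF g]])
  have h: "h \<in> carrier_mat r r" "det h = 1" using hS by (auto simp: SL_def)
  have R: "\<beta>R \<in> carrier_mat r r" "upper_triangular \<beta>R" "det \<beta>R = 1"
    using \<beta> by (auto simp: \<beta>R_def upper_triangular_def of_rat_hom.hom_det)
  have o: "transpose_mat (h * \<beta>R * U) * (h * \<beta>R * U) = 1\<^sub>m r" using orth unfolding h_def \<beta>R_def .
  have hRU: "h * \<beta>R * U \<in> carrier_mat r r" using h R U by simp
  have "det (h * \<beta>R * U) = det U"
    using h R U by (simp add: det_mult[of _ r])
  then have "(det U)\<^sup>2 = 1"
    using arg_cong[OF o, of det] hRU by (simp add: det_mult[of _ r] det_transpose[OF hRU] power2_eq_square)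
  moreover have "det U > 0" unfolding det_upper[OF U(1,2)] using U(3) by (intro prod_pos) auto
  ultimately have dU: "det U = 1" by (simp add: power2_eq_1_iff)
  define V where "V = \<beta>R * U"
  have V: "V \<in> carrier_mat r r" "upper_triangular V" "det V = 1"
    using upper_triangular_mult(1)[OF R(1,2) U(1,2)] R U dU by (auto simp: V_def det_mult[of _ r])
  have Vii: "V $$ (i, i) = of_rat (\<beta> $$ (i, i)) * U $$ (i, i)" if "i < r" for i
    using upper_triangular_mult(2)[OF R(1,2) U(1,2) that] that \<beta>(1) by (simp add: V_def \<beta>R_def)
  have \<beta>ii: "\<beta> $$ (i, i) \<noteq> 0" if "i < r" for i
    using det_upper[OF \<beta>(1,3)] \<beta>(2) that by (metis lessThan_iff prod_zero finite_lessThan zero_neq_one)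
  define M where "M = mat r r (\<lambda>ij. adele_mk (V $$ ij) (\<beta> $$ ij))"
  have M: "M \<in> carrier_mat r r" by (simp add: M_def)
  have uM: "upper_triangular M" using V \<beta> by (auto simp: M_def upper_triangular_def)
  have Mii: "M $$ (i, i) = adele_mk (V $$ (i, i)) (\<beta> $$ (i, i))" if "i < r" for i using that by (simp add: M_def)
  have prodM: "(\<Prod>i<r. M $$ (i, i)) = 1"
  proof -
    have "(\<Prod>i<r. M $$ (i, i)) = (\<Prod>i<r. adele_mk (V $$ (i, i)) (\<beta> $$ (i, i)))"
      using Mii by (intro prod.cong) auto
    also have "\<dots> = adele_mk (det V) (det \<beta>)"
      unfolding det_upper[OF V(1,2)] det_upper[OF \<beta>(1,3)] adele_mk_prod ..
    finally show ?thesis using V \<beta> by simp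
  qed
  have dM: "det M = 1" using det_upper[OF M uM] prodM by simp
  \<comment> \<open>The inverse of a diagonal entry of \<open>M\<close>, needed to divide the
    diagonal off and obtain \<open>n\<close>.\<close>
  define c where "c j = adele_mk (1 / V $$ (j, j)) (1 / \<beta> $$ (j, j))" for j
  have cM: "M $$ (j, j) * c j = 1" if "j < r" for j
    unfolding Mii[OF that] c_def adele_mk_mult[symmetric]
    using Vii[OF that] \<beta>ii[OF that] U(3)[OF that] by simp
  define a where "a = mat r r (\<lambda>(i, j). if i = j then M $$ (i, i) else 0)"
  have a: "a \<in> carrier_mat r r" "diagonal_mat a" by (auto simp: a_def diagonal_mat_def)
  have "upper_triangular a" by (auto simp: a_def upper_triangular_def)
  then have "det a = (\<Prod>i<r. a $$ (i, i))" by (rule det_upper[OF a(1)])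
  also have "\<dots> = 1" unfolding prodM[symmetric] by (intro prod.cong) (auto simp: a_def)
  finally have aS: "a \<in> SL r" using a by (simp add: SL_def)
  define n where "n = mat r r (\<lambda>(i, j). M $$ (i, j) * c j)"
  have n: "n \<in> carrier_mat r r" "upper_triangular n" "\<forall>i<r. n $$ (i, i) = 1"
    using uM M cM by (auto simp: n_def upper_triangular_def)
  have na: "n * a = M"
  proof (rule eq_matI)
    fix i j assume "i < dim_row M" "j < dim_col M"
    then have ij: "i < r" "j < r" using M by auto
    have "(n * a) $$ (i, j) = (\<Sum>l\<in>{0..<r}. n $$ (i, l) * a $$ (l, j))"
      using ij n(1) a(1) by (simp add: scalar_prod_def)
    also have "\<dots> = (\<Sum>l\<in>{j}. n $$ (i, l) * a $$ (l, j))"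
      using ij by (intro sum.mono_neutral_right) (auto simp: a_def)
    also have "\<dots> = M $$ (i, j) * (M $$ (j, j) * c j)" using ij by (simp add: n_def a_def mult_ac)
    finally show "(n * a) $$ (i, j) = M $$ (i, j)" using cM[OF ij(2)] by simp
  qed (use n a M in auto)
  note gi = SL_adj[OF g]
  define k' where "k' = adj_mat g * M"
  have k'S: "k' \<in> SL r" unfolding k'_def using SL_mult[OF gi(4)] M dM by (simp add: SL_def)
  have zk: "zint_mat k'"
    unfolding zint_mat_def
  proof (intro allI impI)
    fix i j assume "i < dim_row k'" "j < dim_col k'"
    then have ij: "i < r" "j < r" using SL_carrier[OF k'S] by auto
    \<comment> \<open>A diagonal rational plus an adele supported at the real place; the second part
      is invisible to integrality.\<close>
    have dec: "M $$ (l, j) = adele_of_rat (\<beta> $$ (l, j)) + adele_mk (V $$ (l, j) - of_rat (\<beta> $$ (l, j))) 0"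
      if "l < r" for l
      using that ij by (simp add: M_def adele_of_rat_mk flip: adele_mk_add)
    have "k' $$ (i, j) = (\<Sum>l\<in>{0..<r}. adj_mat g $$ (i, l) * M $$ (l, j))"
      unfolding k'_def using ij gi(1) M by (simp add: scalar_prod_def)
    also have "\<dots> = (\<Sum>l\<in>{0..<r}. adj_mat g $$ (i, l) * adele_of_rat (\<beta> $$ (l, j))) +
        (\<Sum>l\<in>{0..<r}. adj_mat g $$ (i, l) * adele_mk (V $$ (l, j) - of_rat (\<beta> $$ (l, j))) 0)"
      unfolding sum.distrib[symmetric] by (intro sum.cong) (auto simp: dec distrib_left)
    also have "(\<Sum>l\<in>{0..<r}. adj_mat g $$ (i, l) * adele_of_rat (\<beta> $$ (l, j))) = (adj_mat g * map_mat adele_of_rat \<beta>) $$ (i, j)"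
      using ij gi(1) \<beta>(1) by (simp add: scalar_prod_def)
    finally have kij: "k' $$ (i, j) = (adj_mat g * map_mat adele_of_rat \<beta>) $$ (i, j) +
        (\<Sum>l\<in>{0..<r}. adj_mat g $$ (i, l) * adele_mk (V $$ (l, j) - of_rat (\<beta> $$ (l, j))) 0)" .
    have "zint_mat (adj_mat g * map_mat adele_of_rat \<beta>)"
      using adelic_lattice_col[OF g \<beta>(1)] col_in_zspan[OF \<beta>(1)] \<beta>(4) by blast
    then have 1: "zint ((adj_mat g * map_mat adele_of_rat \<beta>) $$ (i, j))"
      unfolding zint_mat_def using ij gi(1) \<beta>(1) by (auto simp del: index_mult_mat(1))
    have "zint (x * adele_mk t 0)" for x t
    proof -
      have "x * adele_mk t 0 = adele_mk (adele_real x * t) 0"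
      proof (rule adele_eqI)
        fix p :: nat assume p: "prime p"
        interpret cring "Q_p p" using p by (rule cring_Q_p)
        show "adele_padic (x * adele_mk t 0) p = adele_padic (adele_mk (adele_real x * t) 0) p"
          using p adele_padic_closed[OF p, of x] by (simp flip: Q_p_zero)
      qed simp
      then show ?thesis using Z_p_of_int[of _ 0] by (auto simp: zint_def)
    qed
    then show "zint (k' $$ (i, j))" unfolding kij by (intro zint_add 1 zint_sum)
  qed
  have "map_mat adele_real M = V" using V(1) by (intro eq_matI) (auto simp: M_def)
  then have "map_mat adele_real k' = h * V"
    unfolding k'_def h_def using adele_real_hom.mat_hom_mult[OF gi(1) M] adj_adele_real[OF g] by simp
  also have "\<dots> = h * \<beta>R * U" unfolding V_def using assoc_mult_mat[OF h(1) R(1) U(1)] by simp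
  finally have "k' \<in> maximal_compact r" unfolding maximal_compact_zint using k'S zk o by simp
  then have k: "adj_mat k' \<in> maximal_compact r" by (rule maximal_compact_adj)
  have "g * k' = M" unfolding k'_def using assoc_mult_mat[OF SL_carrier[OF g] gi(1) M] gi(2) M by simp
  then have "M * adj_mat k' = g * (k' * adj_mat k')"
    using assoc_mult_mat[OF SL_carrier[OF g] SL_carrier[OF k'S] SL_adj(1)[OF k'S]] by simp
  also have "\<dots> = g" using SL_adj(2)[OF k'S] SL_carrier[OF g] by simp
  finally have "iwasawa r g n a (adj_mat k')" unfolding iwasawa_def using na n aS a k by simp
  moreover have "adele_abs (a $$ (i, i)) = U $$ (i, i)" if i: "i < r" for i
  proof -
    have "adele_abs (a $$ (i, i)) = \<bar>V $$ (i, i)\<bar> / \<bar>of_rat (\<beta> $$ (i, i))\<bar>"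
      using i Mii[OF i] adele_abs_mk[OF \<beta>ii[OF i]] by (simp add: a_def)
    then show ?thesis unfolding Vii[OF i] using \<beta>ii[OF i] U(3)[OF i] by (simp add: abs_mult)
  qed
  ultimately show ?thesis by blast
qed

text \<open>The definite description in \<open>H0\<close> is resolved by the Iwasawa diagonal, that
  of \<open>U\<close>. Its first \<open>i\<close> logarithms sum to the logarithm of a leading
  minor, and since the leading block orthonormalizes the first \<open>i\<close> columns, that minor
  is the inverse square root of their Gram determinant.\<close>

lemma H0_simple_weight:
  fixes \<beta> :: "rat mat"
  assumes g: "g \<in> SL r" and \<beta>: "\<beta> \<in> carrier_mat r r" "det \<beta> = 1" "upper_triangular \<beta>" "zspan \<beta> \<subseteq> adelic_lattice r g"
  shows "dim_vec (H0 r g) = r"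
    "\<And>i. i \<le> r \<Longrightarrow> simple_weight i (H0 r g) =
      - ln (gram (adj_mat (map_mat adele_real g) * map_mat of_rat (first_cols i \<beta>))) / 2"
proof -
  define h where "h = adj_mat (map_mat adele_real g)"
  define \<beta>R :: "real mat" where "\<beta>R = map_mat of_rat \<beta>"
  have h: "h \<in> carrier_mat r r" "det h = 1" using SL_adj(4)[OF SL_adele_real[OF g]] by (auto simp: SL_def h_def)
  have R: "\<beta>R \<in> carrier_mat r r" "det \<beta>R = 1"
    using \<beta> by (auto simp: \<beta>R_def of_rat_hom.hom_det)
  define P where "P = h * \<beta>R"
  have P: "P \<in> carrier_mat r r" "det P = 1" using h R by (auto simp: P_def det_mult[of _ r])
  have "gram P = 1" unfolding gram_def using P by (subst det_mult[of _ r]) (auto simp: det_transpose)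
  then have "mat_inj P" using mat_inj_iff_gram[OF P(1)] by simp
  then obtain U where U: "U \<in> carrier_mat r r" "upper_triangular U" "\<forall>i<r. U $$ (i, i) > 0"
    "transpose_mat (P * U) * (P * U) = 1\<^sub>m r" using orthonormalize[OF P(1)] by blast
  obtain n a k where I: "iwasawa r g n a k" "\<forall>i<r. adele_abs (a $$ (i, i)) = U $$ (i, i)"
    using iwasawa_exists[OF g \<beta> U(1,2)] U(3,4) unfolding P_def h_def \<beta>R_def by blast
  have H: "H0 r g = vec r (\<lambda>i. ln (U $$ (i, i)))"
    unfolding H0_def
  proof (rule the_equality)
    show "\<exists>n a k. iwasawa r g n a k \<and> vec r (\<lambda>i. ln (U $$ (i, i))) = vec r (\<lambda>i. ln (adele_abs (a $$ (i, i))))"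
      using I by (intro exI[of _ n] exI[of _ a] exI[of _ k]) (auto intro!: eq_vecI)
    fix H assume "\<exists>n a k. iwasawa r g n a k \<and> H = vec r (\<lambda>i. ln (adele_abs (a $$ (i, i))))"
    then obtain n' a' k' where I': "iwasawa r g n' a' k'" "H = vec r (\<lambda>i. ln (adele_abs (a' $$ (i, i))))" by blast
    then show "H = vec r (\<lambda>i. ln (U $$ (i, i)))"
      using I(2) iwasawa_abs_unique[OF I(1) I'(1)] by (intro eq_vecI) auto
  qed
  show "dim_vec (H0 r g) = r" unfolding H by simp
  fix i assume i: "i \<le> r"
  define B where "B = mat i i (\<lambda>(a, b). U $$ (a, b))"
  have B: "B \<in> carrier_mat i i" by (simp add: B_def)
  define F where "F = first_cols i P"
  have F: "F \<in> carrier_mat r i" using P by (simp add: F_def)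
  have FB: "first_cols i (P * U) = F * B"
    unfolding F_def B_def by (rule first_cols_mult_upper[OF P(1) U(1,2) i])
  have PU: "P * U \<in> carrier_mat r r" using P U by simp
  have "transpose_mat (first_cols i (P * U)) * first_cols i (P * U) = 1\<^sub>m i"
  proof (rule eq_matI)
    fix x y assume "x < dim_row (1\<^sub>m i :: real mat)" "y < dim_col (1\<^sub>m i :: real mat)"
    then have xy: "x < i" "y < i" by auto
    have c: "col (first_cols i (P * U)) z = col (P * U) z" if "z < i" for z
      using that PU i by (intro eq_vecI) (auto simp: first_cols_def)
    have "(transpose_mat (first_cols i (P * U)) * first_cols i (P * U)) $$ (x, y) = col (P * U) x \<bullet> col (P * U) y"
      using xy c PU by (simp add: first_cols_def)
    also have "\<dots> = (transpose_mat (P * U) * (P * U)) $$ (x, y)" using xy i P(1) U(1) by simp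
    finally show "(transpose_mat (first_cols i (P * U)) * first_cols i (P * U)) $$ (x, y) = 1\<^sub>m i $$ (x, y)"
      unfolding U(4) using xy i by simp
  qed (auto simp: first_cols_def)
  then have "gram (F * B) = 1" unfolding gram_def FB by simp
  then have g1: "(det B)\<^sup>2 * gram F = 1" using gram_mult[OF F B] by simp
  have dB: "det B = (\<Prod>j<i. U $$ (j, j))" unfolding B_def by (rule det_upper_block[OF U(1,2) i])
  have pos: "det B > 0" unfolding dB using U(3) i by (intro prod_pos) auto
  have "ln ((det B)\<^sup>2 * gram F) = 2 * ln (det B) + ln (gram F)"
    using pos g1 by (subst ln_mult) (auto simp: ln_realpow zero_less_mult_iff)
  then have "ln (det B) = - ln (gram F) / 2" unfolding g1 by simp
  moreover have "ln (det B) = (\<Sum>j<i. ln (U $$ (j, j)))"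
  proof -
    have "U $$ (j, j) > 0" if "j < i" for j using U(3) i that by simp
    then show ?thesis unfolding dB by (intro ln_prod) (auto simp: less_imp_neq[THEN not_sym])
  qed
  moreover have "simple_weight i (H0 r g) = (\<Sum>j<i. ln (U $$ (j, j)))"
    unfolding simple_weight_def H using i by (intro sum.cong) auto
  moreover have "F = h * map_mat of_rat (first_cols i \<beta>)"
  proof (rule eq_matI)
    fix x y assume "x < dim_row (h * map_mat of_rat (first_cols i \<beta>))" "y < dim_col (h * map_mat of_rat (first_cols i \<beta>))"
    then have xy: "x < r" "y < i" using h by (auto simp: first_cols_def)
    have "col (map_mat of_rat (first_cols i \<beta>)) y = col \<beta>R y"
      using xy i \<beta>(1) by (intro eq_vecI) (auto simp: first_cols_def \<beta>R_def)
    then show "F $$ (x, y) = (h * map_mat of_rat (first_cols i \<beta>)) $$ (x, y)"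
      using xy i h R \<beta>(1) by (simp add: F_def P_def first_cols_def)
  qed (use F h \<beta>(1) in \<open>auto simp: first_cols_def\<close>)
  ultimately show "simple_weight i (H0 r g) =
      - ln (gram (adj_mat (map_mat adele_real g) * map_mat of_rat (first_cols i \<beta>))) / 2"
    unfolding h_def by simp
qed

section \<open>Ordered partitions and polygons\<close>

text \<open>The total is included so that the recursion on the list is uniform; \<open>ranks\<close>
  drops it.\<close>

definition full_ranks :: "nat list \<Rightarrow> nat set" where
  "full_ranks ds = partial_sum ds ` {1..length ds}"

text \<open>The dimensions of the proper non-zero members of the flag stabilized by the parabolic
  subgroup.\<close>

definition ranks :: "nat list \<Rightarrow> nat set" where
  "ranks ds = partial_sum ds ` {1..<length ds}"

lemma full_ranks_Nil [simp]: "full_ranks [] = {}"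
  by (simp add: full_ranks_def)

lemma full_ranks_Cons: "full_ranks (d # ds) = insert d ((+) d ` full_ranks ds)"
proof -
  have "{1..length (d # ds)} = insert 1 (Suc ` {1..length ds})"
    unfolding image_Suc_atLeastAtMost by auto
  then have "full_ranks (d # ds) = insert (partial_sum (d # ds) 1) ((\<lambda>i. partial_sum (d # ds) (Suc i)) ` {1..length ds})"
    unfolding full_ranks_def by (simp only: image_insert image_image)
  then show ?thesis by (simp add: partial_sum_def full_ranks_def image_image)
qed

lemma finite_full_ranks: "finite (full_ranks ds)"
  by (simp add: full_ranks_def)

lemma full_ranks_pos: "0 \<notin> set ds \<Longrightarrow> n \<in> full_ranks ds \<Longrightarrow> 0 < n"
  by (induction ds arbitrary: n) (auto simp: full_ranks_Cons)

lemma full_ranks_le: "n \<in> full_ranks ds \<Longrightarrow> n \<le> sum_list ds"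
  by (induction ds arbitrary: n) (auto simp: full_ranks_Cons)

lemma sum_list_in_full_ranks: "ds \<noteq> [] \<Longrightarrow> sum_list ds \<in> full_ranks ds"
  by (simp add: full_ranks_def partial_sum_def image_iff) (rule bexI[of _ "length ds"], auto simp: Suc_le_eq)

lemma Min_full_ranks: "0 \<notin> set (d # ds) \<Longrightarrow> Min (full_ranks (d # ds)) = d"
  by (intro Min_eqI) (auto simp: full_ranks_Cons finite_full_ranks)

lemma full_ranks_tail:
  assumes "0 \<notin> set (d # ds)"
  shows "(+) d ` full_ranks ds = full_ranks (d # ds) - {d}"
  using assms full_ranks_pos[of ds] by (fastforce simp: full_ranks_Cons)

text \<open>The smallest partial sum is the first part; the remaining parts follow by
  shifting.\<close>

lemma full_ranks_inj:
  "0 \<notin> set ds \<Longrightarrow> 0 \<notin> set es \<Longrightarrow> full_ranks ds = full_ranks es \<Longrightarrow> ds = es"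
proof (induction ds arbitrary: es)
  case Nil
  then show ?case by (cases es) (auto simp: full_ranks_Cons)
next
  case (Cons d ds)
  obtain e es' where es: "es = e # es'" using Cons.prems(3) by (cases es) (auto simp: full_ranks_Cons)
  have "d = e" using Min_full_ranks[OF Cons.prems(1)] Min_full_ranks[of e es'] Cons.prems(2,3) es by simp
  then have "(+) d ` full_ranks ds = (+) d ` full_ranks es'"
    using full_ranks_tail[OF Cons.prems(1)] full_ranks_tail[of e es'] Cons.prems(2,3) es by simp
  then have "full_ranks ds = full_ranks es'" by (simp add: inj_image_eq_iff)
  then show ?case using Cons es \<open>d = e\<close> by simp
qed

lemma full_ranks_surj: "finite A \<Longrightarrow> 0 \<notin> A \<Longrightarrow> \<exists>ds. 0 \<notin> set ds \<and> full_ranks ds = A"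
proof (induction "card A" arbitrary: A)
  case 0 then show ?case by (intro exI[of _ "[]"]) auto
next
  case (Suc n)
  define d where "d = Min A"
  have ne: "A \<noteq> {}" using Suc.hyps(2) by auto
  have d: "d \<in> A" "d > 0" using Min_in[OF Suc.prems(1) ne] Suc.prems(2) by (auto simp: d_def intro: gr0I)
  have ge: "a \<ge> d" if "a \<in> A" for a using that Suc.prems(1) by (simp add: d_def)
  define B where "B = (\<lambda>a. a - d) ` (A - {d})"
  have img: "(+) d ` B = A - {d}" using ge by (force simp: B_def image_image)
  have "card B = card (A - {d})" unfolding B_def
  proof (rule card_image, rule inj_onI)
    fix a b assume "a \<in> A - {d}" "b \<in> A - {d}" "a - d = b - d"
    then show "a = b" using ge[of a] ge[of b] by auto
  qed
  then have "n = card B" using Suc.hyps(2) d(1) Suc.prems(1) by simp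
  moreover have "0 \<notin> B" unfolding B_def using ge by force
  moreover have "finite B" using Suc.prems(1) by (simp add: B_def)
  ultimately obtain ds where ds: "0 \<notin> set ds" "full_ranks ds = B" using Suc.hyps(1) by blast
  then have "full_ranks (d # ds) = A" using img d(1) by (auto simp: full_ranks_Cons)
  then show ?case using ds(1) d(2) by (intro exI[of _ "d # ds"]) auto
qed

lemma card_full_ranks: "0 \<notin> set ds \<Longrightarrow> card (full_ranks ds) = length ds"
proof (induction ds)
  case (Cons d ds)
  then have "d \<notin> (+) d ` full_ranks ds" using full_ranks_pos[of ds] by fastforce
  then show ?case using Cons by (simp add: full_ranks_Cons finite_full_ranks card_image)
qed simp

lemma full_ranks_ranks:
  assumes "ds \<noteq> []"
  shows "full_ranks ds = insert (sum_list ds) (ranks ds)"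
proof -
  have "{1..length ds} = insert (length ds) {1..<length ds}" using assms by (auto simp: Suc_le_eq)
  then show ?thesis unfolding full_ranks_def ranks_def by (simp add: partial_sum_def)
qed

lemma ranks_eq:
  assumes ds: "ds \<in> ordered_partitions r" and r: "r > 0"
  shows "full_ranks ds = insert r (ranks ds)" "r \<notin> ranks ds" "card (ranks ds) = length ds - 1" "ranks ds \<subseteq> {1..<r}"
proof -
  have d: "sum_list ds = r" "0 \<notin> set ds" "ds \<noteq> []" using ds r by (auto simp: ordered_partitions_def)
  show f: "full_ranks ds = insert r (ranks ds)" using full_ranks_ranks[OF d(3)] d(1) by simp
  have le: "card (ranks ds) \<le> length ds - 1"
    unfolding ranks_def using card_image_le[of "{1..<length ds}" "partial_sum ds"] by simp
  have ins: "card (insert r (ranks ds)) = length ds" using card_full_ranks[OF d(2)] f by simp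
  have fin: "finite (ranks ds)" by (simp add: ranks_def)
  have pos: "length ds > 0" using d(3) by simp
  show r': "r \<notin> ranks ds"
  proof
    assume "r \<in> ranks ds"
    then have "card (ranks ds) = length ds" using ins by (simp add: insert_absorb)
    then show False using le pos by linarith
  qed
  show "card (ranks ds) = length ds - 1" using ins r' fin by simp
  show "ranks ds \<subseteq> {1..<r}"
  proof
    fix n assume n: "n \<in> ranks ds"
    then have m: "n \<in> full_ranks ds" "n \<noteq> r" using f r' by auto
    have "0 < n" "n \<le> r" using full_ranks_pos[OF d(2) m(1)] full_ranks_le[OF m(1)] d(1) by auto
    then show "n \<in> {1..<r}" using m(2) by simp
  qed
qed

text \<open>The combinatorial form of the parametrization of standard parabolic subgroups by sets of
  simple roots.\<close>

lemma ranks_bij: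
  assumes r: "r > 0"
  shows "bij_betw ranks (ordered_partitions r) (Pow {1..<r})"
proof (rule bij_betw_imageI)
  show "inj_on ranks (ordered_partitions r)"
  proof (rule inj_onI)
    fix ds es assume *: "ds \<in> ordered_partitions r" "es \<in> ordered_partitions r" "ranks ds = ranks es"
    then have "full_ranks ds = full_ranks es" using ranks_eq(1)[OF _ r] by simp
    then show "ds = es" using * full_ranks_inj by (simp add: ordered_partitions_def)
  qed
  show "ranks ` ordered_partitions r = Pow {1..<r}"
  proof (intro equalityI subsetI)
    fix A assume A: "A \<in> Pow {1..<r}"
    then have "finite (insert r A)" "0 \<notin> insert r A" using r finite_subset[of A "{1..<r}"] by auto
    then obtain ds where ds: "0 \<notin> set ds" "full_ranks ds = insert r A" using full_ranks_surj by blast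
    have ne: "ds \<noteq> []" using ds(2) by auto
    have "sum_list ds = Max (full_ranks ds)"
      using sum_list_in_full_ranks[OF ne] full_ranks_le finite_full_ranks by (intro Max_eqI[symmetric]) auto
    also have "\<dots> = r" unfolding ds(2) using A finite_subset[of A "{1..<r}"] by (intro Max_eqI) auto
    finally have op: "ds \<in> ordered_partitions r" using ds(1) by (simp add: ordered_partitions_def)
    have "r \<notin> A" using A by auto
    moreover have "insert r (ranks ds) = insert r A" using ranks_eq(1)[OF op r] ds(2) by simp
    ultimately have "ranks ds = A" using insert_ident[OF ranks_eq(2)[OF op r]] by blast
    then show "A \<in> ranks ` ordered_partitions r" using op by blast
  qed (use ranks_eq(4)[OF _ r] in auto)
qed

lemma partial_sum_ranks: "(\<forall>m\<in>{1..<length ds}. P (partial_sum ds m)) \<longleftrightarrow> (\<forall>i\<in>ranks ds. P i)"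
  by (auto simp: ranks_def)

section \<open>Concave polygons and their supporting lines\<close>

locale concave_polygon =
  fixes r :: nat and p :: "real \<Rightarrow> real"
  assumes r2: "r \<ge> 2" and norm: "normalized_polygon r p" and conv: "convex_polygon r p"
begin

definition d :: "nat \<Rightarrow> real" where "d k = p (real k + 1) - p (real k)"

lemma p0: "p 0 = 0" and pr: "p (real r) = 0"
  using norm by (auto simp: normalized_polygon_def)

lemma d_antimono: "i \<le> j \<Longrightarrow> j < r \<Longrightarrow> d j \<le> d i"
proof (induction j)
  case (Suc j)
  have "d (Suc j) \<le> d j"
  proof -
    have "Suc j \<in> {1..<r}" using Suc.prems by simp
    then have "p (real (Suc j) + 1) - p (real (Suc j)) \<le> p (real (Suc j)) - p (real (Suc j) - 1)"
      using conv unfolding convex_polygon_def by blast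
    then show ?thesis by (simp add: d_def add.commute)
  qed
  then show ?case using Suc by (cases "i = Suc j") auto
qed simp

lemma p_sum: "p (real (a + n)) = p (real a) + (\<Sum>m<n. d (a + m))"
  by (induction n) (auto simp: d_def add_ac)

text \<open>Both differences cover \<open>n = a - i = j - b\<close> unit steps; those starting at
  \<open>b\<close> lie to the right of those starting at \<open>i\<close>, where increments are no
  larger.\<close>

lemma four_point:
  assumes "i \<le> a" "i \<le> b" "j \<le> r" "i + j = a + b"
  shows "p (real i) + p (real j) \<le> p (real a) + p (real b)"
proof -
  define n where "n = a - i"
  have n: "a = i + n" "j = b + n" using assms by (simp_all add: n_def)
  have "(\<Sum>m<n. d (b + m)) \<le> (\<Sum>m<n. d (i + m))"
    using assms n by (intro sum_mono d_antimono) auto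
  then show ?thesis unfolding n p_sum by simp
qed

lemma support_line:
  assumes k: "k < r" and j: "j \<le> r"
  shows "p (real j) \<le> p (real k) + d k * (real j - real k)"
proof (cases "k \<le> j")
  case True
  define n where "n = j - k"
  have n: "j = k + n" using True by (simp add: n_def)
  have "(\<Sum>m<n. d (k + m)) \<le> (\<Sum>m<n. d k)" using j n by (intro sum_mono d_antimono) auto
  then show ?thesis unfolding n p_sum by (simp add: mult.commute)
next
  case False
  define n where "n = k - j"
  have n: "k = j + n" using False by (simp add: n_def)
  have "(\<Sum>m<n. d k) \<le> (\<Sum>m<n. d (j + m))" using k n by (intro sum_mono d_antimono) auto
  then show ?thesis unfolding n p_sum by (simp add: algebra_simps)
qed

text \<open>At \<open>k = r\<close> the increment \<open>d r\<close> would read \<open>p\<close>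
  beyond its interval; the last slope \<open>d (r - 1)\<close> supports there as well.\<close>

lemma supergradient: "k \<le> r \<Longrightarrow> \<exists>x. \<forall>j\<le>r. p (real j) \<le> p (real k) + x * (real j - real k)"
proof (cases "k < r")
  case True then show ?thesis using support_line by blast
next
  assume "k \<le> r"
  case False
  then have k: "k = r" using \<open>k \<le> r\<close> by simp
  have "p (real j) \<le> p (real k) + d (r - 1) * (real j - real k)" if j: "j \<le> r" for j
  proof -
    have "p (real j) \<le> p (real (r - 1)) + d (r - 1) * (real j - real (r - 1))"
      using support_line[of "r - 1" j] r2 j by simp
    moreover have "d (r - 1) = p (real r) - p (real (r - 1))" using r2 by (simp add: d_def of_nat_diff)
    moreover have "real (r - 1) = real r - 1" using r2 by (simp add: of_nat_diff)
    ultimately show ?thesis unfolding k by (simp add: algebra_simps)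
  qed
  then show ?thesis by blast
qed

lemma p_affine:
  assumes k: "k < r" and t: "real k \<le> t" "t \<le> real k + 1"
  shows "p t = p (real k) + d k * (t - real k)"
proof -
  have "Suc k \<in> {1..r}" using k by simp
  then obtain a b where ab: "\<forall>t\<in>{real (Suc k) - 1..real (Suc k)}. p t = a * t + b"
    using norm unfolding normalized_polygon_def polygon_def by blast
  have "p t = a * t + b" "p (real k) = a * real k + b" "p (real k + 1) = a * (real k + 1) + b"
    using ab t by auto
  then show ?thesis by (simp add: d_def algebra_simps)
qed

text \<open>The supporting line of the linear piece containing \<open>t\<close> lies above both end
  points, hence above the chord, and agrees with \<open>p\<close> at \<open>t\<close>.\<close>

lemma p_chord:
  assumes ab: "a < b" "b \<le> r" and t: "real a \<le> t" "t \<le> real b"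
    and u: "u \<le> p (real a)" "v \<le> p (real b)"
  shows "u + (t - real a) / (real b - real a) * (v - u) \<le> p t"
proof -
  \<comment> \<open>The right end \<open>r\<close> is assigned to the last piece.\<close>
  define k where "k = (if t = real r then r - 1 else nat \<lfloor>t\<rfloor>)"
  have k: "k < r" "real k \<le> t" "t \<le> real k + 1"
  proof -
    have "0 \<le> t" "t \<le> real r" using t ab by auto
    then show "k < r" "real k \<le> t" "t \<le> real k + 1"
      using r2 by (auto simp: k_def of_nat_diff) linarith+
  qed
  define s where "s = (t - real a) / (real b - real a)"
  have s: "0 \<le> s" "s \<le> 1" using t ab by (auto simp: s_def field_simps)
  have ts: "t = (1 - s) * real a + s * real b"
  proof -
    have "s * (real b - real a) = t - real a" using ab by (simp add: s_def)
    then show ?thesis by (simp add: algebra_simps)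
  qed
  have "u + s * (v - u) = (1 - s) * u + s * v" by (simp add: algebra_simps)
  also have "\<dots> \<le> (1 - s) * (p (real k) + d k * (real a - real k)) + s * (p (real k) + d k * (real b - real k))"
    using support_line[OF k(1), of a] support_line[OF k(1), of b] ab u s
    by (intro add_mono mult_left_mono) auto
  also have "\<dots> = p (real k) + d k * (t - real k)" unfolding ts by (simp add: algebra_simps)
  also have "\<dots> = p t" using p_affine[OF k] by simp
  finally show ?thesis unfolding s_def .
qed

text \<open>The special first and last entries are ordinary differences because \<open>p\<close>
  vanishes at both ends.\<close>

lemma T_of_polygon_nth: "j < r \<Longrightarrow> T_of_polygon r p $ j = d j"
proof -
  assume j: "j < r"
  show ?thesis
  proof (cases "j = r - 1")
    case True
    have e: "real j + 1 = real r" "real r - 1 = real j" using True r2 by (simp_all add: of_nat_diff)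
    have "j \<noteq> 0" using True r2 by simp
    then have "T_of_polygon r p $ j = - p (real r - 1)" using True j by (simp add: T_of_polygon_def)
    then show ?thesis unfolding d_def e pr by simp
  next
    case False
    then show ?thesis using j p0 by (cases "j = 0") (simp_all add: T_of_polygon_def d_def)
  qed
qed

lemma simple_weight_T: "i \<le> r \<Longrightarrow> simple_weight i (T_of_polygon r p) = p (real i)"
  using p_sum[of 0 i] by (simp add: simple_weight_def T_of_polygon_nth p0)

lemma T_carrier: "T_of_polygon r p \<in> carrier_vec r"
  by (simp add: T_of_polygon_def)

end

section \<open>The canonical filtration of a Euclidean lattice\<close>

context euclidean_realization
begin

definition Sats :: "real vec set set" where
  "Sats = {M. saturated_sublattice r M (ev ` \<Lambda>)}"

lemma Sats_iff: "M \<in> Sats \<longleftrightarrow> (\<exists>S. sat S \<and> M = ev ` S)"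
  by (simp add: Sats_def saturated_sublattice_iff)

lemma ev_image_subset_iff:
  assumes S: "sat S" and T: "sat T"
  shows "ev ` S \<subseteq> ev ` T \<longleftrightarrow> S \<subseteq> T"
proof
  assume sub: "ev ` S \<subseteq> ev ` T"
  show "S \<subseteq> T"
  proof
    fix x assume x: "x \<in> S"
    then have "ev x \<in> ev ` T" using sub by blast
    moreover have "x \<in> carrier_vec r" using x saturated_carrier[OF S] by blast
    ultimately show "x \<in> T" using inj_on_image_mem_iff[OF ev_inj _ saturated_carrier[OF T]] by simp
  qed
qed (rule image_mono)

lemma ev_image_Int: "sat S \<Longrightarrow> sat T \<Longrightarrow> ev ` S \<inter> ev ` T = ev ` (S \<inter> T)"
  by (rule inj_on_image_Int[OF ev_inj saturated_carrier saturated_carrier, symmetric])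

lemma sat_zero: "sat {0\<^sub>v r}" and sat_top: "sat \<Lambda>"
  using saturated_in_zero[OF int_module_\<Lambda>] int_module_\<Lambda> by (auto simp: saturated_in_def)

lemma ev_zero: "ev ` {0\<^sub>v r} = {0\<^sub>v r}"
  unfolding ev_def using h(1) by (auto intro!: eq_vecI simp: scalar_prod_def)

lemma no_cols_inj: "mat_inj (0\<^sub>m r 0 :: rat mat)"
  by (rule mat_injI[of _ r 0]) auto

lemma rk_dg_zero: "rk {0\<^sub>v r} = 0" "dg {0\<^sub>v r} = 0"
proof -
  have z: "zspan (0\<^sub>m r 0 :: rat mat) = {0\<^sub>v r}" by (rule zspan_no_cols) simp
  have g: "gram (emb (0\<^sub>m r 0)) = 1"
    unfolding gram_def
    by (rule det_dim_zero) (rule mult_carrier_mat[of _ 0 r], use emb_carrier[of "0\<^sub>m r 0" 0] in auto)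
  show "rk {0\<^sub>v r} = 0" "dg {0\<^sub>v r} = 0"
    using rk_dg[of "0\<^sub>m r 0" 0, OF _ no_cols_inj] g unfolding z ev_zero by simp_all
qed

lemma \<beta>_inj: "mat_inj \<beta>"
proof -
  have "gram \<beta> = 1" unfolding gram_def using \<beta> by (subst det_mult[of _ r]) (auto simp: det_transpose)
  then show ?thesis using mat_inj_iff_gram[OF \<beta>(1)] by simp
qed

text \<open>Covolume one, from \<open>det \<beta> = 1\<close> and the determinant one of
  \<open>h\<close>.\<close>

lemma rk_dg_top: "rk (ev ` \<Lambda>) = r" "dg (ev ` \<Lambda>) = 0"
proof -
  have "det (map_mat of_rat \<beta> :: real mat) = 1" using det_real_of_rat[OF \<beta>(1)] \<beta>(2) by simp
  then have "det (emb \<beta>) = 1" unfolding emb_def using h \<beta> by (simp add: det_mult[of _ r])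
  then have "gram (emb \<beta>) = 1"
    unfolding gram_def using emb_carrier[OF \<beta>(1)] by (subst det_mult[of _ r]) (auto simp: det_transpose)
  then show "rk (ev ` \<Lambda>) = r" "dg (ev ` \<Lambda>) = 0" using rk_dg[OF \<beta>(1) \<beta>_inj] by simp_all
qed

lemma rk_strict_sat:
  assumes S: "sat S" and T: "sat T" and sub: "S \<subset> T"
  shows "rk (ev ` S) < rk (ev ` T)"
proof -
  obtain k m A B where A: "A \<in> carrier_mat r k" "B \<in> carrier_mat r m" "mat_inj (hcat A B)"
    "mat_inj A" "zspan A = S" "zspan (hcat A B) = T"
    by (rule subset_bases[OF bounded S T psubset_imp_subset[OF sub]])
  have "m \<noteq> 0"
  proof
    assume "m = 0"
    then have "zspan B = {0\<^sub>v r}" using zspan_no_cols A(2) by blast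
    then have "T = {x + 0\<^sub>v r |x. x \<in> S}" using zspan_hcat[OF A(1,2)] A(5,6) by auto
    then have "T \<subseteq> S" using saturated_carrier[OF S] by auto
    then show False using sub by blast
  qed
  then show ?thesis
    using rk_dg(2)[OF A(1,4)] rk_dg(2)[OF hcat_carrier[OF A(1,2)] A(3)] A(5,6) by simp
qed

text \<open>Meets and joins are formed among rational subgroups; \<open>ev\<close> is injective and
  so carries inclusions and intersections to the real sublattices.\<close>

sublocale hn: slope_lattice Sats "{0\<^sub>v r}" "ev ` \<Lambda>" rk dg
proof
  show "{0\<^sub>v r} \<in> Sats" using sat_zero ev_zero Sats_iff by metis
  show "ev ` \<Lambda> \<in> Sats" using sat_top Sats_iff by blast
  show "{0\<^sub>v r} \<subseteq> S" if S: "S \<in> Sats" for S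
  proof -
    obtain S' where S': "sat S'" "S = ev ` S'" using S unfolding Sats_iff by blast
    have "{0\<^sub>v r} \<subseteq> S'" using S'(1) by (auto simp: saturated_in_def int_module_def)
    then show ?thesis unfolding S'(2) using ev_zero by blast
  qed
  show "S \<subseteq> ev ` \<Lambda>" if S: "S \<in> Sats" for S
    using S by (auto simp: Sats_def saturated_sublattice_def sublattice_def)
  show "S \<inter> T \<in> Sats" if ST: "S \<in> Sats" "T \<in> Sats" for S T
  proof -
    obtain S' T' where S': "sat S'" "S = ev ` S'" and T': "sat T'" "T = ev ` T'" using ST unfolding Sats_iff by blast
    then show ?thesis using ev_image_Int[OF S'(1) T'(1)] saturated_in_Int[OF S'(1) T'(1)] unfolding Sats_iff by blast
  qed
  show "\<exists>J\<in>Sats. S \<subseteq> J \<and> T \<subseteq> J \<and> (\<forall>U\<in>Sats. S \<subseteq> U \<longrightarrow> T \<subseteq> U \<longrightarrow> J \<subseteq> U) \<and>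
      rk (S \<inter> T) + rk J = rk S + rk T \<and> dg S + dg T \<le> dg (S \<inter> T) + dg J"
    if ST: "S \<in> Sats" "T \<in> Sats" for S T
  proof -
    obtain S' T' where S': "sat S'" "S = ev ` S'" and T': "sat T'" "T = ev ` T'" using ST unfolding Sats_iff by blast
    obtain J where J: "sat J" "S' \<subseteq> J" "T' \<subseteq> J" "\<forall>U. sat U \<longrightarrow> S' \<subseteq> U \<longrightarrow> T' \<subseteq> U \<longrightarrow> J \<subseteq> U"
      "rk (ev ` (S' \<inter> T')) + rk (ev ` J) = rk (ev ` S') + rk (ev ` T')"
      "dg (ev ` S') + dg (ev ` T') \<le> dg (ev ` (S' \<inter> T')) + dg (ev ` J)" "sat (S' \<inter> T')"
      by (rule join_exists[OF S'(1) T'(1)])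
    have "ev ` J \<subseteq> U" if U: "U \<in> Sats" "S \<subseteq> U" "T \<subseteq> U" for U
    proof -
      obtain U' where U': "sat U'" "U = ev ` U'" using U(1) unfolding Sats_iff by blast
      have "S' \<subseteq> U'" "T' \<subseteq> U'"
        using U(2,3) ev_image_subset_iff[OF S'(1) U'(1)] ev_image_subset_iff[OF T'(1) U'(1)] S'(2) T'(2) U'(2) by auto
      then have "J \<subseteq> U'" using J(4) U'(1) by blast
      then show ?thesis unfolding U'(2) by (rule image_mono)
    qed
    moreover have "ev ` J \<in> Sats" using J(1) Sats_iff by blast
    moreover have "S \<subseteq> ev ` J" "T \<subseteq> ev ` J" using J(2,3) S'(2) T'(2) by auto
    moreover have "S \<inter> T = ev ` (S' \<inter> T')" using ev_image_Int[OF S'(1) T'(1)] S'(2) T'(2) by simp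
    ultimately show ?thesis using J(5,6) S'(2) T'(2) by (intro bexI[of _ "ev ` J"]) auto
  qed
  show "rk S < rk T" if ST: "S \<in> Sats" "T \<in> Sats" "S \<subset> T" for S T
  proof -
    obtain S' T' where S': "sat S'" "S = ev ` S'" and T': "sat T'" "T = ev ` T'" using ST unfolding Sats_iff by blast
    have "S' \<subset> T'" using ST(3) ev_image_subset_iff[OF S'(1) T'(1)] S'(2) T'(2) by auto
    then show ?thesis using rk_strict_sat[OF S'(1) T'(1)] S'(2) T'(2) by simp
  qed
  show "finite {S \<in> Sats. dg S > c}" for c
    using finite_saturated[of c] by (simp add: Sats_def)
qed

lemma quotient_slope:
  assumes S: "S \<in> Sats" and T: "T \<in> Sats" and sub: "S \<subseteq> T"
  shows "is_lattice r (quotient_lattice r T S)"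
    "real (lattice_rank r (quotient_lattice r T S)) = real (rk T) - real (rk S)"
    "lattice_slope r (quotient_lattice r T S) = hn.slope S T"
proof -
  obtain S' T' where S': "sat S'" "S = ev ` S'" and T': "sat T'" "T = ev ` T'" using S T unfolding Sats_iff by blast
  have sub': "S' \<subseteq> T'" using sub ev_image_subset_iff[OF S'(1) T'(1)] S'(2) T'(2) by auto
  note q = quotient_facts[OF S'(1) T'(1) sub', folded S'(2) T'(2)]
  show "is_lattice r (quotient_lattice r T S)" by (rule q(1))
  show rkq: "real (lattice_rank r (quotient_lattice r T S)) = real (rk T) - real (rk S)"
    using q(2) by (simp add: rk_def)
  show "lattice_slope r (quotient_lattice r T S) = hn.slope S T"
    unfolding lattice_slope_def hn.slope_def rkq using q(3) by (simp add: dg_def)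
qed

lemma is_lattice_rank_pos:
  assumes M: "is_lattice r M" and ne: "M \<noteq> {0\<^sub>v r}"
  shows "lattice_rank r M > 0"
proof -
  obtain k W where W: "W \<in> carrier_mat r k" "mat_inj W" "M = zspan W" using M unfolding is_lattice_iff by blast
  have "k \<noteq> 0" using zspan_no_cols[of W r] W(1,3) ne by auto
  then show ?thesis using lattice_zspan(2)[OF W(1,2)] W(3) by simp
qed

text \<open>\<open>hn.step\<close> tests saturated members between \<open>S\<close> and
  \<open>T\<close>, semistability all sublattices of the quotient. The lift in
  \<open>sublattice_of_quotient\<close> adds the same rank and no smaller degree, which closes the
  gap.\<close>

lemma semistable_quotient_iff:
  assumes S: "S \<in> Sats" and T: "T \<in> Sats" and sub: "S \<subset> T"
  shows "semistable r (quotient_lattice r T S) \<longleftrightarrow> hn.step S T"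
proof
  assume ss: "semistable r (quotient_lattice r T S)"
  show "hn.step S T"
    unfolding hn.step_def
  proof (intro conjI ballI impI S T sub)
    fix V assume V: "V \<in> Sats" "S \<subseteq> V" "V \<subseteq> T"
    show "dg V - dg S \<le> hn.slope S T * (real (rk V) - real (rk S))"
    proof (cases "V = S")
      case False
      then have SV: "S \<subset> V" using V by blast
      have rkp: "real (rk V) - real (rk S) > 0" using hn.rk_strict[OF S V(1) SV] by simp
      note q = quotient_slope[OF S V(1,2)]
      have "quotient_lattice r V S \<noteq> {0\<^sub>v r}"
      proof
        assume "quotient_lattice r V S = {0\<^sub>v r}"
        then have "rk {0\<^sub>v r} \<noteq> 0" using q(2) rkp by (simp add: rk_def)
        then show False using rk_dg_zero by simp
      qed
      moreover have "sublattice r (quotient_lattice r V S) (quotient_lattice r T S)"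
        unfolding sublattice_def using q(1) quotient_lattice_mono[OF V(3)] by blast
      ultimately have "lattice_slope r (quotient_lattice r V S) \<le> lattice_slope r (quotient_lattice r T S)"
        using ss unfolding semistable_def by blast
      then have "hn.slope S V \<le> hn.slope S T"
        using q(3) quotient_slope(3)[OF S T] sub by auto
      then have "hn.slope S V * (real (rk V) - real (rk S)) \<le> hn.slope S T * (real (rk V) - real (rk S))"
        using rkp by (intro mult_right_mono) auto
      then show ?thesis using rkp by (simp add: hn.slope_def)
    qed simp
  qed
next
  assume st: "hn.step S T"
  obtain S' T' where S': "sat S'" "S = ev ` S'" and T': "sat T'" "T = ev ` T'" using S T unfolding Sats_iff by blast
  have sub': "S' \<subseteq> T'" using sub ev_image_subset_iff[OF S'(1) T'(1)] S'(2) T'(2) by auto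
  have sl: "lattice_slope r (quotient_lattice r T S) = hn.slope S T" using quotient_slope(3)[OF S T] sub by auto
  show "semistable r (quotient_lattice r T S)"
    unfolding semistable_def
  proof (intro conjI allI impI)
    show "is_lattice r (quotient_lattice r T S)" using quotient_slope(1)[OF S T] sub by auto
    fix M assume M: "sublattice r M (quotient_lattice r T S) \<and> M \<noteq> {0\<^sub>v r}"
    then have pos: "rk M > 0" using is_lattice_rank_pos[of M] by (simp add: sublattice_def rk_def)
    obtain V where V: "sat V" "S' \<subseteq> V" "V \<subseteq> T'" "rk (ev ` V) = rk (ev ` S') + rk M" "dg M \<le> dg (ev ` V) - dg (ev ` S')"
      using sublattice_of_quotient[OF S'(1) T'(1) sub', of M] M unfolding S'(2) T'(2) by blast
    have "ev ` V \<in> Sats" "S \<subseteq> ev ` V" "ev ` V \<subseteq> T" using V(1-3) Sats_iff S'(2) T'(2) by auto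
    then have "dg (ev ` V) - dg S \<le> hn.slope S T * (real (rk (ev ` V)) - real (rk S))"
      using st unfolding hn.step_def by blast
    then have "dg M \<le> hn.slope S T * real (rk M)" using V(4,5) S'(2) by simp
    then show "lattice_slope r M \<le> lattice_slope r (quotient_lattice r T S)"
      unfolding sl using pos by (simp add: lattice_slope_def dg_def rk_def field_simps)
  qed
qed

lemma HN_filtration_iff: "HN_filtration r (ev ` \<Lambda>) F \<longleftrightarrow> hn.HN_from {0\<^sub>v r} F"
proof
  assume F: "HN_filtration r (ev ` \<Lambda>) F"
  have mem: "F ! i \<in> Sats" if "i < length F" for i using F that by (auto simp: HN_filtration_def Sats_def)
  have sub: "F ! i \<subset> F ! Suc i" "semistable r (quotient_lattice r (F ! Suc i) (F ! i))" if "Suc i < length F" for i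
    using F that by (auto simp: HN_filtration_def)
  show "hn.HN_from {0\<^sub>v r} F"
    unfolding hn.HN_from_def
  proof (intro conjI allI impI)
    fix i assume i: "Suc i < length F"
    show "hn.step (F ! i) (F ! Suc i)"
      using semistable_quotient_iff[OF mem mem sub(1)[OF i]] sub(2)[OF i] i by simp
  next
    fix i assume i: "Suc (Suc i) < length F"
    have "hn.slope (F ! i) (F ! Suc i) = lattice_slope r (quotient_lattice r (F ! Suc i) (F ! i))"
      using quotient_slope(3)[OF mem mem psubset_imp_subset[OF sub(1)[of i]]] i by simp
    moreover have "hn.slope (F ! Suc i) (F ! Suc (Suc i)) = lattice_slope r (quotient_lattice r (F ! Suc (Suc i)) (F ! Suc i))"
      using quotient_slope(3)[OF mem mem psubset_imp_subset[OF sub(1)[OF i]]] i by simp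
    moreover have "lattice_slope r (quotient_lattice r (F ! Suc (Suc i)) (F ! Suc i))
        < lattice_slope r (quotient_lattice r (F ! Suc i) (F ! i))"
      using F i unfolding HN_filtration_def by blast
    ultimately show "hn.slope (F ! Suc i) (F ! Suc (Suc i)) < hn.slope (F ! i) (F ! Suc i)" by simp
  qed (use F in \<open>auto simp: HN_filtration_def\<close>)
next
  assume F: "hn.HN_from {0\<^sub>v r} F"
  have mem: "F ! i \<in> Sats" if "i < length F" for i using hn.HN_mem[OF F that] .
  have st: "hn.step (F ! i) (F ! Suc i)" if "Suc i < length F" for i using F that by (simp add: hn.HN_from_def)
  have sub: "F ! i \<subset> F ! Suc i" if "Suc i < length F" for i using st[OF that] by (simp add: hn.step_def)
  show "HN_filtration r (ev ` \<Lambda>) F"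
    unfolding HN_filtration_def
  proof (intro conjI allI impI)
    fix i assume "i < length F"
    then show "saturated_sublattice r (F ! i) (ev ` \<Lambda>)" using mem by (simp add: Sats_def)
  next
    fix i assume i: "Suc i < length F"
    show "F ! i \<subset> F ! Suc i" by (rule sub[OF i])
    show "semistable r (quotient_lattice r (F ! Suc i) (F ! i))"
      using semistable_quotient_iff[OF mem mem sub[OF i]] st[OF i] i by simp
  next
    fix i assume i: "Suc (Suc i) < length F"
    have "hn.slope (F ! i) (F ! Suc i) = lattice_slope r (quotient_lattice r (F ! Suc i) (F ! i))"
      using quotient_slope(3)[OF mem mem psubset_imp_subset[OF sub[of i]]] i by simp
    moreover have "hn.slope (F ! Suc i) (F ! Suc (Suc i)) = lattice_slope r (quotient_lattice r (F ! Suc (Suc i)) (F ! Suc i))"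
      using quotient_slope(3)[OF mem mem psubset_imp_subset[OF sub[OF i]]] i by simp
    moreover have "hn.slope (F ! Suc i) (F ! Suc (Suc i)) < hn.slope (F ! i) (F ! Suc i)"
      using F i unfolding hn.HN_from_def by blast
    ultimately show "lattice_slope r (quotient_lattice r (F ! Suc (Suc i)) (F ! Suc i))
        < lattice_slope r (quotient_lattice r (F ! Suc i) (F ! i))" by simp
  qed (use F in \<open>auto simp: hn.HN_from_def\<close>)
qed

text \<open>Existence and uniqueness turn the definite description in
  \<open>canonical_filtration\<close> into a usable property.\<close>

lemma canonical_filtration_HN: "hn.HN_from {0\<^sub>v r} (canonical_filtration r (ev ` \<Lambda>))"
proof -
  obtain F where F: "hn.HN_from {0\<^sub>v r} F" using hn.HN_from_exists[OF hn.bt] by blast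
  have "canonical_filtration r (ev ` \<Lambda>) = F"
    unfolding canonical_filtration_def HN_filtration_iff
    using F hn.HN_unique by (intro the_equality) auto
  then show ?thesis using F by simp
qed

text \<open>Concavity of \<open>p\<close> reduces the comparison to the break points, since chords
  of points below \<open>p\<close> stay below; \<open>HN_le_iff\<close> then compares the break
  points with all saturated sublattices.\<close>

lemma canonical_polygon_le_iff:
  assumes "concave_polygon r p"
  shows "(\<forall>t\<in>{0..real r}. canonical_polygon r (ev ` \<Lambda>) t \<le> p t) \<longleftrightarrow>
    {M \<in> Sats. dg M > p (real (rk M))} = {}"
proof -
  interpret concave_polygon r p by fact
  define F where "F = canonical_filtration r (ev ` \<Lambda>)"
  have F: "hn.HN_from {0\<^sub>v r} F" unfolding F_def by (rule canonical_filtration_HN)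
  define l where "l = length F"
  define \<rho> where "\<rho> i = rk (F ! i)" for i
  have ne: "F \<noteq> []" using F by (simp add: hn.HN_from_def)
  have F0: "F ! 0 = {0\<^sub>v r}" and Fl: "F ! (l - 1) = ev ` \<Lambda>"
    using F ne by (auto simp: hn.HN_from_def hd_conv_nth last_conv_nth l_def)
  have \<rho>0: "\<rho> 0 = 0" and \<rho>l: "\<rho> (l - 1) = r" unfolding \<rho>_def F0 Fl using rk_dg_zero rk_dg_top by auto
  have mono: "\<rho> i < \<rho> j" if "i < j" "j < l" for i j
    unfolding \<rho>_def using hn.rk_strict[OF hn.HN_mem[OF F] hn.HN_mem[OF F] hn.HN_nth_mono[OF F that(1)]] that
    by (simp add: l_def)
  \<comment> \<open>Bottom and top have the different ranks 0 and \<open>r\<close>, so there is at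
    least one segment.\<close>
  have l2: "l \<ge> 2"
  proof (rule ccontr)
    assume "\<not> l \<ge> 2"
    then have "l - 1 = 0" by simp
    then show False using \<rho>0 \<rho>l r2 by simp
  qed
  have \<rho>_le: "\<rho> i \<le> r" if "i < l" for i
  proof (cases "i = l - 1")
    case False
    then have "i < l - 1" "l - 1 < l" using that by linarith+
    then show ?thesis using mono[of i "l - 1"] unfolding \<rho>l by simp
  qed (simp only: \<rho>l le_refl)
  \<comment> \<open>The segment used at \<open>t\<close>; a break point other than 0 counts as the
    right end of its segment.\<close>
  define ix where "ix t = (LEAST i. t \<le> real (\<rho> (Suc i)))" for t
  have cp: "canonical_polygon r (ev ` \<Lambda>) t = dg (F ! ix t) + (t - real (\<rho> (ix t))) /
      (real (\<rho> (Suc (ix t))) - real (\<rho> (ix t))) * (dg (F ! Suc (ix t)) - dg (F ! ix t))" for t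
    by (simp add: canonical_polygon_def Let_def F_def[symmetric] ix_def \<rho>_def rk_def dg_def)
  have ix: "Suc (ix t) < l" "real (\<rho> (ix t)) \<le> t" "t \<le> real (\<rho> (Suc (ix t)))" if t: "0 \<le> t" "t \<le> real r" for t
  proof -
    have "Suc (l - 2) = l - 1" using l2 by simp
    then have l: "t \<le> real (\<rho> (Suc (l - 2)))" using t(2) \<rho>l by (simp only:)
    have 1: "t \<le> real (\<rho> (Suc (ix t)))" unfolding ix_def by (rule LeastI[of "\<lambda>i. t \<le> real (\<rho> (Suc i))", OF l])
    have 2: "ix t \<le> l - 2" unfolding ix_def by (rule Least_le[of "\<lambda>i. t \<le> real (\<rho> (Suc i))", OF l])
    show "Suc (ix t) < l" using 2 l2 by linarith
    show "t \<le> real (\<rho> (Suc (ix t)))" by (rule 1)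
    show "real (\<rho> (ix t)) \<le> t"
    proof (cases "ix t")
      case 0 then show ?thesis using \<rho>0 t by simp
    next
      case (Suc j)
      then have "\<not> t \<le> real (\<rho> (Suc j))" using not_less_Least[of j "\<lambda>i. t \<le> real (\<rho> (Suc i))"] by (simp add: ix_def)
      then show ?thesis using Suc by simp
    qed
  qed
  have "(\<forall>t\<in>{0..real r}. canonical_polygon r (ev ` \<Lambda>) t \<le> p t) \<longleftrightarrow> (\<forall>i<length F. dg (F ! i) \<le> p (real (rk (F ! i))))"
  proof
    assume le: "\<forall>t\<in>{0..real r}. canonical_polygon r (ev ` \<Lambda>) t \<le> p t"
    show "\<forall>i<length F. dg (F ! i) \<le> p (real (rk (F ! i)))"
    proof (intro allI impI)
      fix j assume j: "j < length F"
      show "dg (F ! j) \<le> p (real (rk (F ! j)))"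
      proof (cases j)
        case 0 then show ?thesis using F0 rk_dg_zero p0 by simp
      next
        case (Suc i)
        define t where "t = real (\<rho> j)"
        have jl: "j < l" using j by (simp add: l_def)
        from \<rho>_le[OF jl] have t: "0 \<le> t" "t \<le> real r" by (auto simp: t_def)
        have "Suc (ix t) = j"
        proof (rule antisym)
          have "ix t \<le> i" unfolding ix_def by (rule Least_le) (simp add: t_def Suc)
          then show "Suc (ix t) \<le> j" using Suc by simp
          show "j \<le> Suc (ix t)"
          proof (rule ccontr)
            assume "\<not> j \<le> Suc (ix t)"
            then have "\<rho> (Suc (ix t)) < \<rho> j" using mono[of "Suc (ix t)" j] jl by simp
            then show False using ix(3)[OF t] by (simp add: t_def)
          qed
        qed
        moreover have "\<rho> (ix t) < \<rho> (Suc (ix t))" using mono ix(1)[OF t] by simp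
        ultimately have "canonical_polygon r (ev ` \<Lambda>) t = dg (F ! j)"
          unfolding cp by (simp add: t_def)
        moreover have "canonical_polygon r (ev ` \<Lambda>) t \<le> p t" using le t by simp
        ultimately show ?thesis by (simp add: t_def \<rho>_def)
      qed
    qed
  next
    assume le: "\<forall>i<length F. dg (F ! i) \<le> p (real (rk (F ! i)))"
    show "\<forall>t\<in>{0..real r}. canonical_polygon r (ev ` \<Lambda>) t \<le> p t"
    proof
      fix t assume "t \<in> {0..real r}"
      then have t: "0 \<le> t" "t \<le> real r" by auto
      have rb: "\<rho> (Suc (ix t)) \<le> r" by (rule \<rho>_le[OF ix(1)[OF t]])
      have lt: "\<rho> (ix t) < \<rho> (Suc (ix t))" using mono ix(1)[OF t] by simp
      show "canonical_polygon r (ev ` \<Lambda>) t \<le> p t"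
        unfolding cp
        by (rule p_chord[OF lt rb ix(2,3)[OF t]]) (use le ix(1)[OF t] in \<open>auto simp: \<rho>_def l_def\<close>)
    qed
  qed
  also have "\<dots> \<longleftrightarrow> {M \<in> Sats. dg M > p (real (rk M))} = {}"
    using supergradient by (intro hn.HN_le_iff[OF F]) (simp add: rk_dg_top)
  finally show ?thesis .
qed

lemma chain_sum:
  assumes "concave_polygon r p"
  defines "X \<equiv> {M \<in> Sats. dg M > p (real (rk M))}"
  shows "finite X" "(\<Sum>c\<in>chains_in X. (- 1) ^ card c) = (if X = {} then 1 else 0 :: real)"
proof -
  interpret concave_polygon r p by fact
  show "finite X" "(\<Sum>c\<in>chains_in X. (- 1) ^ card c) = (if X = {} then 1 else 0 :: real)"
    unfolding X_def
    by (rule hn.truncation_sum[of "\<lambda>n. p (real n)"]; use four_point rk_dg_top in simp)+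
qed

end

section \<open>Flags of rational matrices\<close>

lemma gram_square: "A \<in> carrier_mat n n \<Longrightarrow> gram A = (det A)\<^sup>2"
  unfolding gram_def by (subst det_mult[of _ n]) (auto simp: det_transpose power2_eq_square)

lemma mat_inj_first_cols:
  fixes A :: "'a :: comm_ring_1 mat"
  assumes A: "A \<in> carrier_mat r n" and inj: "mat_inj A" and i: "i \<le> n"
  shows "mat_inj (first_cols i A)"
proof (rule mat_injI[OF first_cols_carrier[OF A]])
  have dr: "dim_row (first_cols i A) = r" using A by (simp add: first_cols_def)
  fix c :: "'a vec" assume c: "c \<in> carrier_vec i" "first_cols i A *\<^sub>v c = 0\<^sub>v r"
  define d where "d = vec n (\<lambda>j. if j < i then c $ j else 0)"
  have "A *\<^sub>v d = first_cols i A *\<^sub>v c"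
  proof (rule eq_vecI)
    fix x assume "x < dim_vec (first_cols i A *\<^sub>v c)"
    then have x: "x < r" using dr by simp
    have "(A *\<^sub>v d) $ x = (\<Sum>j\<in>{0..<n}. A $$ (x, j) * (if j < i then c $ j else 0))"
      using A x by (simp add: scalar_prod_def d_def)
    also have "\<dots> = (\<Sum>j\<in>{0..<i}. A $$ (x, j) * c $ j)"
      using i by (intro sum.mono_neutral_cong_right) auto
    also have "\<dots> = (first_cols i A *\<^sub>v c) $ x"
      using A x c(1) by (simp add: scalar_prod_def first_cols_def)
    finally show "(A *\<^sub>v d) $ x = (first_cols i A *\<^sub>v c) $ x" .
  qed (use A dr in simp)
  then have "d = 0\<^sub>v n" using c(2) by (intro mat_injD[OF inj A]) (auto simp: d_def)
  then have "d $ j = 0" if "j < i" for j using that i by simp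
  then show "c = 0\<^sub>v i" using c(1) i by (intro eq_vecI) (auto simp: d_def)
qed

lemma SL_inj: "A \<in> SL r \<Longrightarrow> mat_inj (A :: rat mat)"
  by (subst mat_inj_iff_gram[of _ r r]) (auto simp: SL_def gram_square)

lemma adele_real_of_rat: "adele_real (adele_of_rat x) = of_rat x"
  by transfer simp

lemma adele_real_of_rat_mat: "map_mat adele_real (map_mat adele_of_rat A) = map_mat of_rat A"
  by (rule eq_matI) (auto simp: adele_real_of_rat)

locale adelic_realization =
  fixes r :: nat and g :: "adele mat" and \<beta> :: "rat mat"
  assumes r_pos: "r > 0" and g: "g \<in> SL r"
    and basis: "\<beta> \<in> carrier_mat r r" "det \<beta> = 1" "zspan \<beta> = adelic_lattice r g"
begin

sublocale euclidean_realization r \<beta> "adj_mat (map_mat adele_real g)"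
  using SL_adj(4)[OF SL_adele_real[OF g]] basis bounded_adelic_lattice[OF g]
  by unfold_locales (auto simp: SL_def)

lemma euclidean_adelic_lattice_ev: "euclidean_adelic_lattice r g = ev ` \<Lambda>"
  unfolding euclidean_adelic_lattice_def mat_inv_SL[OF SL_adele_real[OF g]] basis(3) ev_def ..

lemma \<Lambda>_carrier: "x \<in> \<Lambda> \<Longrightarrow> x \<in> carrier_vec r"
  using zspan_carrier[OF basis(1)] by blast

text \<open>The standard flag pulled back along \<open>\<delta>\<close> and traced on the lattice. A
  parabolic subgroup stabilizes its part of the standard flag, so multiplying
  \<open>\<delta>\<close> by it on the left leaves the members at \<open>ranks ds\<close>
  unchanged.\<close>

definition flag :: "rat mat \<Rightarrow> nat \<Rightarrow> rat vec set" where
  "flag \<delta> i = {x \<in> \<Lambda>. \<forall>j\<in>{i..<r}. (\<delta> *\<^sub>v x) $ j = 0}"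

lemma flag_mono: "i \<le> j \<Longrightarrow> flag \<delta> i \<subseteq> flag \<delta> j"
  by (auto simp: flag_def)

lemma flag_saturated:
  assumes \<delta>: "\<delta> \<in> carrier_mat r r"
  shows "sat (flag \<delta> i)"
  unfolding saturated_in_def
proof (intro conjI ballI allI impI)
  show "int_module r (flag \<delta> i)"
    unfolding int_module_def
  proof (intro conjI ballI allI)
    show "flag \<delta> i \<subseteq> carrier_vec r" using \<Lambda>_carrier by (auto simp: flag_def)
    have "\<delta> *\<^sub>v 0\<^sub>v r = 0\<^sub>v r" using \<delta> by (intro eq_vecI) (auto simp: scalar_prod_def)
    then show "0\<^sub>v r \<in> flag \<delta> i" using int_module_\<Lambda> by (simp add: flag_def int_module_def del: index_mult_mat_vec)
    fix x y and n :: int assume xy: "x \<in> flag \<delta> i" "y \<in> flag \<delta> i"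
    then have c: "x \<in> carrier_vec r" "y \<in> carrier_vec r" using \<Lambda>_carrier by (auto simp: flag_def)
    have "\<delta> *\<^sub>v (x + of_int n \<cdot>\<^sub>v y) = \<delta> *\<^sub>v x + of_int n \<cdot>\<^sub>v (\<delta> *\<^sub>v y)"
      using c by (simp add: mult_add_distrib_mat_vec[OF \<delta>] mult_mat_smult_vec[OF \<delta>])
    moreover have "x + of_int n \<cdot>\<^sub>v y \<in> \<Lambda>" using xy int_module_add_smult[OF int_module_\<Lambda>] by (simp add: flag_def)
    ultimately show "x + of_int n \<cdot>\<^sub>v y \<in> flag \<delta> i"
      using xy \<delta> by (simp add: flag_def del: index_mult_mat_vec)
  qed
  show "flag \<delta> i \<subseteq> \<Lambda>" by (auto simp: flag_def)
  fix x and n :: int assume x: "x \<in> \<Lambda>" "n \<noteq> 0" "of_int n \<cdot>\<^sub>v x \<in> flag \<delta> i"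
  have "\<delta> *\<^sub>v (of_int n \<cdot>\<^sub>v x) = of_int n \<cdot>\<^sub>v (\<delta> *\<^sub>v x)" by (rule mult_mat_smult_vec[OF \<delta> \<Lambda>_carrier[OF x(1)]])
  then show "x \<in> flag \<delta> i" using x \<delta> by (simp add: flag_def del: index_mult_mat_vec)
qed

lemma flag_Sats: "\<delta> \<in> SL r \<Longrightarrow> ev ` flag \<delta> i \<in> Sats"
  using flag_saturated[OF SL_carrier] Sats_iff by blast

lemma flag_top: "flag \<delta> r = \<Lambda>"
  by (auto simp: flag_def)

text \<open>The rational matrix cancels: the inverse of \<open>\<delta> g\<close> applied to
  \<open>\<delta> x\<close> is the inverse of \<open>g\<close> applied to \<open>x\<close>.\<close>

lemma adelic_lattice_translate:
  assumes \<delta>: "\<delta> \<in> SL r" and x: "x \<in> carrier_vec r"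
  shows "\<delta> *\<^sub>v x \<in> adelic_lattice r (map_mat adele_of_rat \<delta> * g) \<longleftrightarrow> x \<in> adelic_lattice r g"
proof -
  define D where "D = map_mat adele_of_rat \<delta>"
  have D: "D \<in> SL r" unfolding D_def by (rule SL_adele_of_rat[OF \<delta>])
  define X where "X = map_vec adele_of_rat x"
  have X: "X \<in> carrier_vec r" using x by (simp add: X_def)
  have "map_vec adele_of_rat (\<delta> *\<^sub>v x) = D *\<^sub>v X"
    unfolding D_def X_def by (rule adele_of_rat_hom.mult_mat_vec_hom[OF SL_carrier[OF \<delta>] x])
  moreover have "adj_mat (D * g) *\<^sub>v (D *\<^sub>v X) = adj_mat g *\<^sub>v X"
  proof -
    have "adj_mat (D * g) *\<^sub>v (D *\<^sub>v X) = adj_mat g *\<^sub>v (adj_mat D *\<^sub>v (D *\<^sub>v X))"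
      unfolding adj_mult[OF D g]
      by (rule assoc_mult_mat_vec[OF SL_adj(1)[OF g] SL_adj(1)[OF D]]) (use SL_carrier[OF D] X in simp)
    also have "adj_mat D *\<^sub>v (D *\<^sub>v X) = (adj_mat D * D) *\<^sub>v X"
      by (rule assoc_mult_mat_vec[OF SL_adj(1)[OF D] SL_carrier[OF D] X, symmetric])
    finally show ?thesis using SL_adj(3)[OF D] X by simp
  qed
  moreover have "\<delta> *\<^sub>v x \<in> carrier_vec r" using SL_carrier[OF \<delta>] x by simp
  ultimately show ?thesis
    unfolding adelic_lattice_zint[OF SL_mult[OF D g, unfolded D_def]] adelic_lattice_zint[OF g]
    using x by (simp add: D_def X_def del: index_mult_mat_vec)
qed

text \<open>\<open>\<delta>\<close> carries the flag to the coordinate flag of the lattice of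
  \<open>\<delta> g\<close>, isometrically since it cancels against the inverse of
  \<open>\<delta> g\<close>. A triangular basis spans that coordinate flag by initial columns, and
  \<open>H0_simple_weight\<close> evaluates their volumes.\<close>

lemma rk_dg_flag:
  assumes \<delta>: "\<delta> \<in> SL r"
  shows "dim_vec (H0 r (map_mat adele_of_rat \<delta> * g)) = r"
    "\<And>i. i \<le> r \<Longrightarrow> rk (ev ` flag \<delta> i) = i"
    "\<And>i. i \<le> r \<Longrightarrow> dg (ev ` flag \<delta> i) = simple_weight i (H0 r (map_mat adele_of_rat \<delta> * g))"
proof -
  define D where "D = map_mat adele_of_rat \<delta>"
  have D: "D \<in> SL r" unfolding D_def by (rule SL_adele_of_rat[OF \<delta>])
  have Dg: "D * g \<in> SL r" by (rule SL_mult[OF D g])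
  obtain \<gamma> where \<gamma>: "\<gamma> \<in> carrier_mat r r" "det \<gamma> = 1" "upper_triangular \<gamma>" "zspan \<gamma> = adelic_lattice r (D * g)"
    "\<And>i. i \<le> r \<Longrightarrow> zspan (first_cols i \<gamma>) = coord_flag r (adelic_lattice r (D * g)) i"
    by (rule adelic_triangular_basis[OF Dg r_pos]) (rule that)
  note H = H0_simple_weight[OF Dg \<gamma>(1-3) equalityD1[OF \<gamma>(4)]]
  show "dim_vec (H0 r (map_mat adele_of_rat \<delta> * g)) = r" using H(1) by (simp add: D_def)
  fix i assume i: "i \<le> r"
  define C where "C = first_cols i \<gamma>"
  have C: "C \<in> carrier_mat r i" using \<gamma>(1) by (simp add: C_def)
  have Cinj: "mat_inj C" unfolding C_def
    by (rule mat_inj_first_cols[OF \<gamma>(1) SL_inj[of \<gamma> r] i]) (use \<gamma> in \<open>simp add: SL_def\<close>)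
  note a = SL_adj[OF \<delta>] and dc = SL_carrier[OF \<delta>]
  define A where "A = adj_mat \<delta> * C"
  have A: "A \<in> carrier_mat r i" using a(1) C by (simp add: A_def)
  have \<delta>A: "\<delta> *\<^sub>v (A *\<^sub>v c) = C *\<^sub>v c" if c: "c \<in> carrier_vec i" for c
  proof -
    have "\<delta> *\<^sub>v (A *\<^sub>v c) = (\<delta> * A) *\<^sub>v c" by (rule assoc_mult_mat_vec[OF dc A c, symmetric])
    also have "\<delta> * A = (\<delta> * adj_mat \<delta>) * C" unfolding A_def by (rule assoc_mult_mat[OF dc a(1) C, symmetric])
    finally show ?thesis using a(2) C by simp
  qed
  have Ainj: "mat_inj A"
  proof (rule mat_injI[OF A])
    fix c assume c: "c \<in> carrier_vec i" "A *\<^sub>v c = 0\<^sub>v r"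
    have "C *\<^sub>v c = \<delta> *\<^sub>v 0\<^sub>v r" using \<delta>A[OF c(1)] c(2) by simp
    also have "\<dots> = 0\<^sub>v r" using dc by (intro eq_vecI) (auto simp: scalar_prod_def)
    finally show "c = 0\<^sub>v i" by (rule mat_injD[OF Cinj C c(1)])
  qed
  have zA: "zspan A = flag \<delta> i"
  proof (intro equalityI subsetI)
    fix x assume xA: "x \<in> zspan A"
    then obtain c :: "int vec" where c: "c \<in> carrier_vec i" "x = A *\<^sub>v map_vec of_int c" using zspanE[OF A] by blast
    have xc: "x \<in> carrier_vec r" using c A by simp
    have "\<delta> *\<^sub>v x = C *\<^sub>v map_vec of_int c" unfolding c(2) by (rule \<delta>A) (use c in simp)
    then have "\<delta> *\<^sub>v x \<in> zspan C" using zspanI[OF C c(1)] by simp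
    then have f: "\<delta> *\<^sub>v x \<in> coord_flag r (adelic_lattice r (D * g)) i" using \<gamma>(5)[OF i] by (simp add: C_def)
    then have "x \<in> \<Lambda>" using adelic_lattice_translate[OF \<delta> xc] by (simp add: coord_flag_def basis(3) D_def)
    then show "x \<in> flag \<delta> i" using f by (simp add: coord_flag_def flag_def)
  next
    fix x assume x: "x \<in> flag \<delta> i"
    then have xc: "x \<in> carrier_vec r" using \<Lambda>_carrier by (simp add: flag_def)
    have "\<delta> *\<^sub>v x \<in> adelic_lattice r (D * g)"
      using x adelic_lattice_translate[OF \<delta> xc] by (simp add: flag_def basis(3) D_def)
    then have "\<delta> *\<^sub>v x \<in> zspan C"
      using x \<gamma>(5)[OF i] by (simp add: coord_flag_def flag_def C_def del: index_mult_mat_vec)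
    then obtain c :: "int vec" where c: "c \<in> carrier_vec i" "\<delta> *\<^sub>v x = C *\<^sub>v map_vec of_int c" using zspanE[OF C] by blast
    have "x = (adj_mat \<delta> * \<delta>) *\<^sub>v x" using a(3) xc by simp
    also have "\<dots> = adj_mat \<delta> *\<^sub>v (C *\<^sub>v map_vec of_int c)"
      unfolding c(2)[symmetric] by (rule assoc_mult_mat_vec[OF a(1) dc xc])
    also have "\<dots> = A *\<^sub>v map_vec of_int c"
      unfolding A_def by (rule assoc_mult_mat_vec[OF a(1) C, symmetric]) (use c in simp)
    finally show "x \<in> zspan A" using zspanI[OF A c(1)] by simp
  qed
  show "rk (ev ` flag \<delta> i) = i" using rk_dg(2)[OF A Ainj] by (simp only: zA)
  have "adj_mat (map_mat adele_real (D * g)) = adj_mat (map_mat adele_real g) * adj_mat (map_mat adele_real D)"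
    unfolding adele_real_hom.mat_hom_mult[OF SL_carrier[OF D] SL_carrier[OF g]]
    by (rule adj_mult[OF SL_adele_real[OF D] SL_adele_real[OF g]])
  also have "adj_mat (map_mat adele_real D) = map_mat of_rat (adj_mat \<delta>)"
    unfolding adj_adele_real[OF D, symmetric] unfolding D_def adj_adele_of_rat[OF \<delta>, symmetric]
    by (rule adele_real_of_rat_mat)
  finally have e: "adj_mat (map_mat adele_real (D * g)) * map_mat of_rat C
      = (adj_mat (map_mat adele_real g) * map_mat of_rat (adj_mat \<delta>)) * map_mat of_rat C" by simp
  also have "\<dots> = adj_mat (map_mat adele_real g) * (map_mat of_rat (adj_mat \<delta>) * map_mat of_rat C)"
    by (rule assoc_mult_mat[of _ r r _ r _ i]) (use SL_adj(1)[OF SL_adele_real[OF g]] a(1) C in auto)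
  also have "\<dots> = emb A" unfolding emb_def A_def map_of_rat_mult[OF a(1) C] ..
  finally show "dg (ev ` flag \<delta> i) = simple_weight i (H0 r (map_mat adele_of_rat \<delta> * g))"
    using rk_dg(3)[OF A Ainj] H(2)[OF i] by (simp only: zA C_def D_def)
qed

lemma flag_eqI:
  assumes \<delta>: "\<delta> \<in> SL r" and S: "sat S" "S \<subseteq> flag \<delta> i" "rk (ev ` S) = i" and i: "i \<le> r"
  shows "S = flag \<delta> i"
proof -
  have "ev ` S = ev ` flag \<delta> i"
    using hn.eq_of_rk[of "ev ` S" "ev ` flag \<delta> i"] S rk_dg_flag(2)[OF \<delta> i] flag_Sats[OF \<delta>] Sats_iff by auto
  then show ?thesis
    using inj_on_image_eq_iff[OF ev_inj saturated_carrier[OF S(1)] saturated_carrier[OF flag_saturated[OF SL_carrier[OF \<delta>]]]]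
    by blast
qed

lemma flag_inj: "\<delta> \<in> SL r \<Longrightarrow> \<delta>' \<in> SL r \<Longrightarrow> ev ` flag \<delta> i = ev ` flag \<delta>' j \<Longrightarrow> flag \<delta> i = flag \<delta>' j"
  using inj_on_image_eq_iff[OF ev_inj saturated_carrier[OF flag_saturated] saturated_carrier[OF flag_saturated]] SL_carrier
  by blast

lemma rational_multiple_in_\<Lambda>:
  assumes y: "y \<in> carrier_vec r"
  obtains n :: int where "n > 0" "of_int n \<cdot>\<^sub>v y \<in> \<Lambda>"
proof -
  have b: "\<beta> \<in> SL r" using basis by (simp add: SL_def)
  define c where "c = adj_mat \<beta> *\<^sub>v y"
  have c: "c \<in> carrier_vec r" using SL_adj(1)[OF b] y by (simp add: c_def)
  have y_eq: "\<beta> *\<^sub>v c = y"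
    unfolding c_def using assoc_mult_mat_vec[OF basis(1) SL_adj(1)[OF b] y] SL_adj(2)[OF b] y by simp
  obtain n :: int and d :: "int vec" where nd: "n > 0" "d \<in> carrier_vec (dim_vec c)" "of_int n \<cdot>\<^sub>v c = map_vec of_int d"
    using int_multiple_rat_vec .
  have "of_int n \<cdot>\<^sub>v y = \<beta> *\<^sub>v map_vec of_int d"
    unfolding nd(3)[symmetric] mult_mat_smult_vec[OF basis(1) c] y_eq ..
  moreover have "d \<in> carrier_vec r" using nd(2) c by simp
  ultimately have "of_int n \<cdot>\<^sub>v y \<in> \<Lambda>" using zspanI[OF basis(1)] by simp
  then show thesis using that nd(1) by blast
qed

lemma parabolic_Q_ranks:
  "\<delta> \<in> parabolic_Q r ds \<longleftrightarrow> \<delta> \<in> SL r \<and> (\<forall>m\<in>ranks ds. \<forall>i j. j < m \<and> m \<le> i \<and> i < r \<longrightarrow> \<delta> $$ (i, j) = 0)"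
  unfolding parabolic_Q_def
  using partial_sum_ranks[of ds "\<lambda>m. \<forall>i j. j < m \<and> m \<le> i \<and> i < r \<longrightarrow> \<delta> $$ (i, j) = 0"] by simp

text \<open>Block triangularity means that \<open>\<rho>\<close> preserves the standard subspaces of
  dimensions in \<open>ranks ds\<close>; since the lattice spans \<open>\<rat>^r\<close>, this can
  be read off the lattice flags.\<close>

lemma flag_eq_iff_parabolic:
  assumes \<rho>: "\<rho> \<in> SL r" and \<delta>: "\<delta> \<in> SL r" and ds: "ds \<in> ordered_partitions r"
  shows "(\<forall>i\<in>ranks ds. flag (\<rho> * \<delta>) i = flag \<delta> i) \<longleftrightarrow> \<rho> \<in> parabolic_Q r ds"
proof
  assume eq: "\<forall>i\<in>ranks ds. flag (\<rho> * \<delta>) i = flag \<delta> i"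
  note a = SL_adj[OF \<delta>] and dc = SL_carrier[OF \<delta>] and rc = SL_carrier[OF \<rho>]
  have "\<rho> $$ (i, j) = 0" if m: "m \<in> ranks ds" and ij: "j < m" "m \<le> i" "i < r" for m i j
  proof -
    \<comment> \<open>A multiple of the preimage of the \<open>j\<close>-th unit vector lies in the
      lattice and detects column \<open>j\<close> of \<open>\<rho>\<close>.\<close>
    define y where "y = adj_mat \<delta> *\<^sub>v unit_vec r j"
    have y: "y \<in> carrier_vec r" using a(1) by (simp add: y_def)
    have dy: "\<delta> *\<^sub>v y = unit_vec r j"
      unfolding y_def using assoc_mult_mat_vec[OF dc a(1), of "unit_vec r j"] a(2) by simp
    obtain n :: int where n: "n > 0" "of_int n \<cdot>\<^sub>v y \<in> \<Lambda>" using rational_multiple_in_\<Lambda>[OF y] .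
    have "\<delta> *\<^sub>v (of_int n \<cdot>\<^sub>v y) = of_int n \<cdot>\<^sub>v unit_vec r j"
      unfolding mult_mat_smult_vec[OF dc y] dy ..
    then have "of_int n \<cdot>\<^sub>v y \<in> flag \<delta> m"
      using n(2) ij by (simp add: flag_def del: index_mult_mat_vec)
    then have "of_int n \<cdot>\<^sub>v y \<in> flag (\<rho> * \<delta>) m" using eq m by blast
    then have "((\<rho> * \<delta>) *\<^sub>v (of_int n \<cdot>\<^sub>v y)) $ i = 0" using ij by (simp add: flag_def del: index_mult_mat_vec)
    moreover have "(\<rho> * \<delta>) *\<^sub>v (of_int n \<cdot>\<^sub>v y) = of_int n \<cdot>\<^sub>v (\<rho> *\<^sub>v unit_vec r j)"
      using mult_mat_smult_vec[OF mult_carrier_mat[OF rc dc] y] assoc_mult_mat_vec[OF rc dc y] dy by simp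
    moreover have "(\<rho> *\<^sub>v unit_vec r j) $ i = \<rho> $$ (i, j)" using rc ij by simp
    ultimately show ?thesis using n(1) rc ij by (simp del: index_mult_mat_vec)
  qed
  then show "\<rho> \<in> parabolic_Q r ds" using \<rho> parabolic_Q_ranks by blast
next
  assume P: "\<rho> \<in> parabolic_Q r ds"
  note dc = SL_carrier[OF \<delta>] and rc = SL_carrier[OF \<rho>]
  show "\<forall>i\<in>ranks ds. flag (\<rho> * \<delta>) i = flag \<delta> i"
  proof
    fix m assume m: "m \<in> ranks ds"
    then have mr: "m \<le> r" using ranks_eq(4)[OF ds r_pos] by auto
    have "flag \<delta> m \<subseteq> flag (\<rho> * \<delta>) m"
    proof
      fix x assume x: "x \<in> flag \<delta> m"
      then have xc: "x \<in> carrier_vec r" using \<Lambda>_carrier by (simp add: flag_def)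
      define y where "y = \<delta> *\<^sub>v x"
      have y: "y \<in> carrier_vec r" using dc xc by (simp add: y_def)
      have y0: "y $ k = 0" if "m \<le> k" "k < r" for k using x that by (simp add: flag_def y_def del: index_mult_mat_vec)
      have "(\<rho> *\<^sub>v y) $ i = 0" if i: "m \<le> i" "i < r" for i
      proof -
        have "\<rho> $$ (i, k) * y $ k = 0" if k: "k < r" for k
        proof (cases "k < m")
          case True
          then have "\<rho> $$ (i, k) = 0" using P m i parabolic_Q_ranks by blast
          then show ?thesis by simp
        qed (use y0 k in simp)
        then have "(\<Sum>k\<in>{0..<r}. \<rho> $$ (i, k) * y $ k) = 0" by (intro sum.neutral) simp
        then show ?thesis using rc y i by (simp add: scalar_prod_def)
      qed
      moreover have "(\<rho> * \<delta>) *\<^sub>v x = \<rho> *\<^sub>v y" unfolding y_def by (rule assoc_mult_mat_vec[OF rc dc xc])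
      ultimately show "x \<in> flag (\<rho> * \<delta>) m" using x by (simp add: flag_def del: index_mult_mat_vec)
    qed
    \<comment> \<open>Both sides are saturated of rank \<open>m\<close>, so one inclusion is
      enough.\<close>
    then show "flag (\<rho> * \<delta>) m = flag \<delta> m"
      using flag_eqI[OF SL_mult[OF \<rho> \<delta>] flag_saturated[OF dc] _ rk_dg_flag(2)[OF \<delta> mr] mr] by simp
  qed
qed

lemma coset_flags:
  assumes \<delta>: "\<delta> \<in> SL r" and ds: "ds \<in> ordered_partitions r"
  shows "parabolic_Q r ds #>\<^bsub>SL_Q r\<^esub> \<delta> = {\<delta>' \<in> SL r. \<forall>i\<in>ranks ds. flag \<delta>' i = flag \<delta> i}"
proof (intro equalityI subsetI)
  fix \<delta>' assume "\<delta>' \<in> parabolic_Q r ds #>\<^bsub>SL_Q r\<^esub> \<delta>"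
  then obtain \<rho> where \<rho>: "\<rho> \<in> parabolic_Q r ds" "\<delta>' = \<rho> * \<delta>" by (auto simp: r_coset_def SL_Q_def)
  have "\<rho> \<in> SL r" using \<rho>(1) by (simp add: parabolic_Q_def)
  then show "\<delta>' \<in> {\<delta>' \<in> SL r. \<forall>i\<in>ranks ds. flag \<delta>' i = flag \<delta> i}"
    using \<rho> flag_eq_iff_parabolic[OF _ \<delta> ds, of \<rho>] SL_mult[OF _ \<delta>, of \<rho>] by simp
next
  fix \<delta>' assume "\<delta>' \<in> {\<delta>' \<in> SL r. \<forall>i\<in>ranks ds. flag \<delta>' i = flag \<delta> i}"
  then have \<delta>': "\<delta>' \<in> SL r" "\<forall>i\<in>ranks ds. flag \<delta>' i = flag \<delta> i" by auto
  define \<rho> where "\<rho> = \<delta>' * adj_mat \<delta>"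
  have \<rho>: "\<rho> \<in> SL r" unfolding \<rho>_def by (rule SL_mult[OF \<delta>'(1) SL_adj(4)[OF \<delta>]])
  have e: "\<rho> * \<delta> = \<delta>'"
    unfolding \<rho>_def using assoc_mult_mat[OF SL_carrier[OF \<delta>'(1)] SL_adj(1)[OF \<delta>] SL_carrier[OF \<delta>]] SL_adj(3)[OF \<delta>] SL_carrier[OF \<delta>'(1)] by simp
  have "\<rho> \<in> parabolic_Q r ds" using flag_eq_iff_parabolic[OF \<rho> \<delta> ds] \<delta>'(2) e by simp
  then show "\<delta>' \<in> parabolic_Q r ds #>\<^bsub>SL_Q r\<^esub> \<delta>" using e by (auto simp: r_coset_def SL_Q_def)
qed

text \<open>Transitivity of the rational group on flags: a lattice basis adapted to the chain, with
  its sign corrected, is a matrix \<open>\<gamma>\<close> of determinant one whose inverse carries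
  the chain to the standard flag.\<close>

lemma chain_is_flag:
  assumes c: "c \<subseteq> Sats" "finite c" and ch: "\<And>M N. M \<in> c \<Longrightarrow> N \<in> c \<Longrightarrow> M \<subseteq> N \<or> N \<subseteq> M"
  obtains \<delta> where "\<delta> \<in> SL r" "\<And>M. M \<in> c \<Longrightarrow> ev ` flag \<delta> (rk M) = M"
proof -
  obtain xs where xs: "set xs = c" using finite_list[OF c(2)] by blast
  define ys where "ys = sort_key rk xs"
  have ys: "set ys = c" by (simp add: ys_def xs)
  have "sorted_wrt (\<lambda>M N. rk M \<le> rk N) ys" using sorted_sort_key[of rk xs] by (simp add: ys_def sorted_wrt_map)
  then have sy: "sorted_wrt (\<subseteq>) ys"
  proof (rule sorted_wrt_mono_rel[rotated])
    fix M N assume MN: "M \<in> set ys" "N \<in> set ys" "rk M \<le> rk N"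
    have S: "M \<in> Sats" "N \<in> Sats" using MN c(1) ys by auto
    have "M \<subseteq> N \<or> N \<subseteq> M" using MN ch ys by blast
    then show "M \<subseteq> N" using hn.eq_of_rk[OF S(2,1) _ MN(3)] by blast
  qed
  define pre where "pre M = {x \<in> \<Lambda>. ev x \<in> M}" for M
  have pre: "sat (pre M)" "M = ev ` pre M" if M: "M \<in> c" for M
  proof -
    obtain S where S: "sat S" "M = ev ` S" using M c(1) Sats_iff by blast
    have "S \<subseteq> \<Lambda>" using S(1) by (simp add: saturated_in_def)
    moreover have "ev x \<in> ev ` S \<longleftrightarrow> x \<in> S" if "x \<in> \<Lambda>" for x
      by (rule inj_on_image_mem_iff[OF ev_inj \<Lambda>_carrier[OF that] saturated_carrier[OF S(1)]])
    ultimately have "pre M = S" unfolding pre_def S(2) by blast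
    then show "sat (pre M)" "M = ev ` pre M" using S by auto
  qed
  have sp: "sorted_wrt (\<subseteq>) (map pre ys)"
    unfolding sorted_wrt_map by (rule sorted_wrt_mono_rel[OF _ sy]) (auto simp: pre_def)
  have sats: "sat S" if "S \<in> set (map pre ys)" for S using that pre(1) ys by auto
  obtain k A where A: "A \<in> carrier_mat r k" "mat_inj A" "zspan A = \<Lambda>"
    "\<And>S. S \<in> set (map pre ys) \<Longrightarrow> \<exists>i\<le>k. zspan (first_cols i A) = S"
    by (rule adapted_basis[OF int_module_\<Lambda> bounded sp sats]) (assumption, rule that)
  have kr: "k = r" "gram A = gram \<beta>" using zspan_eq_imp[OF A(1,2) basis(1) \<beta>_inj A(3)] by auto
  have Ar: "A \<in> carrier_mat r r" using A(1) kr(1) by simp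
  \<comment> \<open>\<open>A\<close> and \<open>\<beta>\<close> are bases of the same lattice, and
    \<open>det \<beta> = 1\<close>.\<close>
  have "(det A)\<^sup>2 = 1" using kr(2) gram_square[OF Ar] gram_square[OF basis(1)] basis(2) by simp
  then have "det A = 1 \<or> det A = -1" by (simp add: power2_eq_1_iff)
  then have "\<exists>s :: int. det A = of_int s \<and> \<bar>s\<bar> = 1" by (auto intro: exI[of _ 1] exI[of _ "-1"])
  then obtain s :: int where s: "det A = of_int s" "\<bar>s\<bar> = 1" by blast
  obtain \<gamma> where \<gamma>: "\<gamma> \<in> carrier_mat r r" "det \<gamma> = 1" "upper_triangular A \<Longrightarrow> upper_triangular \<gamma>"
    "\<And>i. i \<le> r \<Longrightarrow> zspan (first_cols i \<gamma>) = zspan (first_cols i A)"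
    by (rule normalize_det[OF Ar s r_pos]) (rule that)
  have \<gamma>S: "\<gamma> \<in> SL r" using \<gamma> by (simp add: SL_def)
  define \<delta> where "\<delta> = adj_mat \<gamma>"
  have \<delta>: "\<delta> \<in> SL r" unfolding \<delta>_def by (rule SL_adj(4)[OF \<gamma>S])
  have z\<gamma>: "zspan \<gamma> = \<Lambda>" using \<gamma>(4)[of r] A(3) first_cols_all[OF \<gamma>(1)] first_cols_all[OF Ar] by simp
  have flag: "zspan (first_cols i \<gamma>) \<subseteq> flag \<delta> i" if i: "i \<le> r" for i
  proof (rule zspan_subset[OF _ first_cols_carrier[OF \<gamma>(1)]])
    show "int_module r (flag \<delta> i)" using flag_saturated[OF SL_carrier[OF \<delta>]] by (simp add: saturated_in_def)
    fix j assume j: "j < i"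
    have cj: "col (first_cols i \<gamma>) j = col \<gamma> j" using j i \<gamma>(1) by (intro eq_vecI) (auto simp: first_cols_def)
    have "col (\<delta> * \<gamma>) j = \<delta> *\<^sub>v col \<gamma> j" using SL_carrier[OF \<delta>] \<gamma>(1) i j by (intro col_mult2[of _ r r _ r]) auto
    then have "\<delta> *\<^sub>v col \<gamma> j = unit_vec r j" using SL_adj(3)[OF \<gamma>S] i j by (simp add: \<delta>_def)
    moreover have "col \<gamma> j \<in> \<Lambda>" using col_in_zspan[OF \<gamma>(1), of j] i j z\<gamma> by simp
    ultimately show "col (first_cols i \<gamma>) j \<in> flag \<delta> i"
      unfolding cj flag_def using j by (simp del: index_mult_mat_vec)
  qed
  have fM: "ev ` flag \<delta> (rk M) = M" if M: "M \<in> c" for M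
  proof -
    obtain i where i: "i \<le> r" "zspan (first_cols i A) = pre M" using A(4)[of "pre M"] M ys kr(1) by auto
    have rkM: "rk M = i"
      using rk_dg(2)[OF first_cols_carrier[OF A(1)] mat_inj_first_cols[OF A(1,2)], of i] i kr(1) pre(2)[OF M, symmetric] by simp
    have "pre M = flag \<delta> i"
      by (rule flag_eqI[OF \<delta> pre(1)[OF M] _ _ i(1)])
        (use flag[OF i(1)] \<gamma>(4)[OF i(1)] i(2) rkM pre(2)[OF M, symmetric] in auto)
    then show ?thesis using rkM pre(2)[OF M, symmetric] by simp
  qed
  show thesis by (rule that[OF \<delta>]) (rule fM)
qed

lemma tau_hat_flag:
  assumes p: "concave_polygon r p" and \<delta>: "\<delta> \<in> SL r" and ds: "ds \<in> ordered_partitions r"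
  shows "tau_hat r ds (H0 r (map_mat adele_of_rat \<delta> * g) - T_of_polygon r p) =
    of_bool (\<forall>i\<in>ranks ds. dg (ev ` flag \<delta> i) > p (real i))"
proof -
  interpret concave_polygon r p by (rule p)
  define H where "H = H0 r (map_mat adele_of_rat \<delta> * g)"
  define T where "T = T_of_polygon r p"
  have dims: "H \<in> carrier_vec r" "T \<in> carrier_vec r"
    unfolding H_def T_def by (rule carrier_vecI[OF rk_dg_flag(1)[OF \<delta>]], rule T_carrier)
  have w: "simple_weight i (H - T) = dg (ev ` flag \<delta> i) - p (real i)" if i: "i \<le> r" for i
  proof -
    have "simple_weight i (H - T) = simple_weight i H - simple_weight i T"
      using dims i by (simp add: simple_weight_def sum_subtractf)
    then show ?thesis using rk_dg_flag(3)[OF \<delta> i] simple_weight_T[OF i] by (simp add: H_def T_def)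
  qed
  \<comment> \<open>Lying in \<open>a0\<close> is a condition on the weight at \<open>r\<close>,
    where degree and polygon both vanish.\<close>
  have "H - T \<in> a0 r"
    using w[OF order_refl] dims unfolding a0_def simple_weight_def flag_top rk_dg_top(2) pr by simp
  moreover have "simple_weight i (H - T) > 0 \<longleftrightarrow> dg (ev ` flag \<delta> i) > p (real i)" if "i \<in> ranks ds" for i
    using w[of i] ranks_eq(4)[OF ds r_pos] that by auto
  ultimately show ?thesis
    unfolding tau_hat_def H_def[symmetric] T_def[symmetric]
    using partial_sum_ranks[of ds "\<lambda>i. simple_weight i (H - T) > 0"] by (simp add: indicator_def)
qed

end

section \<open>The truncation as an alternating sum over chains\<close>

context adelic_realization
begin

text \<open>Sending a coset to its set of flag members identifies the cosets with non-zero summand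
  with the chains in \<open>X\<close> of rank set \<open>ranks ds\<close>. The summands are 0 or 1,
  so the infinite sum is a finite count.\<close>

lemma truncation_term:
  assumes p: "concave_polygon r p" and ds: "ds \<in> ordered_partitions r"
  defines "X \<equiv> {M \<in> Sats. dg M > p (real (rk M))}"
  shows "(\<Sum>\<^sub>\<infinity>C \<in> rcosets\<^bsub>SL_Q r\<^esub> (parabolic_Q r ds).
      tau_hat r ds (H0 r (map_mat adele_of_rat (SOME \<delta>. \<delta> \<in> C) * g) - T_of_polygon r p)) =
    real (card {c \<in> chains_in X. rk ` c = ranks ds})"
proof -
  define R where "R = rcosets\<^bsub>SL_Q r\<^esub> (parabolic_Q r ds)"
  \<comment> \<open>The same choice as in the truncation; a coset consists of all matrices with the
    same flag members, so any representative gives the same summand.\<close>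
  define rep :: "rat mat set \<Rightarrow> rat mat" where "rep C = (SOME \<delta>. \<delta> \<in> C)" for C
  define fl where "fl C = (\<lambda>i. ev ` flag (rep C) i) ` ranks ds" for C
  define Ch where "Ch = {c \<in> chains_in X. rk ` c = ranks ds}"
  have finX: "finite X" unfolding X_def by (rule chain_sum(1)[OF p])
  have rr: "i \<le> r" if "i \<in> ranks ds" for i using ranks_eq(4)[OF ds r_pos] that by auto
  have coset: "C \<in> R \<longleftrightarrow> (\<exists>\<delta>\<in>SL r. C = {\<delta>' \<in> SL r. \<forall>i\<in>ranks ds. flag \<delta>' i = flag \<delta> i})" for C
    unfolding R_def RCOSETS_def using coset_flags[OF _ ds] by (simp add: SL_Q_def)
  have rep: "rep C \<in> SL r" "\<And>\<delta>'. \<delta>' \<in> C \<longleftrightarrow> \<delta>' \<in> SL r \<and> (\<forall>i\<in>ranks ds. flag \<delta>' i = flag (rep C) i)"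
    if C: "C \<in> R" for C
  proof -
    obtain \<delta> where \<delta>: "\<delta> \<in> SL r" "C = {\<delta>' \<in> SL r. \<forall>i\<in>ranks ds. flag \<delta>' i = flag \<delta> i}" using C[unfolded coset] by blast
    have "\<delta> \<in> C" using \<delta>(1) unfolding \<delta>(2) by simp
    then have "rep C \<in> C" unfolding rep_def by (rule someI)
    then have e: "rep C \<in> SL r" "\<forall>i\<in>ranks ds. flag (rep C) i = flag \<delta> i"
      using eqset_imp_iff[OF \<delta>(2), of "rep C"] by auto
    show "rep C \<in> SL r" by (rule e(1))
    show "\<delta>' \<in> C \<longleftrightarrow> \<delta>' \<in> SL r \<and> (\<forall>i\<in>ranks ds. flag \<delta>' i = flag (rep C) i)" for \<delta>'
      using eqset_imp_iff[OF \<delta>(2), of \<delta>'] e(2) by auto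
  qed
  have rk_fl: "rk (ev ` flag (rep C) i) = i" if "C \<in> R" "i \<in> ranks ds" for C i
    by (rule rk_dg_flag(2)[OF rep(1)[OF that(1)] rr[OF that(2)]])
  have tau: "tau_hat r ds (H0 r (map_mat adele_of_rat (rep C) * g) - T_of_polygon r p) = of_bool (fl C \<subseteq> X)"
    if C: "C \<in> R" for C
  proof -
    have "ev ` flag (rep C) i \<in> X \<longleftrightarrow> dg (ev ` flag (rep C) i) > p (real i)" if i: "i \<in> ranks ds" for i
      unfolding X_def using flag_Sats[OF rep(1)[OF C]] rk_fl[OF C i] by simp
    then have "(\<forall>i\<in>ranks ds. dg (ev ` flag (rep C) i) > p (real i)) \<longleftrightarrow> fl C \<subseteq> X" unfolding fl_def by auto
    then show ?thesis using tau_hat_flag[OF p rep(1)[OF C] ds] by simp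
  qed
  have fl_eq: "fl C = (\<lambda>i. ev ` flag \<delta> i) ` ranks ds"
    if "C \<in> R" "\<delta> \<in> C" for C \<delta>
    unfolding fl_def using rep(2)[OF that(1)] that(2) by (intro image_cong) auto
  have bij: "bij_betw fl {C \<in> R. fl C \<subseteq> X} Ch"
  proof (rule bij_betw_imageI)
    show "inj_on fl {C \<in> R. fl C \<subseteq> X}"
    proof (rule inj_onI)
      fix C C' assume C1: "C \<in> {C \<in> R. fl C \<subseteq> X}" and C2: "C' \<in> {C \<in> R. fl C \<subseteq> X}" and eq: "fl C = fl C'"
      have C: "C \<in> R" "C' \<in> R" using CollectD[OF C1] CollectD[OF C2] by simp_all
      have "flag (rep C) i = flag (rep C') i" if i: "i \<in> ranks ds" for i
      proof -
        have "ev ` flag (rep C) i \<in> fl C" unfolding fl_def by (rule imageI[OF i])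
        then have "ev ` flag (rep C) i \<in> fl C'" by (simp only: eq)
        then obtain j where j: "j \<in> ranks ds" "ev ` flag (rep C) i = ev ` flag (rep C') j" unfolding fl_def by (rule imageE)
        \<comment> \<open>The rank recovers the index of a flag member, so equal sets of members
          come from equal flags.\<close>
        then have "i = j" using rk_fl[OF C(1) i] rk_fl[OF C(2) j(1)] by simp
        then show ?thesis using flag_inj[OF rep(1)[OF C(1)] rep(1)[OF C(2)]] j(2) by simp
      qed
      then show "C = C'" unfolding set_eq_iff rep(2)[OF C(1)] rep(2)[OF C(2)] by simp
    qed
    show "fl ` {C \<in> R. fl C \<subseteq> X} = Ch"
    proof (intro equalityI subsetI)
      fix c assume "c \<in> fl ` {C \<in> R. fl C \<subseteq> X}"
      then obtain C where C: "C \<in> R" "c = fl C" "fl C \<subseteq> X" by (elim imageE CollectE conjE)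
      have "S \<subseteq> T \<or> T \<subseteq> S" if ST: "S \<in> fl C" "T \<in> fl C" for S T
      proof -
        obtain i j where "S = ev ` flag (rep C) i" "T = ev ` flag (rep C) j" using ST unfolding fl_def by (elim imageE)
        moreover
        have "ev ` flag (rep C) i \<subseteq> ev ` flag (rep C) j \<or> ev ` flag (rep C) j \<subseteq> ev ` flag (rep C) i"
        proof (cases "i \<le> j")
          case True
          then show ?thesis by (intro disjI1 image_mono flag_mono)
        next
          case False
          then show ?thesis by (intro disjI2 image_mono flag_mono) simp
        qed
        ultimately show ?thesis by simp
      qed
      moreover have "rk ` fl C = ranks ds"
        unfolding fl_def image_image using rk_fl[OF C(1)] by (simp cong: image_cong)
      ultimately show "c \<in> Ch" unfolding Ch_def chains_in_def using C(2,3) by blast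
    next
      fix c assume c: "c \<in> Ch"
      then have cc: "(c \<subseteq> X \<and> (\<forall>M\<in>c. \<forall>N\<in>c. M \<subseteq> N \<or> N \<subseteq> M)) \<and> rk ` c = ranks ds"
        unfolding Ch_def chains_in_def mem_Collect_eq .
      note cX = conjunct1[OF conjunct1[OF cc]] conjunct2[OF cc] and ch = conjunct2[OF conjunct1[OF cc]]
      have cS: "c \<subseteq> Sats" using cX(1) by (auto simp: X_def)
      obtain \<delta> where \<delta>: "\<delta> \<in> SL r" "\<And>M. M \<in> c \<Longrightarrow> ev ` flag \<delta> (rk M) = M"
        by (rule chain_is_flag[OF cS finite_subset[OF cX(1) finX] ch[rule_format]]) (assumption, assumption, rule that)
      define C where "C = {\<delta>' \<in> SL r. \<forall>i\<in>ranks ds. flag \<delta>' i = flag \<delta> i}"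
      have C: "C \<in> R" using \<delta>(1) coset C_def by blast
      have "\<delta> \<in> C" using \<delta>(1) by (simp add: C_def)
      then have "fl C = (\<lambda>M. ev ` flag \<delta> (rk M)) ` c" using fl_eq[OF C] cX(2)[symmetric] by (simp add: image_image)
      also have "\<dots> = c" by (simp add: \<delta>(2))
      finally have "fl C = c" .
      then show "c \<in> fl ` {C \<in> R. fl C \<subseteq> X}" using C cX(1) by blast
    qed
  qed
  have "finite Ch"
    by (rule finite_subset[of _ "Pow X"]) (use finX in \<open>auto simp: Ch_def chains_in_def\<close>)
  then have fin: "finite {C \<in> R. fl C \<subseteq> X}" using bij_betw_finite[OF bij] by simp
  have "(\<Sum>\<^sub>\<infinity>C\<in>R. tau_hat r ds (H0 r (map_mat adele_of_rat (rep C) * g) - T_of_polygon r p))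
      = (\<Sum>\<^sub>\<infinity>C\<in>{C \<in> R. fl C \<subseteq> X}. 1)"
    by (rule infsum_cong_neutral) (auto simp: tau)
  also have "\<dots> = real (card {C \<in> R. fl C \<subseteq> X})" using fin by simp
  finally show ?thesis using bij_betw_same_card[OF bij] by (simp add: R_def rep_def Ch_def)
qed

text \<open>Rank 0 forces the zero lattice and rank \<open>r\<close> the whole lattice; in both
  cases degree and polygon are 0.\<close>

lemma destabilizing_rank:
  assumes p: "concave_polygon r p" and M: "M \<in> Sats" "dg M > p (real (rk M))"
  shows "rk M \<in> {1..<r}"
proof -
  interpret concave_polygon r p by (rule p)
  have top: "ev ` \<Lambda> \<in> Sats" by (rule hn.tp)
  have "rk M \<noteq> 0"
  proof
    assume z: "rk M = 0"
    have "{0\<^sub>v r} = M" by (rule hn.eq_of_rk[OF hn.bt M(1) hn.bt_le[OF M(1)]]) (simp add: z)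
    then show False using M(2) rk_dg_zero p0 by auto
  qed
  moreover have "rk M \<noteq> r"
  proof
    assume z: "rk M = r"
    have "M = ev ` \<Lambda>" by (rule hn.eq_of_rk[OF M(1) top hn.le_tp[OF M(1)]]) (simp add: z rk_dg_top)
    then show False using M(2) rk_dg_top pr by simp
  qed
  moreover have "rk M \<le> r" using hn.rk_mono[OF M(1) top hn.le_tp[OF M(1)]] rk_dg_top(1) by simp
  ultimately show ?thesis by simp
qed

text \<open>The rank is injective on a chain, so the sign attached to a parabolic subgroup is the
  sign of every chain it counts; grouping chains by their rank sets turns the sum over ordered
  partitions into one over chains.\<close>

lemma arthur_truncation_chains:
  assumes p: "concave_polygon r p"
  defines "X \<equiv> {M \<in> Sats. dg M > p (real (rk M))}"
  shows "arthur_truncation_one r (T_of_polygon r p) g = (\<Sum>c\<in>chains_in X. (- 1) ^ card c)"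
proof -
  have finX: "finite X" unfolding X_def by (rule chain_sum(1)[OF p])
  then have finC: "finite (chains_in X)"
    by (intro finite_subset[of "chains_in X" "Pow X"]) (auto simp: chains_in_def)
  have card: "card (rk ` c) = card c" if c: "c \<in> chains_in X" for c
  proof (rule card_image, rule inj_onI)
    fix M N assume MN: "M \<in> c" "N \<in> c" "rk M = rk N"
    have S: "M \<in> Sats" "N \<in> Sats" using MN(1,2) c by (auto simp: chains_in_def X_def)
    have "M \<subseteq> N \<or> N \<subseteq> M" using c MN(1,2) by (auto simp: chains_in_def)
    then show "M = N" using hn.eq_of_rk[OF S] hn.eq_of_rk[OF S(2,1)] MN(3) by auto
  qed
  define G :: "nat set \<Rightarrow> real" where "G A = (\<Sum>c\<in>{c \<in> chains_in X. rk ` c = A}. (- 1) ^ card c)" for A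
  have "arthur_truncation_one r (T_of_polygon r p) g = (\<Sum>ds\<in>ordered_partitions r. G (ranks ds))"
    unfolding arthur_truncation_one_def
  proof (rule sum.cong[OF refl])
    fix ds assume ds: "ds \<in> ordered_partitions r"
    have "G (ranks ds) = (\<Sum>c\<in>{c \<in> chains_in X. rk ` c = ranks ds}. (- 1) ^ (length ds - 1))"
      unfolding G_def
    proof (rule sum.cong[OF refl])
      fix c assume "c \<in> {c \<in> chains_in X. rk ` c = ranks ds}"
      then have "card c = length ds - 1" using card[of c] ranks_eq(3)[OF ds r_pos] by auto
      then show "(- 1) ^ card c = ((- 1) ^ (length ds - 1) :: real)" by simp
    qed
    then show "(- 1) ^ (length ds - 1) * (\<Sum>\<^sub>\<infinity>C \<in> rcosets\<^bsub>SL_Q r\<^esub> (parabolic_Q r ds).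
        tau_hat r ds (H0 r (map_mat adele_of_rat (SOME \<delta>. \<delta> \<in> C) * g) - T_of_polygon r p)) = G (ranks ds)"
      unfolding truncation_term[OF p ds] X_def by simp
  qed
  also have "\<dots> = (\<Sum>A\<in>Pow {1..<r}. G A)" by (rule sum.reindex_bij_betw[OF ranks_bij[OF r_pos]])
  also have "\<dots> = (\<Sum>c\<in>chains_in X. (- 1) ^ card c)"
    unfolding G_def
  proof (rule sum.group[OF finC])
    show "(`) rk ` chains_in X \<subseteq> Pow {1..<r}"
      using destabilizing_rank[OF p] unfolding chains_in_def X_def by blast
  qed simp
  finally show ?thesis .
qed

end

theorem mainTheorem6:
  fixes r :: nat
  assumes "r \<ge> 2"
  shows "\<exists>c :: real. \<forall>p.
    normalized_polygon r p \<and> convex_polygon r p \<and>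
    (\<forall>i\<in>{1..<r}. simple_root i (T_of_polygon r p) > c) \<longrightarrow>
    (\<forall>g :: adele mat. g \<in> SL r \<longrightarrow>
      (if \<forall>t\<in>{0..real r}. canonical_polygon r (euclidean_adelic_lattice r g) t \<le> p t
       then 1 else 0)
      = arthur_truncation_one r (T_of_polygon r p) g)"
\<comment> \<open>The identity is combinatorial and exact, without error terms to absorb; the
  threshold 0 corresponds to strictly decreasing slopes of the polygon.\<close>
proof (rule exI[of _ 0], intro allI impI)
  fix p and g :: "adele mat"
  assume "normalized_polygon r p \<and> convex_polygon r p \<and> (\<forall>i\<in>{1..<r}. simple_root i (T_of_polygon r p) > 0)"
    and g: "g \<in> SL r"
  then have p: "concave_polygon r p" using assms by unfold_locales auto
  have r: "r > 0" using assms by simp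
  obtain \<beta> where \<beta>: "\<beta> \<in> carrier_mat r r" "det \<beta> = 1" "upper_triangular \<beta>" "zspan \<beta> = adelic_lattice r g"
    "\<And>i. i \<le> r \<Longrightarrow> zspan (first_cols i \<beta>) = coord_flag r (adelic_lattice r g) i"
    by (rule adelic_triangular_basis[OF g r]) (rule that)
  interpret adelic_realization r g \<beta> by unfold_locales (fact r g \<beta>)+
  show "(if \<forall>t\<in>{0..real r}. canonical_polygon r (euclidean_adelic_lattice r g) t \<le> p t then 1 else 0)
      = arthur_truncation_one r (T_of_polygon r p) g"
    unfolding arthur_truncation_chains[OF p] chain_sum(2)[OF p] euclidean_adelic_lattice_ev canonical_polygon_le_iff[OF p] ..
qed

end
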